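(* Let $\delta>0$ be a sufficiently small absolute constant, and let $\phi=\phi(t,x)$, $x\in\mathbb{R}^3$, be a solution of the wave equation $\square\phi=f$, where $\square=-\partial_t^2+\Delta$. (i) If the solution is supported in the interior region, i.e. $|x|\le t$ on its support, then $$|\partial\phi(t,x)|\lesssim \delta^{-1}\Big[\langle t\rangle^{-(1-\delta)/2}\,\langle t-|x|\rangle^{-1/2+\delta}\,\|\partial\,\Gamma^{\le 3}\phi(t)\|_{L^2_x}+\langle t\rangle^{1/2+\delta}\,\|\Gamma^{\le 2}f(t)\|_{L^2_x}\Big].$$ (ii) In the general case (no support assumption), for any $x_0\in\mathbb{R}^3$, $$\begin{aligned}|\partial\phi(t,x_0)|\lesssim{}& \delta^{-1}|t|^{-1/2}\langle x_0\rangle^{\delta}\,\|\Gamma^{\le 3}\phi(t)\|_{L^2}^{(1-\delta)/2}\Big[\|\Gamma^{\le 3}\phi(t)\|_{L^2}+\|r^2\,\Gamma^{\le 3}\phi(0)\|_{L^2}\\&+\langle t\rangle\|\Gamma^{\le 1}f(t)\|_{L^2}+\int_0^t\|u\,\partial\Gamma^{\le 1}f(s)\|_{L^2(\Sigma^{ext}_s)}\,ds\Big]^{(1+\delta)/2}+\|\Gamma^{\le 1}f(t)\|_{L^2}.\end{aligned}$$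
   Context: Work on $\mathbb{R}^{1+3}$ with coordinates $(t,x)=(t,x^1,x^2,x^3)$, $r=|x|$. $\partial\psi=(\partial_t\psi,\partial_1\psi,\partial_2\psi,\partial_3\psi)$ is the spacetime gradient. $S=t\partial_t+\sum_{i=1}^3x^i\partial_i$ is the scaling vector field, and $\Gamma$ denotes any element of $\{S,\partial_1,\partial_2,\partial_3\}$. $\Gamma^{\le k}\psi$ is the collection of all compositions of at most $k$ such vector fields applied to $\psi$; norms of such collections are sums over the collection (similarly for $\partial\Gamma^{\le k}\psi$). $\psi(t)$ is the restriction to the slice $\Sigma_t=\{t\}\times\mathbb{R}^3$, and $L^2=L^2_x=L^2(\mathbb{R}^3)$ unless indicated. $\Sigma^{ext}_t=\{x\in\Sigma_t:|x|\ge t\}$. $u=t-r$ (so $u=s-r$ on $\Sigma_s$). $\langle a\rangle=(1+|a|^2)^{1/2}$. $A\lesssim B$ means $A\le CB$ with an absolute constant $C$ (independent of $\phi,f,t,x,x_0,\delta$). The time $t$ at which the estimates are stated is assumed to be larger than a fixed absolute constant. Solutions are understood to be sufficiently regular and decaying for the expressions to make sense. *)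

theory Defs
  imports "HOL-Analysis.Analysis"
begin

type_synonym spacetime = "real \<times> (real ^ 3)"

definition dderiv :: "'a::euclidean_space \<Rightarrow> ('a \<Rightarrow> real) \<Rightarrow> 'a \<Rightarrow> real" where
  "dderiv v \<psi> p = frechet_derivative \<psi> (at p) v"

primrec C_k :: "nat \<Rightarrow> ('a::euclidean_space \<Rightarrow> real) \<Rightarrow> bool" where
  "C_k 0 \<psi> \<longleftrightarrow> continuous_on UNIV \<psi>"
| "C_k (Suc k) \<psi> \<longleftrightarrow> (\<forall>p. \<psi> differentiable (at p)) \<and> (\<forall>b\<in>Basis. C_k k (dderiv b \<psi>))"

definition dt :: "(spacetime \<Rightarrow> real) \<Rightarrow> spacetime \<Rightarrow> real" where
  "dt = dderiv (1, 0)"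

definition dx :: "3 \<Rightarrow> (spacetime \<Rightarrow> real) \<Rightarrow> spacetime \<Rightarrow> real" where
  "dx i = dderiv (0, axis i 1)"

(* The standard basis of the product consists of (1, 0) and the (0, axis i 1), so b ranging
   over Basis runs through the four coordinate derivatives. *)
definition abs_grad :: "(spacetime \<Rightarrow> real) \<Rightarrow> spacetime \<Rightarrow> real" where
  "abs_grad \<psi> p = sqrt (\<Sum>b\<in>Basis. (dderiv b \<psi> p)\<^sup>2)"

definition box_op :: "(spacetime \<Rightarrow> real) \<Rightarrow> spacetime \<Rightarrow> real" where
  "box_op \<psi> p = - dt (dt \<psi>) p + (\<Sum>i\<in>UNIV. dx i (dx i \<psi>) p)"

definition scaling :: "(spacetime \<Rightarrow> real) \<Rightarrow> spacetime \<Rightarrow> real" where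
  "scaling \<psi> p = fst p * dt \<psi> p + (\<Sum>i\<in>UNIV. (snd p $ i) * dx i \<psi> p)"

(* The time translation is not among the commuting fields. *)
datatype gamma = Scal | Transl 3

primrec gamma_op :: "gamma \<Rightarrow> (spacetime \<Rightarrow> real) \<Rightarrow> spacetime \<Rightarrow> real" where
  "gamma_op Scal = scaling"
| "gamma_op (Transl i) = dx i"

(* Compositions are indexed by words in the fields; the empty word gives the function itself. *)
definition Gam :: "gamma list \<Rightarrow> (spacetime \<Rightarrow> real) \<Rightarrow> spacetime \<Rightarrow> real" where
  "Gam w \<psi> = foldr gamma_op w \<psi>"

definition words :: "nat \<Rightarrow> gamma list set" where
  "words k = {w. length w \<le> k}"

lemma finite_words: "finite (words k)"
proof -
  have "(UNIV :: gamma set) = insert Scal (range Transl)"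
    using gamma.exhaust by blast
  then have "finite (UNIV :: gamma set)"
    by (metis finite finite_imageI finite_insert)
  then show ?thesis
    using finite_lists_length_le[of "UNIV :: gamma set" k] by (simp add: words_def)
qed

definition jap :: "'a::real_normed_vector \<Rightarrow> real" where
  "jap a = sqrt (1 + (norm a)\<^sup>2)"

definition L2_on :: "(real ^ 3) set \<Rightarrow> ((real ^ 3) \<Rightarrow> real) \<Rightarrow> bool" where
  "L2_on A g \<longleftrightarrow> set_borel_measurable lborel A g \<and> set_integrable lborel A (\<lambda>x. (g x)\<^sup>2)"

definition L2norm_on :: "(real ^ 3) set \<Rightarrow> ((real ^ 3) \<Rightarrow> real) \<Rightarrow> real" where
  "L2norm_on A g = sqrt (LINT x:A|lborel. (g x)\<^sup>2)"

definition L2norm_Gam :: "nat \<Rightarrow> (spacetime \<Rightarrow> real) \<Rightarrow> real \<Rightarrow> real" where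
  "L2norm_Gam k \<psi> t = (\<Sum>w\<in>words k. L2norm_on UNIV (\<lambda>x. Gam w \<psi> (t, x)))"

definition L2norm_grad_Gam :: "nat \<Rightarrow> (spacetime \<Rightarrow> real) \<Rightarrow> real \<Rightarrow> real" where
  "L2norm_grad_Gam k \<psi> t =
     (\<Sum>w\<in>words k. \<Sum>b\<in>Basis. L2norm_on UNIV (\<lambda>x. dderiv b (Gam w \<psi>) (t, x)))"

definition L2norm_r2_Gam :: "nat \<Rightarrow> (spacetime \<Rightarrow> real) \<Rightarrow> real \<Rightarrow> real" where
  "L2norm_r2_Gam k \<psi> t =
     (\<Sum>w\<in>words k. L2norm_on UNIV (\<lambda>x. (norm x)\<^sup>2 * Gam w \<psi> (t, x)))"

definition ext :: "real \<Rightarrow> (real ^ 3) set" where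
  "ext t = {x. norm x \<ge> t}"

definition L2norm_u_grad_Gam_ext :: "nat \<Rightarrow> (spacetime \<Rightarrow> real) \<Rightarrow> real \<Rightarrow> real" where
  "L2norm_u_grad_Gam_ext k \<psi> s =
     (\<Sum>w\<in>words k. \<Sum>b\<in>Basis.
        L2norm_on (ext s) (\<lambda>x. (s - norm x) * dderiv b (Gam w \<psi>) (s, x)))"

(* L2norm_on takes a junk value on functions that are not square integrable; this predicate says
   that every norm in the estimate without support assumption, and the time integral, is finite. *)
definition finite_norms :: "(spacetime \<Rightarrow> real) \<Rightarrow> (spacetime \<Rightarrow> real) \<Rightarrow> real \<Rightarrow> bool" where
  "finite_norms \<phi> f t \<longleftrightarrow>
     (\<forall>w\<in>words 3. L2_on UNIV (\<lambda>x. Gam w \<phi> (t, x))) \<and>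
     (\<forall>w\<in>words 3. L2_on UNIV (\<lambda>x. (norm x)\<^sup>2 * Gam w \<phi> (0, x))) \<and>
     (\<forall>w\<in>words 1. L2_on UNIV (\<lambda>x. Gam w f (t, x))) \<and>
     (\<forall>s\<in>{0..t}. \<forall>w\<in>words 1. \<forall>b\<in>Basis.
        L2_on (ext s) (\<lambda>x. (s - norm x) * dderiv b (Gam w f) (s, x))) \<and>
     set_integrable lborel {0..t} (L2norm_u_grad_Gam_ext 1 f)"

end

theory Submission
  imports Defs
begin

text \<open>
  Both estimates hold on a single time slice. Since \<open>t \<partial>\<^sub>t = S - x \<cdot> \<partial>\<close>, the equation becomes
  \<open>\<Delta>\<psi> - t\<^sup>-\<^sup>2 x\<^sub>i x\<^sub>j \<partial>\<^sub>i \<partial>\<^sub>j \<psi> = \<box>\<psi> + t\<^sup>-\<^sup>2 (2 r\<partial>\<^sub>r \<psi> - 2 r\<partial>\<^sub>r S\<psi> + S\<^sup>2\<psi> - S\<psi>)\<close>, whose left side is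
  elliptic for \<open>|x| < t\<close>, degenerates in the radial direction on the cone and is hyperbolic outside. A weighted
  elliptic estimate inside and a Rellich multiplier outside control the angular derivatives of \<open>\<partial>\<phi>\<close> on the thin
  shell \<open>r\<^sub>0 \<le> |x| \<le> r\<^sub>0 + O(r\<^sub>0\<^sup>-\<^sup>2)\<close> with the trace of the right order. Averaging over boxes in such a shell is
  then a two-dimensional Sobolev embedding in the angular variables that fails only by \<open>log r\<^sub>0\<close>, and this
  logarithm is absorbed by \<open>\<delta>\<^sup>-\<^sup>1 \<langle>x\<^sub>0\<rangle>\<^bsup>\<delta>\<^esup>\<close> or \<open>\<delta>\<^sup>-\<^sup>1 t\<^bsup>\<delta>/2\<^esup>\<close>.
\<close>

section \<open>Partial derivatives and compactly supported functions\<close>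

text \<open>The norms of order three leave two derivatives of \<open>\<partial>\<phi>\<close> in L2,
  which by itself gives a bound by A and Hoelder continuity with exponent 1/2, but no decay in t.
  Decay comes from a balance. If A bounds the norm of \<phi> and F that of f, the elliptic and the
  Rellich estimate both lose, up to constants, \<theta> A^2 + (F + A/t)^2 / \<theta> for a free
  \<theta> >= 1/t. The best \<theta> makes this m0 = A (F + A/t), and sqrt m0 is t^(-1/2) times the
  geometric mean of A and A + tF: this is the source of the exponents (1 - \<delta>)/2 and (1 +
  \<delta>)/2. The thickness r0^(-2) of the shell comes from the Hoelder modulus, whose error A
  r0^(-1) is then of size A/t or less and is absorbed by sqrt m0. With support in the cone \<theta>
  is 1/t, and a weight of size 1 + t - |x| becomes affordable; it turns into the decay in t - |x|.
  The time derivative is a separate obstacle: recovering it from S loses |x|/t far outside the cone,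
  and this loss is repaired by the factor |x|^2/t^2 - 1 that the Rellich estimate puts on radial
  derivatives.\<close>

definition pd :: "3 \<Rightarrow> (real^3 \<Rightarrow> real) \<Rightarrow> (real^3 \<Rightarrow> real) \<Rightarrow> bool" where
  "pd i v v' \<longleftrightarrow> (\<forall>x. ((\<lambda>\<tau>. v (x + \<tau> *\<^sub>R axis i 1)) has_real_derivative v' x) (at 0))"

text \<open>Full C^1 regularity, kept apart from \<open>pd\<close>: the divergence theorem below
  asks only for the i-th partial of the i-th component of a field, so it also accepts factors that
  are known to be differentiable along one axis only.\<close>

definition has_grad :: "(real^3 \<Rightarrow> real) \<Rightarrow> (3 \<Rightarrow> real^3 \<Rightarrow> real) \<Rightarrow> bool" where
  "has_grad v v1 \<longleftrightarrow> (\<forall>x. (v has_derivative (\<lambda>h. \<Sum>i\<in>UNIV. h $ i * v1 i x)) (at x)) \<and>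
     (\<forall>i. continuous_on UNIV (v1 i))"

definition comp_supp :: "(real^3 \<Rightarrow> real) \<Rightarrow> bool" where
  "comp_supp f \<longleftrightarrow> continuous_on UNIV f \<and> (\<exists>N. \<forall>x. N < norm x \<longrightarrow> f x = 0)"

lemma pd_cong: "pd i v v' \<Longrightarrow> (\<And>x. v' x = v'' x) \<Longrightarrow> pd i v v''"
  by (simp add: pd_def)

lemma pd_coord: "pd i (\<lambda>x. x $ j) (\<lambda>x. if i = j then 1 else 0)"
  unfolding pd_def by (auto simp: axis_def intro!: derivative_eq_intros)

lemma pd_diff: "pd i u u' \<Longrightarrow> pd i v v' \<Longrightarrow> pd i (\<lambda>x. u x - v x) (\<lambda>x. u' x - v' x)"
  unfolding pd_def by (auto intro!: DERIV_diff)

lemma pd_mult: "pd i u u' \<Longrightarrow> pd i v v' \<Longrightarrow> pd i (\<lambda>x. u x * v x) (\<lambda>x. u' x * v x + v' x * u x)"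
  unfolding pd_def using DERIV_mult by fastforce

lemma pd_cmult: "pd i u u' \<Longrightarrow> pd i (\<lambda>x. c * u x) (\<lambda>x. c * u' x)"
  unfolding pd_def by (auto intro!: DERIV_cmult)

lemma pd_sum: "(\<And>j. j \<in> S \<Longrightarrow> pd i (u j) (u' j)) \<Longrightarrow> pd i (\<lambda>x. \<Sum>j\<in>S. u j x) (\<lambda>x. \<Sum>j\<in>S. u' j x)"
  unfolding pd_def by (auto intro!: DERIV_sum)

lemma pd_comp:
  assumes "\<And>x. (f has_real_derivative f' (v x)) (at (v x))" "pd i v v'"
  shows "pd i (\<lambda>x. f (v x)) (\<lambda>x. f' (v x) * v' x)"
  unfolding pd_def
proof
  fix x
  have "((\<lambda>\<tau>. v (x + \<tau> *\<^sub>R axis i 1)) has_real_derivative v' x) (at 0)"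
    using assms(2) by (simp add: pd_def)
  moreover have "(f has_real_derivative f' (v x)) (at (v (x + 0 *\<^sub>R axis i 1)))"
    using assms(1) by simp
  ultimately show "((\<lambda>\<tau>. f (v (x + \<tau> *\<^sub>R axis i 1))) has_real_derivative f' (v x) * v' x) (at 0)"
    using DERIV_chain2[where f=f and g="\<lambda>\<tau>. v (x + \<tau> *\<^sub>R axis i 1)"] by blast
qed

lemma pd_sqnorm: "pd i (\<lambda>x. x \<bullet> x) (\<lambda>x. 2 * x $ i)"
proof (rule pd_cong[where v'="\<lambda>x. \<Sum>j\<in>UNIV. (if i = j then 1 else 0) * x $ j + (if i = j then 1 else 0) * x $ j"])
  show "pd i (\<lambda>x. x \<bullet> x) (\<lambda>x. \<Sum>j\<in>UNIV. (if i = j then 1 else 0) * x $ j + (if i = j then 1 else 0) * x $ j)"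
    unfolding inner_vec_def inner_real_def
    by (intro pd_sum pd_mult pd_coord)
qed (use exhaust_3[of i] in \<open>auto simp: sum_3\<close>)

lemma pd_line:
  assumes "pd i v v'"
  shows "((\<lambda>\<tau>. v (x + \<tau> *\<^sub>R axis i 1)) has_real_derivative v' (x + \<sigma> *\<^sub>R axis i 1)) (at \<sigma>)"
proof -
  have "((\<lambda>\<tau>. v ((x + \<sigma> *\<^sub>R axis i 1) + \<tau> *\<^sub>R axis i 1)) has_real_derivative v' (x + \<sigma> *\<^sub>R axis i 1)) (at 0)"
    using assms by (simp add: pd_def)
  then have "((\<lambda>\<tau>. v (x + (\<tau> + \<sigma>) *\<^sub>R axis i 1)) has_real_derivative v' (x + \<sigma> *\<^sub>R axis i 1)) (at 0)"
    by (simp add: algebra_simps)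
  then show ?thesis
    using DERIV_shift[of "\<lambda>\<tau>. v (x + \<tau> *\<^sub>R axis i 1)" "v' (x + \<sigma> *\<^sub>R axis i 1)" 0 \<sigma>] by simp
qed

lemma has_grad_pd:
  assumes "has_grad v v1"
  shows "pd i v (v1 i)"
  unfolding pd_def
proof
  fix x
  have 1: "(v has_derivative (\<lambda>h. \<Sum>j\<in>UNIV. h $ j * v1 j x)) (at (x + 0 *\<^sub>R axis i 1))"
    using assms by (simp add: has_grad_def)
  have 2: "((\<lambda>\<tau>::real. x + \<tau> *\<^sub>R axis i 1) has_derivative (\<lambda>\<tau>. \<tau> *\<^sub>R axis i 1)) (at 0)"
    by (auto intro!: derivative_eq_intros)
  have "((\<lambda>\<tau>. v (x + \<tau> *\<^sub>R axis i 1)) has_derivative (\<lambda>\<tau>. \<Sum>j\<in>UNIV. (\<tau> *\<^sub>R axis i (1::real)) $ j * v1 j x)) (at 0)"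
    using has_derivative_compose[OF 2 1] by simp
  moreover have "(\<lambda>\<tau>. \<Sum>j\<in>UNIV. (\<tau> *\<^sub>R axis i (1::real)) $ j * v1 j x) = (*) (v1 i x)"
  proof
    fix \<tau> :: real
    have "(\<Sum>j\<in>UNIV. (\<tau> *\<^sub>R axis i (1::real)) $ j * v1 j x) = (\<Sum>j\<in>UNIV. if j = i then \<tau> * v1 i x else 0)"
      by (intro sum.cong) (auto simp: axis_def)
    then show "(\<Sum>j\<in>UNIV. (\<tau> *\<^sub>R axis i (1::real)) $ j * v1 j x) = v1 i x * \<tau>"
      by simp
  qed
  ultimately show "((\<lambda>\<tau>. v (x + \<tau> *\<^sub>R axis i 1)) has_real_derivative v1 i x) (at 0)"
    by (simp add: has_field_derivative_def)
qed

lemma has_grad_cont: "has_grad v v1 \<Longrightarrow> continuous_on UNIV v"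
  unfolding has_grad_def by (meson continuous_at_imp_continuous_on has_derivative_continuous)

lemma has_grad_cont1: "has_grad v v1 \<Longrightarrow> continuous_on UNIV (v1 i)"
  by (simp add: has_grad_def)

lemma comp_supp_cont: "comp_supp f \<Longrightarrow> continuous_on UNIV f"
  by (simp add: comp_supp_def)

lemma comp_suppI: "continuous_on UNIV f \<Longrightarrow> (\<And>x. N < norm x \<Longrightarrow> f x = 0) \<Longrightarrow> comp_supp f"
  by (auto simp: comp_supp_def)

lemma comp_supp_multR: "continuous_on UNIV g \<Longrightarrow> comp_supp f \<Longrightarrow> comp_supp (\<lambda>x. g x * f x)"
  unfolding comp_supp_def by (auto intro!: continuous_intros)

lemma comp_supp_multL: "continuous_on UNIV g \<Longrightarrow> comp_supp f \<Longrightarrow> comp_supp (\<lambda>x. f x * g x)"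
  unfolding comp_supp_def by (auto intro!: continuous_intros)

lemma comp_supp_add:
  assumes "comp_supp f" "comp_supp g"
  shows "comp_supp (\<lambda>x. f x + g x)"
proof -
  obtain N M where "\<And>x. N < norm x \<Longrightarrow> f x = 0" "\<And>x. M < norm x \<Longrightarrow> g x = 0"
    using assms by (auto simp: comp_supp_def)
  then show ?thesis
    using assms by (intro comp_suppI[of _ "max N M"]) (auto simp: comp_supp_def intro!: continuous_intros)
qed

lemma comp_supp_zero: "comp_supp (\<lambda>x. 0)"
  by (simp add: comp_supp_def)

lemma comp_supp_diff: "comp_supp f \<Longrightarrow> comp_supp g \<Longrightarrow> comp_supp (\<lambda>x. f x - g x)"
  using comp_supp_add[of f "\<lambda>x. - 1 * g x"] comp_supp_multR[of "\<lambda>x. - 1" g] by simp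

lemma comp_supp_sum: "(\<And>j. j \<in> S \<Longrightarrow> comp_supp (f j)) \<Longrightarrow> comp_supp (\<lambda>x. \<Sum>j\<in>S. f j x)"
  by (induction S rule: infinite_finite_induct) (auto simp: comp_supp_zero intro!: comp_supp_add)

lemma comp_supp_lborel:
  assumes "comp_supp f"
  shows "integrable lborel f"
proof -
  obtain N where N: "\<And>x. N < norm x \<Longrightarrow> f x = 0"
    using assms by (auto simp: comp_supp_def)
  have "integrable lborel (\<lambda>x. indicator (cball 0 N) x *\<^sub>R f x)"
    using assms by (intro borel_integrable_compact) (auto simp: comp_supp_def intro: continuous_on_subset)
  also have "(\<lambda>x. indicator (cball 0 N) x *\<^sub>R f x) = f"
    using N by (auto simp: indicator_def fun_eq_iff not_le)
  finally show ?thesis .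
qed

lemma comp_supp_integrable: "comp_supp f \<Longrightarrow> f integrable_on UNIV"
  using comp_supp_lborel integrable_on_lborel by blast

lemma pd_comp_supp:
  assumes "pd i g g'" "comp_supp g" "continuous_on UNIV g'"
  shows "comp_supp g'"
proof -
  obtain N where N: "\<And>x. N < norm x \<Longrightarrow> g x = 0"
    using assms by (auto simp: comp_supp_def)
  have "g' x = 0" if "N < norm x" for x
  proof -
    have "\<forall>\<^sub>F \<tau> in nhds 0. N < norm (x + \<tau> *\<^sub>R axis i (1::real))"
      by (rule order_tendstoD(1)[OF _ that])
        (auto intro!: tendsto_eq_intros filterlim_ident)
    then have "\<forall>\<^sub>F \<tau> in nhds 0. g (x + \<tau> *\<^sub>R axis i (1::real)) = 0"
      by (rule eventually_mono) (use N in auto)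
    then have "((\<lambda>\<tau>. g (x + \<tau> *\<^sub>R axis i 1)) has_real_derivative 0) (at 0)"
      using DERIV_cong_ev[of 0 0 "\<lambda>\<tau>. g (x + \<tau> *\<^sub>R axis i 1)" "\<lambda>_. 0" 0 0] by simp
    moreover have "((\<lambda>\<tau>. g (x + \<tau> *\<^sub>R axis i 1)) has_real_derivative g' x) (at 0)"
      using assms by (simp add: pd_def)
    ultimately show ?thesis
      using DERIV_unique by blast
  qed
  then show ?thesis
    using assms(3) by (rule comp_suppI[rotated])
qed

lemma integral_translate:
  assumes "comp_supp f"
  shows "integral UNIV (\<lambda>x. f (c + x)) = integral UNIV f"
proof -
  have f: "integrable lborel f" using assms by (rule comp_supp_lborel)
  obtain N where N: "\<And>x. N < norm x \<Longrightarrow> f x = 0"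
    using assms by (auto simp: comp_supp_def)
  have "f (c + x) = 0" if "N + norm c < norm x" for x
    by (rule N) (use that norm_triangle_ineq2[of x "-c"] in \<open>simp add: add.commute\<close>)
  then have "comp_supp (\<lambda>x. f (c + x))"
    using assms by (intro comp_suppI[of _ "N + norm c"])
      (auto simp: comp_supp_def intro!: continuous_intros continuous_on_compose2[of UNIV f])
  then have "integrable lborel (\<lambda>x. f (c + x))"
    by (rule comp_supp_lborel)
  then have "integral UNIV (\<lambda>x. f (c + x)) = (LINT x|lborel. f (c + x))"
    by (rule integral_lborel)
  also have "\<dots> = (LINT x|distr lborel borel ((+) c). f x)"
    using f by (subst integral_distr) auto
  also have "\<dots> = integral UNIV f"
    unfolding lborel_distr_plus using f by (rule integral_lborel[symmetric])
  finally show ?thesis .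
qed

text \<open>The integral of \<open>g\<close> over its translates along the i-th axis does not depend
  on the translation parameter \<tau>; differentiating under the integral sign at 0 leaves the
  integral of \<open>g'\<close>.\<close>

lemma integral_pd_zero:
  assumes g: "pd i g g'" "comp_supp g" and g': "continuous_on UNIV g'"
  shows "integral UNIV g' = 0"
proof -
  obtain N where N: "\<And>x. N < norm x \<Longrightarrow> g x = 0"
    using assms by (auto simp: comp_supp_def)
  obtain N' where N': "\<And>x. N' < norm x \<Longrightarrow> g' x = 0"
    using pd_comp_supp[OF g g'] by (auto simp: comp_supp_def)
  \<comment> \<open>The margin 1 keeps the supports of all translates with |\<tau>| <= 1 inside one
    box, so the domain of integration stays fixed while \<tau> varies.\<close>
  define M where "M = max N N' + 1"
  obtain a :: "real^3" where "cball 0 M \<subseteq> cbox (-a) a"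
    using bounded_subset_cbox_symmetric[OF bounded_cball] by blast
  then have a: "norm x \<le> M \<Longrightarrow> x \<in> cbox (-a) a" for x
    by auto
  have gc: "continuous_on UNIV g"
    using g by (simp add: comp_supp_def)
  define K where "K = (\<lambda>\<tau>. integral (cbox (-a) a) (\<lambda>x. g (x + \<tau> *\<^sub>R axis i 1)))"
  have "(K has_real_derivative integral (cbox (-a) a) (\<lambda>x. g' (x + 0 *\<^sub>R axis i 1))) (at 0 within {-1..1})"
    unfolding K_def
  proof (rule leibniz_rule_field_derivative)
    show "((\<lambda>\<tau>. g (x + \<tau> *\<^sub>R axis i 1)) has_real_derivative g' (x + \<tau> *\<^sub>R axis i 1)) (at \<tau> within {-1..1})" for \<tau> x
      using pd_line[OF g(1)] DERIV_subset by blast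
    show "(\<lambda>x. g (x + \<tau> *\<^sub>R axis i 1)) integrable_on cbox (- a) a" for \<tau>
      by (intro integrable_continuous continuous_on_compose2[OF gc] continuous_intros) auto
    show "continuous_on ({-1..1} \<times> cbox (- a) a) (\<lambda>(\<tau>, x). g' (x + \<tau> *\<^sub>R axis i 1))"
      unfolding split_beta
      by (intro continuous_on_compose2[OF g'] continuous_intros) auto
  qed auto
  then have 1: "(K has_real_derivative integral (cbox (-a) a) g') (at 0 within {-1..1})"
    by simp
  have K: "K \<tau> = integral UNIV g" if "\<tau> \<in> {-1..1}" for \<tau>
  proof -
    have "g (x + \<tau> *\<^sub>R axis i 1) = 0" if "x \<notin> cbox (-a) a" for x
    proof (rule N)
      have "M < norm x" using a that not_le by blast
      moreover have "norm (\<tau> *\<^sub>R axis i (1::real)) \<le> 1"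
        using \<open>\<tau> \<in> {-1..1}\<close> by (simp add: abs_le_iff)
      ultimately show "N < norm (x + \<tau> *\<^sub>R axis i 1)"
        using norm_diff_ineq[of x "\<tau> *\<^sub>R axis i (1::real)"] by (simp add: M_def)
    qed
    then have "K \<tau> = integral UNIV (\<lambda>x. g (x + \<tau> *\<^sub>R axis i 1))"
      unfolding K_def by (subst integral_restrict_UNIV[symmetric]) (auto intro!: arg_cong[where f="integral UNIV"])
    then show ?thesis
      using integral_translate[OF g(2), of "\<tau> *\<^sub>R axis i 1"] by (simp add: add.commute)
  qed
  have "(K has_real_derivative 0) (at 0 within {-1..1})"
    by (rule has_field_derivative_transform_within[of "\<lambda>_. integral UNIV g" _ _ _ 1]) (use K in auto)
  then have "integral (cbox (-a) a) g' = 0"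
    using 1 vector_derivative_unique_within[of 0 "{-1..1}" K] 
    by (simp add: has_real_derivative_iff_has_vector_derivative trivial_limit_within islimpt_Icc)
  moreover have "integral (cbox (-a) a) g' = integral UNIV g'"
  proof -
    have "g' x = 0" if "x \<notin> cbox (-a) a" for x
      by (rule N') (use a[of x] that in \<open>force simp: M_def\<close>)
    then show ?thesis
      by (subst integral_restrict_UNIV[symmetric]) (auto intro!: arg_cong[where f="integral UNIV"])
  qed
  ultimately show ?thesis by simp
qed

section \<open>Energy identities for the slice operator\<close>

text \<open>The squared length of the cross product of x and g, that is |x|^2 times the squared
  length of the part of g tangent to the sphere through x. Without a division by |x| it stays
  polynomial and is harmless at the origin.\<close>

definition tang :: "real^3 \<Rightarrow> (3 \<Rightarrow> real) \<Rightarrow> real" where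
  "tang x g = (x \<bullet> x) * (\<Sum>i\<in>UNIV. (g i)\<^sup>2) - (\<Sum>i\<in>UNIV. x $ i * g i)\<^sup>2"

lemma tang_lagrange:
  "tang x g = (x $ 1 * g 2 - x $ 2 * g 1)\<^sup>2 + (x $ 1 * g 3 - x $ 3 * g 1)\<^sup>2 + (x $ 2 * g 3 - x $ 3 * g 2)\<^sup>2"
  unfolding tang_def inner_vec_def sum_3 inner_real_def by (simp add: power2_eq_square algebra_simps)

lemma tang_nonneg: "0 \<le> tang x g"
  unfolding tang_lagrange by simp

lemma radial_deriv_sq_le: "(\<Sum>i\<in>UNIV. x $ i * g i)\<^sup>2 \<le> (x \<bullet> x) * (\<Sum>i\<in>UNIV. (g i)\<^sup>2)" for x :: "real^3"
  using tang_nonneg[of x g] by (simp add: tang_def)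

text \<open>A nonnegative quadratic form bounds its polarization: expand it at g + h and at g -
  h.\<close>

lemma tang_polar:
  "\<bar>2 * ((x \<bullet> x) * (\<Sum>i\<in>UNIV. g i * h i) - (\<Sum>i\<in>UNIV. x $ i * g i) * (\<Sum>i\<in>UNIV. x $ i * h i))\<bar>
    \<le> tang x g + tang x h"
proof -
  have "tang x (\<lambda>i. g i + h i) = tang x g + tang x h
      + 2 * ((x \<bullet> x) * (\<Sum>i\<in>UNIV. g i * h i) - (\<Sum>i\<in>UNIV. x $ i * g i) * (\<Sum>i\<in>UNIV. x $ i * h i))"
    "tang x (\<lambda>i. g i - h i) = tang x g + tang x h
      - 2 * ((x \<bullet> x) * (\<Sum>i\<in>UNIV. g i * h i) - (\<Sum>i\<in>UNIV. x $ i * g i) * (\<Sum>i\<in>UNIV. x $ i * h i))"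
    unfolding tang_def sum_3 by (simp_all add: power2_eq_square algebra_simps)
  with tang_nonneg[of x "\<lambda>i. g i + h i"] tang_nonneg[of x "\<lambda>i. g i - h i"] show ?thesis
    by linarith
qed

lemma integral_divergence:
  assumes "\<And>i. pd i (X i) (X' i)" "\<And>i. comp_supp (X i)" "\<And>i. continuous_on UNIV (X' i)"
    and "\<And>x. F x = (\<Sum>i\<in>UNIV. X' i x)"
  shows "comp_supp F" "integral UNIV F = 0"
proof -
  have c: "comp_supp (X' i)" for i
    using assms pd_comp_supp by blast
  have F: "F = (\<lambda>x. \<Sum>i\<in>UNIV. X' i x)"
    using assms(4) by auto
  show "comp_supp F"
    unfolding F by (intro comp_supp_sum c)
  show "integral UNIV F = 0"
    unfolding F using integral_pd_zero[OF assms(1-3)]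
    by (subst integral_sum) (auto intro: comp_supp_integrable c)
qed

lemma DERIV_continuous_nonneg:
  fixes n :: "real \<Rightarrow> real"
  shows "(\<And>y. 0 \<le> y \<Longrightarrow> (n has_real_derivative n' y) (at y)) \<Longrightarrow> continuous_on {0..} n"
  by (rule continuous_at_imp_continuous_on) (auto intro: DERIV_isCont)

lemma continuous_on_radial: "continuous_on {0..} f \<Longrightarrow> continuous_on UNIV (\<lambda>x::real^3. f (x \<bullet> x))"
  by (rule continuous_on_compose2[of "{0..}" f]) (auto intro!: continuous_intros)

lemma pd_radial:
  assumes "\<And>y. 0 \<le> y \<Longrightarrow> (f has_real_derivative f' y) (at y)"
  shows "pd i (\<lambda>x. f (x \<bullet> x)) (\<lambda>x. f' (x \<bullet> x) * (2 * x $ i))"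
  by (rule pd_comp[where v="\<lambda>x. x \<bullet> x"]) (auto intro: assms pd_sqnorm)

text \<open>The integrand is the divergence of the field x n(|x|^2) V. With V a square or a
  \<open>tang\<close> this is integration by parts in the radial direction, and a weight whose
  derivative is concentrated on a shell yields the trace of V there.\<close>

lemma radial_identity:
  fixes n :: "real \<Rightarrow> real"
  assumes V: "\<And>i. pd i V (V1 i)" "continuous_on UNIV V" "\<And>i. continuous_on UNIV (V1 i)"
    and n: "\<And>y. 0 \<le> y \<Longrightarrow> (n has_real_derivative n' y) (at y)" "continuous_on {0..} n'"
    and supp: "comp_supp (\<lambda>x::real^3. n (x \<bullet> x))"
  shows "comp_supp (\<lambda>x. (2 * (x \<bullet> x) * n' (x \<bullet> x) + 3 * n (x \<bullet> x)) * V x + n (x \<bullet> x) * (\<Sum>i\<in>UNIV. x $ i * V1 i x))"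
      (is "comp_supp ?F")
    and "integral UNIV (\<lambda>x. (2 * (x \<bullet> x) * n' (x \<bullet> x) + 3 * n (x \<bullet> x)) * V x + n (x \<bullet> x) * (\<Sum>i\<in>UNIV. x $ i * V1 i x)) = 0"
proof -
  let ?X = "\<lambda>i x. n (x \<bullet> x) * (x $ i * V x)"
  let ?X' = "\<lambda>i x. (n' (x \<bullet> x) * (2 * x $ i)) * (x $ i * V x) + (1 * V x + V1 i x * x $ i) * n (x \<bullet> x)"
  have n_cont: "continuous_on {0..} n"
    using n(1) by (rule DERIV_continuous_nonneg)
  have pd: "pd i (?X i) (?X' i)" for i
  proof -
    have *: "pd i (\<lambda>x. x $ i * V x) (\<lambda>x. 1 * V x + V1 i x * x $ i)"
      using pd_mult[OF pd_coord V(1), of i i] by simp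
    show ?thesis
      by (rule pd_mult[OF pd_radial[OF n(1)] *])
  qed
  have "comp_supp (?X i)" for i
    by (intro comp_supp_multL supp continuous_intros V)
  moreover have "continuous_on UNIV (?X' i)" for i
    by (intro continuous_intros V continuous_on_compose2[OF n(2)] continuous_on_compose2[OF n_cont]) auto
  moreover have "?F x = (\<Sum>i\<in>UNIV. ?X' i x)" for x
    unfolding sum_3 inner_vec_def inner_real_def by (simp add: algebra_simps)
  ultimately show "comp_supp ?F" "integral UNIV ?F = 0"
    using integral_divergence[of ?X ?X' ?F] pd by blast+
qed

text \<open>The equation is tested against W \<psi>, the source being kept as a derivative so that
  only G itself appears in F. In the application \<psi> is the k-th derivative of a solution, G is
  the slice operator applied to that solution, and 2a x . grad \<psi> is the commutator of the
  operator with the k-th derivative.\<close>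

lemma elliptic_identity:
  fixes W :: "real \<Rightarrow> real"
  assumes g: "has_grad \<psi> \<psi>1" "\<And>i. has_grad (\<psi>1 i) (\<psi>2 i)" and sym: "\<And>i j x. \<psi>2 i j x = \<psi>2 j i x"
    and W: "\<And>y. 0 \<le> y \<Longrightarrow> (W has_real_derivative W' y) (at y)" "continuous_on {0..} W'"
    and supp: "comp_supp (\<lambda>x. W (x \<bullet> x) * \<psi> x)"
    and G: "pd k G Gk" "continuous_on UNIV G" "continuous_on UNIV Gk"
    and eq: "\<And>x. (\<Sum>i\<in>UNIV. \<psi>2 i i x) - a * (\<Sum>i\<in>UNIV. \<Sum>j\<in>UNIV. x $ i * x $ j * \<psi>2 i j x)
                = Gk x + 2 * a * (\<Sum>i\<in>UNIV. x $ i * \<psi>1 i x)"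
  defines "F \<equiv> \<lambda>x. W (x \<bullet> x) * ((\<Sum>i\<in>UNIV. (\<psi>1 i x)\<^sup>2) - a * (\<Sum>i\<in>UNIV. x $ i * \<psi>1 i x)\<^sup>2)
        + (2 * W' (x \<bullet> x) * (1 - a * (x \<bullet> x)) - 2 * a * W (x \<bullet> x)) * \<psi> x * (\<Sum>i\<in>UNIV. x $ i * \<psi>1 i x)
        - (W (x \<bullet> x) * \<psi>1 k x + 2 * x $ k * W' (x \<bullet> x) * \<psi> x) * G x"
  shows "comp_supp F" "integral UNIV F = 0"
proof -
  let ?R = "\<lambda>x. \<Sum>j\<in>UNIV. x $ j * \<psi>1 j x"
  let ?p = "\<lambda>i x. (W' (x \<bullet> x) * (2 * x $ i)) * \<psi> x + \<psi>1 i x * W (x \<bullet> x)"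
  let ?R' = "\<lambda>i x. \<Sum>j\<in>UNIV. (if i = j then 1 else 0) * \<psi>1 j x + \<psi>2 j i x * x $ j"
  let ?X = "\<lambda>i x. (W (x \<bullet> x) * \<psi> x) * (\<psi>1 i x - a * (x $ i * ?R x)) - (if i = k then (W (x \<bullet> x) * \<psi> x) * G x else 0)"
  let ?X' = "\<lambda>i x. ?p i x * (\<psi>1 i x - a * (x $ i * ?R x)) + (\<psi>2 i i x - a * (1 * ?R x + ?R' i x * x $ i)) * (W (x \<bullet> x) * \<psi> x)
     - (if i = k then ?p k x * G x + Gk x * (W (x \<bullet> x) * \<psi> x) else 0)"
  have Wc: "continuous_on {0..} W"
    using W(1) by (rule DERIV_continuous_nonneg)
  have cont: "continuous_on UNIV \<psi>" "\<And>i. continuous_on UNIV (\<psi>1 i)" "\<And>i j. continuous_on UNIV (\<psi>2 i j)"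
    using g by (auto intro: has_grad_cont has_grad_cont1)
  have Ws: "continuous_on UNIV (\<lambda>x::real^3. W (x \<bullet> x))" "continuous_on UNIV (\<lambda>x::real^3. W' (x \<bullet> x))"
    by (rule continuous_on_radial, fact)+
  have pw: "pd i (\<lambda>x. W (x \<bullet> x) * \<psi> x) (?p i)" for i
    by (rule pd_mult[OF pd_radial[OF W(1)] has_grad_pd[OF g(1)]])
  have pR: "pd i ?R (?R' i)" for i
    by (intro pd_sum pd_mult pd_coord has_grad_pd g)
  have px: "pd i (\<lambda>x. x $ i * ?R x) (\<lambda>x. 1 * ?R x + ?R' i x * x $ i)" for i
    using pd_mult[OF pd_coord pR, of i i] by simp
  have p1: "pd i (\<lambda>x. (W (x \<bullet> x) * \<psi> x) * (\<psi>1 i x - a * (x $ i * ?R x)))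
     (\<lambda>x. ?p i x * (\<psi>1 i x - a * (x $ i * ?R x)) + (\<psi>2 i i x - a * (1 * ?R x + ?R' i x * x $ i)) * (W (x \<bullet> x) * \<psi> x))" for i
    by (intro pd_mult pw pd_diff pd_cmult px has_grad_pd g)
  have p2: "pd k (\<lambda>x. (W (x \<bullet> x) * \<psi> x) * G x) (\<lambda>x. ?p k x * G x + Gk x * (W (x \<bullet> x) * \<psi> x))"
    by (intro pd_mult pw G)
  have pd: "pd i (?X i) (?X' i)" for i
  proof (cases "i = k")
    case True
    then show ?thesis using pd_diff[OF p1[of k] p2] by simp
  next
    case False
    then show ?thesis using p1[of i] by simp
  qed
  have cR: "continuous_on UNIV ?R" "\<And>i. continuous_on UNIV (?R' i)"
    by (intro continuous_intros cont)+
  have cs: "comp_supp (?X i)" for i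
  proof (cases "i = k")
    case True
    have "comp_supp (\<lambda>x. (W (x \<bullet> x) * \<psi> x) * (\<psi>1 k x - a * (x $ k * ?R x)) - (W (x \<bullet> x) * \<psi> x) * G x)"
      by (intro comp_supp_diff comp_supp_multL[OF _ supp] continuous_intros cont G)
    then show ?thesis using True by simp
  next
    case False
    have "comp_supp (\<lambda>x. (W (x \<bullet> x) * \<psi> x) * (\<psi>1 i x - a * (x $ i * ?R x)))"
      by (intro comp_supp_multL[OF _ supp] continuous_intros cont)
    then show ?thesis using False by simp
  qed
  have cX': "continuous_on UNIV (?X' i)" for i
  proof (cases "i = k")
    case True
    have "continuous_on UNIV (\<lambda>x. ?p i x * (\<psi>1 i x - a * (x $ i * ?R x)) + (\<psi>2 i i x - a * (1 * ?R x + ?R' i x * x $ i)) * (W (x \<bullet> x) * \<psi> x)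
     - (?p k x * G x + Gk x * (W (x \<bullet> x) * \<psi> x)))"
      by (intro continuous_intros cont Ws G)
    then show ?thesis using True by simp
  next
    case False
    have "continuous_on UNIV (\<lambda>x. ?p i x * (\<psi>1 i x - a * (x $ i * ?R x)) + (\<psi>2 i i x - a * (1 * ?R x + ?R' i x * x $ i)) * (W (x \<bullet> x) * \<psi> x))"
      by (intro continuous_intros cont Ws G)
    then show ?thesis using False by simp
  qed
  have "F x = (\<Sum>i\<in>UNIV. ?X' i x)" for x
  proof -
    have "(\<Sum>i\<in>UNIV. ?X' i x) = (\<Sum>i\<in>UNIV. ?p i x * (\<psi>1 i x - a * (x $ i * ?R x)) + (\<psi>2 i i x - a * (1 * ?R x + ?R' i x * x $ i)) * (W (x \<bullet> x) * \<psi> x))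
      - (?p k x * G x + Gk x * (W (x \<bullet> x) * \<psi> x))"
      by (simp add: sum_subtractf)
    \<comment> \<open>With R = x . grad \<psi>, the field grad \<psi> - a x R has as divergence the
      slice operator on \<psi> minus 4aR: three from div x, one from differentiating x inside R. The
      commutator term of the equation reduces the 4 to 2.\<close>
    also have "(\<Sum>i\<in>UNIV. ?p i x * (\<psi>1 i x - a * (x $ i * ?R x)) + (\<psi>2 i i x - a * (1 * ?R x + ?R' i x * x $ i)) * (W (x \<bullet> x) * \<psi> x))
      = W (x \<bullet> x) * ((\<Sum>i\<in>UNIV. (\<psi>1 i x)\<^sup>2) - a * (?R x)\<^sup>2)
        + (2 * W' (x \<bullet> x) * (1 - a * (x \<bullet> x)) - 4 * a * W (x \<bullet> x)) * \<psi> x * ?R x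
        + W (x \<bullet> x) * \<psi> x * ((\<Sum>i\<in>UNIV. \<psi>2 i i x) - a * (\<Sum>i\<in>UNIV. \<Sum>j\<in>UNIV. x $ i * x $ j * \<psi>2 i j x))"
      unfolding inner_vec_def inner_real_def sum_3
      by (simp add: sym[of 2 1] sym[of 3 1] sym[of 3 2] power2_eq_square algebra_simps)
    also note eq
    finally show ?thesis
      unfolding F_def by (simp add: algebra_simps)
  qed
  then show "comp_supp F" "integral UNIV F = 0"
    using integral_divergence[of ?X ?X' F] pd cs cX' by blast+
qed

text \<open>Rellich's field for the multiplier R - 2P and the form |grad \<Phi>|^2 - a R^2, weighted
  by m(|x|^2). The summand -2P is there to cancel the product of R and RP that the equation
  produces: its size a |x|^2 could not be bounded by squared gradients uniformly in |x|, even after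
  weighting. At top order there remains -m' times a tangential part plus a |x|^2 - 1 times a radial
  part, nonnegative outside the cone when m decreases.\<close>

lemma rellich_identity:
  fixes m :: "real \<Rightarrow> real"
  assumes g: "\<And>i. pd i \<Phi> (\<Phi>1 i)" "\<And>i. has_grad (\<Phi>1 i) (\<Phi>2 i)" and sym: "\<And>i j x. \<Phi>2 i j x = \<Phi>2 j i x"
    and m: "\<And>y. 0 \<le> y \<Longrightarrow> (m has_real_derivative m' y) (at y)" "continuous_on {0..} m'"
    and supp: "comp_supp (\<lambda>x::real^3. m (x \<bullet> x))"
    and P: "has_grad P P1"
    and eq: "\<And>x. (\<Sum>i\<in>UNIV. \<Phi>2 i i x) - a * (\<Sum>i\<in>UNIV. \<Sum>j\<in>UNIV. x $ i * x $ j * \<Phi>2 i j x)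
                = f x + a * (2 * (\<Sum>i\<in>UNIV. x $ i * \<Phi>1 i x) - 2 * (\<Sum>i\<in>UNIV. x $ i * P1 i x) + Q x)"
  defines "R \<equiv> \<lambda>x. \<Sum>i\<in>UNIV. x $ i * \<Phi>1 i x" and "RP \<equiv> \<lambda>x. \<Sum>i\<in>UNIV. x $ i * P1 i x"
  defines "F \<equiv> \<lambda>x. - m' (x \<bullet> x) * (tang x (\<lambda>i. \<Phi>1 i x) + (a * (x \<bullet> x) - 1) * (R x)\<^sup>2)
       + m (x \<bullet> x) * (R x - 2 * P x) * f x
       + a * m (x \<bullet> x) * (Q x * R x + 4 * P x * R x + 4 * P x * RP x - 2 * P x * Q x)
       - m (x \<bullet> x) / 2 * (\<Sum>i\<in>UNIV. (\<Phi>1 i x)\<^sup>2) - a * m (x \<bullet> x) / 2 * (R x)\<^sup>2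
       - 2 * m (x \<bullet> x) * (\<Sum>i\<in>UNIV. \<Phi>1 i x * P1 i x)
       - 4 * m' (x \<bullet> x) * (1 - a * (x \<bullet> x)) * P x * R x"
  shows "comp_supp F" "integral UNIV F = 0"
proof -
  let ?R' = "\<lambda>i x. \<Sum>j\<in>UNIV. (if i = j then 1 else 0) * \<Phi>1 j x + \<Phi>2 j i x * x $ j"
  let ?n = "\<lambda>x. \<Sum>j\<in>UNIV. \<Phi>1 j x * \<Phi>1 j x"
  let ?n' = "\<lambda>i x. \<Sum>j\<in>UNIV. \<Phi>2 j i x * \<Phi>1 j x + \<Phi>2 j i x * \<Phi>1 j x"
  let ?K = "\<lambda>i x. R x * \<Phi>1 i x - (1/2) * (x $ i * ?n x) - (a/2) * (x $ i * (R x * R x)) - 2 * (P x * (\<Phi>1 i x - a * (x $ i * R x)))"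
  let ?K' = "\<lambda>i x. (?R' i x * \<Phi>1 i x + \<Phi>2 i i x * R x) - (1/2) * (1 * ?n x + ?n' i x * x $ i)
      - (a/2) * (1 * (R x * R x) + (?R' i x * R x + ?R' i x * R x) * x $ i)
      - 2 * (P1 i x * (\<Phi>1 i x - a * (x $ i * R x)) + (\<Phi>2 i i x - a * (1 * R x + ?R' i x * x $ i)) * P x)"
  let ?X = "\<lambda>i x. m (x \<bullet> x) * ?K i x"
  let ?X' = "\<lambda>i x. (m' (x \<bullet> x) * (2 * x $ i)) * ?K i x + ?K' i x * m (x \<bullet> x)"
  have mc: "continuous_on {0..} m"
    using m(1) by (rule DERIV_continuous_nonneg)
  have ms: "continuous_on UNIV (\<lambda>x::real^3. m (x \<bullet> x))" "continuous_on UNIV (\<lambda>x::real^3. m' (x \<bullet> x))"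
    by (rule continuous_on_radial, fact)+
  have cont: "\<And>i. continuous_on UNIV (\<Phi>1 i)" "\<And>i j. continuous_on UNIV (\<Phi>2 i j)"
     "continuous_on UNIV P" "\<And>i. continuous_on UNIV (P1 i)"
    using g P by (auto intro: has_grad_cont has_grad_cont1)
  have cR: "continuous_on UNIV R" unfolding R_def by (intro continuous_intros cont)
  have pR: "pd i R (?R' i)" for i
    unfolding R_def by (intro pd_sum pd_mult pd_coord has_grad_pd g)
  have px: "pd i (\<lambda>x. x $ i * u x) (\<lambda>x. 1 * u x + u' x * x $ i)" if "pd i u u'" for i u u'
    using pd_mult[OF pd_coord that, of i] by simp
  have pK: "pd i (?K i) (?K' i)" for i
  proof -
    have \<Phi>1: "pd i (\<Phi>1 j) (\<Phi>2 j i)" for j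
      by (rule has_grad_pd[OF g(2)])
    have n: "pd i ?n (?n' i)"
      by (intro pd_sum pd_mult \<Phi>1)
    show ?thesis
      by (rule pd_diff[OF pd_diff[OF pd_diff[OF pd_mult[OF pR \<Phi>1] pd_cmult[OF px[OF n]]]
            pd_cmult[OF px[OF pd_mult[OF pR pR]]]]
            pd_cmult[OF pd_mult[OF has_grad_pd[OF P] pd_diff[OF \<Phi>1 pd_cmult[OF px[OF pR]]]]]])
  qed
  have "pd i (?X i) (?X' i)" for i
    by (rule pd_mult[OF pd_radial[OF m(1)] pK])
  moreover have "comp_supp (?X i)" for i
    by (intro comp_supp_multL supp continuous_intros cont cR)
  moreover have "continuous_on UNIV (?X' i)" for i
    by (intro continuous_intros cont cR ms)
  moreover have "F x = (\<Sum>i\<in>UNIV. ?X' i x)" for x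
  proof -
    \<comment> \<open>Each sum is named as a scalar here, after which the divergence identity is
      polynomial in those scalars. Symmetry of the Hessian identifies the two ways in which B and E
      arise.\<close>
    define L where "L = (\<Sum>i\<in>UNIV. \<Phi>2 i i x) - a * (\<Sum>i\<in>UNIV. \<Sum>j\<in>UNIV. x $ i * x $ j * \<Phi>2 i j x)"
    define r where "r = R x"
    define D where "D = (\<Sum>i\<in>UNIV. \<Phi>2 i i x)"
    define E where "E = (\<Sum>i\<in>UNIV. \<Sum>j\<in>UNIV. x $ i * x $ j * \<Phi>2 i j x)"
    define n where "n = ?n x"
    define B where "B = (\<Sum>i\<in>UNIV. \<Sum>j\<in>UNIV. \<Phi>2 j i x * x $ j * \<Phi>1 i x)"
    define S where "S = (\<Sum>i\<in>UNIV. \<Phi>1 i x * P1 i x)"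
    define s where "s = x \<bullet> x"
    have r: "(\<Sum>i\<in>UNIV. x $ i * \<Phi>1 i x) = r" by (simp add: r_def R_def)
    have rP: "(\<Sum>i\<in>UNIV. x $ i * P1 i x) = RP x" by (simp add: RP_def)
    have n2: "(\<Sum>i\<in>UNIV. (\<Phi>1 i x)\<^sup>2) = n" by (simp add: n_def power2_eq_square)

    have e2: "(\<Sum>i\<in>UNIV. x $ i * (x $ i * c)) = s * c" for c
      by (simp add: s_def inner_vec_def sum_distrib_right mult.assoc)
    have k1: "(\<Sum>i\<in>UNIV. x $ i * ?K i x) = r * r - s * n / 2 - a / 2 * s * (r * r) - 2 * P x * (r - a * s * r)"
    proof -
      have "(\<Sum>i\<in>UNIV. x $ i * ?K i x) = r * (\<Sum>i\<in>UNIV. x $ i * \<Phi>1 i x) - (1/2) * (\<Sum>i\<in>UNIV. x $ i * (x $ i * n))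
        - (a/2) * (\<Sum>i\<in>UNIV. x $ i * (x $ i * (r * r))) - 2 * P x * ((\<Sum>i\<in>UNIV. x $ i * \<Phi>1 i x) - a * (\<Sum>i\<in>UNIV. x $ i * (x $ i * r)))"
        unfolding n_def[symmetric] r_def[symmetric] sum_3 by (simp add: algebra_simps)
      then show ?thesis unfolding r e2 by (simp add: algebra_simps)
    qed
    have k2: "(\<Sum>i\<in>UNIV. ?R' i x * \<Phi>1 i x + \<Phi>2 i i x * r) = n + B + D * r"
      unfolding n_def B_def D_def sum_3 by (simp add: algebra_simps)
    have k3: "(\<Sum>i\<in>UNIV. 1 * n + ?n' i x * x $ i) = 3 * n + 2 * B"
      unfolding B_def sum_3 by (simp add: sym[of 2 1] sym[of 3 1] sym[of 3 2] algebra_simps)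
    have RE: "(\<Sum>i\<in>UNIV. ?R' i x * x $ i) = r + E"
      unfolding E_def r[symmetric] sum_3 by (simp add: sym[of 2 1] sym[of 3 1] sym[of 3 2] algebra_simps)
    have k4: "(\<Sum>i\<in>UNIV. 1 * (r * r) + (?R' i x * r + ?R' i x * r) * x $ i) = 3 * (r * r) + 2 * r * (r + E)"
      unfolding RE[symmetric] sum_3 by (simp add: algebra_simps)
    have k5: "(\<Sum>i\<in>UNIV. P1 i x * (\<Phi>1 i x - a * (x $ i * r)) + (\<Phi>2 i i x - a * (1 * r + ?R' i x * x $ i)) * P x)
        = S - a * r * RP x + (D - a * (3 * r + (r + E))) * P x"
      unfolding RE[symmetric] S_def rP[symmetric] D_def sum_3 by (simp add: algebra_simps)
    have "(\<Sum>i\<in>UNIV. ?K' i x) = (\<Sum>i\<in>UNIV. ?R' i x * \<Phi>1 i x + \<Phi>2 i i x * r) - (1/2) * (\<Sum>i\<in>UNIV. 1 * n + ?n' i x * x $ i)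
       - (a/2) * (\<Sum>i\<in>UNIV. 1 * (r * r) + (?R' i x * r + ?R' i x * r) * x $ i)
       - 2 * (\<Sum>i\<in>UNIV. P1 i x * (\<Phi>1 i x - a * (x $ i * r)) + (\<Phi>2 i i x - a * (1 * r + ?R' i x * x $ i)) * P x)"
      unfolding n_def[symmetric] r_def[symmetric] by (simp add: sum_subtractf sum_distrib_left)
    then have K': "(\<Sum>i\<in>UNIV. ?K' i x) = n + B + D * r - (3 * n + 2 * B) / 2 - a / 2 * (3 * (r * r) + 2 * r * (r + E))
       - 2 * (S - a * r * RP x + (D - a * (3 * r + (r + E))) * P x)"
      unfolding k2 k3 k4 k5 by simp
    have "(\<Sum>i\<in>UNIV. ?X' i x) = 2 * m' s * (\<Sum>i\<in>UNIV. x $ i * ?K i x) + m s * (\<Sum>i\<in>UNIV. ?K' i x)"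
      unfolding sum.distrib sum_distrib_left s_def by (simp add: mult_ac)
    also have "\<dots> = 2 * m' s * (r * r - s * n / 2 - a / 2 * s * (r * r) - 2 * P x * (r - a * s * r))
       + m s * (n + B + D * r - (3 * n + 2 * B) / 2 - a / 2 * (3 * (r * r) + 2 * r * (r + E))
       - 2 * (S - a * r * RP x + (D - a * (3 * r + (r + E))) * P x))"
      by (simp only: k1 K')
    also have "\<dots> = m (x \<bullet> x) * (R x - 2 * P x) * L
       - m' (x \<bullet> x) * (tang x (\<lambda>i. \<Phi>1 i x) + (a * (x \<bullet> x) - 1) * (R x)\<^sup>2)
       - 4 * m' (x \<bullet> x) * (1 - a * (x \<bullet> x)) * P x * R x
       - m (x \<bullet> x) / 2 * (\<Sum>i\<in>UNIV. (\<Phi>1 i x)\<^sup>2) - 5 * a * m (x \<bullet> x) / 2 * (R x)\<^sup>2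
       - 2 * m (x \<bullet> x) * (\<Sum>i\<in>UNIV. \<Phi>1 i x * P1 i x) + 2 * a * m (x \<bullet> x) * R x * RP x
       + 8 * a * m (x \<bullet> x) * P x * R x"
      unfolding L_def tang_def n2 r D_def[symmetric] E_def[symmetric] S_def[symmetric] r_def[symmetric] s_def[symmetric]
      by (simp add: power2_eq_square algebra_simps)
    also have "L = f x + a * (2 * R x - 2 * RP x + Q x)"
      unfolding L_def R_def RP_def by (rule eq)
    finally show ?thesis
      unfolding F_def by (simp add: power2_eq_square algebra_simps)
  qed
  ultimately show "comp_supp F" "integral UNIV F = 0"
    using integral_divergence[of ?X ?X' F] by blast+
qed

section \<open>Cutoffs\<close>

text \<open>C^1 with a piecewise linear derivative. This is all the regularity the weights need: the
  identities differentiate a weight once and want that derivative continuous.\<close>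

definition possq :: "real \<Rightarrow> real" where
  "possq y = (max 0 y)\<^sup>2"

lemma possq_deriv: "(possq has_real_derivative 2 * max 0 y) (at y)"
proof -
  consider "y < 0" | "y > 0" | "y = 0" by linarith
  then show ?thesis
  proof cases
    case 1
    then have "\<forall>\<^sub>F z in nhds y. possq z = 0"
      using eventually_nhds_in_open[of "{..<0}" y] by (auto elim!: eventually_mono simp: possq_def)
    with 1 show ?thesis
      using DERIV_cong_ev[of y y possq "\<lambda>_. 0" 0 0] by simp
  next
    case 2
    then have "\<forall>\<^sub>F z in nhds y. possq z = z\<^sup>2"
      using eventually_nhds_in_open[of "{0<..}" y] by (auto elim!: eventually_mono simp: possq_def)
    moreover have "((\<lambda>z::real. z\<^sup>2) has_real_derivative 2 * y) (at y)"
      by (auto intro!: derivative_eq_intros)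
    ultimately show ?thesis
      using DERIV_cong_ev[of y y possq "\<lambda>z. z\<^sup>2" "2 * y" "2 * y"] 2 by simp
  next
    case 3
    have "((\<lambda>z. possq z / z) \<longlongrightarrow> 0) (at 0)"
    proof (rule Lim_null_comparison)
      show "\<forall>\<^sub>F z in at 0. norm (possq z / z) \<le> \<bar>z\<bar>"
        by (auto intro!: always_eventually simp: possq_def max_def power2_eq_square)
      show "((\<lambda>z::real. \<bar>z\<bar>) \<longlongrightarrow> 0) (at 0)"
        by (auto intro!: tendsto_eq_intros)
    qed
    then show ?thesis
      using 3 by (simp add: has_field_derivative_iff possq_def)
  qed
qed

text \<open>The hat on [0,2] with peak 1 at 1, written as a second difference of the positive part,
  so that \<open>cutoff\<close>, one minus its antiderivative, is built from the same second
  difference of \<open>possq\<close>.\<close>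

definition tent :: "real \<Rightarrow> real" where
  "tent y = max 0 y - 2 * max 0 (y - 1) + max 0 (y - 2)"

definition cutoff :: "real \<Rightarrow> real" where
  "cutoff y = 1 - (possq y - 2 * possq (y - 1) + possq (y - 2)) / 2"

lemma cutoff_deriv: "(cutoff has_real_derivative - tent y) (at y)"
proof -
  have "((\<lambda>y. possq (y - c)) has_real_derivative 2 * max 0 (y - c)) (at y)" for c
  proof -
    have "((\<lambda>y. y - c) has_real_derivative 1) (at y)"
      by (auto intro!: derivative_eq_intros)
    from DERIV_chain2[OF possq_deriv this] show ?thesis by simp
  qed
  from this[of 0] this[of 1] this[of 2] show ?thesis
    unfolding cutoff_def[abs_def] tent_def by (auto intro!: derivative_eq_intros simp: field_simps)
qed

lemma tent_nonneg: "0 \<le> tent y"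
  by (auto simp: tent_def max_def)

lemma tent_zero: "y \<le> 0 \<Longrightarrow> tent y = 0" "2 \<le> y \<Longrightarrow> tent y = 0"
  by (auto simp: tent_def max_def)

lemma tent_ge: "1/2 \<le> y \<Longrightarrow> y \<le> 3/2 \<Longrightarrow> 1/2 \<le> tent y"
  by (auto simp: tent_def max_def)

lemma tent_cont: "continuous_on S tent"
  unfolding tent_def[abs_def] by (intro continuous_intros)

lemma cutoff_one: "y \<le> 0 \<Longrightarrow> cutoff y = 1"
  by (simp add: cutoff_def possq_def)

lemma cutoff_zero: "2 \<le> y \<Longrightarrow> cutoff y = 0"
  by (simp add: cutoff_def possq_def power2_eq_square algebra_simps)

lemma cutoff_mono: "y \<le> z \<Longrightarrow> cutoff z \<le> cutoff y"
  by (rule DERIV_nonpos_imp_nonincreasing[of y z cutoff])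
    (use cutoff_deriv tent_nonneg in \<open>auto intro!: exI[of _ "- tent _"]\<close>)

lemma cutoff_bounds: "0 \<le> cutoff y" "cutoff y \<le> 1"
  using cutoff_mono[of y "max y 2"] cutoff_mono[of "min y 0" y] cutoff_zero[of "max y 2"] cutoff_one[of "min y 0"]
  by auto

text \<open>The shell selected below starts at \<open>|x|\<^sup>2 = s\<^sub>0\<close> and has width of order \<open>\<kappa>\<close> in \<open>|x|\<^sup>2\<close>.\<close>

definition shell :: "real \<Rightarrow> real \<Rightarrow> real \<Rightarrow> real" where
  "shell s0 \<kappa> y = tent ((y - s0) / \<kappa>) / \<kappa>"

definition shellcut :: "real \<Rightarrow> real \<Rightarrow> real \<Rightarrow> real" where
  "shellcut s0 \<kappa> y = cutoff ((y - s0) / \<kappa>)"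

lemma shellcut_deriv:
  assumes "0 < \<kappa>"
  shows "(shellcut s0 \<kappa> has_real_derivative - shell s0 \<kappa> y) (at y)"
proof -
  have "((\<lambda>y. (y - s0) / \<kappa>) has_real_derivative 1/\<kappa>) (at y)"
    using assms by (auto intro!: derivative_eq_intros)
  from DERIV_chain2[OF cutoff_deriv this] show ?thesis
    by (simp add: shellcut_def[abs_def] shell_def)
qed

lemma shell_nonneg: "0 < \<kappa> \<Longrightarrow> 0 \<le> shell s0 \<kappa> y"
  by (simp add: shell_def tent_nonneg)

lemma shell_zero: "0 < \<kappa> \<Longrightarrow> y \<le> s0 \<Longrightarrow> shell s0 \<kappa> y = 0"
  by (simp add: shell_def tent_zero divide_nonpos_pos)

lemma shell_ge: "0 < \<kappa> \<Longrightarrow> s0 + \<kappa>/2 \<le> y \<Longrightarrow> y \<le> s0 + 3/2*\<kappa> \<Longrightarrow> 1 / (2*\<kappa>) \<le> shell s0 \<kappa> y"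
  using tent_ge[of "(y - s0) / \<kappa>"] by (simp add: shell_def field_simps)

lemma shell_cont: "0 < \<kappa> \<Longrightarrow> continuous_on S (shell s0 \<kappa>)"
  unfolding shell_def[abs_def] by (intro continuous_intros continuous_on_compose2[OF tent_cont[of UNIV]]) auto

lemma shellcut_bounds: "0 \<le> shellcut s0 \<kappa> y" "shellcut s0 \<kappa> y \<le> 1"
  by (simp_all add: shellcut_def cutoff_bounds)

lemma shellcut_zero: "0 < \<kappa> \<Longrightarrow> s0 + 2 * \<kappa> \<le> y \<Longrightarrow> shellcut s0 \<kappa> y = 0"
  by (simp add: shellcut_def cutoff_zero field_simps)

lemma shell_zero2: "0 < \<kappa> \<Longrightarrow> s0 + 2 * \<kappa> \<le> y \<Longrightarrow> shell s0 \<kappa> y = 0"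
  by (simp add: shell_def tent_zero field_simps)

lemma sq_gt_norm:
  fixes x :: "real^3"
  assumes "sqrt \<bar>c\<bar> < norm x" shows "c < x \<bullet> x"
proof -
  have "\<bar>c\<bar> < (norm x)\<^sup>2"
    using assms real_less_rsqrt real_sqrt_less_iff
    by (metis abs_ge_zero norm_ge_zero real_sqrt_abs abs_norm_cancel)
  then show ?thesis by (simp add: power2_norm_eq_inner)
qed

lemma comp_supp_radial:
  assumes "continuous_on {0..} f" "\<And>y. c \<le> y \<Longrightarrow> f y = 0"
  shows "comp_supp (\<lambda>x::real^3. f (x \<bullet> x))"
  by (rule comp_suppI[of _ "sqrt \<bar>c\<bar>"]) (use assms sq_gt_norm in \<open>auto intro!: continuous_on_radial intro: less_imp_le\<close>)

text \<open>The form in which every energy identity is used: F is an exact divergence, so a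
  pointwise bound of K modulo F becomes a bound of integrals.\<close>

lemma integral_le_of_zero:
  assumes "comp_supp K" "comp_supp F" "integral UNIV F = 0" "Bd integrable_on UNIV" "\<And>x. K x \<le> F x + Bd x"
  shows "integral UNIV K \<le> integral UNIV Bd"
proof -
  have "integral UNIV K \<le> integral UNIV (\<lambda>x. F x + Bd x)"
    using assms(5) by (intro integral_le[OF comp_supp_integrable[OF assms(1)] integrable_add[OF comp_supp_integrable[OF assms(2)] assms(4)]])
  also have "\<dots> = integral UNIV Bd"
    using assms by (subst integral_add) (auto intro: comp_supp_integrable)
  finally show ?thesis .
qed

section \<open>The exterior Rellich estimate\<close>

lemma mult_le_theta:
  fixes \<theta> x y :: real
  assumes "0 < \<theta>"
  shows "x * y \<le> \<theta> * x\<^sup>2 + y\<^sup>2 / \<theta>"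
proof -
  have "0 \<le> (\<theta> * x - y)\<^sup>2 / \<theta> + \<theta> * x\<^sup>2 + y\<^sup>2 / \<theta>" using assms by auto
  also have "\<dots> = 2 * (\<theta> * x\<^sup>2 + y\<^sup>2 / \<theta> - x * y)"
    using assms by (simp add: power2_eq_square field_simps)
  finally show ?thesis by simp
qed

lemma abs_mult_le_sq: "\<bar>x\<bar> * \<bar>y\<bar> \<le> (x\<^sup>2 + y\<^sup>2) / 2" for x y :: real
  using sum_squares_bound[of "\<bar>x\<bar>" "\<bar>y\<bar>"] by simp

lemma mult_bound_neg: "\<bar>x\<bar> \<le> B \<Longrightarrow> 0 \<le> c \<Longrightarrow> c \<le> 1 \<Longrightarrow> - B \<le> c * x" for x B c :: real
proof -
  assume "\<bar>x\<bar> \<le> B" "0 \<le> c" "c \<le> 1"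
  then have "\<bar>c * x\<bar> \<le> 1 * B" unfolding abs_mult by (intro mult_mono) auto
  then show ?thesis by linarith
qed

text \<open>The integrand of \<open>rellich_identity\<close> with all quantities frozen at one
  point: s = |x|^2, q = (t^2 + s)^(-1/2), \<mu> the cutoff and \<nu> minus its derivative, so that m
  = \<mu> q; D and DP are squared gradients. Subtracted is 4a times the radial identity for P^2,
  which supplies 8 a s \<nu> q P^2 on the shell. All bulk terms are at most \<theta> times squares
  because q and a are at most 1/t <= \<theta>; only f is split with 1/\<theta>.\<close>

lemma rellich_pointwise:
  fixes s t q \<mu> \<nu> a D R P DP RP S Q f \<theta> T :: real
  assumes s: "0 \<le> s" and t: "1 \<le> t" and q: "0 < q" "q\<^sup>2 * (t\<^sup>2 + s) = 1" and \<mu>: "0 \<le> \<mu>" "\<mu> \<le> 1"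
    and \<nu>: "0 \<le> \<nu>" "s < t\<^sup>2 \<Longrightarrow> \<nu> = 0" and a: "a = 1 / t\<^sup>2" and \<theta>: "1 / t \<le> \<theta>"
    and D: "0 \<le> D" "R\<^sup>2 \<le> s * D" and DP: "0 \<le> DP" "RP\<^sup>2 \<le> s * DP" and S: "\<bar>S\<bar> \<le> (D + DP) / 2"
    and T: "T = s * D - R\<^sup>2"
  defines "m' \<equiv> - (\<nu> * q) - \<mu> * q ^ 3 / 2"
  shows "\<nu> * q * (T + (a * s - 1) / 2 * R\<^sup>2) \<le>
     (- m' * (T + (a * s - 1) * R\<^sup>2) + \<mu> * q * (R - 2 * P) * f
       + a * (\<mu> * q) * (Q * R + 4 * P * R + 4 * P * RP - 2 * P * Q)
       - \<mu> * q / 2 * D - a * (\<mu> * q) / 2 * R\<^sup>2 - 2 * (\<mu> * q) * S - 4 * m' * (1 - a * s) * P * R)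
     - 4 * a * ((2 * s * m' + 3 * (\<mu> * q)) * P\<^sup>2 + \<mu> * q * (2 * P * RP))
     + (40 * (\<theta> * (D + P\<^sup>2 + DP + Q\<^sup>2)) + 40 * (f\<^sup>2 / \<theta>))"
proof -
  have t0: "0 < t" and \<theta>0: "0 < \<theta>" using t \<theta> by (auto intro: less_le_trans[rotated])
  have T0: "0 \<le> T" using D T by simp
  have qt: "q\<^sup>2 * t\<^sup>2 \<le> 1" "q\<^sup>2 * s \<le> 1"
  proof -
    have "0 \<le> q\<^sup>2 * s" "0 \<le> q\<^sup>2 * t\<^sup>2" using s by auto
    moreover have "q\<^sup>2 * t\<^sup>2 + q\<^sup>2 * s = 1" using q(2) by (simp add: distrib_left)
    ultimately show "q\<^sup>2 * t\<^sup>2 \<le> 1" "q\<^sup>2 * s \<le> 1" by linarith+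
  qed
  have "(q * t)\<^sup>2 \<le> 1\<^sup>2" using qt(1) by (simp add: power_mult_distrib)
  then have "q * t \<le> 1" by (rule power2_le_imp_le) simp
  then have qt': "q \<le> 1 / t" using t0 by (simp add: field_simps)
  then have q\<theta>: "q \<le> \<theta>" using \<theta> by linarith
  have "1 / t \<le> 1" using t by simp
  then have q1: "q \<le> 1" using qt' by linarith
  have a0: "0 < a" using t0 a by simp
  have "t * 1 \<le> t * t" using t by (intro mult_left_mono) auto
  then have "a \<le> 1 / t" unfolding a using t0 by (simp add: field_simps power2_eq_square)
  then have a\<theta>: "a \<le> \<theta>" using \<theta> by linarith
  define y where "y = sqrt D"
  define z where "z = sqrt DP"
  have y: "0 \<le> y" "y\<^sup>2 = D" "0 \<le> z" "z\<^sup>2 = DP" using D DP by (auto simp: y_def z_def)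
  have qR2: "q\<^sup>2 * R\<^sup>2 \<le> D"
  proof -
    have "q\<^sup>2 * R\<^sup>2 \<le> q\<^sup>2 * (s * D)" using D by (intro mult_left_mono) auto
    also have "\<dots> \<le> 1 * D" unfolding mult.assoc[symmetric] using qt D by (intro mult_right_mono) auto
    finally show ?thesis by simp
  qed
  have qR: "q * \<bar>R\<bar> \<le> y"
    by (rule power2_le_imp_le) (use qR2 y in \<open>auto simp: power_mult_distrib\<close>)
  have qRP2: "q\<^sup>2 * RP\<^sup>2 \<le> DP"
  proof -
    have "q\<^sup>2 * RP\<^sup>2 \<le> q\<^sup>2 * (s * DP)" using DP by (intro mult_left_mono) auto
    also have "\<dots> \<le> 1 * DP" unfolding mult.assoc[symmetric] using qt DP by (intro mult_right_mono) auto
    finally show ?thesis by simp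
  qed
  have qRP: "q * \<bar>RP\<bar> \<le> z"
    by (rule power2_le_imp_le) (use qRP2 y in \<open>auto simp: power_mult_distrib\<close>)
  \<comment> \<open>The only mixed term carried by the shell. Young's inequality 4PR <= R^2/2 + 8P^2
    spends half of the radial term and leaves 8 a s \<nu> q P^2, exactly what the identity for P^2
    returns.\<close>
  have e1: "\<nu> * q * (T + (a * s - 1) * R\<^sup>2) + 4 * (\<nu> * q) * (1 - a * s) * P * R
      \<ge> \<nu> * q * (T + (a * s - 1) / 2 * R\<^sup>2) - 8 * \<nu> * q * (a * s) * P\<^sup>2"
  proof (cases "\<nu> = 0")
    case False
    then have "t\<^sup>2 \<le> s" using \<nu> by force
    then have as: "0 \<le> a * s - 1" using t0 by (simp add: a field_simps)
    have "0 \<le> (R + 4 * P)\<^sup>2" "0 \<le> (R - 4 * P)\<^sup>2" by auto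
    then have "4 * P * R \<le> R\<^sup>2 / 2 + 8 * P\<^sup>2" by (simp add: power2_eq_square algebra_simps)
    then have "(a * s - 1) * (4 * P * R) \<le> (a * s - 1) * (R\<^sup>2 / 2 + 8 * P\<^sup>2)"
      using as by (intro mult_left_mono) auto
    also have "\<dots> \<le> (a * s - 1) * (R\<^sup>2 / 2) + 8 * (a * s) * P\<^sup>2"
      by (simp add: algebra_simps)
    finally have "(T + (a * s - 1) / 2 * R\<^sup>2) - 8 * (a * s) * P\<^sup>2
       \<le> (T + (a * s - 1) * R\<^sup>2) + 4 * (1 - a * s) * P * R"
      by (simp add: left_diff_distrib right_diff_distrib diff_divide_distrib mult_ac)
    then have "\<nu> * q * ((T + (a * s - 1) / 2 * R\<^sup>2) - 8 * (a * s) * P\<^sup>2)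
       \<le> \<nu> * q * ((T + (a * s - 1) * R\<^sup>2) + 4 * (1 - a * s) * P * R)"
      using \<nu> q by (intro mult_left_mono) auto
    then show ?thesis by (simp add: algebra_simps)
  qed auto
  \<comment> \<open>Here the weight (t^2 + s)^(-1/2) pays off: q^2 (t^2 + s) = 1 gives a q^2 s = a -
    q^2, the coefficients a of R^2 cancel, and only -2 q^2 R^2 >= -2D remains.\<close>
  have e2: "- \<theta> * D \<le> \<mu> * q ^ 3 / 2 * (T + (a * s - 1) * R\<^sup>2) - a * (\<mu> * q) / 2 * R\<^sup>2"
  proof -
    have "a * (q\<^sup>2 * s - 1) = - q\<^sup>2"
    proof -
      have "q\<^sup>2 * s - 1 = - (q\<^sup>2 * t\<^sup>2)" using q(2) by (simp add: algebra_simps)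
      then show ?thesis using t0 by (simp add: a)
    qed
    then have *: "a * q\<^sup>2 * s = a - q\<^sup>2" by (simp add: algebra_simps)
    have "\<mu> * q ^ 3 / 2 * (T + (a * s - 1) * R\<^sup>2) - a * (\<mu> * q) / 2 * R\<^sup>2
        = \<mu> * q / 2 * (q\<^sup>2 * T + (a * q\<^sup>2 * s) * R\<^sup>2 - q\<^sup>2 * R\<^sup>2 - a * R\<^sup>2)"
      by (simp add: algebra_simps power2_eq_square power3_eq_cube)
    also have "\<dots> = \<mu> * q / 2 * (q\<^sup>2 * T - 2 * (q\<^sup>2 * R\<^sup>2))" unfolding * by (simp add: algebra_simps)
    also have "\<dots> \<ge> \<mu> * q / 2 * (0 - 2 * D)"
      using \<mu> q qR2 T0 by (intro mult_left_mono diff_mono) auto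
    moreover have "\<mu> * q * D \<le> \<theta> * D"
      using \<mu> q\<theta> q D mult_mono[of \<mu> 1 q \<theta>] by (intro mult_right_mono) auto
    ultimately show ?thesis by simp
  qed
  have e3: "- (\<theta> * D + f\<^sup>2/\<theta> + (2 * (\<theta> * P\<^sup>2) + 2 * (f\<^sup>2/\<theta>))) \<le> \<mu> * (q * (R - 2 * P) * f)"
  proof (rule mult_bound_neg[OF _ \<mu>])
    have "q * \<bar>R - 2 * P\<bar> \<le> q * (\<bar>R\<bar> + 2 * \<bar>P\<bar>)"
      using q abs_triangle_ineq4[of R "2 * P"] by (intro mult_left_mono) auto
    also have "\<dots> \<le> y + 2 * \<bar>P\<bar>"
      using q q1 qR mult_right_mono[of q 1 "\<bar>P\<bar>"] by (simp add: distrib_left)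
    finally have "\<bar>q * (R - 2 * P) * f\<bar> \<le> (y + 2 * \<bar>P\<bar>) * \<bar>f\<bar>"
      unfolding abs_mult using q by (intro mult_right_mono) auto
    also have "\<dots> \<le> \<theta> * D + f\<^sup>2/\<theta> + (2 * (\<theta> * P\<^sup>2) + 2 * (f\<^sup>2/\<theta>))"
      using mult_le_theta[OF \<theta>0, of y "\<bar>f\<bar>"] mult_le_theta[OF \<theta>0, of "\<bar>P\<bar>" "\<bar>f\<bar>"] y
      by (simp add: algebra_simps)
    finally show "\<bar>q * (R - 2 * P) * f\<bar> \<le> \<theta> * D + f\<^sup>2/\<theta> + (2 * (\<theta> * P\<^sup>2) + 2 * (f\<^sup>2/\<theta>))" .
  qed
  have absq: "\<bar>q\<bar> = q" using q by simp
  have e4: "- (\<theta> * (Q\<^sup>2 + D + 2 * (P\<^sup>2 + D) + 2 * (P\<^sup>2 + DP) + P\<^sup>2 + Q\<^sup>2)) \<le> \<mu> * (a * q * (Q * R + 4 * P * R + 4 * P * RP - 2 * P * Q))"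
  proof (rule mult_bound_neg[OF _ \<mu>])
    have "\<bar>q * (Q * R + 4 * P * R + 4 * P * RP - 2 * P * Q)\<bar> \<le> \<bar>Q\<bar> * y + 4 * (\<bar>P\<bar> * y) + 4 * (\<bar>P\<bar> * z) + 2 * (\<bar>P\<bar> * \<bar>Q\<bar>)"
    proof -
      have "\<bar>q * (Q * R + 4 * P * R + 4 * P * RP - 2 * P * Q)\<bar> \<le> \<bar>Q * (q * R)\<bar> + 4 * \<bar>P * (q * R)\<bar> + 4 * \<bar>P * (q * RP)\<bar> + 2 * \<bar>q * (P * Q)\<bar>"
        by (simp add: algebra_simps)
      moreover have "\<bar>Q * (q * R)\<bar> \<le> \<bar>Q\<bar> * y" "\<bar>P * (q * R)\<bar> \<le> \<bar>P\<bar> * y" "\<bar>P * (q * RP)\<bar> \<le> \<bar>P\<bar> * z"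
        unfolding abs_mult absq by (intro mult_left_mono qR qRP abs_ge_zero)+
      moreover have "\<bar>q * (P * Q)\<bar> \<le> \<bar>P\<bar> * \<bar>Q\<bar>"
        using mult_right_mono[OF q1, of "\<bar>P\<bar> * \<bar>Q\<bar>"] by (simp add: abs_mult absq)
      ultimately show ?thesis by linarith
    qed
    also have "\<dots> \<le> Q\<^sup>2 + D + 2 * (P\<^sup>2 + D) + 2 * (P\<^sup>2 + DP) + P\<^sup>2 + Q\<^sup>2"
      using abs_mult_le_sq[of Q y] abs_mult_le_sq[of P y] abs_mult_le_sq[of P z] abs_mult_le_sq[of P Q] y
      by (simp add: abs_of_nonneg[OF y(1)] abs_of_nonneg[OF y(3)]) (smt (verit) zero_le_power2)
    finally have "a * \<bar>q * (Q * R + 4 * P * R + 4 * P * RP - 2 * P * Q)\<bar> \<le> \<theta> * (Q\<^sup>2 + D + 2 * (P\<^sup>2 + D) + 2 * (P\<^sup>2 + DP) + P\<^sup>2 + Q\<^sup>2)"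
      using a\<theta> a0 \<theta>0 by (intro mult_mono) auto
    then show "\<bar>a * q * (Q * R + 4 * P * R + 4 * P * RP - 2 * P * Q)\<bar> \<le> \<theta> * (Q\<^sup>2 + D + 2 * (P\<^sup>2 + D) + 2 * (P\<^sup>2 + DP) + P\<^sup>2 + Q\<^sup>2)"
      using a0 by (simp add: abs_mult mult.assoc)
  qed
  have e5: "- (\<theta> * (D + (D + DP))) \<le> \<mu> * (- (q / 2) * D - 2 * q * S)"
  proof (rule mult_bound_neg[OF _ \<mu>])
    have "\<bar>- (q / 2) * D - 2 * q * S\<bar> \<le> q * D / 2 + 2 * q * \<bar>S\<bar>"
      using abs_triangle_ineq4[of "- (q / 2) * D" "2 * q * S"] q D by (simp add: abs_mult)
    moreover have "0 \<le> q * D" using q D by simp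
    ultimately have "\<bar>- (q / 2) * D - 2 * q * S\<bar> \<le> q * D + 2 * q * \<bar>S\<bar>" by linarith
    also have "\<dots> \<le> q * (D + (D + DP))"
      using mult_left_mono[OF S, of "2 * q"] q by (simp add: algebra_simps)
    also have "\<dots> \<le> \<theta> * (D + (D + DP))"
      using D DP q\<theta> by (intro mult_right_mono) auto
    finally show "\<bar>- (q / 2) * D - 2 * q * S\<bar> \<le> \<theta> * (D + (D + DP))" .
  qed
  have e7: "- (\<theta> * (P\<^sup>2 + D)) \<le> \<mu> * (2 * q ^ 3 * (1 - a * s) * P * R)"
  proof (rule mult_bound_neg[OF _ \<mu>])
    have "q\<^sup>2 * \<bar>1 - a * s\<bar> \<le> q\<^sup>2 * (1 + a * s)"
      using mult_nonneg_nonneg[of a s] a0 s by (intro mult_left_mono) (auto simp: abs_le_iff)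
    also have "\<dots> = a * (q\<^sup>2 * (t\<^sup>2 + s))" using t0 by (simp add: a field_simps)
    finally have *: "q\<^sup>2 * \<bar>1 - a * s\<bar> \<le> a" using q by simp
    have "\<bar>2 * q ^ 3 * (1 - a * s) * P * R\<bar> = 2 * ((q\<^sup>2 * \<bar>1 - a * s\<bar>) * (\<bar>P\<bar> * (q * \<bar>R\<bar>)))"
      using q by (simp add: abs_mult power2_eq_square power3_eq_cube)
    also have "\<dots> \<le> 2 * (\<theta> * (\<bar>P\<bar> * y))"
      using * a\<theta> qR q \<theta>0 y by (intro mult_left_mono mult_mono) auto
    also have "\<dots> = \<theta> * (2 * (\<bar>P\<bar> * \<bar>y\<bar>))" using y by simp
    also have "\<dots> \<le> \<theta> * (P\<^sup>2 + D)"
      using abs_mult_le_sq[of P y] y \<theta>0 by (intro mult_left_mono) auto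
    finally show "\<bar>2 * q ^ 3 * (1 - a * s) * P * R\<bar> \<le> \<theta> * (P\<^sup>2 + D)" .
  qed
  have e8: "- (\<theta> * (12 * P\<^sup>2 + 4 * (P\<^sup>2 + DP))) \<le> \<mu> * (- 12 * a * q * P\<^sup>2 - 8 * a * q * P * RP)"
  proof (rule mult_bound_neg[OF _ \<mu>])
    have "\<bar>- 12 * a * q * P\<^sup>2 - 8 * a * q * P * RP\<bar> \<le> a * (12 * (q * P\<^sup>2) + 8 * (\<bar>P\<bar> * (q * \<bar>RP\<bar>)))"
      using a0 q abs_triangle_ineq4[of "- 12 * a * q * P\<^sup>2" "8 * a * q * P * RP"] by (simp add: abs_mult distrib_left mult_ac)
    also have "\<dots> \<le> a * (12 * P\<^sup>2 + 8 * (\<bar>P\<bar> * z))"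
      using a0 q1 qRP mult_right_mono[OF q1, of "P\<^sup>2"] mult_left_mono[OF qRP, of "\<bar>P\<bar>"] by (intro mult_left_mono) auto
    also have "\<dots> \<le> a * (12 * P\<^sup>2 + 4 * (P\<^sup>2 + DP))"
      using abs_mult_le_sq[of P z] y a0 by (intro mult_left_mono) auto
    also have "\<dots> \<le> \<theta> * (12 * P\<^sup>2 + 4 * (P\<^sup>2 + DP))"
      using a\<theta> DP by (intro mult_right_mono) auto
    finally show "\<bar>- 12 * a * q * P\<^sup>2 - 8 * a * q * P * RP\<bar> \<le> \<theta> * (12 * P\<^sup>2 + 4 * (P\<^sup>2 + DP))" .
  qed
  have e9: "0 \<le> 4 * a * s * \<mu> * q ^ 3 * P\<^sup>2" using a0 s \<mu> q by auto
  have nn: "0 \<le> \<theta> * D" "0 \<le> \<theta> * P\<^sup>2" "0 \<le> \<theta> * DP" "0 \<le> \<theta> * Q\<^sup>2" "0 \<le> f\<^sup>2/\<theta>"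
    using \<theta>0 D DP by auto
  show ?thesis
    using e1 e2 e3 e4 e5 e7 e8 e9 nn unfolding m'_def
    by (simp add: algebra_simps add_divide_distrib diff_divide_distrib)
qed

lemma inverse_sqrt_deriv:
  fixes t y :: real
  assumes "0 < t" "0 \<le> y"
  shows "((\<lambda>y. 1 / sqrt (t\<^sup>2 + y)) has_real_derivative (- ((1 / sqrt (t\<^sup>2 + y)) ^ 3) / 2)) (at y)"
proof -
  have p: "0 < t\<^sup>2 + y" using assms by (simp add: add_pos_nonneg)
  have "((\<lambda>y. inverse (sqrt (t\<^sup>2 + y))) has_real_derivative
      (- (inverse (sqrt (t\<^sup>2 + y)) * (inverse (sqrt (t\<^sup>2 + y)) / 2) * inverse (sqrt (t\<^sup>2 + y))))) (at y)"
    using p by (auto intro!: derivative_eq_intros)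
  then show ?thesis
    by (simp add: field_simps power3_eq_cube)
qed

lemma sum_abs_mult_le:
  fixes u v :: "3 \<Rightarrow> real"
  shows "\<bar>\<Sum>i\<in>UNIV. u i * v i\<bar> \<le> ((\<Sum>i\<in>UNIV. (u i)\<^sup>2) + (\<Sum>i\<in>UNIV. (v i)\<^sup>2)) / 2"
proof -
  have "\<bar>\<Sum>i\<in>UNIV. u i * v i\<bar> \<le> (\<Sum>i\<in>UNIV. \<bar>u i\<bar> * \<bar>v i\<bar>)"
    unfolding abs_mult[symmetric] by (rule sum_abs)
  also have "\<dots> \<le> (\<Sum>i\<in>UNIV. ((u i)\<^sup>2 + (v i)\<^sup>2) / 2)"
    by (intro sum_mono abs_mult_le_sq)
  finally show ?thesis by (simp add: sum.distrib sum_divide_distrib[symmetric])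
qed

abbreviation L2sq :: "(real^3 \<Rightarrow> real) \<Rightarrow> real" where
  "L2sq v \<equiv> integral UNIV (\<lambda>x. (v x)\<^sup>2)"

abbreviation sq_integrable :: "(real^3 \<Rightarrow> real) \<Rightarrow> bool" where
  "sq_integrable v \<equiv> (\<lambda>x. (v x)\<^sup>2) integrable_on UNIV"

text \<open>The Rellich weight m as a function of |x|^2. In \<open>wcut'\<close> the first term
  lives on the shell and produces the trace; the second comes from the decay of the inverse root and
  is spread over the ball inside.\<close>

definition wcut :: "real \<Rightarrow> real \<Rightarrow> real \<Rightarrow> real \<Rightarrow> real" where
  "wcut t s0 \<kappa> y = shellcut s0 \<kappa> y * (1 / sqrt (t\<^sup>2 + y))"

definition wcut' :: "real \<Rightarrow> real \<Rightarrow> real \<Rightarrow> real \<Rightarrow> real" where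
  "wcut' t s0 \<kappa> y = - (shell s0 \<kappa> y * (1 / sqrt (t\<^sup>2 + y))) - shellcut s0 \<kappa> y * (1 / sqrt (t\<^sup>2 + y)) ^ 3 / 2"

lemma wcut_deriv:
  assumes "0 < t" "0 < \<kappa>" "0 \<le> y"
  shows "(wcut t s0 \<kappa> has_real_derivative wcut' t s0 \<kappa> y) (at y)"
  unfolding wcut_def[abs_def] wcut'_def
  using DERIV_mult[OF shellcut_deriv[OF assms(2)] inverse_sqrt_deriv[OF assms(1,3)], of s0]
  by (simp add: algebra_simps)

lemma shellcut_cont: "0 < \<kappa> \<Longrightarrow> continuous_on S (shellcut s0 \<kappa>)"
  by (rule continuous_at_imp_continuous_on) (auto intro: DERIV_isCont shellcut_deriv)

lemma inverse_sqrt_cont: "0 < t \<Longrightarrow> continuous_on {0..} (\<lambda>y::real. 1 / sqrt (t\<^sup>2 + y))"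
  by (intro continuous_intros) (auto simp: add_pos_nonneg less_imp_neq[THEN not_sym])

lemma wcut_cont:
  assumes "0 < t" "0 < \<kappa>"
  shows "continuous_on {0..} (wcut t s0 \<kappa>)" "continuous_on {0..} (wcut' t s0 \<kappa>)"
  unfolding wcut_def[abs_def] wcut'_def[abs_def]
  by (intro continuous_intros shellcut_cont shell_cont inverse_sqrt_cont assms; simp)+

lemma comp_supp_wcut:
  assumes "0 < t" "0 < \<kappa>"
  shows "comp_supp (\<lambda>x::real^3. wcut t s0 \<kappa> (x \<bullet> x))"
  by (rule comp_supp_radial[where c="s0 + 2 * \<kappa>"]) (use assms wcut_cont in \<open>auto simp: wcut_def shellcut_zero\<close>)

lemma comp_supp_shell:
  assumes "0 < t" "0 < \<kappa>" "continuous_on UNIV g"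
  shows "comp_supp (\<lambda>x::real^3. shell s0 \<kappa> (x \<bullet> x) * (1 / sqrt (t\<^sup>2 + x \<bullet> x)) * g x)"
proof -
  have "continuous_on {0..} (\<lambda>y. shell s0 \<kappa> y * (1 / sqrt (t\<^sup>2 + y)))"
    by (intro continuous_on_mult shell_cont inverse_sqrt_cont assms)
  then have "comp_supp (\<lambda>x::real^3. shell s0 \<kappa> (x \<bullet> x) * (1 / sqrt (t\<^sup>2 + x \<bullet> x)))"
    by (intro comp_supp_radial[where c="s0 + 2 * \<kappa>" and f="\<lambda>y. shell s0 \<kappa> y * (1 / sqrt (t\<^sup>2 + y))"])
      (use assms in \<open>auto simp: shell_zero2\<close>)
  then show ?thesis
    by (rule comp_supp_multL[OF assms(3)])
qed

text \<open>Inside the cone the radial coefficient |x|^2/t^2 - 1 would be negative, so the shell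
  starts at s0 >= t^2. The parameter \<theta> stays free and is fixed later by balancing the
  gradient norms against f.\<close>

theorem rellich_estimate:
  assumes t: "1 \<le> t" and \<theta>: "1 / t \<le> \<theta>" and s0: "t\<^sup>2 \<le> s0" and \<kappa>: "0 < \<kappa>"
    and g: "\<And>i. pd i \<Phi> (\<Phi>1 i)" "\<And>i. has_grad (\<Phi>1 i) (\<Phi>2 i)" and sym: "\<And>i j x. \<Phi>2 i j x = \<Phi>2 j i x"
    and P: "has_grad P P1"
    and eq: "\<And>x. (\<Sum>i\<in>UNIV. \<Phi>2 i i x) - (1/t\<^sup>2) * (\<Sum>i\<in>UNIV. \<Sum>j\<in>UNIV. x $ i * x $ j * \<Phi>2 i j x)
                = f x + (1/t\<^sup>2) * (2 * (\<Sum>i\<in>UNIV. x $ i * \<Phi>1 i x) - 2 * (\<Sum>i\<in>UNIV. x $ i * P1 i x) + Q x)"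
    and L2: "\<And>i. sq_integrable (\<Phi>1 i)" "sq_integrable P" "\<And>i. sq_integrable (P1 i)" "sq_integrable Q" "sq_integrable f"
  defines "K \<equiv> \<lambda>x. shell s0 \<kappa> (x \<bullet> x) * (1 / sqrt (t\<^sup>2 + x \<bullet> x)) *
       (tang x (\<lambda>i. \<Phi>1 i x) + ((1/t\<^sup>2) * (x \<bullet> x) - 1) / 2 * (\<Sum>i\<in>UNIV. x $ i * \<Phi>1 i x)\<^sup>2)"
  shows "comp_supp K"
    and "integral UNIV K \<le> 40 * (\<theta> * ((\<Sum>i\<in>UNIV. L2sq (\<Phi>1 i)) + L2sq P + (\<Sum>i\<in>UNIV. L2sq (P1 i)) + L2sq Q)) + 40 * (L2sq f / \<theta>)"
proof -
  define a where "a = 1 / t\<^sup>2"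
  have t0: "0 < t" using t by simp
  define R where "R = (\<lambda>x. \<Sum>i\<in>UNIV. x $ i * \<Phi>1 i x)"
  define RP where "RP = (\<lambda>x. \<Sum>i\<in>UNIV. x $ i * P1 i x)"
  define F where "F = (\<lambda>x. - wcut' t s0 \<kappa> (x \<bullet> x) * (tang x (\<lambda>i. \<Phi>1 i x) + (a * (x \<bullet> x) - 1) * (R x)\<^sup>2)
       + wcut t s0 \<kappa> (x \<bullet> x) * (R x - 2 * P x) * f x
       + a * wcut t s0 \<kappa> (x \<bullet> x) * (Q x * R x + 4 * P x * R x + 4 * P x * RP x - 2 * P x * Q x)
       - wcut t s0 \<kappa> (x \<bullet> x) / 2 * (\<Sum>i\<in>UNIV. (\<Phi>1 i x)\<^sup>2) - a * wcut t s0 \<kappa> (x \<bullet> x) / 2 * (R x)\<^sup>2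
       - 2 * wcut t s0 \<kappa> (x \<bullet> x) * (\<Sum>i\<in>UNIV. \<Phi>1 i x * P1 i x)
       - 4 * wcut' t s0 \<kappa> (x \<bullet> x) * (1 - a * (x \<bullet> x)) * P x * R x)"
  have cont: "\<And>i. continuous_on UNIV (\<Phi>1 i)" "continuous_on UNIV P" "\<And>i. continuous_on UNIV (P1 i)"
    using g P by (auto intro: has_grad_cont has_grad_cont1)
  have F: "comp_supp F" "integral UNIV F = 0"
    using rellich_identity[OF g sym wcut_deriv[OF t0 \<kappa>, of _ s0] wcut_cont(2)[OF t0 \<kappa>, of s0] comp_supp_wcut[OF t0 \<kappa>, of s0] P, where a=a and f=f and Q=Q] eq
    unfolding F_def R_def RP_def a_def by auto
  \<comment> \<open>The exact divergence belonging to P^2; taken with the factor -4a it controls P^2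
    on the shell.\<close>
  define F2 where "F2 = (\<lambda>x. (2 * (x \<bullet> x) * wcut' t s0 \<kappa> (x \<bullet> x) + 3 * wcut t s0 \<kappa> (x \<bullet> x)) * (P x * P x)
      + wcut t s0 \<kappa> (x \<bullet> x) * (\<Sum>i\<in>UNIV. x $ i * (P1 i x * P x + P1 i x * P x)))"
  have F2: "comp_supp F2" "integral UNIV F2 = 0"
    unfolding F2_def
    by (rule radial_identity[OF _ _ _ wcut_deriv[OF t0 \<kappa>, of _ s0] wcut_cont(2)[OF t0 \<kappa>, of s0] comp_supp_wcut[OF t0 \<kappa>, of s0]];
        (intro pd_mult has_grad_pd[OF P] continuous_intros cont | simp))+
  have F2_eq: "F2 x = (2 * (x \<bullet> x) * wcut' t s0 \<kappa> (x \<bullet> x) + 3 * wcut t s0 \<kappa> (x \<bullet> x)) * (P x)\<^sup>2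
      + wcut t s0 \<kappa> (x \<bullet> x) * (2 * P x * RP x)" for x
  proof -
    have "(\<Sum>i\<in>UNIV. x $ i * (P1 i x * P x + P1 i x * P x)) = 2 * P x * RP x"
      unfolding RP_def sum_distrib_left by (intro sum.cong) auto
    then show ?thesis unfolding F2_def by (simp add: power2_eq_square)
  qed
  define Bd where "Bd = (\<lambda>x. 40 * (\<theta> * ((\<Sum>i\<in>UNIV. (\<Phi>1 i x)\<^sup>2) + (P x)\<^sup>2 + (\<Sum>i\<in>UNIV. (P1 i x)\<^sup>2) + (Q x)\<^sup>2)) + 40 * ((f x)\<^sup>2 / \<theta>))"
  have Bd: "(Bd has_integral (40 * (\<theta> * ((\<Sum>i\<in>UNIV. L2sq (\<Phi>1 i)) + L2sq P + (\<Sum>i\<in>UNIV. L2sq (P1 i)) + L2sq Q)) + 40 * (L2sq f / \<theta>))) UNIV"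
    unfolding Bd_def
    by (intro has_integral_add has_integral_mult_right has_integral_divide has_integral_sum integrable_integral L2 finite)
  show K: "comp_supp K"
    unfolding K_def tang_def
    by (intro comp_supp_shell t0 \<kappa> continuous_intros cont) simp_all
  have pw: "K x \<le> (F x - 4 * a * F2 x) + Bd x" for x
  proof -
    have q: "0 < 1 / sqrt (t\<^sup>2 + x \<bullet> x)" "(1 / sqrt (t\<^sup>2 + x \<bullet> x))\<^sup>2 * (t\<^sup>2 + x \<bullet> x) = 1"
    proof -
      have "0 < t\<^sup>2 + x \<bullet> x" using t0 by (simp add: add_pos_nonneg)
      then show "0 < 1 / sqrt (t\<^sup>2 + x \<bullet> x)" "(1 / sqrt (t\<^sup>2 + x \<bullet> x))\<^sup>2 * (t\<^sup>2 + x \<bullet> x) = 1"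
        by (simp_all add: power_divide)
    qed
    have "shell s0 \<kappa> (x \<bullet> x) = 0" if "x \<bullet> x < t\<^sup>2"
      using that s0 by (intro shell_zero \<kappa>) auto
    note z = this
    show ?thesis
      unfolding K_def F_def F2_eq Bd_def wcut_def wcut'_def a_def R_def RP_def
      by (rule rellich_pointwise[OF inner_ge_zero t q shellcut_bounds shell_nonneg[OF \<kappa>] z refl \<theta>])
        (use sum_abs_mult_le[of "\<lambda>i. \<Phi>1 i x" "\<lambda>i. P1 i x"] in \<open>auto simp: tang_def sum_nonneg radial_deriv_sq_le\<close>)
  qed
  have F3: "comp_supp (\<lambda>x. 4 * a * F2 x)" by (intro comp_supp_multR F2 continuous_intros)
  have "integral UNIV K \<le> integral UNIV Bd"
  proof (rule integral_le_of_zero[OF K _ _ _ pw])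
    show "comp_supp (\<lambda>x. F x - 4 * a * F2 x)" by (intro comp_supp_diff F F3)
    show "integral UNIV (\<lambda>x. F x - 4 * a * F2 x) = 0"
      using F F2 F3 by (subst integral_diff) (auto intro: comp_supp_integrable)
    show "Bd integrable_on UNIV" using Bd by blast
  qed
  also have "\<dots> = 40 * (\<theta> * ((\<Sum>i\<in>UNIV. L2sq (\<Phi>1 i)) + L2sq P + (\<Sum>i\<in>UNIV. L2sq (P1 i)) + L2sq Q)) + 40 * (L2sq f / \<theta>)"
    using Bd by (rule integral_unique)
  finally show "integral UNIV K \<le> 40 * (\<theta> * ((\<Sum>i\<in>UNIV. L2sq (\<Phi>1 i)) + L2sq P + (\<Sum>i\<in>UNIV. L2sq (P1 i)) + L2sq Q)) + 40 * (L2sq f / \<theta>)" .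
qed

section \<open>Traces on thin shells\<close>

lemma mult_bound_pos: "\<bar>x\<bar> \<le> B \<Longrightarrow> 0 \<le> c \<Longrightarrow> c \<le> 1 \<Longrightarrow> c * x \<le> B" for x B c :: real
  using mult_bound_neg[of "- x" B c] by simp

text \<open>\<open>radial_identity\<close> for the square of v with the weight \<open>wcut\<close>:
  the part of its integrand that sits on the shell is -K. The rest is bounded by squares of v and
  its gradient, since with q = (t^2 + |x|^2)^(-1/2) both q and q |x| are at most 1.\<close>

lemma shell_trace:
  fixes s0 :: real
  assumes t: "1 \<le> t" and \<kappa>: "0 < \<kappa>" and v: "has_grad v v1" and L2: "sq_integrable v" "\<And>i. sq_integrable (v1 i)"
  defines "K \<equiv> \<lambda>x. shell s0 \<kappa> (x \<bullet> x) * (1 / sqrt (t\<^sup>2 + x \<bullet> x)) * (2 * (x \<bullet> x) * (v x)\<^sup>2)"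
  shows "comp_supp K"
    and "integral UNIV K \<le> 4 * (L2sq v + (\<Sum>i\<in>UNIV. L2sq (v1 i)))"
proof -
  have t0: "0 < t" using t by simp
  have cont: "continuous_on UNIV v" "\<And>i. continuous_on UNIV (v1 i)"
    using v by (auto intro: has_grad_cont has_grad_cont1)
  define RP where "RP = (\<lambda>x. \<Sum>i\<in>UNIV. x $ i * v1 i x)"
  define F2 where "F2 = (\<lambda>x. (2 * (x \<bullet> x) * wcut' t s0 \<kappa> (x \<bullet> x) + 3 * wcut t s0 \<kappa> (x \<bullet> x)) * (v x * v x)
      + wcut t s0 \<kappa> (x \<bullet> x) * (\<Sum>i\<in>UNIV. x $ i * (v1 i x * v x + v1 i x * v x)))"
  have F2: "comp_supp F2" "integral UNIV F2 = 0"
    unfolding F2_def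
    by (rule radial_identity[OF _ _ _ wcut_deriv[OF t0 \<kappa>, of _ s0] wcut_cont(2)[OF t0 \<kappa>, of s0] comp_supp_wcut[OF t0 \<kappa>, of s0]];
        (intro pd_mult has_grad_pd[OF v] continuous_intros cont | simp))+
  define Bd where "Bd = (\<lambda>x. 4 * ((v x)\<^sup>2 + (\<Sum>i\<in>UNIV. (v1 i x)\<^sup>2)))"
  have Bd: "(Bd has_integral (4 * (L2sq v + (\<Sum>i\<in>UNIV. L2sq (v1 i))))) UNIV"
    unfolding Bd_def
    by (intro has_integral_add has_integral_mult_right has_integral_sum integrable_integral L2 finite)
  show K: "comp_supp K"
    unfolding K_def by (intro comp_supp_shell t0 \<kappa> continuous_intros cont)
  have pw: "K x \<le> - F2 x + Bd x" for x
  proof -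
    define q where "q = 1 / sqrt (t\<^sup>2 + x \<bullet> x)"
    define \<mu> where "\<mu> = shellcut s0 \<kappa> (x \<bullet> x)"
    define D where "D = (\<Sum>i\<in>UNIV. (v1 i x)\<^sup>2)"
    have \<mu>: "0 \<le> \<mu>" "\<mu> \<le> 1" unfolding \<mu>_def by (rule shellcut_bounds)+
    have "1 \<le> t\<^sup>2" using t by (simp add: one_le_power)
    then have p: "1 \<le> t\<^sup>2 + x \<bullet> x" using inner_ge_zero[of x] by linarith
    then have q: "0 < q" "q \<le> 1" "q\<^sup>2 * (t\<^sup>2 + x \<bullet> x) = 1"
      by (auto simp: q_def power_divide)
    have D0: "0 \<le> D" by (simp add: D_def sum_nonneg)
    have "q\<^sup>2 * (x \<bullet> x) \<le> q\<^sup>2 * (t\<^sup>2 + x \<bullet> x)" by (intro mult_left_mono) auto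
    then have qs: "q\<^sup>2 * (x \<bullet> x) \<le> 1" using q by simp
    have "(q * \<bar>RP x\<bar>)\<^sup>2 = q\<^sup>2 * (RP x)\<^sup>2" by (simp add: power_mult_distrib)
    also have "\<dots> \<le> q\<^sup>2 * ((x \<bullet> x) * D)"
      using radial_deriv_sq_le[of x "\<lambda>i. v1 i x"] by (intro mult_left_mono) (auto simp: RP_def D_def)
    also have "\<dots> \<le> 1 * D" unfolding mult.assoc[symmetric] using qs D0 by (intro mult_right_mono) auto
    finally have qR: "q * \<bar>RP x\<bar> \<le> sqrt D" using real_le_rsqrt by simp
    have "(\<Sum>i\<in>UNIV. x $ i * (v1 i x * v x + v1 i x * v x)) = 2 * v x * RP x"
      unfolding RP_def sum_distrib_left by (intro sum.cong) auto
    then have F2x: "F2 x = - K x - (x \<bullet> x) * \<mu> * q ^ 3 * (v x)\<^sup>2 + \<mu> * (3 * q * (v x)\<^sup>2 + 2 * q * v x * RP x)"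
      unfolding F2_def K_def wcut_def wcut'_def q_def[symmetric] \<mu>_def[symmetric]
      by (simp add: algebra_simps power2_eq_square)
    have "\<bar>2 * q * v x * RP x\<bar> = 2 * (\<bar>v x\<bar> * (q * \<bar>RP x\<bar>))" using q by (simp add: abs_mult)
    also have "\<dots> \<le> 2 * (\<bar>v x\<bar> * sqrt D)" using qR by (intro mult_left_mono) auto
    also have "\<dots> \<le> (v x)\<^sup>2 + D" using abs_mult_le_sq[of "v x" "sqrt D"] D0 by simp
    finally have 1: "\<bar>2 * q * v x * RP x\<bar> \<le> (v x)\<^sup>2 + D" .
    have 2: "q * (v x)\<^sup>2 \<le> (v x)\<^sup>2" using q mult_right_mono[of q 1 "(v x)\<^sup>2"] by simp
    have 3: "0 \<le> q * (v x)\<^sup>2" using q by simp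
    have "\<bar>3 * q * (v x)\<^sup>2 + 2 * q * v x * RP x\<bar> \<le> 4 * (v x)\<^sup>2 + D" using 1 2 3 by linarith
    from mult_bound_pos[OF this \<mu>] have "\<mu> * (3 * q * (v x)\<^sup>2 + 2 * q * v x * RP x) \<le> 4 * (v x)\<^sup>2 + D" .
    moreover have "0 \<le> (x \<bullet> x) * \<mu> * q ^ 3 * (v x)\<^sup>2" using \<mu> q by simp
    ultimately show ?thesis unfolding F2x Bd_def D_def[symmetric] using D0 by simp
  qed
  have "integral UNIV K \<le> integral UNIV Bd"
  proof (rule integral_le_of_zero[OF K _ _ _ pw])
    show "comp_supp (\<lambda>x. - F2 x)" using comp_supp_diff[OF comp_supp_zero F2(1)] by simp
    show "integral UNIV (\<lambda>x. - F2 x) = 0" using F2 by simp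
    show "Bd integrable_on UNIV" using Bd by blast
  qed
  also have "\<dots> = 4 * (L2sq v + (\<Sum>i\<in>UNIV. L2sq (v1 i)))"
    using Bd by (rule integral_unique)
  finally show "integral UNIV K \<le> 4 * (L2sq v + (\<Sum>i\<in>UNIV. L2sq (v1 i)))" .
qed

text \<open>The angular part commutes with the radial derivative, so its trace on a sphere costs one derivative of
  the same angular type.\<close>

lemma tang_trace:
  assumes t: "1 \<le> t" and \<kappa>: "0 < \<kappa>" and g: "\<And>i. has_grad (H1 i) (H2 i)" and sym: "\<And>i j x. H2 i j x = H2 j i x"
    and p: "\<And>y. 0 \<le> y \<Longrightarrow> (p has_real_derivative p' y) (at y)" "continuous_on {0..} p'"
    and w: "continuous_on {0..} w"
    and b: "\<And>x. shellcut s0 \<kappa> (x \<bullet> x) = 0 \<or> (\<forall>i. H1 i x = 0 \<and> (\<forall>j. H2 i j x = 0)) \<or>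
       (0 \<le> p (x \<bullet> x) \<and> p (x \<bullet> x) \<le> w (x \<bullet> x) \<and> 2 * (x \<bullet> x) * \<bar>p' (x \<bullet> x)\<bar> \<le> 64 * t * w (x \<bullet> x) \<and> norm x \<le> 2 * t)"
    and B: "Bd integrable_on UNIV" "\<And>x. 80 * t * (if shellcut s0 \<kappa> (x \<bullet> x) = 0 then 0 else w (x \<bullet> x)) * (tang x (\<lambda>i. H1 i x) + (\<Sum>k\<in>UNIV. tang x (\<lambda>i. H2 k i x))) \<le> Bd x"
  defines "K \<equiv> \<lambda>x. shell s0 \<kappa> (x \<bullet> x) * (2 * (x \<bullet> x) * p (x \<bullet> x) * tang x (\<lambda>i. H1 i x))"
  shows "comp_supp K" and "integral UNIV K \<le> integral UNIV Bd"
proof -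
  let ?T = "\<lambda>x. tang x (\<lambda>i. H1 i x)"
  let ?R' = "\<lambda>i x. \<Sum>j\<in>UNIV. (if i = j then 1 else 0) * H1 j x + H2 j i x * x $ j"
  let ?T1 = "\<lambda>i x. (2 * x $ i) * (\<Sum>j\<in>UNIV. H1 j x * H1 j x) + (\<Sum>j\<in>UNIV. H2 j i x * H1 j x + H2 j i x * H1 j x) * (x \<bullet> x)
     - (?R' i x * (\<Sum>j\<in>UNIV. x $ j * H1 j x) + ?R' i x * (\<Sum>j\<in>UNIV. x $ j * H1 j x))"
  let ?n = "\<lambda>y. shellcut s0 \<kappa> y * p y"
  let ?n' = "\<lambda>y. - shell s0 \<kappa> y * p y + p' y * shellcut s0 \<kappa> y"
  have cont: "continuous_on UNIV (H1 i)" "continuous_on UNIV (H2 i j)" for i j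
    using g by (auto intro: has_grad_cont has_grad_cont1)
  have pc: "continuous_on {0..} p" using p(1) by (rule DERIV_continuous_nonneg)
  have T_alt: "?T = (\<lambda>x. (x \<bullet> x) * (\<Sum>j\<in>UNIV. H1 j x * H1 j x) - (\<Sum>j\<in>UNIV. x $ j * H1 j x) * (\<Sum>j\<in>UNIV. x $ j * H1 j x))"
    by (simp add: tang_def power2_eq_square)
  have pT: "pd i ?T (?T1 i)" for i
  proof -
    have "pd i (\<lambda>x. \<Sum>j\<in>UNIV. x $ j * H1 j x) (?R' i)"
      by (intro pd_sum pd_mult pd_coord has_grad_pd g)
    moreover have "pd i (\<lambda>x. \<Sum>j\<in>UNIV. H1 j x * H1 j x) (\<lambda>x. \<Sum>j\<in>UNIV. H2 j i x * H1 j x + H2 j i x * H1 j x)"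
      by (intro pd_sum pd_mult has_grad_pd g)
    ultimately show ?thesis
      unfolding T_alt by (intro pd_diff pd_mult[OF pd_sqnorm] pd_mult)
  qed
  have cT: "continuous_on UNIV ?T" "continuous_on UNIV (?T1 i)" for i
    unfolding tang_def by (intro continuous_intros cont)+
  have nd: "(?n has_real_derivative ?n' y) (at y)" if "0 \<le> y" for y
    using DERIV_mult[OF shellcut_deriv[OF \<kappa>] p(1)[OF that], of s0] by simp
  have nc: "continuous_on {0..} ?n'" "continuous_on {0..} ?n"
    by (intro continuous_intros shell_cont shellcut_cont \<kappa> pc p)+
  have supp: "comp_supp (\<lambda>x::real^3. ?n (x \<bullet> x))"
    by (rule comp_supp_radial[where c="s0 + 2 * \<kappa>"]) (use nc \<kappa> in \<open>auto simp: shellcut_zero\<close>)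
  define F where "F = (\<lambda>x. (2 * (x \<bullet> x) * ?n' (x \<bullet> x) + 3 * ?n (x \<bullet> x)) * ?T x + ?n (x \<bullet> x) * (\<Sum>i\<in>UNIV. x $ i * ?T1 i x))"
  have F: "comp_supp F" "integral UNIV F = 0"
    unfolding F_def by (rule radial_identity[OF pT cT nd nc(1) supp]; assumption)+
  have "comp_supp (\<lambda>x::real^3. shell s0 \<kappa> (x \<bullet> x))"
    by (rule comp_supp_radial[where c="s0 + 2 * \<kappa>"]) (use shell_cont \<kappa> in \<open>auto simp: shell_zero2\<close>)
  then show K: "comp_supp K"
    unfolding K_def by (intro comp_supp_multL continuous_intros cT continuous_on_radial pc)
  have pw: "K x \<le> - F x + Bd x" for x
  proof -
    define s where "s = x \<bullet> x"
    define T where "T = ?T x"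
    define Tk where "Tk = (\<Sum>k\<in>UNIV. tang x (\<lambda>i. H2 k i x))"
    define RT where "RT = (\<Sum>i\<in>UNIV. x $ i * ?T1 i x)"
    have nn: "0 \<le> T" "0 \<le> Tk" unfolding T_def Tk_def by (auto intro!: tang_nonneg sum_nonneg)
    \<comment> \<open>By the symmetry of H2 the radial derivative of T contains only polarized
      tangential forms of H1 with the gradients of its components, so no full gradient
      enters.\<close>
    have "RT = 2 * T + (\<Sum>k\<in>UNIV. x $ k * (2 * ((x \<bullet> x) * (\<Sum>i\<in>UNIV. H1 i x * H2 k i x)
        - (\<Sum>i\<in>UNIV. x $ i * H1 i x) * (\<Sum>i\<in>UNIV. x $ i * H2 k i x))))"
      unfolding RT_def T_def tang_def power2_eq_square inner_vec_def inner_real_def sum_3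
      by (simp add: sym[of 2 1] sym[of 3 1] sym[of 3 2] algebra_simps)
    moreover have "\<bar>\<Sum>k\<in>UNIV. x $ k * (2 * ((x \<bullet> x) * (\<Sum>i\<in>UNIV. H1 i x * H2 k i x)
        - (\<Sum>i\<in>UNIV. x $ i * H1 i x) * (\<Sum>i\<in>UNIV. x $ i * H2 k i x)))\<bar> \<le> (\<Sum>k\<in>UNIV. norm x * (T + tang x (\<lambda>i. H2 k i x)))"
    proof (rule order_trans[OF sum_abs], rule sum_mono)
      fix k
      show "\<bar>x $ k * (2 * ((x \<bullet> x) * (\<Sum>i\<in>UNIV. H1 i x * H2 k i x)
        - (\<Sum>i\<in>UNIV. x $ i * H1 i x) * (\<Sum>i\<in>UNIV. x $ i * H2 k i x)))\<bar> \<le> norm x * (T + tang x (\<lambda>i. H2 k i x))"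
        unfolding abs_mult[of "x $ k"] T_def
        by (intro mult_mono component_le_norm_cart tang_polar) auto
    qed
    moreover have "(\<Sum>k\<in>UNIV. norm x * (T + tang x (\<lambda>i. H2 k i x))) = norm x * (3 * T + Tk)"
      by (simp add: Tk_def sum.distrib flip: sum_distrib_left)
    ultimately have RT: "\<bar>RT\<bar> \<le> 2 * T + norm x * (3 * T + Tk)" using nn by linarith
    have Fx: "F x = - K x + shellcut s0 \<kappa> s * ((2 * s * p' s + 3 * p s) * T + p s * RT)"
      unfolding F_def K_def s_def T_def RT_def by (simp add: algebra_simps)
    have "shellcut s0 \<kappa> s * ((2 * s * p' s + 3 * p s) * T + p s * RT) \<le> Bd x"
    proof -
      consider "shellcut s0 \<kappa> s = 0" | "shellcut s0 \<kappa> s \<noteq> 0" "\<forall>i. H1 i x = 0 \<and> (\<forall>j. H2 i j x = 0)"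
        | "shellcut s0 \<kappa> s \<noteq> 0" "0 \<le> p s" "p s \<le> w s" "2 * s * \<bar>p' s\<bar> \<le> 64 * t * w s" "norm x \<le> 2 * t"
        using b[of x] unfolding s_def by blast
      then show ?thesis
      proof cases
        case 1
        then show ?thesis using B(2)[of x] by (simp add: s_def)
      next
        case 2
        then have "T = 0" "Tk = 0" "RT = 0" by (auto simp: T_def Tk_def RT_def tang_def)
        then show ?thesis using B(2)[of x] 2 by (simp add: s_def T_def Tk_def)
      next
        case 3
        have w0: "0 \<le> w s" using 3 by linarith
        have "\<bar>(2 * s * p' s + 3 * p s) * T + p s * RT\<bar> \<le> (64 * t * w s + 3 * w s) * T + w s * (2 * T + 2 * t * (3 * T + Tk))"
        proof -
          have s0': "0 \<le> s" by (simp add: s_def)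
          have "\<bar>2 * s * p' s + 3 * p s\<bar> \<le> 64 * t * w s + 3 * w s"
            using 3 s0' abs_triangle_ineq[of "2 * s * p' s" "3 * p s"] by (simp add: abs_mult)
          then have "\<bar>(2 * s * p' s + 3 * p s) * T\<bar> \<le> (64 * t * w s + 3 * w s) * T"
            unfolding abs_mult using nn by (intro mult_mono) auto
          moreover have "\<bar>p s * RT\<bar> \<le> w s * (2 * T + 2 * t * (3 * T + Tk))"
          proof -
            have "norm x * (3 * T + Tk) \<le> 2 * t * (3 * T + Tk)" using 3 nn by (intro mult_right_mono) auto
            then have "\<bar>RT\<bar> \<le> 2 * T + 2 * t * (3 * T + Tk)" using RT by linarith
            then show ?thesis unfolding abs_mult using 3 w0 by (intro mult_mono) auto
          qed
          ultimately show ?thesis by linarith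
        qed
        \<comment> \<open>70 = 64 + 6 and 5 = 3 + 2; t >= 1 lets 80 t cover everything.\<close>
        also have "\<dots> = (70 * t + 5) * (w s * T) + 2 * t * (w s * Tk)" by (simp add: algebra_simps)
        also have "\<dots> \<le> (80 * t) * (w s * T) + 80 * t * (w s * Tk)"
          using t w0 nn by (intro add_mono mult_right_mono) auto
        also have "\<dots> = 80 * t * w s * (T + Tk)" by (simp add: algebra_simps)
        also have "\<dots> \<le> Bd x" using B(2)[of x] 3 by (simp add: s_def T_def Tk_def)
        finally have "\<bar>(2 * s * p' s + 3 * p s) * T + p s * RT\<bar> \<le> Bd x" .
        from mult_bound_pos[OF this shellcut_bounds] show ?thesis .
      qed
    qed
    then show ?thesis unfolding Fx by simp
  qed
  show "integral UNIV K \<le> integral UNIV Bd"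
  proof (rule integral_le_of_zero[OF K _ _ B(1)])
    show "comp_supp (\<lambda>x. - F x)" using comp_supp_diff[OF comp_supp_zero F(1)] by simp
    show "integral UNIV (\<lambda>x. - F x) = 0" using F by simp
    show "K x \<le> - F x + Bd x" for x using pw[of x] by simp
  qed
qed

section \<open>Weighted elliptic estimates\<close>

text \<open>A C^1 profile that vanishes for v <= 0 and rises towards 1, with v times its derivative
  bounded. The latter keeps the derivative of the weight harmless deep inside the cone, where its
  coefficient 1 - a |x|^2 is of order one.\<close>

definition rcut :: "real \<Rightarrow> real" where
  "rcut v = possq v / (1 + possq v)"

definition rcut' :: "real \<Rightarrow> real" where
  "rcut' v = 2 * max 0 v / (1 + possq v)\<^sup>2"

lemma possq_nonneg: "0 \<le> possq v"
  by (simp add: possq_def)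

lemma rcut_deriv: "(rcut has_real_derivative rcut' v) (at v)"
proof -
  have p: "1 + possq v \<noteq> 0" using possq_nonneg[of v] by linarith
  have "((\<lambda>v. possq v / (1 + possq v)) has_real_derivative
     (2 * max 0 v * (1 + possq v) - possq v * (2 * max 0 v)) / ((1 + possq v) * (1 + possq v))) (at v)"
    using p by (auto intro!: derivative_eq_intros possq_deriv)
  then show ?thesis
    by (simp add: rcut_def[abs_def] rcut'_def power2_eq_square algebra_simps)
qed

lemma rcut_bounds: "0 \<le> rcut v" "rcut v \<le> 1"
  using possq_nonneg[of v] by (auto simp: rcut_def)

lemma rcut_zero: "v \<le> 0 \<Longrightarrow> rcut v = 0" "v \<le> 0 \<Longrightarrow> rcut' v = 0"
  by (auto simp: rcut_def rcut'_def possq_def)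

lemma rcut_ge: "1 \<le> v \<Longrightarrow> 1/2 \<le> rcut v"
proof -
  assume "1 \<le> v"
  then have "1 \<le> possq v" by (simp add: possq_def one_le_power)
  then show ?thesis by (simp add: rcut_def field_simps)
qed

text \<open>The 7 in the last claim is a bound for (6t + 9)/t, the shift between v = ((t + 3)^2 -
  |x|^2)/t and (t^2 - |x|^2)/t.\<close>

lemma rcut'_bounds:
  shows "0 \<le> rcut' v" "rcut' v \<le> 1" "0 < v \<Longrightarrow> rcut' v * (v + 7) \<le> 9"
proof -
  define z where "z = max 0 v"
  have z: "0 \<le> z" "possq v = z\<^sup>2" by (auto simp: z_def possq_def)
  have sq: "2 * z \<le> 1 + z\<^sup>2" using sum_squares_bound[of 1 z] by simp
  have one: "1 \<le> 1 + z\<^sup>2" by simp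
  have le: "1 + z\<^sup>2 \<le> (1 + z\<^sup>2)\<^sup>2" using mult_left_mono[OF one, of "1 + z\<^sup>2"] by (simp add: power2_eq_square)
  have p: "0 < (1 + z\<^sup>2)\<^sup>2" using one by (intro zero_less_power) linarith
  show "0 \<le> rcut' v" using z p by (simp add: rcut'_def z_def[symmetric])
  show "rcut' v \<le> 1" using z p sq le by (simp add: rcut'_def z_def[symmetric])
  show "rcut' v * (v + 7) \<le> 9" if "0 < v"
  proof -
    have vz: "v = z" using that by (simp add: z_def)
    have "2 * z * (z + 7) \<le> 9 * (1 + z\<^sup>2)" using sq by (simp add: power2_eq_square algebra_simps)
    also have "\<dots> \<le> 9 * (1 + z\<^sup>2)\<^sup>2" using le by simp
    finally show ?thesis using p z unfolding rcut'_def z_def[symmetric] vz[symmetric]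
      by (simp add: vz field_simps)
  qed
qed

lemma rcut'_cont: "continuous_on UNIV rcut'"
proof -
  have "continuous_on UNIV possq" by (rule continuous_at_imp_continuous_on) (auto intro: DERIV_isCont possq_deriv)
  moreover have "(1 + possq v)\<^sup>2 \<noteq> 0" for v using possq_nonneg[of v] by auto
  ultimately show ?thesis unfolding rcut'_def[abs_def] by (intro continuous_intros) auto
qed

text \<open>The elliptic region reaches slightly beyond the light cone: for \<open>t \<le> |x| \<le> t + 3\<close> the symbol is negative
  only by \<open>O(1/t)\<close>, which the energy absorbs.\<close>

definition ewt :: "real \<Rightarrow> real \<Rightarrow> real" where
  "ewt t y = rcut (((t + 3)\<^sup>2 - y) / t)"

definition ewt' :: "real \<Rightarrow> real \<Rightarrow> real" where
  "ewt' t y = - rcut' (((t + 3)\<^sup>2 - y) / t) / t"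

lemma ewt_deriv:
  assumes "0 < t" shows "(ewt t has_real_derivative ewt' t y) (at y)"
proof -
  have "((\<lambda>y. ((t + 3)\<^sup>2 - y) / t) has_real_derivative - 1 / t) (at y)"
    using assms by (auto intro!: derivative_eq_intros)
  from DERIV_chain2[OF rcut_deriv this] show ?thesis by (simp add: ewt_def[abs_def] ewt'_def)
qed

lemma ewt'_cont: "0 < t \<Longrightarrow> continuous_on S (ewt' t)"
  unfolding ewt'_def[abs_def] by (intro continuous_intros continuous_on_compose2[OF rcut'_cont]) auto

lemma ewt_cont: "0 < t \<Longrightarrow> continuous_on S (ewt t)"
  by (rule continuous_at_imp_continuous_on) (auto intro: DERIV_isCont ewt_deriv)

lemma ewt_bounds: "0 \<le> ewt t y" "ewt t y \<le> 1"
  by (simp_all add: ewt_def rcut_bounds)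

lemma ewt_zero: "0 < t \<Longrightarrow> (t + 3)\<^sup>2 \<le> y \<Longrightarrow> ewt t y = 0" "0 < t \<Longrightarrow> (t + 3)\<^sup>2 \<le> y \<Longrightarrow> ewt' t y = 0"
  by (simp_all add: ewt_def ewt'_def rcut_zero divide_nonpos_pos)

lemma ewt_ge: "1 \<le> t \<Longrightarrow> y \<le> (t + 2)\<^sup>2 \<Longrightarrow> 1/2 \<le> ewt t y"
  unfolding ewt_def by (rule rcut_ge) (simp add: field_simps power2_eq_square)

lemma ewt'_abs:
  assumes "0 < t"
  shows "\<bar>ewt' t y\<bar> \<le> 1 / t"
  using rcut'_bounds[of "((t + 3)\<^sup>2 - y) / t"] assms by (simp add: ewt'_def divide_right_mono)

text \<open>The summand (7/t) D restores positivity on the strip beyond the cone, where (t + 3)^2 <=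
  t^2 + 7t, and costs only 7 \<theta> D. The remaining terms are O(1/t) because |x| = O(t) on the
  support of the weight.\<close>

lemma elliptic_pointwise_cut:
  fixes s t D R \<psi> \<psi>k xk G \<Gamma> \<theta> a :: real
  assumes t: "9 \<le> t" and s: "0 \<le> s" and \<theta>: "1 / t \<le> \<theta>" and a: "a = 1 / t\<^sup>2"
    and D: "0 \<le> D" "R\<^sup>2 \<le> s * D" "\<psi>k\<^sup>2 \<le> D" and xk: "xk\<^sup>2 \<le> s" and G: "s \<le> (t + 3)\<^sup>2 \<Longrightarrow> G\<^sup>2 \<le> \<Gamma>" "0 \<le> \<Gamma>"
  shows "ewt t s * ((D - a * R\<^sup>2) + (7/t) * D) \<le>
     (ewt t s * (D - a * R\<^sup>2) + (2 * ewt' t s * (1 - a * s) - 2 * a * ewt t s) * \<psi> * R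
        - (ewt t s * \<psi>k + 2 * xk * ewt' t s * \<psi>) * G) + (100 * (\<theta> * (\<psi>\<^sup>2 + D)) + 100 * (\<Gamma> / \<theta>))"
proof (cases "s < (t + 3)\<^sup>2")
  case False
  have "0 < \<theta>" using t \<theta> by (auto intro: less_le_trans[rotated])
  then have "0 \<le> 100 * (\<theta> * (\<psi>\<^sup>2 + D)) + 100 * (\<Gamma> / \<theta>)" using D G by simp
  then show ?thesis using False t by (simp add: ewt_zero)
next
  case True
  have t0: "0 < t" and \<theta>0: "0 < \<theta>" using t \<theta> by (auto intro: less_le_trans[rotated])
  define w where "w = ewt t s"
  define w' where "w' = ewt' t s"
  define y where "y = sqrt D"
  have y: "0 \<le> y" "y\<^sup>2 = D" using D by (auto simp: y_def)
  have w: "0 \<le> w" "w \<le> 1" unfolding w_def by (rule ewt_bounds)+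
  have w': "\<bar>w'\<bar> \<le> 1 / t" unfolding w'_def using t0 by (rule ewt'_abs)
  have "(t + 3)\<^sup>2 \<le> (2 * t)\<^sup>2" using t by (intro power_mono) auto
  then have s2: "s \<le> (2 * t)\<^sup>2" using True by linarith
  have R: "\<bar>R\<bar> \<le> 2 * t * y"
  proof (rule power2_le_imp_le)
    have "R\<^sup>2 \<le> (2 * t)\<^sup>2 * D" using D(2) mult_right_mono[OF s2 D(1)] by linarith
    then show "\<bar>R\<bar>\<^sup>2 \<le> (2 * t * y)\<^sup>2" by (simp add: power_mult_distrib y)
  qed (use t0 y in auto)
  have xk: "\<bar>xk\<bar> \<le> 2 * t"
    by (rule power2_le_imp_le) (use xk s2 t0 in auto)
  have \<psi>k: "\<bar>\<psi>k\<bar> \<le> y" by (rule power2_le_imp_le) (use D y in auto)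
  \<comment> \<open>R can be as large as 2t sqrt D, so this product has to be O(1/t^2). One factor
    1/t comes from w', the other from 1 - a s = (v - (6t + 9)/t)/t, and the growth in v is absorbed
    by \<open>rcut'\<close>.\<close>
  have b: "\<bar>w' * (1 - a * s)\<bar> \<le> 9 / t\<^sup>2"
  proof -
    define v where "v = ((t + 3)\<^sup>2 - s) / t"
    have v: "0 < v" using True t0 by (simp add: v_def)
    have "1 - a * s = (v - (6 * t + 9) / t) / t"
      using t0 by (simp add: a v_def field_simps power2_eq_square)
    moreover have "\<bar>v - (6 * t + 9) / t\<bar> \<le> v + 7"
    proof -
      have "(6 * t + 9) / t = 6 + 9 / t" "9 / t \<le> 1" "0 \<le> 9 / t" using t by (auto simp: field_simps)
      then show ?thesis using v unfolding abs_le_iff by linarith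
    qed
    ultimately have "\<bar>1 - a * s\<bar> \<le> (v + 7) / t" using t0 by (simp add: divide_right_mono)
    then have "rcut' v * \<bar>1 - a * s\<bar> \<le> rcut' v * ((v + 7) / t)"
      using rcut'_bounds(1) by (intro mult_left_mono) auto
    also have "\<dots> \<le> 9 / t" using rcut'_bounds(3)[OF v] t0 by (simp add: divide_right_mono)
    finally have "rcut' v * \<bar>1 - a * s\<bar> / t \<le> 9 / t / t" using t0 by (intro divide_right_mono) auto
    then show ?thesis
      unfolding w'_def ewt'_def v_def[symmetric] using t0 rcut'_bounds(1)[of v]
      by (simp add: abs_mult power2_eq_square)
  qed
  have aw: "a * w \<le> 1 / t\<^sup>2" using w t0 by (simp add: a divide_right_mono)
  have "\<bar>(2 * w' * (1 - a * s) - 2 * a * w) * \<psi> * R\<bar> \<le> (20 / t\<^sup>2) * \<bar>\<psi>\<bar> * (2 * t * y)"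
  proof -
    have "\<bar>2 * w' * (1 - a * s) - 2 * a * w\<bar> \<le> 2 * \<bar>w' * (1 - a * s)\<bar> + 2 * (a * w)"
    proof -
      have "2 * w' * (1 - a * s) - 2 * a * w = 2 * (w' * (1 - a * s)) - 2 * (a * w)" by simp
      moreover have "0 \<le> a * w" using w t0 by (simp add: a)
      ultimately show ?thesis by linarith
    qed
    also have "\<dots> \<le> 20 / t\<^sup>2" using b aw by simp
    finally show ?thesis unfolding abs_mult using R by (intro mult_mono) auto
  qed
  also have "\<dots> = 40 * ((1 / t) * (\<bar>\<psi>\<bar> * \<bar>y\<bar>))" using t0 y by (simp add: power2_eq_square)
  also have "\<dots> \<le> 40 * (\<theta> * ((\<psi>\<^sup>2 + D) / 2))"
    using abs_mult_le_sq[of \<psi> y] y \<theta> \<theta>0 by (intro mult_left_mono mult_mono) auto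
  finally have 1: "\<bar>(2 * w' * (1 - a * s) - 2 * a * w) * \<psi> * R\<bar> \<le> 20 * (\<theta> * (\<psi>\<^sup>2 + D))" by simp
  have "\<bar>(w * \<psi>k + 2 * xk * w' * \<psi>) * G\<bar> \<le> (y + 4 * \<bar>\<psi>\<bar>) * \<bar>G\<bar>"
  proof -
    have "\<bar>w * \<psi>k\<bar> \<le> 1 * y" unfolding abs_mult using w \<psi>k y by (intro mult_mono) auto
    moreover have "\<bar>2 * xk * w' * \<psi>\<bar> \<le> 2 * (2 * t) * (1 / t) * \<bar>\<psi>\<bar>"
      unfolding abs_mult using xk w' t0 by (intro mult_mono) auto
    ultimately have "\<bar>w * \<psi>k + 2 * xk * w' * \<psi>\<bar> \<le> y + 4 * \<bar>\<psi>\<bar>" using t0 by simp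
    then show ?thesis unfolding abs_mult by (intro mult_right_mono) auto
  qed
  also have "\<dots> \<le> \<theta> * D + G\<^sup>2/\<theta> + 4 * (\<theta> * \<psi>\<^sup>2 + G\<^sup>2/\<theta>)"
    using mult_le_theta[OF \<theta>0, of y "\<bar>G\<bar>"] mult_le_theta[OF \<theta>0, of "\<bar>\<psi>\<bar>" "\<bar>G\<bar>"] y
    by (simp add: distrib_right)
  also have "\<dots> = \<theta> * D + 4 * (\<theta> * \<psi>\<^sup>2) + 5 * (G\<^sup>2/\<theta>)" by simp
  finally have 2: "\<bar>(w * \<psi>k + 2 * xk * w' * \<psi>) * G\<bar> \<le> \<theta> * D + 4 * (\<theta> * \<psi>\<^sup>2) + 5 * (\<Gamma>/\<theta>)"
    using divide_right_mono[OF G(1), of \<theta>] True \<theta>0 by simp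
  have "w * ((7/t) * D) \<le> 1 * (7 * (\<theta> * D))"
  proof (rule mult_mono)
    show "(7/t) * D \<le> 7 * (\<theta> * D)" using mult_right_mono[OF \<theta> D(1)] by simp
  qed (use w D t0 in auto)
  moreover have "0 \<le> \<theta> * D" "0 \<le> \<theta> * \<psi>\<^sup>2" "0 \<le> \<Gamma>/\<theta>" using \<theta>0 D G by auto
  ultimately show ?thesis
    using 1 2 unfolding w_def[symmetric] w'_def[symmetric] by (simp add: distrib_left abs_le_iff)
qed

text \<open>With b = 1 - a s one has w = 1 + t b and w (D - a R^2) >= t b^2 D. The cross terms with
  \<psi> and with G are each at most t b^2 D / 4 plus squares weighted by 1/t and t; the two
  quarters together are the half given up on the left. Such a weight, growing with the distance to
  the cone, is positive on the support of \<psi>.\<close>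

lemma elliptic_pointwise_supp:
  fixes s t D R \<psi> \<psi>k xk G \<Gamma> a :: real
  assumes t: "1 \<le> t" and s: "0 \<le> s" and a: "a = 1 / t\<^sup>2"
    and D: "0 \<le> D" "R\<^sup>2 \<le> s * D" "\<psi>k\<^sup>2 \<le> D" and xk: "xk\<^sup>2 \<le> s" and G: "s \<le> t\<^sup>2 \<Longrightarrow> G\<^sup>2 \<le> \<Gamma>" "0 \<le> \<Gamma>"
    and supp: "t\<^sup>2 < s \<Longrightarrow> \<psi> = 0 \<and> D = 0"
  defines "w \<equiv> 1 + (t\<^sup>2 - s) / t"
  shows "w * (D - a * R\<^sup>2) / 2 \<le>
     (w * (D - a * R\<^sup>2) + (2 * (- 1 / t) * (1 - a * s) - 2 * a * w) * \<psi> * R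
        - (w * \<psi>k + 2 * xk * (- 1 / t) * \<psi>) * G) + (100 * (1 / t * (\<psi>\<^sup>2 + D)) + 100 * (\<Gamma> / (1 / t)))"
proof (cases "s \<le> t\<^sup>2")
  case False
  then have "\<psi> = 0" "D = 0" using supp by auto
  then have "R = 0" "\<psi>k = 0" using D by auto
  then show ?thesis using \<open>\<psi> = 0\<close> \<open>D = 0\<close> G t by simp
next
  case True
  have t0: "0 < t" using t by simp
  define b where "b = 1 - a * s"
  have b: "0 \<le> b" "b \<le> 1" using True s t0 by (auto simp: b_def a)
  have wb: "w = 1 + t * b" using t0 by (simp add: w_def b_def a field_simps power2_eq_square)
  define y where "y = sqrt D"
  have y: "0 \<le> y" "y\<^sup>2 = D" using D by (auto simp: y_def)
  have R: "\<bar>R\<bar> \<le> t * y"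
  proof (rule power2_le_imp_le)
    have "R\<^sup>2 \<le> t\<^sup>2 * D" using D(2) mult_right_mono[OF True D(1)] by linarith
    then show "\<bar>R\<bar>\<^sup>2 \<le> (t * y)\<^sup>2" by (simp add: power_mult_distrib y)
  qed (use t0 y in auto)
  have xk: "\<bar>xk\<bar> \<le> t"
    by (rule power2_le_imp_le) (use xk True t0 in auto)
  have \<psi>k: "\<bar>\<psi>k\<bar> \<le> y" by (rule power2_le_imp_le) (use D y in auto)
  have w0: "0 \<le> w" using b t0 by (simp add: wb)
  have "a * R\<^sup>2 \<le> a * (s * D)" using D t0 by (intro mult_left_mono) (auto simp: a)
  then have "b * D \<le> D - a * R\<^sup>2" by (simp add: b_def algebra_simps)
  then have "w * (b * D) \<le> w * (D - a * R\<^sup>2)" using w0 by (rule mult_left_mono)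
  moreover have "0 \<le> b * D" using b D by simp
  ultimately have lhs: "t * b\<^sup>2 * D \<le> w * (D - a * R\<^sup>2)" unfolding wb by (simp add: power2_eq_square algebra_simps)
  have "\<bar>(2 * (- 1 / t) * (1 - a * s) - 2 * a * w) * \<psi> * R\<bar> \<le> ((2 * b + 2 * w / t) / t) * \<bar>\<psi>\<bar> * (t * y)"
  proof -
    have "2 * (- 1 / t) * (1 - a * s) - 2 * a * w = - ((2 * b + 2 * w / t) / t)"
      using t0 by (simp add: b_def a field_simps power2_eq_square)
    moreover have nn: "0 \<le> (2 * b + 2 * w / t) / t" using b w0 t0 by simp
    ultimately have "\<bar>2 * (- 1 / t) * (1 - a * s) - 2 * a * w\<bar> = (2 * b + 2 * w / t) / t"
      by (simp only: abs_minus_cancel abs_of_nonneg)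
    then show ?thesis unfolding abs_mult[of _ R] abs_mult[of _ \<psi>]
      using R mult_nonneg_nonneg[OF nn abs_ge_zero[of \<psi>]] by (intro mult_mono) auto
  qed
  also have "\<dots> = (2 * b + 2 * w / t) * (\<bar>\<psi>\<bar> * y)" using t0 by simp
  also have "\<dots> = 4 * b * (\<bar>\<psi>\<bar> * y) + 2 / t * (\<bar>\<psi>\<bar> * y)" using t0 by (simp add: wb field_simps)
  finally have 1: "\<bar>(2 * (- 1 / t) * (1 - a * s) - 2 * a * w) * \<psi> * R\<bar> \<le> 4 * b * (\<bar>\<psi>\<bar> * y) + 2 / t * (\<bar>\<psi>\<bar> * y)" .
  have 2: "2 / t * (\<bar>\<psi>\<bar> * y) \<le> 1 / t * (\<psi>\<^sup>2 + D)"
  proof -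
    have "2 / t * (\<bar>\<psi>\<bar> * \<bar>y\<bar>) \<le> 2 / t * ((\<psi>\<^sup>2 + y\<^sup>2) / 2)"
      using abs_mult_le_sq[of \<psi> y] t0 by (intro mult_left_mono) auto
    also have "\<dots> = 1 / t * (\<psi>\<^sup>2 + D)" using y t0 by (simp add: field_simps)
    finally show ?thesis using y by simp
  qed
  have "0 \<le> t * (b * y / 2 - 4 * \<bar>\<psi>\<bar> / t)\<^sup>2" using t0 by simp
  also have "\<dots> = t * b\<^sup>2 * D / 4 + 16 * (1 / t * \<psi>\<^sup>2) - 4 * b * (\<bar>\<psi>\<bar> * y)"
    using t0 by (simp add: y(2)[symmetric] power2_eq_square field_simps)
  finally have 3: "4 * b * (\<bar>\<psi>\<bar> * y) \<le> t * b\<^sup>2 * D / 4 + 16 * (1 / t * \<psi>\<^sup>2)" by simp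
  have G': "G\<^sup>2 \<le> \<Gamma>" using G True by simp
  have "\<bar>(w * \<psi>k + 2 * xk * (- 1 / t) * \<psi>) * G\<bar> \<le> (w * y + 2 * \<bar>\<psi>\<bar>) * \<bar>G\<bar>"
  proof -
    have "\<bar>w * \<psi>k\<bar> \<le> w * y" unfolding abs_mult using w0 \<psi>k y by (intro mult_mono) auto
    moreover have "\<bar>2 * xk * (- 1 / t) * \<psi>\<bar> \<le> 2 * t * (1 / t) * \<bar>\<psi>\<bar>"
      unfolding abs_mult using xk t0 by (intro mult_mono) auto
    moreover have "2 * t * (1 / t) * \<bar>\<psi>\<bar> = 2 * \<bar>\<psi>\<bar>" using t0 by simp
    ultimately have "\<bar>w * \<psi>k + 2 * xk * (- 1 / t) * \<psi>\<bar> \<le> w * y + 2 * \<bar>\<psi>\<bar>" by linarith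
    then show ?thesis unfolding abs_mult by (intro mult_right_mono) auto
  qed
  also have "\<dots> = y * \<bar>G\<bar> + t * (b * y * \<bar>G\<bar>) + 2 * (\<bar>\<psi>\<bar> * \<bar>G\<bar>)" by (simp add: wb algebra_simps)
  finally have 4: "\<bar>(w * \<psi>k + 2 * xk * (- 1 / t) * \<psi>) * G\<bar> \<le> y * \<bar>G\<bar> + t * (b * y * \<bar>G\<bar>) + 2 * (\<bar>\<psi>\<bar> * \<bar>G\<bar>)" .
  have tG: "t * G\<^sup>2 \<le> t * \<Gamma>" using G' t0 by simp
  have "y * \<bar>G\<bar> \<le> 1 / t * D + t * G\<^sup>2"
    using mult_le_theta[of "1/t" y "\<bar>G\<bar>"] t0 y by (simp add: mult.commute)
  then have 5: "y * \<bar>G\<bar> \<le> 1 / t * D + t * \<Gamma>" using tG by linarith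
  have "\<bar>\<psi>\<bar> * \<bar>G\<bar> \<le> 1 / t * \<psi>\<^sup>2 + t * G\<^sup>2"
    using mult_le_theta[of "1/t" "\<bar>\<psi>\<bar>" "\<bar>G\<bar>"] t0 by (simp add: mult.commute)
  then have 6: "2 * (\<bar>\<psi>\<bar> * \<bar>G\<bar>) \<le> 2 * (1 / t * \<psi>\<^sup>2) + 2 * (t * \<Gamma>)" using tG by linarith
  have "0 \<le> t * (b * y / 2 - \<bar>G\<bar>)\<^sup>2" using t0 by simp
  also have "\<dots> = t * b\<^sup>2 * D / 4 + t * G\<^sup>2 - t * (b * y * \<bar>G\<bar>)"
    by (simp add: y(2)[symmetric] power2_eq_square field_simps flip: abs_mult)
  finally have 7: "t * (b * y * \<bar>G\<bar>) \<le> t * b\<^sup>2 * D / 4 + t * \<Gamma>"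
    using tG by linarith
  have nn: "0 \<le> 1 / t * \<psi>\<^sup>2" "0 \<le> 1 / t * D" "0 \<le> t * \<Gamma>" using t0 D G by auto
  have tot: "\<bar>(2 * (- 1 / t) * (1 - a * s) - 2 * a * w) * \<psi> * R\<bar> + \<bar>(w * \<psi>k + 2 * xk * (- 1 / t) * \<psi>) * G\<bar>
    \<le> w * (D - a * R\<^sup>2) / 2 + (100 * (1 / t * (\<psi>\<^sup>2 + D)) + 100 * (\<Gamma> / (1 / t)))"
    using 1 2 3 4 5 6 7 nn lhs by (simp add: distrib_left mult.commute)
  define X Y where "X = (2 * (- 1 / t) * (1 - a * s) - 2 * a * w) * \<psi> * R" and "Y = (w * \<psi>k + 2 * xk * (- 1 / t) * \<psi>) * G"
  show ?thesis using tot unfolding X_def[symmetric] Y_def[symmetric]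
    using abs_ge_self[of Y] abs_ge_minus_self[of X] by linarith
qed

lemma coord_sq_le: "(x $ k)\<^sup>2 \<le> x \<bullet> x" for x :: "real^3"
  using component_le_norm_cart[of x k] by (simp add: abs_le_square_iff[of "x $ k" "norm x", simplified] power2_norm_eq_inner)

lemma term_le_sum_sq: "(g k)\<^sup>2 \<le> (\<Sum>i\<in>UNIV. (g i)\<^sup>2)" for g :: "3 \<Rightarrow> real"
  by (rule member_le_sum[of k UNIV "\<lambda>i. (g i)\<^sup>2"]) auto

text \<open>A majorant \<Gamma> stands in for the square of G because the slice operator has
  coefficients growing like |x|^2: G is under control only where the weight lives.\<close>

theorem elliptic_estimate_cut:
  assumes t: "9 \<le> t" and \<theta>: "1 / t \<le> \<theta>"
    and g: "has_grad \<psi> \<psi>1" "\<And>i. has_grad (\<psi>1 i) (\<psi>2 i)" and sym: "\<And>i j x. \<psi>2 i j x = \<psi>2 j i x"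
    and G: "pd k G Gk" "continuous_on UNIV G" "continuous_on UNIV Gk"
    and eq: "\<And>x. (\<Sum>i\<in>UNIV. \<psi>2 i i x) - (1/t\<^sup>2) * (\<Sum>i\<in>UNIV. \<Sum>j\<in>UNIV. x $ i * x $ j * \<psi>2 i j x)
                = Gk x + 2 * (1/t\<^sup>2) * (\<Sum>i\<in>UNIV. x $ i * \<psi>1 i x)"
    and \<Gamma>: "\<Gamma> integrable_on UNIV" "\<And>x. 0 \<le> \<Gamma> x" "\<And>x. norm x \<le> t + 3 \<Longrightarrow> (G x)\<^sup>2 \<le> \<Gamma> x"
    and L2: "sq_integrable \<psi>" "\<And>i. sq_integrable (\<psi>1 i)"
  defines "K \<equiv> \<lambda>x. ewt t (x \<bullet> x) * (((\<Sum>i\<in>UNIV. (\<psi>1 i x)\<^sup>2) - (1/t\<^sup>2) * (\<Sum>i\<in>UNIV. x $ i * \<psi>1 i x)\<^sup>2) + (7/t) * (\<Sum>i\<in>UNIV. (\<psi>1 i x)\<^sup>2))"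
  shows "comp_supp K"
    and "integral UNIV K \<le> 100 * (\<theta> * (L2sq \<psi> + (\<Sum>i\<in>UNIV. L2sq (\<psi>1 i)))) + 100 * (integral UNIV \<Gamma> / \<theta>)"
proof -
  have t0: "0 < t" using t by simp
  have cont: "continuous_on UNIV \<psi>" "\<And>i. continuous_on UNIV (\<psi>1 i)"
    using g by (auto intro: has_grad_cont has_grad_cont1)
  have ws: "comp_supp (\<lambda>x::real^3. ewt t (x \<bullet> x))"
    by (rule comp_supp_radial[where c="(t + 3)\<^sup>2"]) (use t0 ewt_cont ewt_zero in auto)
  define F where "F = (\<lambda>x. ewt t (x \<bullet> x) * ((\<Sum>i\<in>UNIV. (\<psi>1 i x)\<^sup>2) - (1/t\<^sup>2) * (\<Sum>i\<in>UNIV. x $ i * \<psi>1 i x)\<^sup>2)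
        + (2 * ewt' t (x \<bullet> x) * (1 - (1/t\<^sup>2) * (x \<bullet> x)) - 2 * (1/t\<^sup>2) * ewt t (x \<bullet> x)) * \<psi> x * (\<Sum>i\<in>UNIV. x $ i * \<psi>1 i x)
        - (ewt t (x \<bullet> x) * \<psi>1 k x + 2 * x $ k * ewt' t (x \<bullet> x) * \<psi> x) * G x)"
  have F: "comp_supp F" "integral UNIV F = 0"
    unfolding F_def
    by (rule elliptic_identity[OF g sym ewt_deriv[OF t0] ewt'_cont[OF t0] comp_supp_multL[OF cont(1) ws] G eq])+
  define Bd where "Bd = (\<lambda>x. 100 * (\<theta> * ((\<psi> x)\<^sup>2 + (\<Sum>i\<in>UNIV. (\<psi>1 i x)\<^sup>2))) + 100 * (\<Gamma> x / \<theta>))"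
  have Bd: "(Bd has_integral (100 * (\<theta> * (L2sq \<psi> + (\<Sum>i\<in>UNIV. L2sq (\<psi>1 i)))) + 100 * (integral UNIV \<Gamma> / \<theta>))) UNIV"
    unfolding Bd_def
    by (intro has_integral_add has_integral_mult_right has_integral_divide has_integral_sum integrable_integral L2 \<Gamma> finite)
  show K: "comp_supp K"
    unfolding K_def by (intro comp_supp_multL[OF _ ws] continuous_intros cont)
  have pw: "K x \<le> F x + Bd x" for x
    unfolding K_def F_def Bd_def
  proof (rule elliptic_pointwise_cut[OF t inner_ge_zero \<theta> refl])
    show "(G x)\<^sup>2 \<le> \<Gamma> x" if "x \<bullet> x \<le> (t + 3)\<^sup>2"
      using that t0 by (intro \<Gamma>(3)) (auto simp: norm_le_square)
    show "(\<psi>1 k x)\<^sup>2 \<le> (\<Sum>i\<in>UNIV. (\<psi>1 i x)\<^sup>2)" by (rule term_le_sum_sq)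
  qed (auto simp: sum_nonneg radial_deriv_sq_le coord_sq_le \<Gamma>)
  have "integral UNIV K \<le> integral UNIV Bd"
    by (rule integral_le_of_zero[OF K F _ pw]) (use Bd in blast)
  then show "integral UNIV K \<le> 100 * (\<theta> * (L2sq \<psi> + (\<Sum>i\<in>UNIV. L2sq (\<psi>1 i)))) + 100 * (integral UNIV \<Gamma> / \<theta>)"
    using integral_unique[OF Bd] by simp
qed

text \<open>The compact support of \<psi> replaces a cutoff in the weight, and \<theta> is fixed to
  1/t: gradients are charged with 1/t, the source with t.\<close>

theorem elliptic_estimate_supp:
  assumes t: "1 \<le> t"
    and g: "has_grad \<psi> \<psi>1" "\<And>i. has_grad (\<psi>1 i) (\<psi>2 i)" and sym: "\<And>i j x. \<psi>2 i j x = \<psi>2 j i x"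
    and G: "pd k G Gk" "continuous_on UNIV G" "continuous_on UNIV Gk"
    and eq: "\<And>x. (\<Sum>i\<in>UNIV. \<psi>2 i i x) - (1/t\<^sup>2) * (\<Sum>i\<in>UNIV. \<Sum>j\<in>UNIV. x $ i * x $ j * \<psi>2 i j x)
                = Gk x + 2 * (1/t\<^sup>2) * (\<Sum>i\<in>UNIV. x $ i * \<psi>1 i x)"
    and \<Gamma>: "\<Gamma> integrable_on UNIV" "\<And>x. 0 \<le> \<Gamma> x" "\<And>x. norm x \<le> t \<Longrightarrow> (G x)\<^sup>2 \<le> \<Gamma> x"
    and L2: "sq_integrable \<psi>" "\<And>i. sq_integrable (\<psi>1 i)"
    and supp: "\<And>x. t < norm x \<Longrightarrow> \<psi> x = 0" "\<And>x i. t < norm x \<Longrightarrow> \<psi>1 i x = 0"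
  defines "K \<equiv> \<lambda>x. (1 + (t\<^sup>2 - x \<bullet> x) / t) * ((\<Sum>i\<in>UNIV. (\<psi>1 i x)\<^sup>2) - (1/t\<^sup>2) * (\<Sum>i\<in>UNIV. x $ i * \<psi>1 i x)\<^sup>2) / 2"
  shows "comp_supp K"
    and "integral UNIV K \<le> 100 * (1/t * (L2sq \<psi> + (\<Sum>i\<in>UNIV. L2sq (\<psi>1 i)))) + 100 * (integral UNIV \<Gamma> / (1/t))"
proof -
  have t0: "0 < t" using t by simp
  let ?w = "\<lambda>y. 1 + (t\<^sup>2 - y) / t"
  have cont: "continuous_on UNIV \<psi>" "\<And>i. continuous_on UNIV (\<psi>1 i)"
    using g by (auto intro: has_grad_cont has_grad_cont1)
  have wd: "(?w has_real_derivative - 1 / t) (at y)" for y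
    using t0 by (auto intro!: derivative_eq_intros)
  have cw: "continuous_on UNIV (\<lambda>x::real^3. ?w (x \<bullet> x))"
    using t0 by (intro continuous_intros) auto
  have ws: "comp_supp (\<lambda>x. ?w (x \<bullet> x) * \<psi> x)"
    by (rule comp_suppI[of _ t]) (use supp in \<open>auto intro!: continuous_on_mult cw cont\<close>)
  define F where "F = (\<lambda>x. ?w (x \<bullet> x) * ((\<Sum>i\<in>UNIV. (\<psi>1 i x)\<^sup>2) - (1/t\<^sup>2) * (\<Sum>i\<in>UNIV. x $ i * \<psi>1 i x)\<^sup>2)
        + (2 * (- 1 / t) * (1 - (1/t\<^sup>2) * (x \<bullet> x)) - 2 * (1/t\<^sup>2) * ?w (x \<bullet> x)) * \<psi> x * (\<Sum>i\<in>UNIV. x $ i * \<psi>1 i x)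
        - (?w (x \<bullet> x) * \<psi>1 k x + 2 * x $ k * (- 1 / t) * \<psi> x) * G x)"
  have F: "comp_supp F" "integral UNIV F = 0"
    unfolding F_def
    by (rule elliptic_identity[OF g sym wd continuous_on_const ws G eq])+
  define Bd where "Bd = (\<lambda>x. 100 * (1/t * ((\<psi> x)\<^sup>2 + (\<Sum>i\<in>UNIV. (\<psi>1 i x)\<^sup>2))) + 100 * (\<Gamma> x / (1/t)))"
  have Bd: "(Bd has_integral (100 * (1/t * (L2sq \<psi> + (\<Sum>i\<in>UNIV. L2sq (\<psi>1 i)))) + 100 * (integral UNIV \<Gamma> / (1/t)))) UNIV"
    unfolding Bd_def
    by (intro has_integral_add has_integral_mult_right has_integral_divide has_integral_sum integrable_integral L2 \<Gamma> finite)
  show K: "comp_supp K"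
    unfolding K_def
    by (rule comp_suppI[of _ t]) (use supp t0 in \<open>auto intro!: continuous_intros cw cont\<close>)
  have pw: "K x \<le> F x + Bd x" for x
    unfolding K_def F_def Bd_def
  proof (rule elliptic_pointwise_supp[OF t inner_ge_zero refl])
    show "(G x)\<^sup>2 \<le> \<Gamma> x" if "x \<bullet> x \<le> t\<^sup>2"
      using that t0 by (intro \<Gamma>(3)) (auto simp: norm_le_square)
    show "\<psi> x = 0 \<and> (\<Sum>i\<in>UNIV. (\<psi>1 i x)\<^sup>2) = 0" if "t\<^sup>2 < x \<bullet> x"
    proof -
      have "t < norm x" using that t0 by (meson norm_le_square not_le less_imp_le)
      then show ?thesis using supp by simp
    qed
    show "(\<psi>1 k x)\<^sup>2 \<le> (\<Sum>i\<in>UNIV. (\<psi>1 i x)\<^sup>2)" by (rule term_le_sum_sq)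
  qed (auto simp: sum_nonneg radial_deriv_sq_le coord_sq_le \<Gamma>)
  have "integral UNIV K \<le> integral UNIV Bd"
    by (rule integral_le_of_zero[OF K F _ pw]) (use Bd in blast)
  then show "integral UNIV K \<le> 100 * (1/t * (L2sq \<psi> + (\<Sum>i\<in>UNIV. L2sq (\<psi>1 i)))) + 100 * (integral UNIV \<Gamma> / (1/t))"
    using integral_unique[OF Bd] by simp
qed

section \<open>Cube averages and pointwise bounds\<close>

definition cube :: "(real^3) set" where
  "cube = cbox 0 (\<chi> i. 1)"

lemma cube_iff: "q \<in> cube \<longleftrightarrow> (\<forall>i. 0 \<le> q $ i \<and> q $ i \<le> 1)"
  by (simp add: cube_def mem_box_cart)

lemma content_cube: "measure lborel cube = 1"
proof -
  have ne: "cbox (0::real^3) (\<chi> i. 1) \<noteq> {}" by (simp add: interval_ne_empty_cart)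
  show ?thesis unfolding cube_def using content_cbox_cart[OF ne] by simp
qed

lemma integral_cube_const: "integral cube (\<lambda>q. c :: real) = c"
  unfolding cube_def integral_const content_cube[unfolded cube_def] by (rule scaleR_one)

lemma compact_cube: "compact cube"
  unfolding cube_def by (rule compact_cbox)

lemma integrable_on_compact:
  fixes f :: "real^3 \<Rightarrow> real"
  assumes "compact S" "continuous_on S f"
  shows "f integrable_on S"
proof -
  have "integrable lborel (\<lambda>x. indicator S x *\<^sub>R f x)"
    using assms by (rule borel_integrable_compact)
  then have "(\<lambda>x. indicator S x *\<^sub>R f x) integrable_on UNIV" by (rule integrable_on_lborel)
  also have "(\<lambda>x. indicator S x *\<^sub>R f x) = (\<lambda>x. if x \<in> S then f x else 0)" by (auto simp: indicator_def)
  finally show ?thesis by (simp add: integrable_restrict_UNIV)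
qed

text \<open>Cauchy-Schwarz on a set of measure one, from |f| <= f^2/(2M) + M/2.\<close>

lemma integral_cube_abs_le:
  fixes f :: "real^3 \<Rightarrow> real"
  assumes "continuous_on cube f" "integral cube (\<lambda>q. (f q)\<^sup>2) \<le> M\<^sup>2" "0 < M"
  shows "integral cube (\<lambda>q. \<bar>f q\<bar>) \<le> M"
proof -
  have le: "\<bar>f q\<bar> \<le> (f q)\<^sup>2 / (2 * M) + M / 2" for q
  proof -
    have "0 \<le> (\<bar>f q\<bar> - M)\<^sup>2 / (2 * M)" using assms by simp
    also have "\<dots> = (f q)\<^sup>2 / (2 * M) + M / 2 - \<bar>f q\<bar>" using assms by (simp add: power2_eq_square field_simps flip: abs_mult)
    finally show ?thesis by simp
  qed
  have i: "(\<lambda>q. (f q)\<^sup>2) integrable_on cube" "(\<lambda>q. \<bar>f q\<bar>) integrable_on cube" "(\<lambda>q::real^3. M / 2) integrable_on cube"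
    by (intro integrable_on_compact compact_cube continuous_intros assms)+
  have "integral cube (\<lambda>q. \<bar>f q\<bar>) \<le> integral cube (\<lambda>q. (f q)\<^sup>2 / (2 * M) + M / 2)"
    by (intro integral_le i integrable_add integrable_on_divide le)
  also have "\<dots> = integral cube (\<lambda>q. (f q)\<^sup>2) / (2 * M) + M / 2"
    by (subst integral_add) (auto simp: i integrable_on_divide integral_cube_const)
  also have "\<dots> \<le> M\<^sup>2 / (2 * M) + M / 2" using assms by (intro add_right_mono divide_right_mono) auto
  also have "\<dots> = M" using assms by (simp add: power2_eq_square)
  finally show ?thesis .
qed

text \<open>\<gamma> is left general because three families of maps are differentiated: cubes
  dilated about a point, cubes sliding from one point to another, and the sphere charts.\<close>

lemma average_deriv:
  assumes u: "has_grad u u1" and U: "open U" "convex U" "\<sigma>0 \<in> U"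
    and \<gamma>: "\<And>\<sigma> q. \<sigma> \<in> U \<Longrightarrow> q \<in> cube \<Longrightarrow> ((\<lambda>\<sigma>. \<gamma> \<sigma> q) has_vector_derivative \<gamma>' \<sigma> q) (at \<sigma>)"
    and cont: "continuous_on (U \<times> cube) (\<lambda>(\<sigma>, q). \<gamma> \<sigma> q)" "continuous_on (U \<times> cube) (\<lambda>(\<sigma>, q). \<gamma>' \<sigma> q)"
    and \<phi>: "continuous_on cube \<phi>"
  shows "((\<lambda>\<sigma>. integral cube (\<lambda>q. \<phi> q * u (\<gamma> \<sigma> q))) has_real_derivative
           integral cube (\<lambda>q. \<phi> q * (\<Sum>i\<in>UNIV. \<gamma>' \<sigma>0 q $ i * u1 i (\<gamma> \<sigma>0 q)))) (at \<sigma>0)"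
proof -
  have uc: "continuous_on UNIV u" "\<And>i. continuous_on UNIV (u1 i)"
    using u by (auto intro: has_grad_cont has_grad_cont1)
  have sl: "continuous_on cube (\<lambda>q. \<gamma> \<sigma> q)" if "\<sigma> \<in> U" for \<sigma>
  proof -
    have "continuous_on cube (\<lambda>q. (\<sigma>, q))" by (intro continuous_intros)
    from continuous_on_compose2[OF cont(1) this] that show ?thesis by auto
  qed
  have "((\<lambda>\<sigma>. integral cube (\<lambda>q. \<phi> q * u (\<gamma> \<sigma> q))) has_real_derivative
           integral cube (\<lambda>q. \<phi> q * (\<Sum>i\<in>UNIV. \<gamma>' \<sigma>0 q $ i * u1 i (\<gamma> \<sigma>0 q)))) (at \<sigma>0 within U)"
    unfolding cube_def
  proof (rule leibniz_rule_field_derivative[OF _ _ _ U(3,2)])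
    fix \<sigma> and q :: "real^3"
    assume "\<sigma> \<in> U" "q \<in> cbox 0 (\<chi> i. 1)"
    then have \<sigma>: "\<sigma> \<in> U" "q \<in> cube" by (auto simp: cube_def)
    have "(u has_derivative (\<lambda>h. \<Sum>i\<in>UNIV. h $ i * u1 i (\<gamma> \<sigma> q))) (at (\<gamma> \<sigma> q))"
      using u by (simp add: has_grad_def)
    from has_derivative_compose[OF \<gamma>[OF \<sigma>, unfolded has_vector_derivative_def] this]
    have "((\<lambda>\<sigma>. u (\<gamma> \<sigma> q)) has_derivative (\<lambda>h. \<Sum>i\<in>UNIV. (h *\<^sub>R \<gamma>' \<sigma> q) $ i * u1 i (\<gamma> \<sigma> q))) (at \<sigma>)" .
    moreover have "(\<lambda>h. \<Sum>i\<in>UNIV. (h *\<^sub>R \<gamma>' \<sigma> q) $ i * u1 i (\<gamma> \<sigma> q)) = (*) (\<Sum>i\<in>UNIV. \<gamma>' \<sigma> q $ i * u1 i (\<gamma> \<sigma> q))"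
      by (auto simp: fun_eq_iff sum_distrib_left mult_ac)
    ultimately have "((\<lambda>\<sigma>. u (\<gamma> \<sigma> q)) has_real_derivative (\<Sum>i\<in>UNIV. \<gamma>' \<sigma> q $ i * u1 i (\<gamma> \<sigma> q))) (at \<sigma>)"
      by (simp add: has_field_derivative_def)
    then show "((\<lambda>\<sigma>. \<phi> q * u (\<gamma> \<sigma> q)) has_real_derivative \<phi> q * (\<Sum>i\<in>UNIV. \<gamma>' \<sigma> q $ i * u1 i (\<gamma> \<sigma> q))) (at \<sigma> within U)"
      by (intro DERIV_cmult) (rule has_field_derivative_at_within)
  next
    show "(\<lambda>q. \<phi> q * u (\<gamma> \<sigma> q)) integrable_on cbox 0 (\<chi> i. 1)" if "\<sigma> \<in> U" for \<sigma>
      unfolding cube_def[symmetric]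
      by (intro integrable_on_compact compact_cube continuous_on_mult \<phi> continuous_on_compose2[OF uc(1) sl[OF that]]) auto
    have "continuous_on (U \<times> cube) (\<lambda>p. \<phi> (snd p) * (\<Sum>i\<in>UNIV. (\<lambda>(\<sigma>, q). \<gamma>' \<sigma> q) p $ i * u1 i ((\<lambda>(\<sigma>, q). \<gamma> \<sigma> q) p)))"
      by (intro continuous_intros continuous_on_compose2[OF \<phi>] continuous_on_compose2[OF uc(2) cont(1)] cont(2)) auto
    then show "continuous_on (U \<times> cbox 0 (\<chi> i. 1)) (\<lambda>(\<sigma>, q). \<phi> q * (\<Sum>i\<in>UNIV. \<gamma>' \<sigma> q $ i * u1 i (\<gamma> \<sigma> q)))"
      by (simp add: split_beta cube_def)
  qed
  then show ?thesis by (simp only: at_within_open[OF U(3,1)])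
qed

lemma change_of_variables_le:
  fixes \<Theta> :: "real^3 \<Rightarrow> real^3" and F :: "real^3 \<Rightarrow> real"
  assumes \<Theta>: "\<And>q. q \<in> cube \<Longrightarrow> (\<Theta> has_derivative \<Theta>' q) (at q)" "inj_on \<Theta> cube"
    and J: "\<And>q. q \<in> cube \<Longrightarrow> J \<le> \<bar>det (matrix (\<Theta>' q))\<bar>"
    and F: "continuous_on UNIV F" "\<And>x. 0 \<le> F x"
  shows "J * integral cube (\<lambda>q. F (\<Theta> q)) \<le> integral (\<Theta> ` cube) F" "compact (\<Theta> ` cube)"
proof -
  have c: "continuous_on cube \<Theta>"
    using \<Theta>(1) by (meson continuous_at_imp_continuous_on has_derivative_continuous)
  show cpt: "compact (\<Theta> ` cube)" using c compact_cube by (rule compact_continuous_image)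
  have S: "cube \<in> sets lebesgue" by (simp add: cube_def)
  have Fi: "F absolutely_integrable_on (\<Theta> ` cube)"
    using integrable_on_compact[OF cpt continuous_on_subset[OF F(1)]] F(2)
    by (intro nonnegative_absolutely_integrable_1) auto
  \<comment> \<open>The change of variables theorem concerns integrands with values in
    \<open>real^n\<close>, hence the detour through \<open>real^1\<close>.\<close>
  let ?f = "\<lambda>x. vec (F x) :: real^1"
  have "?f absolutely_integrable_on (\<Theta> ` cube)"
    using Fi by (subst absolutely_integrable_on_1_iff) simp
  then have "(\<lambda>q. \<bar>det (matrix (\<Theta>' q))\<bar> *\<^sub>R ?f (\<Theta> q)) absolutely_integrable_on cube \<and>
        integral cube (\<lambda>q. \<bar>det (matrix (\<Theta>' q))\<bar> *\<^sub>R ?f (\<Theta> q)) = integral (\<Theta> ` cube) ?f"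
    by (subst has_absolute_integral_change_of_variables[OF S has_derivative_at_withinI[OF \<Theta>(1)] \<Theta>(2)]) auto
  then have "(\<lambda>q. \<bar>det (matrix (\<Theta>' q))\<bar> *\<^sub>R ?f (\<Theta> q)) integrable_on cube"
     "integral cube (\<lambda>q. \<bar>det (matrix (\<Theta>' q))\<bar> *\<^sub>R ?f (\<Theta> q)) = integral (\<Theta> ` cube) ?f"
    using absolutely_integrable_on_def by blast+
  then have d: "(\<lambda>q. \<bar>det (matrix (\<Theta>' q))\<bar> * F (\<Theta> q)) integrable_on cube"
     "integral cube (\<lambda>q. \<bar>det (matrix (\<Theta>' q))\<bar> * F (\<Theta> q)) = integral (\<Theta> ` cube) F"
    by (simp_all add: integrable_on_1_iff integral_on_1_eq)
  have "J * integral cube (\<lambda>q. F (\<Theta> q)) = integral cube (\<lambda>q. J * F (\<Theta> q))" by simp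
  also have "\<dots> \<le> integral cube (\<lambda>q. \<bar>det (matrix (\<Theta>' q))\<bar> * F (\<Theta> q))"
  proof (rule integral_le[OF _ d(1)])
    show "(\<lambda>q. J * F (\<Theta> q)) integrable_on cube"
      by (intro integrable_on_compact compact_cube continuous_intros continuous_on_compose2[OF F(1) c]) auto
    show "J * F (\<Theta> q) \<le> \<bar>det (matrix (\<Theta>' q))\<bar> * F (\<Theta> q)" if "q \<in> cube" for q
      using J[OF that] F(2) by (intro mult_right_mono)
  qed
  finally show "J * integral cube (\<lambda>q. F (\<Theta> q)) \<le> integral (\<Theta> ` cube) F" using d(2) by simp
qed

lemma integral_compact_mono:
  fixes f :: "real^3 \<Rightarrow> real"
  assumes "compact S" "compact T" "S \<subseteq> T" "continuous_on T f" "\<And>x. 0 \<le> f x"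
  shows "integral S f \<le> integral T f"
  by (rule integral_subset_le[OF assms(3) integrable_on_compact[OF assms(1) continuous_on_subset[OF assms(4,3)]]
        integrable_on_compact[OF assms(2,4)]]) (simp add: assms(5))

lemma cube_norm_le: "q \<in> cube \<Longrightarrow> norm q \<le> 2"
proof -
  assume "q \<in> cube"
  then have "q $ i * q $ i \<le> 1" for i
    using mult_mono[of "q $ i" 1 "q $ i" 1] by (simp add: cube_iff)
  from this[of 1] this[of 2] this[of 3] have "q \<bullet> q \<le> 2\<^sup>2"
    unfolding inner_vec_def inner_real_def sum_3 by simp
  then show ?thesis by (simp add: norm_le_square)
qed

text \<open>The dilated cube has volume d^3 and lies in the ball of radius 2d, the diagonal sqrt 3
  being below 2.\<close>

lemma average_sq_le:
  fixes u :: "real^3 \<Rightarrow> real"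
  assumes u: "continuous_on UNIV u" and d: "0 < d" and B: "integral (cball x (2 * d)) (\<lambda>y. (u y)\<^sup>2) \<le> B\<^sup>2"
  shows "integral cube (\<lambda>q. (u (x + d *\<^sub>R q))\<^sup>2) \<le> (B / (d * sqrt d))\<^sup>2"
proof -
  have der: "((\<lambda>q. x + d *\<^sub>R q) has_derivative (\<lambda>h. d *\<^sub>R h)) (at q)" for q
    by (auto intro!: derivative_eq_intros)
  have det: "d ^ 3 \<le> \<bar>det (matrix (\<lambda>h::real^3. d *\<^sub>R h))\<bar>"
    using d by (simp add: det_3 matrix_def axis_def power3_eq_cube)
  have inj: "inj_on (\<lambda>q. x + d *\<^sub>R q) cube" using d by (auto simp: inj_on_def)
  note cv = change_of_variables_le[OF der inj det, of "\<lambda>y. (u y)\<^sup>2"]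
  have cu: "continuous_on UNIV (\<lambda>y. (u y)\<^sup>2)" by (intro continuous_intros u)
  have "d ^ 3 * integral cube (\<lambda>q. (u (x + d *\<^sub>R q))\<^sup>2) \<le> integral ((\<lambda>q. x + d *\<^sub>R q) ` cube) (\<lambda>y. (u y)\<^sup>2)"
    by (rule cv(1)) (use cu in auto)
  also have "\<dots> \<le> integral (cball x (2 * d)) (\<lambda>y. (u y)\<^sup>2)"
  proof (rule integral_compact_mono)
    show "compact ((\<lambda>q. x + d *\<^sub>R q) ` cube)" by (rule cv(2)) (use cu in auto)
    show "(\<lambda>q. x + d *\<^sub>R q) ` cube \<subseteq> cball x (2 * d)" using cube_norm_le d by (auto simp: dist_norm)
    show "continuous_on (cball x (2 * d)) (\<lambda>y. (u y)\<^sup>2)" using cu by (rule continuous_on_subset) simp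
  qed simp_all
  also have "\<dots> \<le> B\<^sup>2" by (rule B)
  finally have "integral cube (\<lambda>q. (u (x + d *\<^sub>R q))\<^sup>2) \<le> B\<^sup>2 / d ^ 3" using d by (simp add: field_simps)
  also have "B\<^sup>2 / d ^ 3 = (B / (d * sqrt d))\<^sup>2"
    using d by (simp add: power_divide power_mult_distrib power3_eq_cube power2_eq_square)
  finally show ?thesis .
qed

lemma average_abs_le:
  fixes u :: "real^3 \<Rightarrow> real"
  assumes u: "continuous_on UNIV u" and d: "0 < d" and B: "integral (cball x (2 * d)) (\<lambda>y. (u y)\<^sup>2) \<le> B\<^sup>2" "0 < B"
  shows "integral cube (\<lambda>q. \<bar>u (x + d *\<^sub>R q)\<bar>) \<le> B / (d * sqrt d)"
proof (rule integral_cube_abs_le[OF _ average_sq_le[OF u d B(1)]])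
  show "continuous_on cube (\<lambda>q. u (x + d *\<^sub>R q))"
    by (rule continuous_on_compose2[OF u]) (auto intro!: continuous_intros)
qed (use d B in simp)

lemma integral_cube_abs_bound:
  fixes f g :: "real^3 \<Rightarrow> real"
  assumes "continuous_on cube f" "continuous_on cube g" "\<And>q. q \<in> cube \<Longrightarrow> \<bar>f q\<bar> \<le> g q"
  shows "\<bar>integral cube f\<bar> \<le> integral cube g"
  using integral_norm_bound_integral[OF integrable_on_compact[OF compact_cube assms(1)]
      integrable_on_compact[OF compact_cube assms(2)]] assms(3) by simp

section \<open>Local Sobolev and Hoelder bounds from averages at varying scale\<close>

definition loc_bd :: "real^3 \<Rightarrow> real \<Rightarrow> real \<Rightarrow> (real^3 \<Rightarrow> real) \<Rightarrow> bool" where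
  "loc_bd x \<rho> B v \<longleftrightarrow> integral (cball x \<rho>) (\<lambda>y. (v y)\<^sup>2) \<le> B\<^sup>2"

lemma loc_bd_mono:
  assumes "loc_bd x \<rho> B v" "cball y \<sigma> \<subseteq> cball x \<rho>" "continuous_on UNIV v"
  shows "loc_bd y \<sigma> B v"
proof -
  have "integral (cball y \<sigma>) (\<lambda>y. (v y)\<^sup>2) \<le> integral (cball x \<rho>) (\<lambda>y. (v y)\<^sup>2)"
    by (rule integral_compact_mono) (use assms in \<open>auto intro!: continuous_intros intro: continuous_on_subset\<close>)
  then show ?thesis using assms(1) by (simp add: loc_bd_def)
qed

lemma average_abs_le':
  assumes "continuous_on UNIV u" "0 < d" "loc_bd x \<rho> B u" "2 * d \<le> \<rho>" "0 < B"
  shows "integral cube (\<lambda>q. \<bar>u (x + d *\<^sub>R q)\<bar>) \<le> B / (d * sqrt d)"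
proof -
  have "loc_bd x (2 * d) B u" by (rule loc_bd_mono[OF assms(3)]) (use assms in auto)
  then show ?thesis using assms by (intro average_abs_le) (auto simp: loc_bd_def)
qed

lemma sum_abs_bound:
  fixes f :: "3 \<Rightarrow> real^3 \<Rightarrow> real"
  assumes c: "\<And>i. continuous_on cube (f i)" "\<And>i. continuous_on cube (c i)" "continuous_on cube \<phi>"
    and b: "\<And>i q. q \<in> cube \<Longrightarrow> \<bar>c i q\<bar> \<le> 1" "\<And>q. q \<in> cube \<Longrightarrow> \<bar>\<phi> q\<bar> \<le> 1"
    and M: "\<And>i. integral cube (\<lambda>q. \<bar>f i q\<bar>) \<le> M"
  shows "\<bar>integral cube (\<lambda>q. \<phi> q * (\<Sum>i\<in>UNIV. c i q * f i q))\<bar> \<le> 3 * M"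
proof -
  have "\<bar>integral cube (\<lambda>q. \<phi> q * (\<Sum>i\<in>UNIV. c i q * f i q))\<bar> \<le> integral cube (\<lambda>q. \<Sum>i\<in>UNIV. \<bar>f i q\<bar>)"
  proof (rule integral_cube_abs_bound)
    fix q assume q: "q \<in> cube"
    have "\<bar>\<phi> q * (\<Sum>i\<in>UNIV. c i q * f i q)\<bar> \<le> 1 * (\<Sum>i\<in>UNIV. \<bar>c i q * f i q\<bar>)"
      unfolding abs_mult[of "\<phi> q"] using b(2)[OF q] by (intro mult_mono sum_abs) auto
    also have "\<dots> \<le> 1 * (\<Sum>i\<in>UNIV. \<bar>f i q\<bar>)"
    proof (intro mult_left_mono sum_mono)
      show "\<bar>c i q * f i q\<bar> \<le> \<bar>f i q\<bar>" for i
        using mult_right_mono[OF b(1)[OF q, of i], of "\<bar>f i q\<bar>"] by (simp add: abs_mult)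
    qed simp
    finally show "\<bar>\<phi> q * (\<Sum>i\<in>UNIV. c i q * f i q)\<bar> \<le> (\<Sum>i\<in>UNIV. \<bar>f i q\<bar>)" by simp
  qed (intro continuous_intros c)+
  also have "\<dots> = (\<Sum>i\<in>UNIV. integral cube (\<lambda>q. \<bar>f i q\<bar>))"
    by (intro integral_sum finite integrable_on_compact compact_cube continuous_intros c)
  also have "\<dots> \<le> (\<Sum>i\<in>(UNIV::3 set). M)" by (intro sum_mono M)
  finally show ?thesis by simp
qed

lemma average_affine_deriv:
  assumes u: "has_grad u u1" and \<phi>: "continuous_on cube \<phi>"
  shows "((\<lambda>\<sigma>. integral cube (\<lambda>q. \<phi> q * u (x + \<sigma> *\<^sub>R q))) has_real_derivative
           integral cube (\<lambda>q. \<phi> q * (\<Sum>i\<in>UNIV. q $ i * u1 i (x + \<sigma> *\<^sub>R q)))) (at \<sigma>)"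
  by (rule average_deriv[OF u open_UNIV convex_UNIV UNIV_I _ _ _ \<phi>, where \<gamma>="\<lambda>\<sigma> q. x + \<sigma> *\<^sub>R q" and \<gamma>'="\<lambda>\<sigma> q. q"])
    (auto simp: split_beta intro!: derivative_eq_intros continuous_intros)

lemma DERIV_neg_inverse_sqrt: "0 < \<sigma> \<Longrightarrow> ((\<lambda>\<sigma>. - (2 * c) / sqrt \<sigma>) has_real_derivative c / (\<sigma> * sqrt \<sigma>)) (at \<sigma>)"
  by (auto intro!: derivative_eq_intros simp: field_simps)

lemma DERIV_bound_interval:
  fixes k h :: "real \<Rightarrow> real"
  assumes "a \<le> b" "continuous_on {a..b} k" "continuous_on {a..b} h"
    and "\<And>x. a < x \<Longrightarrow> x < b \<Longrightarrow> (k has_real_derivative k' x) (at x)"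
    and "\<And>x. a < x \<Longrightarrow> x < b \<Longrightarrow> (h has_real_derivative h' x) (at x)"
    and "\<And>x. a < x \<Longrightarrow> x < b \<Longrightarrow> \<bar>k' x\<bar> \<le> h' x"
  shows "\<bar>k b - k a\<bar> \<le> h b - h a"
proof (cases "a = b")
  case False
  then have "norm (k b - k a) \<le> h b - h a"
    using assms by (intro differentiable_bound_general[where f'=k' and \<phi>'=h'])
      (auto simp: has_real_derivative_iff_has_vector_derivative)
  then show ?thesis by simp
qed simp

lemma average_cont:
  assumes u: "has_grad u u1" and \<phi>: "continuous_on cube \<phi>"
  shows "continuous_on S (\<lambda>\<sigma>. integral cube (\<lambda>q. \<phi> q * u (x + \<sigma> *\<^sub>R q)))"
  by (rule continuous_at_imp_continuous_on) (use average_affine_deriv[OF assms] DERIV_isCont in blast)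

text \<open>The derivative of the average in the scale \<sigma> is the average of q . grad u, at
  most 3B \<sigma>^(-3/2), with antiderivative -6B \<sigma>^(-1/2). The weight \<phi> makes room for
  the factors q_i that such a derivative creates.\<close>

lemma average_diff_le:
  assumes u: "has_grad u u1" and \<phi>: "continuous_on cube \<phi>" "\<And>q. q \<in> cube \<Longrightarrow> \<bar>\<phi> q\<bar> \<le> 1"
    and d: "0 < d" "d \<le> R" and B: "\<And>i. loc_bd x (2 * R) B (u1 i)" "0 < B"
  shows "\<bar>integral cube (\<lambda>q. \<phi> q * u (x + R *\<^sub>R q)) - integral cube (\<lambda>q. \<phi> q * u (x + d *\<^sub>R q))\<bar> \<le> 6 * B / sqrt d - 6 * B / sqrt R"
proof -
  have c: "continuous_on UNIV (u1 i)" for i using u by (rule has_grad_cont1)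
  have "\<bar>integral cube (\<lambda>q. \<phi> q * u (x + R *\<^sub>R q)) - integral cube (\<lambda>q. \<phi> q * u (x + d *\<^sub>R q))\<bar>
     \<le> - (2 * (3 * B)) / sqrt R - - (2 * (3 * B)) / sqrt d"
  proof (rule DERIV_bound_interval[OF d(2) average_cont[OF u \<phi>(1)] _ average_affine_deriv[OF u \<phi>(1)]])
    show "continuous_on {d..R} (\<lambda>\<sigma>. - (2 * (3 * B)) / sqrt \<sigma>)"
      using d by (intro continuous_intros) auto
    show "((\<lambda>\<sigma>. - (2 * (3 * B)) / sqrt \<sigma>) has_real_derivative (3 * B) / (\<sigma> * sqrt \<sigma>)) (at \<sigma>)" if "d < \<sigma>" for \<sigma>
      using that d by (intro DERIV_neg_inverse_sqrt) auto
    show "\<bar>integral cube (\<lambda>q. \<phi> q * (\<Sum>i\<in>UNIV. q $ i * u1 i (x + \<sigma> *\<^sub>R q)))\<bar> \<le> (3 * B) / (\<sigma> * sqrt \<sigma>)"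
      if "d < \<sigma>" "\<sigma> < R" for \<sigma>
    proof -
      have "integral cube (\<lambda>q. \<bar>u1 i (x + \<sigma> *\<^sub>R q)\<bar>) \<le> B / (\<sigma> * sqrt \<sigma>)" for i
        using that d B by (intro average_abs_le'[OF c, of _ _ "2 * R"]) auto
      then have "\<bar>integral cube (\<lambda>q. \<phi> q * (\<Sum>i\<in>UNIV. q $ i * u1 i (x + \<sigma> *\<^sub>R q)))\<bar> \<le> 3 * (B / (\<sigma> * sqrt \<sigma>))"
        by (intro sum_abs_bound \<phi> continuous_on_compose2[OF c] continuous_intros) (auto simp: cube_iff)
      then show ?thesis by simp
    qed
  qed
  then show ?thesis by simp
qed

text \<open>Comparison with the unit cube, where the average is at most B. One derivative in L2
  improves the trivial rate d^(-3/2) to d^(-1/2), which is integrable at d = 0.\<close>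

lemma weighted_average_le:
  assumes u: "has_grad u u1" and \<phi>: "continuous_on cube \<phi>" "\<And>q. q \<in> cube \<Longrightarrow> \<bar>\<phi> q\<bar> \<le> 1"
    and d: "0 < d" "d \<le> 1" and B: "loc_bd x 2 B u" "\<And>i. loc_bd x 2 B (u1 i)" "0 < B"
  shows "\<bar>integral cube (\<lambda>q. \<phi> q * u (x + d *\<^sub>R q))\<bar> \<le> 7 * B / sqrt d"
proof -
  have uc: "continuous_on UNIV u" using u by (rule has_grad_cont)
  have "\<bar>integral cube (\<lambda>q. \<phi> q * u (x + 1 *\<^sub>R q))\<bar> \<le> integral cube (\<lambda>q. \<bar>u (x + 1 *\<^sub>R q)\<bar>)"
  proof (rule integral_cube_abs_bound)
    show "\<bar>\<phi> q * u (x + 1 *\<^sub>R q)\<bar> \<le> \<bar>u (x + 1 *\<^sub>R q)\<bar>" if "q \<in> cube" for q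
      using mult_right_mono[OF \<phi>(2)[OF that], of "\<bar>u (x + q)\<bar>"] by (simp add: abs_mult)
  qed (intro continuous_intros \<phi> continuous_on_compose2[OF uc]; simp)+
  also have "\<dots> \<le> B / (1 * sqrt 1)"
    using B by (intro average_abs_le'[OF uc, of _ _ 2]) auto
  finally have 1: "\<bar>integral cube (\<lambda>q. \<phi> q * u (x + 1 *\<^sub>R q))\<bar> \<le> B" by simp
  have 2: "\<bar>integral cube (\<lambda>q. \<phi> q * u (x + 1 *\<^sub>R q)) - integral cube (\<lambda>q. \<phi> q * u (x + d *\<^sub>R q))\<bar> \<le> 6 * B / sqrt d - 6 * B / sqrt 1"
    using B d by (intro average_diff_le[OF u \<phi>]) auto
  have "B \<le> B / sqrt d" using B d by (simp add: field_simps)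
  then show ?thesis using 1 2 by (simp add: abs_le_iff)
qed

text \<open>The average is continuous in the scale and equals v x at scale 0; its derivative is at
  most 21 B \<sigma>^(-1/2), three coordinates with 7B each. Integration gives 42 B sqrt d.\<close>

lemma center_minus_average_le:
  assumes v: "has_grad v v1" "\<And>i. has_grad (v1 i) (v2 i)" and d: "0 < d" "d \<le> 1"
    and B: "\<And>i. loc_bd x 2 B (v1 i)" "\<And>i j. loc_bd x 2 B (v2 i j)" "0 < B"
  shows "\<bar>integral cube (\<lambda>q. v (x + d *\<^sub>R q)) - v x\<bar> \<le> 42 * B * sqrt d"
proof -
  let ?k = "\<lambda>\<sigma>. integral cube (\<lambda>q. 1 * v (x + \<sigma> *\<^sub>R q))"
  have "\<bar>?k d - ?k 0\<bar> \<le> 42 * B * sqrt d - 42 * B * sqrt 0"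
  proof (rule DERIV_bound_interval[OF _ average_cont[OF v(1) continuous_on_const] _ average_affine_deriv[OF v(1) continuous_on_const]])
    show "((\<lambda>\<sigma>. 42 * B * sqrt \<sigma>) has_real_derivative 21 * B / sqrt \<sigma>) (at \<sigma>)" if "0 < \<sigma>" for \<sigma>
      using that by (auto intro!: derivative_eq_intros simp: field_simps)
    show "\<bar>integral cube (\<lambda>q. 1 * (\<Sum>i\<in>UNIV. q $ i * v1 i (x + \<sigma> *\<^sub>R q)))\<bar> \<le> 21 * B / sqrt \<sigma>"
      if s: "0 < \<sigma>" "\<sigma> < d" for \<sigma>
    proof -
      have c: "continuous_on UNIV (v1 i)" for i using v(1) by (rule has_grad_cont1)
      have "integral cube (\<lambda>q. 1 * (\<Sum>i\<in>UNIV. q $ i * v1 i (x + \<sigma> *\<^sub>R q))) = (\<Sum>i\<in>UNIV. integral cube (\<lambda>q. q $ i * v1 i (x + \<sigma> *\<^sub>R q)))"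
        unfolding mult_1 by (intro integral_sum finite integrable_on_compact compact_cube continuous_intros continuous_on_compose2[OF c]) auto
      also have "\<bar>\<dots>\<bar> \<le> (\<Sum>i\<in>(UNIV::3 set). 7 * B / sqrt \<sigma>)"
        using s d B by (intro order_trans[OF sum_abs] sum_mono weighted_average_le[OF v(2)] continuous_intros) (auto simp: cube_iff)
      finally show ?thesis by simp
    qed
  qed (use d in \<open>auto intro!: continuous_intros\<close>)
  then show ?thesis by (simp add: integral_cube_const)
qed

text \<open>From the point to the unit cube costs 42B, from there to the cube of side R another 6B,
  and on the large cube v itself enters with R^(-3/2). The L2 norm of v is thus scaled down while
  the derivatives keep a fixed constant.\<close>

lemma sobolev_scaled:
  assumes v: "has_grad v v1" "\<And>i. has_grad (v1 i) (v2 i)" and R: "1 \<le> R"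
    and B: "\<And>i. loc_bd x (2 * R) B (v1 i)" "\<And>i j. loc_bd x (2 * R) B (v2 i j)" "0 < B"
    and V: "loc_bd x (2 * R) V v" "0 < V"
  shows "\<bar>v x\<bar> \<le> 48 * B + V / (R * sqrt R)"
proof -
  have c: "continuous_on UNIV v" "continuous_on UNIV (v1 i)" "continuous_on UNIV (v2 i j)" for i j
    using v by (auto intro: has_grad_cont has_grad_cont1)
  have B2: "loc_bd x 2 B (v1 i)" "loc_bd x 2 B (v2 i j)" for i j
    by (rule loc_bd_mono[OF B(1)], use R c in auto)[1] (rule loc_bd_mono[OF B(2)], use R c in auto)
  have 1: "\<bar>integral cube (\<lambda>q. v (x + 1 *\<^sub>R q)) - v x\<bar> \<le> 42 * B * sqrt 1"
    by (rule center_minus_average_le[OF v _ _ B2 B(3)]) auto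
  have 2: "\<bar>integral cube (\<lambda>q. 1 * v (x + R *\<^sub>R q)) - integral cube (\<lambda>q. 1 * v (x + 1 *\<^sub>R q))\<bar> \<le> 6 * B / sqrt 1 - 6 * B / sqrt R"
    by (rule average_diff_le[OF v(1) continuous_on_const _ _ R B(1) B(3)]) auto
  have "\<bar>integral cube (\<lambda>q. v (x + R *\<^sub>R q))\<bar> \<le> integral cube (\<lambda>q. \<bar>v (x + R *\<^sub>R q)\<bar>)"
    by (rule integral_cube_abs_bound) (auto intro!: continuous_intros continuous_on_compose2[OF c(1)])
  also have "\<dots> \<le> V / (R * sqrt R)"
    using R V by (intro average_abs_le'[OF c(1), of _ _ "2 * R"]) auto
  finally have 3: "\<bar>integral cube (\<lambda>q. v (x + R *\<^sub>R q))\<bar> \<le> V / (R * sqrt R)" .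
  have "0 \<le> 6 * B / sqrt R" using B R by simp
  then show ?thesis using 1 2 3 by simp
qed

text \<open>Each of the two points is compared with its average over a cube of side d, at the price
  42B; sliding one cube onto the other over a distance of at most d costs 21B. Hence 105.\<close>

lemma hoelder_half:
  assumes v: "has_grad v v1" "\<And>i. has_grad (v1 i) (v2 i)" and d: "norm (y - x) \<le> d" "0 < d" "d \<le> 1"
    and B: "\<And>i. loc_bd x 3 B (v1 i)" "\<And>i j. loc_bd x 3 B (v2 i j)" "0 < B"
  shows "\<bar>v y - v x\<bar> \<le> 105 * B * sqrt d"
proof -
  have c: "continuous_on UNIV v" "continuous_on UNIV (v1 i)" "continuous_on UNIV (v2 i j)" for i j
    using v by (auto intro: has_grad_cont has_grad_cont1)
  have sub: "cball z 2 \<subseteq> cball x 3" if "norm (z - x) \<le> 1" for z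
  proof
    fix w assume "w \<in> cball z 2"
    then show "w \<in> cball x 3" using that dist_triangle[of x w z] by (simp add: dist_norm norm_minus_commute)
  qed
  have B2: "loc_bd z 2 B (v1 i)" "loc_bd z 2 B (v2 i j)" if "norm (z - x) \<le> 1" for z i j
    by (rule loc_bd_mono[OF B(1) sub[OF that] c(2)], rule loc_bd_mono[OF B(2) sub[OF that] c(3)])
  have 1: "\<bar>integral cube (\<lambda>q. v (x + d *\<^sub>R q)) - v x\<bar> \<le> 42 * B * sqrt d"
    by (rule center_minus_average_le[OF v d(2,3) B2 B(3)]) auto
  have 2: "\<bar>integral cube (\<lambda>q. v (y + d *\<^sub>R q)) - v y\<bar> \<le> 42 * B * sqrt d"
    by (rule center_minus_average_le[OF v d(2,3) B2 B(3)]) (use d in auto)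
  let ?g = "\<lambda>\<tau> q. (x + \<tau> *\<^sub>R (y - x)) + d *\<^sub>R q"
  let ?k = "\<lambda>\<tau>. integral cube (\<lambda>q. 1 * v (?g \<tau> q))"
  have kd: "(?k has_real_derivative integral cube (\<lambda>q. 1 * (\<Sum>i\<in>UNIV. (y - x) $ i * v1 i (?g \<tau> q)))) (at \<tau>)" for \<tau>
    by (rule average_deriv[OF v(1) open_UNIV convex_UNIV UNIV_I, where \<gamma>="?g" and \<gamma>'="\<lambda>\<tau> q. y - x"])
      (auto simp: split_beta intro!: derivative_eq_intros continuous_intros)
  have "\<bar>?k 1 - ?k 0\<bar> \<le> 21 * B * sqrt d * 1 - 21 * B * sqrt d * 0"
  proof (rule DERIV_bound_interval[OF zero_le_one _ _ kd])
    show "continuous_on {0..1} ?k"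
      by (rule continuous_at_imp_continuous_on) (use kd DERIV_isCont in blast)
    show "((\<lambda>\<tau>. 21 * B * sqrt d * \<tau>) has_real_derivative 21 * B * sqrt d) (at \<tau>)" for \<tau>
      by (auto intro!: derivative_eq_intros)
    show "\<bar>integral cube (\<lambda>q. 1 * (\<Sum>i\<in>UNIV. (y - x) $ i * v1 i (?g \<tau> q)))\<bar> \<le> 21 * B * sqrt d"
      if t: "0 < \<tau>" "\<tau> < 1" for \<tau>
    proof -
      define z where "z = x + \<tau> *\<^sub>R (y - x)"
      have "\<tau> * norm (y - x) \<le> 1 * 1" using t d by (intro mult_mono) auto
      then have z: "norm (z - x) \<le> 1" using t by (simp add: z_def)
      have "integral cube (\<lambda>q. 1 * (\<Sum>i\<in>UNIV. (y - x) $ i * v1 i (z + d *\<^sub>R q))) = (\<Sum>i\<in>UNIV. (y - x) $ i * integral cube (\<lambda>q. 1 * v1 i (z + d *\<^sub>R q)))"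
        unfolding mult_1 by (subst integral_sum) (auto intro!: integrable_on_compact compact_cube continuous_intros continuous_on_compose2[OF c(2)])
      also have "\<bar>\<dots>\<bar> \<le> (\<Sum>i\<in>(UNIV::3 set). d * (7 * B / sqrt d))"
      proof (intro order_trans[OF sum_abs] sum_mono)
        fix i :: 3
        have "\<bar>integral cube (\<lambda>q. 1 * v1 i (z + d *\<^sub>R q))\<bar> \<le> 7 * B / sqrt d"
          by (rule weighted_average_le[OF v(2) continuous_on_const _ d(2,3) B2(1)[OF z] B2(2)[OF z] B(3)]) simp
        moreover have "\<bar>(y - x) $ i\<bar> \<le> d" using component_le_norm_cart[of "y - x" i] d by linarith
        ultimately show "\<bar>(y - x) $ i * integral cube (\<lambda>q. 1 * v1 i (z + d *\<^sub>R q))\<bar> \<le> d * (7 * B / sqrt d)"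
          unfolding abs_mult[of "(y - x) $ i"] using d by (intro mult_mono) auto
      qed
      also have "\<dots> = 21 * B * (d / sqrt d)" by simp
      also have "d / sqrt d = sqrt d" using d by (simp add: real_div_sqrt)
      finally show ?thesis by (simp add: z_def)
    qed
  qed (auto intro!: continuous_intros)
  then have 3: "\<bar>integral cube (\<lambda>q. v (y + d *\<^sub>R q)) - integral cube (\<lambda>q. v (x + d *\<^sub>R q))\<bar> \<le> 21 * B * sqrt d" by simp
  show ?thesis using 1 2 3 by linarith
qed

section \<open>Sphere charts\<close>

lemma has_derivative_vec_lambda:
  fixes f :: "'a::real_normed_vector \<Rightarrow> 3 \<Rightarrow> real"
  assumes "\<And>a. ((\<lambda>z. f z a) has_derivative (\<lambda>h. f' h a)) (at z)"
  shows "((\<lambda>z. \<chi> a. f z a) has_derivative (\<lambda>h. \<chi> a. f' h a)) (at z)"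
  by (subst has_derivative_componentwise_within) (auto simp: Basis_vec_def inner_axis assms)

text \<open>Up to reordering the matrix is triangular: every row but the i-th has only its diagonal
  entry.\<close>

lemma det_diag_row:
  fixes A :: "real^3^3"
  assumes "\<And>r c. r \<noteq> i \<Longrightarrow> r \<noteq> c \<Longrightarrow> A $ r $ c = 0"
  shows "det A = A $ 1 $ 1 * A $ 2 $ 2 * A $ 3 $ 3"
  using exhaust_3[of i] assms by (auto simp: det_3)

lemma omega_sq_le_tang: "(x $ a * g b - x $ b * g a)\<^sup>2 \<le> tang x g"
proof -
  have "(x $ a * g b - x $ b * g a)\<^sup>2 = (x $ b * g a - x $ a * g b)\<^sup>2" by (simp add: power2_commute)
  with exhaust_3[of a] exhaust_3[of b] show ?thesis
    unfolding tang_lagrange by auto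
qed

lemma sum_split_coord: "(\<Sum>a\<in>UNIV. f a) = f i + (\<Sum>a\<in>UNIV - {i}. f a)" for f :: "3 \<Rightarrow> real"
  by (simp add: sum.remove[of UNIV i])

lemma sum_minus_coord_le:
  fixes f :: "3 \<Rightarrow> real"
  assumes "\<And>a. \<bar>f a\<bar> \<le> c"
  shows "\<bar>\<Sum>a\<in>UNIV - {i}. f a\<bar> \<le> 2 * c"
proof -
  have "\<bar>\<Sum>a\<in>UNIV - {i}. f a\<bar> \<le> (\<Sum>a\<in>UNIV - {i}. c)"
    by (rule order_trans[OF sum_abs]) (intro sum_mono assms)
  also have "\<dots> = 2 * c" by (simp add: card_Diff_singleton)
  finally show ?thesis .
qed

text \<open>Around \<open>x\<^sub>0\<close> the sphere is a graph over the two coordinates other than the largest one; averaging over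
  \<open>\<epsilon> \<times> d \<times> d\<close> boxes in the coordinates (radius, other two) only sees angular derivatives as \<open>d\<close> varies. Each dyadic
  scale of \<open>d\<close> costs the same amount, whence the logarithm.\<close>

locale graph_chart =
  fixes x0 :: "real^3" and r0 \<epsilon> :: real and i :: 3
  assumes r0: "norm x0 = r0" and \<epsilon>: "0 < \<epsilon>" "160 * \<epsilon> \<le> r0" and i: "r0\<^sup>2 \<le> 3 * (x0 $ i)\<^sup>2"
begin

text \<open>q_i selects the radius \<open>rho\<close> between r0 + \<epsilon> and r0 + 2\<epsilon>,
  the middle of the shell where its weight is bounded below; d times the other two coordinates of q
  moves the point along the sphere. \<open>ee\<close> is the square of the i-th coordinate there,
  \<open>chart_d\<close> the derivative of the chart in d, and \<open>chart_q\<close> that in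
  q.\<close>

definition "sg = sgn (x0 $ i)"
definition "rho q = r0 + \<epsilon> + \<epsilon> * (q :: real^3) $ i"
definition "pc d q a = x0 $ a + d * (q :: real^3) $ a"
definition "ee d q = (rho q)\<^sup>2 - (\<Sum>a\<in>UNIV - {i}. (pc d q a)\<^sup>2)"
definition chart :: "real \<Rightarrow> real^3 \<Rightarrow> real^3" where
  "chart d q = (\<chi> a. if a = i then sg * sqrt (ee d q) else pc d q a)"
definition chart_d :: "real \<Rightarrow> real^3 \<Rightarrow> real^3" where
  "chart_d d q = (\<chi> a. if a = i then - sg * (\<Sum>b\<in>UNIV - {i}. pc d q b * q $ b) / sqrt (ee d q) else q $ a)"

lemma r0_pos: "0 < r0" using \<epsilon> by linarith

lemma sg: "sg * sg = 1" "\<bar>sg\<bar> = 1" "sg * \<bar>x0 $ i\<bar> = x0 $ i"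
  using i r0_pos by (auto simp: sg_def sgn_if)

lemma x0_sq: "(x0 $ i)\<^sup>2 + (\<Sum>a\<in>UNIV - {i}. (x0 $ a)\<^sup>2) = r0\<^sup>2"
proof -
  have "r0\<^sup>2 = (\<Sum>a\<in>UNIV. (x0 $ a)\<^sup>2)"
    unfolding r0[symmetric] power2_norm_eq_inner by (simp add: inner_vec_def power2_eq_square)
  then show ?thesis using sum_split_coord[of "\<lambda>a. (x0 $ a)\<^sup>2" i] by simp
qed

lemma pc_sq_diff:
  assumes "0 \<le> d" "q \<in> cube"
  shows "\<bar>(\<Sum>a\<in>UNIV - {i}. (pc d q a)\<^sup>2) - (\<Sum>a\<in>UNIV - {i}. (x0 $ a)\<^sup>2)\<bar> \<le> 2 * (2 * d * r0 + d\<^sup>2)"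
  unfolding sum_subtractf[symmetric]
proof (rule sum_minus_coord_le)
  fix a
  have q: "0 \<le> q $ a" "q $ a \<le> 1" using assms by (auto simp: cube_iff)
  have x: "\<bar>x0 $ a\<bar> \<le> r0" using component_le_norm_cart[of x0 a] r0 by simp
  have "(pc d q a)\<^sup>2 - (x0 $ a)\<^sup>2 = 2 * d * (q $ a * x0 $ a) + d\<^sup>2 * (q $ a)\<^sup>2"
    by (simp add: pc_def power2_eq_square algebra_simps)
  moreover have "\<bar>q $ a * x0 $ a\<bar> \<le> 1 * r0" unfolding abs_mult using q x by (intro mult_mono) auto
  then have "\<bar>2 * d * (q $ a * x0 $ a)\<bar> \<le> 2 * d * r0" using assms by (simp add: abs_mult mult_left_mono)
  moreover have "(q $ a)\<^sup>2 \<le> 1" using q by (simp add: power_le_one)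
  then have "\<bar>d\<^sup>2 * (q $ a)\<^sup>2\<bar> \<le> d\<^sup>2" using mult_left_mono[of "(q $ a)\<^sup>2" 1 "d\<^sup>2"] by (simp add: abs_mult)
  ultimately show "\<bar>(pc d q a)\<^sup>2 - (x0 $ a)\<^sup>2\<bar> \<le> 2 * d * r0 + d\<^sup>2" by linarith
qed

lemma rho_bounds: "q \<in> cube \<Longrightarrow> r0 + \<epsilon> \<le> rho q" "q \<in> cube \<Longrightarrow> rho q \<le> r0 + 2 * \<epsilon>"
  using \<epsilon> by (auto simp: rho_def cube_iff)

text \<open>The choice of i leaves at least r0^2/3 for the i-th coordinate, and moving the other two
  by d <= r0/19 costs at most 4/19 + 2/361 of r0^2. The limit r0/19 lies beyond the largest scale
  r0/20 used later, so that all scales in use are interior points.\<close>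

lemma ee_lower:
  assumes d: "0 \<le> d" "d \<le> r0 / 19" "q \<in> cube"
  shows "r0\<^sup>2 / 10 \<le> ee d q"
proof -
  have "(\<Sum>a\<in>UNIV - {i}. (x0 $ a)\<^sup>2) \<le> 2 / 3 * r0\<^sup>2" using x0_sq i by linarith
  moreover have "d * r0 \<le> r0\<^sup>2 / 19" using mult_right_mono[OF d(2), of r0] r0_pos by (simp add: power2_eq_square)
  moreover have "d\<^sup>2 \<le> r0\<^sup>2 / 361" using power_mono[OF d(2,1), of 2] by (simp add: power_divide)
  moreover have "r0\<^sup>2 \<le> (rho q)\<^sup>2" using rho_bounds[OF d(3)] r0_pos \<epsilon> by (intro power_mono) auto
  moreover have "2 * (2 * d * r0 + d\<^sup>2) = 4 * (d * r0) + 2 * d\<^sup>2" by simp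
  moreover have "0 \<le> r0\<^sup>2" by simp
  ultimately show ?thesis using pc_sq_diff[OF d(1,3)] unfolding ee_def abs_le_iff by linarith
qed

lemma ee_pos: "0 \<le> d \<Longrightarrow> d \<le> r0 / 19 \<Longrightarrow> q \<in> cube \<Longrightarrow> 0 < ee d q"
  using ee_lower[of d q] r0_pos zero_less_power[of r0 2] by linarith

lemma sqrt_ee_lower: "0 \<le> d \<Longrightarrow> d \<le> r0 / 19 \<Longrightarrow> q \<in> cube \<Longrightarrow> 2 * r0 / 7 \<le> sqrt (ee d q)"
proof -
  assume "0 \<le> d" "d \<le> r0 / 19" "q \<in> cube"
  then have "r0\<^sup>2 / 10 \<le> ee d q" by (rule ee_lower)
  moreover have "(2 * r0 / 7)\<^sup>2 = 4 / 49 * r0\<^sup>2" by (simp add: power_divide power_mult_distrib)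
  ultimately have "(2 * r0 / 7)\<^sup>2 \<le> ee d q" using zero_le_power2[of r0] by linarith
  then show ?thesis by (rule real_le_rsqrt)
qed

lemma chart_norm:
  assumes "0 \<le> d" "d \<le> r0 / 19" "q \<in> cube"
  shows "norm (chart d q) = rho q"
proof -
  have "chart d q \<bullet> chart d q = (sg * sqrt (ee d q))\<^sup>2 + (\<Sum>a\<in>UNIV - {i}. (pc d q a)\<^sup>2)"
    unfolding inner_vec_def inner_real_def by (subst sum_split_coord[of _ i]) (simp add: chart_def power2_eq_square)
  also have "(sg * sqrt (ee d q))\<^sup>2 = ee d q"
  proof -
    have "(sg * sqrt (ee d q))\<^sup>2 = (sg * sg) * (sqrt (ee d q))\<^sup>2" by (simp add: power2_eq_square mult_ac)
    then show ?thesis using ee_pos[OF assms] sg(1) by simp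
  qed
  finally have "(norm (chart d q))\<^sup>2 = (rho q)\<^sup>2" by (simp add: ee_def power2_norm_eq_inner)
  moreover have "0 \<le> rho q" using rho_bounds[OF assms(3)] r0_pos \<epsilon> by linarith
  ultimately show ?thesis by (rule power2_eq_imp_eq[OF _ norm_ge_zero])
qed

lemma ee_deriv_d:
  "((\<lambda>d. ee d q) has_real_derivative - (\<Sum>b\<in>UNIV - {i}. 2 * pc d q b * q $ b)) (at d)"
  unfolding ee_def pc_def by (auto intro!: derivative_eq_intros simp: sum_negf[symmetric] algebra_simps)

lemma chart_deriv_d:
  assumes "0 \<le> d" "d \<le> r0 / 19" "q \<in> cube"
  shows "((\<lambda>d. chart d q) has_vector_derivative chart_d d q) (at d)"
proof -
  have "((\<lambda>d. \<chi> a. if a = i then sg * sqrt (ee d q) else pc d q a) has_derivative (\<lambda>h. \<chi> a. h * (chart_d d q $ a))) (at d)"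
  proof (rule has_derivative_vec_lambda)
    fix a
    show "((\<lambda>d. if a = i then sg * sqrt (ee d q) else pc d q a) has_derivative (\<lambda>h. h * (chart_d d q $ a))) (at d)"
    proof (cases "a = i")
      case True
      have "((\<lambda>d. sg * sqrt (ee d q)) has_real_derivative chart_d d q $ i) (at d)"
      proof -
        have eq: "chart_d d q $ i = sg * (inverse (sqrt (ee d q)) / 2 * - (\<Sum>b\<in>UNIV - {i}. 2 * pc d q b * q $ b))"
        proof -
          have "(\<Sum>b\<in>UNIV - {i}. 2 * pc d q b * q $ b) = 2 * (\<Sum>b\<in>UNIV - {i}. pc d q b * q $ b)"
            unfolding sum_distrib_left by (intro sum.cong) auto
          then show ?thesis by (simp add: chart_d_def inverse_eq_divide)
        qed
        show ?thesis unfolding eq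
          by (rule DERIV_cmult[OF DERIV_chain2[where f=sqrt and g="\<lambda>d. ee d q" and x=d and s=UNIV,
                OF DERIV_real_sqrt[OF ee_pos[OF assms]] ee_deriv_d]])
      qed
      then show ?thesis using True by (simp add: has_field_derivative_def mult_commute_abs)
    next
      case False
      have "((\<lambda>d. pc d q a) has_real_derivative q $ a) (at d)"
        unfolding pc_def by (auto intro!: derivative_eq_intros)
      then show ?thesis using False by (simp add: has_field_derivative_def chart_d_def mult_commute_abs)
    qed
  qed
  moreover have "(\<lambda>h. \<chi> a. h * (chart_d d q $ a)) = (\<lambda>h. h *\<^sub>R chart_d d q)"
    by (auto simp: vec_eq_iff)
  ultimately show ?thesis
    by (simp add: has_vector_derivative_def chart_def[abs_def])
qed

lemma chart_cont:
  "continuous_on ({0<..<r0/19} \<times> cube) (\<lambda>(d, q). chart d q)"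
  "continuous_on ({0<..<r0/19} \<times> cube) (\<lambda>(d, q). chart_d d q)"
proof -
  have pc: "continuous_on S (\<lambda>z. pc (fst z) (snd z) a)" for a and S :: "(real \<times> (real^3)) set"
    unfolding pc_def by (intro continuous_intros)
  have ee: "continuous_on S (\<lambda>z. ee (fst z) (snd z))" for S :: "(real \<times> (real^3)) set"
    unfolding ee_def rho_def by (intro continuous_intros pc)
  have nz: "\<forall>z\<in>{0<..<r0/19} \<times> cube. sqrt (ee (fst z) (snd z)) \<noteq> 0"
  proof
    fix z :: "real \<times> (real^3)" assume "z \<in> {0<..<r0/19} \<times> cube"
    then have "0 < ee (fst z) (snd z)" by (intro ee_pos) auto
    then show "sqrt (ee (fst z) (snd z)) \<noteq> 0" by simp
  qed
  have "continuous_on ({0<..<r0/19} \<times> cube) (\<lambda>z. if a = i then sg * sqrt (ee (fst z) (snd z)) else pc (fst z) (snd z) a)" for a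
    by (cases "a = i") (auto intro!: continuous_intros ee pc)
  then show "continuous_on ({0<..<r0/19} \<times> cube) (\<lambda>(d, q). chart d q)"
    unfolding split_beta chart_def by (rule continuous_on_vec_lambda)
  have "continuous_on ({0<..<r0/19} \<times> cube) (\<lambda>z. if a = i then - sg * (\<Sum>b\<in>UNIV - {i}. pc (fst z) (snd z) b * snd z $ b) / sqrt (ee (fst z) (snd z)) else snd z $ a)" for a
    by (cases "a = i") (auto intro!: continuous_intros ee pc nz[rule_format])
  then show "continuous_on ({0<..<r0/19} \<times> cube) (\<lambda>(d, q). chart_d d q)"
    unfolding split_beta chart_d_def by (rule continuous_on_vec_lambda)
qed

definition chart_q :: "real \<Rightarrow> real^3 \<Rightarrow> real^3 \<Rightarrow> real^3" where
  "chart_q d q h = (\<chi> a. if a = i then sg * ((2 * rho q * (\<epsilon> * h $ i) - (\<Sum>b\<in>UNIV - {i}. 2 * pc d q b * (d * h $ b))) / (2 * sqrt (ee d q)))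
     else d * h $ a)"

lemma chart_deriv_q:
  assumes "0 \<le> d" "d \<le> r0 / 19" "q \<in> cube"
  shows "(chart d has_derivative chart_q d q) (at q)"
proof -
  have comp: "((\<lambda>q. q $ a) has_derivative (\<lambda>h. h $ a)) (at q)" for a and q :: "real^3"
    by (rule bounded_linear_imp_has_derivative[OF bounded_linear_vec_nth])
  have pcd: "((\<lambda>q. pc d q a) has_derivative (\<lambda>h. d * h $ a)) (at q)" for a
    unfolding pc_def by (auto intro!: derivative_eq_intros comp)
  have rhod: "(rho has_derivative (\<lambda>h. \<epsilon> * h $ i)) (at q)"
    unfolding rho_def by (auto intro!: derivative_eq_intros comp)
  have eed: "((\<lambda>q. ee d q) has_derivative (\<lambda>h. 2 * rho q * (\<epsilon> * h $ i) - (\<Sum>b\<in>UNIV - {i}. 2 * pc d q b * (d * h $ b)))) (at q)"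
    unfolding ee_def by (auto intro!: derivative_eq_intros pcd rhod simp: mult_ac)
  have "((\<lambda>q. \<chi> a. if a = i then sg * sqrt (ee d q) else pc d q a) has_derivative (\<lambda>h. \<chi> a. if a = i then sg * ((2 * rho q * (\<epsilon> * h $ i) - (\<Sum>b\<in>UNIV - {i}. 2 * pc d q b * (d * h $ b))) / (2 * sqrt (ee d q)))
     else d * h $ a)) (at q)"
  proof (rule has_derivative_vec_lambda)
    fix a
    have "((\<lambda>q. sg * sqrt (ee d q)) has_derivative (\<lambda>h. sg * ((2 * rho q * (\<epsilon> * h $ i) - (\<Sum>b\<in>UNIV - {i}. 2 * pc d q b * (d * h $ b))) / (2 * sqrt (ee d q))))) (at q)"
    proof -
      have "(sqrt has_derivative (*) (inverse (sqrt (ee d q)) / 2)) (at (ee d q))"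
        using DERIV_real_sqrt[OF ee_pos[OF assms]] by (simp add: has_field_derivative_def)
      from has_derivative_mult_right[OF has_derivative_compose[OF eed this], of sg]
      have *: "((\<lambda>q. sg * sqrt (ee d q)) has_derivative (\<lambda>h. sg * (inverse (sqrt (ee d q)) / 2 * (2 * rho q * (\<epsilon> * h $ i) - (\<Sum>b\<in>UNIV - {i}. 2 * pc d q b * (d * h $ b)))))) (at q)" .
      have "inverse s / 2 * X = X / (2 * s)" for s X :: real by (simp add: inverse_eq_divide)
      then show ?thesis using * by (simp only:)
    qed
    with pcd[of a] show "((\<lambda>q. if a = i then sg * sqrt (ee d q) else pc d q a) has_derivative (\<lambda>h. if a = i then sg * ((2 * rho q * (\<epsilon> * h $ i) - (\<Sum>b\<in>UNIV - {i}. 2 * pc d q b * (d * h $ b))) / (2 * sqrt (ee d q)))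
     else d * h $ a)) (at q)"
      by (cases "a = i") (simp_all only: if_True if_False simp_thms)
  qed
  then show ?thesis unfolding chart_def[abs_def] chart_q_def[abs_def] .
qed

text \<open>The i-th diagonal entry is, up to sign, rho \<epsilon> / sqrt ee, and sqrt ee is a
  coordinate of a point at distance rho, hence at most rho. The other two entries are d.\<close>

lemma chart_det:
  assumes "0 < d" "d \<le> r0 / 19" "q \<in> cube"
  shows "\<epsilon> * d\<^sup>2 \<le> \<bar>det (matrix (chart_q d q))\<bar>"
proof -
  let ?A = "matrix (chart_q d q)"
  have ii: "?A $ i $ i = sg * (rho q * \<epsilon> / sqrt (ee d q))"
    by (simp add: matrix_def chart_q_def axis_def)
  have rr: "?A $ r $ r = d" if "r \<noteq> i" for r
    using that by (simp add: matrix_def chart_q_def axis_def)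
  have "det ?A = ?A $ 1 $ 1 * ?A $ 2 $ 2 * ?A $ 3 $ 3"
    by (rule det_diag_row[of i]) (simp add: matrix_def chart_q_def axis_def)
  also have "\<dots> = (sg * (rho q * \<epsilon> / sqrt (ee d q))) * d\<^sup>2"
    using exhaust_3[of i] ii rr[of 1] rr[of 2] rr[of 3] by (auto simp: power2_eq_square)
  finally have det: "\<bar>det ?A\<bar> = \<bar>rho q * \<epsilon> / sqrt (ee d q)\<bar> * d\<^sup>2"
    using sg by (simp add: abs_mult)
  have rho: "0 < rho q" using rho_bounds[OF assms(3)] r0_pos \<epsilon> by linarith
  have "ee d q \<le> (rho q)\<^sup>2" unfolding ee_def by (simp add: sum_nonneg)
  then have "sqrt (ee d q) \<le> rho q" using rho by (simp add: real_le_lsqrt)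
  moreover have "0 < sqrt (ee d q)" using ee_pos[of d q] assms by simp
  ultimately have "\<epsilon> \<le> rho q * \<epsilon> / sqrt (ee d q)" using \<epsilon> by (simp add: field_simps)
  then have "\<epsilon> \<le> \<bar>rho q * \<epsilon> / sqrt (ee d q)\<bar>" using abs_ge_self order_trans by blast
  then show ?thesis unfolding det by (rule mult_right_mono) simp
qed

lemma chart_inj:
  assumes "0 < d" "d \<le> r0 / 19"
  shows "inj_on (chart d) cube"
proof (rule inj_onI)
  fix q q' assume q: "q \<in> cube" "q' \<in> cube" and eq: "chart d q = chart d q'"
  have "rho q = rho q'" using chart_norm[of d q] chart_norm[of d q'] assms q eq by simp
  then have "q $ i = q' $ i" using \<epsilon> by (simp add: rho_def)
  moreover have "q $ a = q' $ a" if "a \<noteq> i" for a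
    using arg_cong[OF eq, of "\<lambda>v. v $ a"] that assms by (simp add: chart_def pc_def)
  ultimately show "q = q'" by (metis vec_eq_iff)
qed

text \<open>A box of volume at least \<epsilon> d^2 is set against a shell integral of order
  \<epsilon>: the thickness cancels and a two-dimensional average is left.\<close>

lemma chart_average_le:
  assumes d: "0 < d" "d \<le> r0 / 19" and F: "continuous_on UNIV F" "\<And>x. 0 \<le> F x"
    and K: "\<And>S. compact S \<Longrightarrow> S \<subseteq> {x. r0 + \<epsilon> \<le> norm x \<and> norm x \<le> r0 + 2 * \<epsilon>} \<Longrightarrow> integral S F \<le> \<epsilon> * K\<^sup>2"
  shows "integral cube (\<lambda>q. F (chart d q)) \<le> (K / d)\<^sup>2"
proof -
  note cv = change_of_variables_le[OF chart_deriv_q chart_inj[OF d] chart_det F]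
  have "\<epsilon> * d\<^sup>2 * integral cube (\<lambda>q. F (chart d q)) \<le> integral (chart d ` cube) F"
    by (rule cv(1)) (use d in auto)
  also have "\<dots> \<le> \<epsilon> * K\<^sup>2"
  proof (rule K)
    show "compact (chart d ` cube)" by (rule cv(2)) (use d in auto)
    show "chart d ` cube \<subseteq> {x. r0 + \<epsilon> \<le> norm x \<and> norm x \<le> r0 + 2 * \<epsilon>}"
      using chart_norm[of d] d rho_bounds by auto
  qed
  finally show ?thesis using \<epsilon> d by (simp add: field_simps power_divide)
qed

text \<open>The square of the i-th coordinate moves by at most 8 \<epsilon> r0 + 6 \<epsilon>^2 <= 9
  \<epsilon> r0. Division by r0/2, a lower bound for the i-th coordinate of x0, gives 18 \<epsilon>;
  the other two coordinates add \<epsilon> each.\<close>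

lemma chart_near:
  assumes "q \<in> cube"
  shows "norm (chart \<epsilon> q - x0) \<le> 20 * \<epsilon>"
proof -
  have e: "0 \<le> \<epsilon>" "\<epsilon> \<le> r0 / 19" using \<epsilon> by auto
  have other: "\<bar>(chart \<epsilon> q - x0) $ a\<bar> \<le> \<epsilon>" if "a \<noteq> i" for a
    using that assms \<epsilon> by (simp add: chart_def pc_def cube_iff abs_mult mult_left_le)
  have "(chart \<epsilon> q - x0) $ i = sg * (sqrt (ee \<epsilon> q) - \<bar>x0 $ i\<bar>)"
    using sg by (simp add: chart_def right_diff_distrib)
  then have ci: "\<bar>(chart \<epsilon> q - x0) $ i\<bar> = \<bar>sqrt (ee \<epsilon> q) - \<bar>x0 $ i\<bar>\<bar>" using sg by (simp add: abs_mult)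
  have "(r0 / 2)\<^sup>2 = r0\<^sup>2 / 4" by (simp add: power_divide)
  then have "(r0 / 2)\<^sup>2 \<le> (x0 $ i)\<^sup>2" using i zero_le_power2[of "x0 $ i"] by linarith
  then have xi: "r0 / 2 \<le> \<bar>x0 $ i\<bar>" using abs_le_square_iff[of "r0/2" "x0 $ i"] r0_pos by simp
  have ee0: "0 \<le> ee \<epsilon> q" using ee_pos[OF e assms] by simp
  have "\<bar>ee \<epsilon> q - (x0 $ i)\<^sup>2\<bar> \<le> 9 * \<epsilon> * r0"
  proof -
    have "(r0 + \<epsilon>)\<^sup>2 \<le> (rho q)\<^sup>2" "(rho q)\<^sup>2 \<le> (r0 + 2 * \<epsilon>)\<^sup>2"
      using rho_bounds[OF assms] r0_pos \<epsilon> by (auto intro!: power_mono)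
    moreover have "(r0 + \<epsilon>)\<^sup>2 = r0\<^sup>2 + 2 * (\<epsilon> * r0) + \<epsilon>\<^sup>2" "(r0 + 2 * \<epsilon>)\<^sup>2 = r0\<^sup>2 + 4 * (\<epsilon> * r0) + 4 * \<epsilon>\<^sup>2"
      by (simp_all add: power2_eq_square algebra_simps)
    moreover have "0 \<le> \<epsilon> * r0" "0 \<le> \<epsilon>\<^sup>2" using \<epsilon> r0_pos by auto
    ultimately have "0 \<le> (rho q)\<^sup>2 - r0\<^sup>2" "(rho q)\<^sup>2 - r0\<^sup>2 \<le> 4 * (\<epsilon> * r0) + 4 * \<epsilon>\<^sup>2"
      by linarith+
    moreover have "160 * \<epsilon>\<^sup>2 \<le> \<epsilon> * r0" using mult_left_mono[OF \<epsilon>(2), of \<epsilon>] \<epsilon> by (simp add: power2_eq_square)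
    moreover have "2 * (2 * \<epsilon> * r0 + \<epsilon>\<^sup>2) = 4 * (\<epsilon> * r0) + 2 * \<epsilon>\<^sup>2" by simp
    moreover have "9 * \<epsilon> * r0 = 9 * (\<epsilon> * r0)" by simp
    moreover have "0 \<le> \<epsilon>\<^sup>2" by simp
    ultimately show ?thesis
      using pc_sq_diff[OF e(1) assms] x0_sq unfolding ee_def by (auto simp: abs_le_iff)
  qed
  also have "ee \<epsilon> q - (x0 $ i)\<^sup>2 = (sqrt (ee \<epsilon> q) - \<bar>x0 $ i\<bar>) * (sqrt (ee \<epsilon> q) + \<bar>x0 $ i\<bar>)"
    using ee0 by (simp add: algebra_simps power2_eq_square)
  finally have "\<bar>sqrt (ee \<epsilon> q) - \<bar>x0 $ i\<bar>\<bar> * (sqrt (ee \<epsilon> q) + \<bar>x0 $ i\<bar>) \<le> 9 * \<epsilon> * r0"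
    using ee0 by (simp add: abs_mult)
  moreover have "\<bar>sqrt (ee \<epsilon> q) - \<bar>x0 $ i\<bar>\<bar> * (r0 / 2) \<le> \<bar>sqrt (ee \<epsilon> q) - \<bar>x0 $ i\<bar>\<bar> * (sqrt (ee \<epsilon> q) + \<bar>x0 $ i\<bar>)"
    using xi ee0 by (intro mult_left_mono add_increasing) auto
  ultimately have "\<bar>sqrt (ee \<epsilon> q) - \<bar>x0 $ i\<bar>\<bar> * r0 \<le> (18 * \<epsilon>) * r0" by simp
  then have ci2: "\<bar>(chart \<epsilon> q - x0) $ i\<bar> \<le> 18 * \<epsilon>" unfolding ci using r0_pos by simp
  have "norm (chart \<epsilon> q - x0) \<le> (\<Sum>a\<in>UNIV. \<bar>(chart \<epsilon> q - x0) $ a\<bar>)" by (rule norm_le_l1_cart)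
  also have "\<dots> = \<bar>(chart \<epsilon> q - x0) $ i\<bar> + (\<Sum>a\<in>UNIV - {i}. \<bar>(chart \<epsilon> q - x0) $ a\<bar>)" by (rule sum_split_coord)
  also have "\<dots> \<le> 18 * \<epsilon> + (\<Sum>a\<in>UNIV - {i}. \<epsilon>)" using ci2 other by (intro add_mono sum_mono) auto
  also have "\<dots> = 20 * \<epsilon>" by (simp add: card_Diff_singleton)
  finally show ?thesis .
qed

text \<open>The derivative of the chart in d is tangent to the sphere, hence a combination of the
  two rotation fields x_i e_a - x_a e_i with a different from i, with coefficients q_a / sqrt ee up
  to sign. The constant is 2 / sqrt ee <= 7 / r0.\<close>

lemma chart_deriv_le_tang:
  assumes "0 < d" "d \<le> r0 / 19" "q \<in> cube"
  shows "\<bar>\<Sum>a\<in>UNIV. chart_d d q $ a * g a\<bar> \<le> 7 / r0 * sqrt (tang (chart d q) g)"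
proof -
  let ?e = "sqrt (ee d q)" and ?x = "chart d q"
  have e: "0 < ?e" using ee_pos[of d q] assms by simp
  have "(\<Sum>a\<in>UNIV. chart_d d q $ a * g a) = (\<Sum>a\<in>UNIV - {i}. q $ a * g a) - sg * (\<Sum>b\<in>UNIV - {i}. pc d q b * q $ b) / ?e * g i"
    by (subst sum_split_coord[of _ i]) (simp add: chart_d_def)
  also have "\<dots> = (\<Sum>a\<in>UNIV - {i}. q $ a * (sg / ?e * (?x $ i * g a - ?x $ a * g i)))"
  proof -
    have "q $ a * (sg / ?e * (?x $ i * g a - ?x $ a * g i)) = q $ a * g a - sg * (pc d q a * q $ a) / ?e * g i" if "a \<noteq> i" for a
    proof -
      have "sg / ?e * (?x $ i * g a) = (sg * sg) * g a" using e by (simp add: chart_def)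
      moreover have "?x $ a = pc d q a" using that by (simp add: chart_def)
      ultimately show ?thesis using sg by (simp add: right_diff_distrib mult_ac)
    qed
    then have "(\<Sum>a\<in>UNIV - {i}. q $ a * (sg / ?e * (?x $ i * g a - ?x $ a * g i))) = (\<Sum>a\<in>UNIV - {i}. q $ a * g a - sg * (pc d q a * q $ a) / ?e * g i)"
      by (intro sum.cong) auto
    then show ?thesis by (simp add: sum_subtractf sum_distrib_left sum_distrib_right sum_divide_distrib)
  qed
  also have "\<bar>\<dots>\<bar> \<le> 2 * (1 / ?e * sqrt (tang ?x g))"
  proof (rule sum_minus_coord_le)
    fix a
    have "\<bar>?x $ i * g a - ?x $ a * g i\<bar> \<le> sqrt (tang ?x g)"
      by (rule real_le_rsqrt) (simp add: omega_sq_le_tang)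
    then have "1 / ?e * \<bar>?x $ i * g a - ?x $ a * g i\<bar> \<le> 1 / ?e * sqrt (tang ?x g)"
      using e by (intro mult_left_mono) auto
    moreover have "0 \<le> q $ a" "q $ a \<le> 1" using assms by (auto simp: cube_iff)
    moreover have "\<bar>q $ a * (sg / ?e * (?x $ i * g a - ?x $ a * g i))\<bar> = q $ a * (1 / ?e * \<bar>?x $ i * g a - ?x $ a * g i\<bar>)"
      using sg e calculation by (simp add: abs_mult)
    ultimately show "\<bar>q $ a * (sg / ?e * (?x $ i * g a - ?x $ a * g i))\<bar> \<le> 1 / ?e * sqrt (tang ?x g)"
      using mult_mono[of "q $ a" 1 "1 / ?e * \<bar>?x $ i * g a - ?x $ a * g i\<bar>" "1 / ?e * sqrt (tang ?x g)"] e by simp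
  qed
  also have "\<dots> \<le> 7 / r0 * sqrt (tang ?x g)"
  proof -
    have "2 / ?e \<le> 7 / r0" using sqrt_ee_lower[of d q] assms e r0_pos by (simp add: field_simps)
    then have "2 / ?e * sqrt (tang ?x g) \<le> 7 / r0 * sqrt (tang ?x g)" by (intro mult_right_mono) (auto simp: tang_nonneg)
    then show ?thesis by simp
  qed
  finally show ?thesis .
qed

text \<open>If k(d) is the average of H over the box of width d, then |k'(d)| <= 7M/d, and
  integration from \<epsilon> to r0/20 produces the logarithm. At d = r0/20 the average is bounded
  through N, at d = \<epsilon> it differs from H x0 by at most \<beta>.\<close>

lemma sup_bound:
  assumes H: "has_grad H H1" and MN: "0 < M" "0 < N"
    and T: "\<And>S. compact S \<Longrightarrow> S \<subseteq> {x. r0 + \<epsilon> \<le> norm x \<and> norm x \<le> r0 + 2 * \<epsilon>} \<Longrightarrow> integral S (\<lambda>x. tang x (\<lambda>a. H1 a x)) \<le> \<epsilon> * (r0 * M)\<^sup>2"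
    and N: "\<And>S. compact S \<Longrightarrow> S \<subseteq> {x. r0 + \<epsilon> \<le> norm x \<and> norm x \<le> r0 + 2 * \<epsilon>} \<Longrightarrow> integral S (\<lambda>x. (H x)\<^sup>2) \<le> \<epsilon> * N\<^sup>2"
    and \<beta>: "\<And>y. norm (y - x0) \<le> 20 * \<epsilon> \<Longrightarrow> \<bar>H y - H x0\<bar> \<le> \<beta>"
  shows "\<bar>H x0\<bar> \<le> \<beta> + 7 * M * ln (r0 / \<epsilon>) + 20 * N / r0"
proof -
  let ?k = "\<lambda>d. integral cube (\<lambda>q. 1 * H (chart d q))"
  let ?T = "\<lambda>x. tang x (\<lambda>a. H1 a x)"
  have Hc: "continuous_on UNIV H" "continuous_on UNIV (H1 a)" for a
    using H by (auto intro: has_grad_cont has_grad_cont1)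
  have Tc: "continuous_on UNIV ?T" unfolding tang_def by (intro continuous_intros Hc)
  have cc: "continuous_on cube (chart d)" if "0 < d" "d \<le> r0 / 19" for d
    using chart_deriv_q[of d] that by (meson continuous_at_imp_continuous_on has_derivative_continuous less_imp_le)
  have kd: "(?k has_real_derivative integral cube (\<lambda>q. 1 * (\<Sum>a\<in>UNIV. chart_d d q $ a * H1 a (chart d q)))) (at d)"
    if "0 < d" "d < r0 / 19" for d
    by (rule average_deriv[OF H, of "{0<..<r0/19}"])
      (use that chart_cont chart_deriv_d in \<open>auto intro: convex_real_interval\<close>)
  have kd_le: "\<bar>integral cube (\<lambda>q. 1 * (\<Sum>a\<in>UNIV. chart_d d q $ a * H1 a (chart d q)))\<bar> \<le> 7 * M / d"
    if d: "0 < d" "d < r0 / 19" for d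
  proof -
    have cT: "continuous_on cube (\<lambda>q. sqrt (?T (chart d q)))"
      using cc[of d] d by (intro continuous_intros continuous_on_compose2[OF Tc]) auto
    have "continuous_on cube (\<lambda>q. chart_d d q)"
    proof -
      have "continuous_on cube (\<lambda>q. (d, q))" by (intro continuous_intros)
      moreover have "(\<lambda>q. (d, q)) ` cube \<subseteq> {0<..<r0/19} \<times> cube" using d by auto
      ultimately show ?thesis using continuous_on_compose2[OF chart_cont(2)] by fastforce
    qed
    then have "continuous_on cube (\<lambda>q. 1 * (\<Sum>a\<in>UNIV. chart_d d q $ a * H1 a (chart d q)))"
      using cc[of d] d by (intro continuous_intros continuous_on_compose2[OF Hc(2)]) auto
    then have "\<bar>integral cube (\<lambda>q. 1 * (\<Sum>a\<in>UNIV. chart_d d q $ a * H1 a (chart d q)))\<bar> \<le> integral cube (\<lambda>q. 7 / r0 * \<bar>sqrt (?T (chart d q))\<bar>)"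
    proof (rule integral_cube_abs_bound)
      show "\<bar>1 * (\<Sum>a\<in>UNIV. chart_d d q $ a * H1 a (chart d q))\<bar> \<le> 7 / r0 * \<bar>sqrt (?T (chart d q))\<bar>" if "q \<in> cube" for q
        using chart_deriv_le_tang[of d q "\<lambda>a. H1 a (chart d q)"] d that by (simp add: tang_nonneg)
    qed (use r0_pos in \<open>auto intro!: continuous_intros cT\<close>)
    also have "\<dots> = 7 / r0 * integral cube (\<lambda>q. \<bar>sqrt (?T (chart d q))\<bar>)" by simp
    also have "\<dots> \<le> 7 / r0 * (r0 * M / d)"
    proof (rule mult_left_mono)
      show "integral cube (\<lambda>q. \<bar>sqrt (?T (chart d q))\<bar>) \<le> r0 * M / d"
      proof (rule integral_cube_abs_le[OF cT])
      have "integral cube (\<lambda>q. ?T (chart d q)) \<le> (r0 * M / d)\<^sup>2"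
        by (rule chart_average_le[OF _ _ Tc tang_nonneg T]) (use d in auto)
      then show "integral cube (\<lambda>q. (sqrt (?T (chart d q)))\<^sup>2) \<le> (r0 * M / d)\<^sup>2" by (simp add: tang_nonneg)
      qed (use r0_pos MN d in auto)
    qed (use r0_pos in auto)
    finally show ?thesis using r0_pos by simp
  qed
  have \<epsilon>D: "\<epsilon> \<le> r0 / 20" "r0 / 20 < r0 / 19" using \<epsilon> r0_pos by auto
  have "\<bar>?k (r0 / 20) - ?k \<epsilon>\<bar> \<le> 7 * M * ln (r0 / 20) - 7 * M * ln \<epsilon>"
  proof (rule DERIV_bound_interval[OF \<epsilon>D(1)])
    show "continuous_on {\<epsilon>..r0 / 20} ?k"
    proof (rule continuous_at_imp_continuous_on, rule ballI)
      fix d assume "d \<in> {\<epsilon>..r0 / 20}"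
      then have "0 < d" "d < r0 / 19" using \<epsilon> \<epsilon>D by auto
      from DERIV_isCont[OF kd[OF this]] show "isCont ?k d" .
    qed
    show "continuous_on {\<epsilon>..r0 / 20} (\<lambda>d. 7 * M * ln d)" using \<epsilon> by (intro continuous_intros) auto
    show "((\<lambda>d. 7 * M * ln d) has_real_derivative 7 * M / d) (at d)" if "\<epsilon> < d" for d
      using that \<epsilon> by (auto intro!: derivative_eq_intros)
    show "(?k has_real_derivative integral cube (\<lambda>q. 1 * (\<Sum>a\<in>UNIV. chart_d d q $ a * H1 a (chart d q)))) (at d)" if "\<epsilon> < d" "d < r0 / 20" for d
      using that \<epsilon> \<epsilon>D by (intro kd) auto
    show "\<bar>integral cube (\<lambda>q. 1 * (\<Sum>a\<in>UNIV. chart_d d q $ a * H1 a (chart d q)))\<bar> \<le> 7 * M / d" if "\<epsilon> < d" "d < r0 / 20" for d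
      using that \<epsilon> \<epsilon>D by (intro kd_le) auto
  qed
  also have "\<dots> = 7 * M * (ln (r0 / 20) - ln \<epsilon>)" by (simp add: right_diff_distrib)
  also have "\<dots> \<le> 7 * M * ln (r0 / \<epsilon>)"
    using MN r0_pos \<epsilon> by (intro mult_left_mono) (auto simp: ln_div)
  finally have 1: "\<bar>?k (r0 / 20) - ?k \<epsilon>\<bar> \<le> 7 * M * ln (r0 / \<epsilon>)" .
  have cH: "continuous_on cube (\<lambda>q. H (chart d q))" if "0 < d" "d \<le> r0 / 19" for d
    using cc[OF that] by (intro continuous_on_compose2[OF Hc(1)]) auto
  have "\<bar>?k (r0 / 20)\<bar> \<le> integral cube (\<lambda>q. \<bar>H (chart (r0 / 20) q)\<bar>)"
    by (rule integral_cube_abs_bound) (use cH[of "r0/20"] r0_pos in \<open>auto intro!: continuous_intros\<close>)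
  also have "\<dots> \<le> N / (r0 / 20)"
  proof (rule integral_cube_abs_le[OF cH])
    show "integral cube (\<lambda>q. (H (chart (r0 / 20) q))\<^sup>2) \<le> (N / (r0 / 20))\<^sup>2"
      by (rule chart_average_le[where F="\<lambda>x. (H x)\<^sup>2", OF _ _ _ _ N]) (use r0_pos in \<open>auto intro!: continuous_intros Hc\<close>)
  qed (use r0_pos MN in auto)
  finally have 2: "\<bar>?k (r0 / 20)\<bar> \<le> 20 * N / r0" by (simp add: mult.commute)
  have \<epsilon>19: "\<epsilon> \<le> r0 / 19" using \<epsilon> by simp
  have "?k \<epsilon> - H x0 = integral cube (\<lambda>q. H (chart \<epsilon> q) - H x0)"
    by (subst integral_diff) (auto simp: integral_cube_const intro!: integrable_on_compact compact_cube cH \<epsilon> \<epsilon>19)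
  also have "\<bar>\<dots>\<bar> \<le> integral cube (\<lambda>q. \<beta>)"
    by (rule integral_cube_abs_bound) (auto intro!: continuous_intros cH \<epsilon> \<epsilon>19 \<beta> chart_near)
  finally have 3: "\<bar>?k \<epsilon> - H x0\<bar> \<le> \<beta>" by (simp add: integral_cube_const)
  show ?thesis using 1 2 3 by linarith
qed

end

text \<open>The largest coordinate carries at least a third of |x0|^2, so one of the three charts
  always applies.\<close>

theorem shell_sup_bound:
  fixes x0 :: "real^3"
  assumes "norm x0 = r0" "0 < \<epsilon>" "160 * \<epsilon> \<le> r0"
    and H: "has_grad H H1" and MN: "0 < M" "0 < N"
    and T: "\<And>S. compact S \<Longrightarrow> S \<subseteq> {x. r0 + \<epsilon> \<le> norm x \<and> norm x \<le> r0 + 2 * \<epsilon>} \<Longrightarrow> integral S (\<lambda>x. tang x (\<lambda>a. H1 a x)) \<le> \<epsilon> * (r0 * M)\<^sup>2"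
    and N: "\<And>S. compact S \<Longrightarrow> S \<subseteq> {x. r0 + \<epsilon> \<le> norm x \<and> norm x \<le> r0 + 2 * \<epsilon>} \<Longrightarrow> integral S (\<lambda>x. (H x)\<^sup>2) \<le> \<epsilon> * N\<^sup>2"
    and \<beta>: "\<And>y. norm (y - x0) \<le> 20 * \<epsilon> \<Longrightarrow> \<bar>H y - H x0\<bar> \<le> \<beta>"
  shows "\<bar>H x0\<bar> \<le> \<beta> + 7 * M * ln (r0 / \<epsilon>) + 20 * N / r0"
proof -
  have "\<exists>i. r0\<^sup>2 \<le> 3 * (x0 $ i)\<^sup>2"
  proof (rule ccontr)
    assume "\<not> ?thesis"
    then have "3 * (x0 $ 1)\<^sup>2 < r0\<^sup>2" "3 * (x0 $ 2)\<^sup>2 < r0\<^sup>2" "3 * (x0 $ 3)\<^sup>2 < r0\<^sup>2" by (auto simp: not_le)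
    moreover have "r0\<^sup>2 = (x0 $ 1)\<^sup>2 + (x0 $ 2)\<^sup>2 + (x0 $ 3)\<^sup>2"
      unfolding assms(1)[symmetric] power2_norm_eq_inner by (simp add: inner_vec_def sum_3 power2_eq_square)
    ultimately show False by linarith
  qed
  then obtain i where "r0\<^sup>2 \<le> 3 * (x0 $ i)\<^sup>2" ..
  then interpret graph_chart x0 r0 \<epsilon> i using assms by unfold_locales auto
  show ?thesis by (rule sup_bound[OF H MN T N \<beta>])
qed

section \<open>The wave equation on a time slice\<close>

lemma dderiv_has_derivative: "\<psi> differentiable (at p) \<Longrightarrow> (\<psi> has_derivative (\<lambda>v. dderiv v \<psi> p)) (at p)"
  unfolding dderiv_def using frechet_derivative_works by blast

lemma dderiv_eqI: "(\<psi> has_derivative D) (at p) \<Longrightarrow> dderiv v \<psi> p = D v"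
  unfolding dderiv_def using frechet_derivative_at by force

lemma dderiv_add: "f differentiable (at p) \<Longrightarrow> g differentiable (at p) \<Longrightarrow> dderiv b (\<lambda>p. f p + g p) p = dderiv b f p + dderiv b g p"
  by (intro dderiv_eqI has_derivative_add dderiv_has_derivative)

lemma dderiv_minus: "f differentiable (at p) \<Longrightarrow> dderiv b (\<lambda>p. - f p) p = - dderiv b f p"
  by (intro dderiv_eqI has_derivative_minus dderiv_has_derivative)

lemma dderiv_mult: "f differentiable (at p) \<Longrightarrow> g differentiable (at p) \<Longrightarrow> dderiv b (\<lambda>p. f p * g p) p = f p * dderiv b g p + dderiv b f p * g p"
  by (rule dderiv_eqI[OF has_derivative_mult[OF dderiv_has_derivative dderiv_has_derivative]])

lemma dderiv_sum: "(\<And>i. i \<in> I \<Longrightarrow> f i differentiable (at p)) \<Longrightarrow> dderiv b (\<lambda>p. \<Sum>i\<in>I. f i p) p = (\<Sum>i\<in>I. dderiv b (f i) p)"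
  by (intro dderiv_eqI has_derivative_sum dderiv_has_derivative)

lemma C_k_differentiable: "C_k (Suc n) \<psi> \<Longrightarrow> \<psi> differentiable (at p)"
  by simp

lemma C_k_decr: "C_k (Suc n) \<psi> \<Longrightarrow> C_k n \<psi>"
proof (induction n arbitrary: \<psi>)
  case 0
  then show ?case by (auto intro!: continuous_at_imp_continuous_on differentiable_imp_continuous_within)
next
  case (Suc n)
  have "C_k n (dderiv b \<psi>)" if "b \<in> Basis" for b using Suc.IH Suc.prems that by simp
  then show ?case using Suc.prems by simp
qed

lemma C_k_le: "m \<le> n \<Longrightarrow> C_k n \<psi> \<Longrightarrow> C_k m \<psi>"
  by (induction n rule: nat_induct) (auto simp: le_Suc_eq simp del: C_k.simps intro: C_k_decr)

lemma C_k_cont: "C_k n \<psi> \<Longrightarrow> continuous_on UNIV \<psi>"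
  using C_k_le[of 0 n] by simp

lemma C_k_add: "C_k n f \<Longrightarrow> C_k n g \<Longrightarrow> C_k n (\<lambda>p. f p + g p)"
proof (induction n arbitrary: f g)
  case 0 then show ?case by (auto intro: continuous_on_add)
next
  case (Suc n)
  have "dderiv b (\<lambda>p. f p + g p) = (\<lambda>p. dderiv b f p + dderiv b g p)" for b
    using Suc.prems by (auto simp: dderiv_add)
  then show ?case using Suc by auto
qed

lemma C_k_mult: "C_k n f \<Longrightarrow> C_k n g \<Longrightarrow> C_k n (\<lambda>p. f p * g p)"
proof (induction n arbitrary: f g)
  case 0 then show ?case by (auto intro: continuous_on_mult)
next
  case (Suc n)
  have eq: "dderiv b (\<lambda>p. f p * g p) = (\<lambda>p. f p * dderiv b g p + dderiv b f p * g p)" for b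
    using Suc.prems by (auto simp: dderiv_mult)
  have "C_k n (\<lambda>p. f p * dderiv b g p + dderiv b f p * g p)" if "b \<in> Basis" for b
    using Suc.prems that by (intro C_k_add Suc.IH C_k_decr[of n f] C_k_decr[of n g]) auto
  then show ?case using Suc.prems by (auto simp: eq intro: differentiable_mult)
qed

lemma C_k_const: "C_k n (\<lambda>p :: 'a :: euclidean_space. c)"
proof (induction n arbitrary: c)
  case (Suc n)
  have eq: "dderiv b (\<lambda>p :: 'a. c) = (\<lambda>p. 0)" for b by (auto intro!: dderiv_eqI derivative_eq_intros)
  show ?case using Suc[of 0] by (simp add: eq)
qed simp

lemma C_k_sum: "(\<And>i. i \<in> I \<Longrightarrow> C_k n (f i)) \<Longrightarrow> C_k n (\<lambda>p. \<Sum>i\<in>I. f i p)"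
  by (induction I rule: infinite_finite_induct) (auto intro: C_k_const C_k_add)

lemma C_k_linear:
  assumes "bounded_linear L" shows "C_k n L"
proof (cases n)
  case 0 then show ?thesis using assms by (simp add: linear_continuous_on)
next
  case (Suc m)
  have d: "(L has_derivative L) (at p)" for p using assms by (rule bounded_linear_imp_has_derivative)
  then have "dderiv b L = (\<lambda>p. L b)" for b by (auto intro!: dderiv_eqI)
  then show ?thesis using Suc d by (auto simp: C_k_const differentiable_def)
qed

lemma basis_spacetime: "(1, 0) \<in> (Basis :: spacetime set)" "(0, axis i 1) \<in> (Basis :: spacetime set)"
  by (auto simp: Basis_prod_def Basis_vec_def)

lemma C_k_dx: "C_k (Suc n) \<psi> \<Longrightarrow> C_k n (dx i \<psi>)"
  unfolding dx_def using basis_spacetime by simp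

lemma C_k_dt: "C_k (Suc n) \<psi> \<Longrightarrow> C_k n (dt \<psi>)"
  unfolding dt_def using basis_spacetime by simp

lemma C_k_coord: "C_k n (\<lambda>p::spacetime. snd p $ i)" "C_k n (\<lambda>p::spacetime. fst p)"
  by (intro C_k_linear bounded_linear_compose[OF bounded_linear_vec_nth bounded_linear_snd] bounded_linear_fst)+

lemma C_k_scaling: "C_k (Suc n) \<psi> \<Longrightarrow> C_k n (scaling \<psi>)"
  unfolding scaling_def[abs_def] by (intro C_k_add C_k_mult C_k_sum C_k_coord C_k_dt C_k_dx)

lemma C_k_Gam: "C_k (n + length w) \<psi> \<Longrightarrow> C_k n (Gam w \<psi>)"
proof (induction w arbitrary: n)
  case Nil then show ?case by (simp add: Gam_def)
next
  case (Cons a w)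
  have "C_k (Suc n + length w) \<psi>" using Cons.prems by (simp del: C_k.simps)
  then have "C_k (Suc n) (Gam w \<psi>)" by (rule Cons.IH)
  then show ?case by (cases a) (auto simp: Gam_def simp del: C_k.simps intro: C_k_scaling C_k_dx)
qed

lemma line_deriv:
  assumes "C_k (Suc n) \<psi>"
  shows "((\<lambda>\<sigma>. \<psi> (p + \<sigma> *\<^sub>R b)) has_real_derivative dderiv b \<psi> (p + \<sigma> *\<^sub>R b)) (at \<sigma>)"
proof -
  have 1: "((\<lambda>\<sigma>. p + \<sigma> *\<^sub>R b) has_derivative (\<lambda>h. h *\<^sub>R b)) (at \<sigma>)"
    by (auto intro!: derivative_eq_intros)
  have d: "(\<psi> has_derivative (\<lambda>v. dderiv v \<psi> (p + \<sigma> *\<^sub>R b))) (at (p + \<sigma> *\<^sub>R b))"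
    using assms by (intro dderiv_has_derivative) simp
  have "dderiv (h *\<^sub>R b) \<psi> (p + \<sigma> *\<^sub>R b) = dderiv b \<psi> (p + \<sigma> *\<^sub>R b) * h" for h
    using linear_scale[OF has_derivative_linear[OF d]] by simp
  then show ?thesis
    using has_derivative_compose[OF 1 d] by (simp add: has_field_derivative_def)
qed

text \<open>The mean value theorem along c and then along b. The difference on the left is symmetric
  in b and c, so the two mixed derivatives agree at points arbitrarily close to p, and by continuity
  at p.\<close>

lemma second_difference:
  assumes C: "C_k 2 \<psi>" and bc: "b \<in> Basis" "c \<in> Basis" and h: "0 < h"
  shows "\<exists>\<sigma> \<tau>. 0 < \<sigma> \<and> \<sigma> < h \<and> 0 < \<tau> \<and> \<tau> < h \<and>
    \<psi> (p + h *\<^sub>R c + h *\<^sub>R b) - \<psi> (p + h *\<^sub>R c) - \<psi> (p + h *\<^sub>R b) + \<psi> p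
      = h * h * dderiv b (dderiv c \<psi>) (p + \<sigma> *\<^sub>R c + \<tau> *\<^sub>R b)"
proof -
  have C1: "C_k (Suc 1) \<psi>" and C2: "C_k (Suc 0) (dderiv c \<psi>)"
    using C bc by (simp_all add: numeral_2_eq_2)
  let ?f = "\<lambda>\<sigma>. \<psi> ((p + h *\<^sub>R b) + \<sigma> *\<^sub>R c) - \<psi> (p + \<sigma> *\<^sub>R c)"
  have "(?f has_real_derivative dderiv c \<psi> ((p + h *\<^sub>R b) + \<sigma> *\<^sub>R c) - dderiv c \<psi> (p + \<sigma> *\<^sub>R c)) (at \<sigma>)" for \<sigma>
    by (intro DERIV_diff line_deriv[OF C1])
  from MVT2[OF h, of ?f, OF this] obtain \<sigma> where \<sigma>: "0 < \<sigma>" "\<sigma> < h"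
    "?f h - ?f 0 = (h - 0) * (dderiv c \<psi> ((p + h *\<^sub>R b) + \<sigma> *\<^sub>R c) - dderiv c \<psi> (p + \<sigma> *\<^sub>R c))" by auto
  have "((\<lambda>\<tau>. dderiv c \<psi> ((p + \<sigma> *\<^sub>R c) + \<tau> *\<^sub>R b)) has_real_derivative dderiv b (dderiv c \<psi>) ((p + \<sigma> *\<^sub>R c) + \<tau> *\<^sub>R b)) (at \<tau>)" for \<tau>
    by (rule line_deriv[OF C2])
  from MVT2[OF h, of "\<lambda>\<tau>. dderiv c \<psi> ((p + \<sigma> *\<^sub>R c) + \<tau> *\<^sub>R b)", OF this] obtain \<tau> where \<tau>: "0 < \<tau>" "\<tau> < h"
    "dderiv c \<psi> ((p + \<sigma> *\<^sub>R c) + h *\<^sub>R b) - dderiv c \<psi> ((p + \<sigma> *\<^sub>R c) + 0 *\<^sub>R b) = (h - 0) * dderiv b (dderiv c \<psi>) ((p + \<sigma> *\<^sub>R c) + \<tau> *\<^sub>R b)" by auto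
  have "\<psi> (p + h *\<^sub>R c + h *\<^sub>R b) - \<psi> (p + h *\<^sub>R c) - \<psi> (p + h *\<^sub>R b) + \<psi> p = ?f h - ?f 0"
    by (simp add: add_ac)
  also have "\<dots> = h * h * dderiv b (dderiv c \<psi>) (p + \<sigma> *\<^sub>R c + \<tau> *\<^sub>R b)"
    using \<sigma>(3) \<tau>(3) by (simp add: add_ac)
  finally show ?thesis using \<sigma> \<tau> by blast
qed

lemma dderiv_commute:
  assumes C: "C_k 2 \<psi>" and bc: "b \<in> Basis" "c \<in> Basis"
  shows "dderiv b (dderiv c \<psi>) p = dderiv c (dderiv b \<psi>) p"
proof (rule ccontr)
  let ?A = "dderiv b (dderiv c \<psi>)" and ?B = "dderiv c (dderiv b \<psi>)"
  assume ne: "?A p \<noteq> ?B p"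
  define e where "e = \<bar>?A p - ?B p\<bar> / 2"
  have e: "0 < e" using ne by (simp add: e_def)
  have "continuous_on UNIV ?A" "continuous_on UNIV ?B"
    using C bc by (simp_all add: numeral_2_eq_2)
  then have "isCont ?A p" "isCont ?B p" by (auto simp: continuous_on_eq_continuous_at)
  then obtain d1 d2 where d: "0 < d1" "\<And>q. dist q p < d1 \<Longrightarrow> dist (?A q) (?A p) < e"
      "0 < d2" "\<And>q. dist q p < d2 \<Longrightarrow> dist (?B q) (?B p) < e"
    using e unfolding continuous_at_eps_delta by (metis (no_types))
  define h where "h = min d1 d2 / 2"
  have h: "0 < h" "2 * h \<le> d1" "2 * h \<le> d2" using d by (auto simp: h_def)
  have nb: "norm b = 1" "norm c = 1" using bc by auto
  have near: "dist (p + \<sigma> *\<^sub>R v + \<tau> *\<^sub>R w) p < 2 * h"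
    if "0 < \<sigma>" "\<sigma> < h" "0 < \<tau>" "\<tau> < h" "norm v = 1" "norm w = 1" for \<sigma> \<tau> :: real and v w :: 'a
    using norm_triangle_ineq[of "\<sigma> *\<^sub>R v" "\<tau> *\<^sub>R w"] that by (simp add: dist_norm add.assoc)
  obtain \<sigma> \<tau> where 1: "0 < \<sigma>" "\<sigma> < h" "0 < \<tau>" "\<tau> < h"
    "\<psi> (p + h *\<^sub>R c + h *\<^sub>R b) - \<psi> (p + h *\<^sub>R c) - \<psi> (p + h *\<^sub>R b) + \<psi> p = h * h * ?A (p + \<sigma> *\<^sub>R c + \<tau> *\<^sub>R b)"
    using second_difference[OF C bc h(1), of p] by blast
  obtain \<sigma>' \<tau>' where 2: "0 < \<sigma>'" "\<sigma>' < h" "0 < \<tau>'" "\<tau>' < h"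
    "\<psi> (p + h *\<^sub>R b + h *\<^sub>R c) - \<psi> (p + h *\<^sub>R b) - \<psi> (p + h *\<^sub>R c) + \<psi> p = h * h * ?B (p + \<sigma>' *\<^sub>R b + \<tau>' *\<^sub>R c)"
    using second_difference[OF C bc(2,1) h(1), of p] by blast
  have pe: "p + h *\<^sub>R c + h *\<^sub>R b = p + h *\<^sub>R b + h *\<^sub>R c" by (simp add: add_ac)
  have X: "\<psi> (p + h *\<^sub>R c + h *\<^sub>R b) - \<psi> (p + h *\<^sub>R c) - \<psi> (p + h *\<^sub>R b) + \<psi> p
    = \<psi> (p + h *\<^sub>R b + h *\<^sub>R c) - \<psi> (p + h *\<^sub>R b) - \<psi> (p + h *\<^sub>R c) + \<psi> p" unfolding pe by simp
  have "h * h * ?A (p + \<sigma> *\<^sub>R c + \<tau> *\<^sub>R b) = h * h * ?B (p + \<sigma>' *\<^sub>R b + \<tau>' *\<^sub>R c)" using X unfolding 1(5) 2(5) .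
  then have "?A (p + \<sigma> *\<^sub>R c + \<tau> *\<^sub>R b) = ?B (p + \<sigma>' *\<^sub>R b + \<tau>' *\<^sub>R c)" using h by simp
  moreover have "dist (?A (p + \<sigma> *\<^sub>R c + \<tau> *\<^sub>R b)) (?A p) < e"
    using near[OF 1(1-4) nb(2,1)] h by (intro d(2)) simp
  moreover have "dist (?B (p + \<sigma>' *\<^sub>R b + \<tau>' *\<^sub>R c)) (?B p) < e"
    using near[OF 2(1-4) nb] h by (intro d(4)) simp
  ultimately show False using e_def by (auto simp: dist_real_def abs_if split: if_splits)
qed

lemma dx_dx_commute: "C_k 2 \<psi> \<Longrightarrow> dx i (dx j \<psi>) = dx j (dx i \<psi>)"
  unfolding dx_def by (auto intro!: dderiv_commute basis_spacetime)

lemma dx_dt_commute: "C_k 2 \<psi> \<Longrightarrow> dx i (dt \<psi>) = dt (dx i \<psi>)"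
  unfolding dx_def dt_def by (auto intro!: dderiv_commute basis_spacetime)

section \<open>Restriction to a time slice and the scaling field\<close>

lemma slice_has_grad:
  assumes "C_k (Suc n) \<psi>"
  shows "has_grad (\<lambda>x. \<psi> (t, x)) (\<lambda>i x. dx i \<psi> (t, x))"
  unfolding has_grad_def
proof (intro conjI allI)
  fix x :: "real^3"
  have 1: "((\<lambda>x. (t, x)) has_derivative (\<lambda>h. (0, h))) (at x)" by (auto intro!: derivative_eq_intros)
  have d: "(\<psi> has_derivative (\<lambda>v. dderiv v \<psi> (t, x))) (at (t, x))"
    using assms by (intro dderiv_has_derivative) simp
  interpret linear "\<lambda>v. dderiv v \<psi> (t, x)" by (rule has_derivative_linear[OF d])
  have "dderiv (0, h) \<psi> (t, x) = (\<Sum>i\<in>UNIV. h $ i * dx i \<psi> (t, x))" for h :: "real^3"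
  proof -
    have "(0, h) = (\<Sum>i\<in>UNIV. h $ i *\<^sub>R (0::real, (axis i (1::real) :: real^3)))"
      by (simp add: sum_3 vec_eq_iff axis_def prod_eq_iff forall_3)
    then have "dderiv (0, h) \<psi> (t, x) = (\<Sum>i\<in>UNIV. dderiv (h $ i *\<^sub>R (0, axis i 1)) \<psi> (t, x))"
      by (simp only: sum)
    then show ?thesis by (simp only: scale dx_def real_scaleR_def)
  qed
  then show "((\<lambda>x. \<psi> (t, x)) has_derivative (\<lambda>h. \<Sum>i\<in>UNIV. h $ i * dx i \<psi> (t, x))) (at x)"
    using has_derivative_compose[OF 1 d] by simp
next
  fix i
  have "continuous_on UNIV (dx i \<psi>)" using C_k_dx[OF assms] by (rule C_k_cont)
  then show "continuous_on UNIV (\<lambda>x. dx i \<psi> (t, x))"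
    by (rule continuous_on_compose2) (auto intro!: continuous_intros)
qed

lemma dderiv_fst: "dderiv b (\<lambda>p::spacetime. fst p) p = fst b"
  by (intro dderiv_eqI bounded_linear_imp_has_derivative bounded_linear_fst)

lemma dderiv_coord: "dderiv b (\<lambda>p::spacetime. snd p $ i) p = snd b $ i"
  by (intro dderiv_eqI bounded_linear_imp_has_derivative bounded_linear_compose[OF bounded_linear_vec_nth bounded_linear_snd])

lemma dderiv_scaling:
  assumes "C_k 2 \<psi>"
  shows "dderiv b (scaling \<psi>) p = fst b * dt \<psi> p + fst p * dderiv b (dt \<psi>) p
    + (\<Sum>i\<in>UNIV. snd b $ i * dx i \<psi> p + snd p $ i * dderiv b (dx i \<psi>) p)"
proof -
  have C: "C_k (Suc (Suc 0)) \<psi>" using assms by (simp add: numeral_2_eq_2)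
  have d: "dt \<psi> differentiable (at p)" "dx i \<psi> differentiable (at p)" "(\<lambda>p::spacetime. fst p) differentiable (at p)"
    "(\<lambda>p::spacetime. snd p $ i) differentiable (at p)" for i
    using C_k_dt[OF C] C_k_dx[OF C] C_k_coord[of "Suc 0"] C_k_differentiable by blast+
  show ?thesis unfolding scaling_def[abs_def]
    by (simp add: dderiv_add dderiv_mult dderiv_sum d dderiv_fst dderiv_coord add_ac mult_ac)
qed

lemma dx_scaling:
  assumes "C_k 2 \<psi>"
  shows "dx i (scaling \<psi>) p = fst p * dx i (dt \<psi>) p + dx i \<psi> p + (\<Sum>j\<in>UNIV. snd p $ j * dx i (dx j \<psi>) p)"
proof -
  have "(\<Sum>j\<in>UNIV. (axis i (1::real)) $ j * dx j \<psi> p) = dx i \<psi> p"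
    using exhaust_3[of i] by (auto simp: sum_3 axis_def)
  then show ?thesis
    using dderiv_scaling[OF assms, of "(0, axis i 1)" p] by (simp add: dx_def sum.distrib)
qed

lemma dt_scaling:
  assumes "C_k 2 \<psi>"
  shows "dt (scaling \<psi>) p = dt \<psi> p + fst p * dt (dt \<psi>) p + (\<Sum>j\<in>UNIV. snd p $ j * dt (dx j \<psi>) p)"
  using dderiv_scaling[OF assms, of "(1, 0)" p] by (simp add: dt_def)

text \<open>Eliminating \<open>\<partial>\<^sub>t\<close> by \<open>t \<partial>\<^sub>t = S - x \<cdot> \<partial>\<close> turns the wave equation into an equation on a single time slice.\<close>

lemma slice_equation:
  assumes C: "C_k 2 \<psi>" and t: "t \<noteq> 0"
  shows "(\<Sum>i\<in>UNIV. dx i (dx i \<psi>) (t, x)) - (1 / t\<^sup>2) * (\<Sum>i\<in>UNIV. \<Sum>j\<in>UNIV. x $ i * x $ j * dx j (dx i \<psi>) (t, x))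
    = box_op \<psi> (t, x) + (1 / t\<^sup>2) * (2 * (\<Sum>i\<in>UNIV. x $ i * dx i \<psi> (t, x)) - 2 * (\<Sum>i\<in>UNIV. x $ i * dx i (scaling \<psi>) (t, x))
        + (scaling (scaling \<psi>) (t, x) - scaling \<psi> (t, x)))"
proof -
  define X where "X = (\<Sum>i\<in>UNIV. \<Sum>j\<in>UNIV. x $ i * x $ j * dx j (dx i \<psi>) (t, x))"
  define Y where "Y = (\<Sum>i\<in>UNIV. x $ i * dx i (dt \<psi>) (t, x))"
  define R where "R = (\<Sum>i\<in>UNIV. x $ i * dx i \<psi> (t, x))"
  have RS: "(\<Sum>i\<in>UNIV. x $ i * dx i (scaling \<psi>) (t, x)) = t * Y + R + X"
    unfolding X_def Y_def R_def dx_scaling[OF C]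
    by (simp add: distrib_left sum.distrib sum_distrib_left dx_dx_commute[OF C] mult_ac)
      (simp add: sum_3 dx_dx_commute[OF C, of 2 1] dx_dx_commute[OF C, of 3 1] dx_dx_commute[OF C, of 3 2])?
  have "dt (scaling \<psi>) (t, x) = dt \<psi> (t, x) + t * dt (dt \<psi>) (t, x) + Y"
    unfolding dt_scaling[OF C] Y_def by (simp add: dx_dt_commute[OF C])
  then have SS: "scaling (scaling \<psi>) (t, x) = t * dt \<psi> (t, x) + t\<^sup>2 * dt (dt \<psi>) (t, x) + t * Y + (t * Y + R + X)"
    using RS by (simp add: scaling_def[of "scaling \<psi>"] algebra_simps power2_eq_square)
  have S: "scaling \<psi> (t, x) = t * dt \<psi> (t, x) + R" by (simp add: scaling_def R_def)
  \<comment> \<open>As operators S^2 - S - 2 r\<partial>_r S + 2 r\<partial>_r = t^2 \<partial>_t^2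
    - x_i x_j \<partial>_i \<partial>_j: the mixed terms tY and all first order terms
    cancel.\<close>
  have eq: "2 * R - 2 * (t * Y + R + X) + (scaling (scaling \<psi>) (t, x) - scaling \<psi> (t, x)) = t\<^sup>2 * dt (dt \<psi>) (t, x) - X"
    unfolding SS S by simp
  then have "(1 / t\<^sup>2) * (2 * R - 2 * (t * Y + R + X) + (scaling (scaling \<psi>) (t, x) - scaling \<psi> (t, x))) = dt (dt \<psi>) (t, x) - (1 / t\<^sup>2) * X"
    unfolding eq using t by (simp add: right_diff_distrib)
  then show ?thesis
    unfolding RS X_def[symmetric] R_def[symmetric] by (simp add: box_op_def)
qed

lemma box_dx:
  assumes C: "C_k 3 \<psi>"
  shows "box_op (dx l \<psi>) p = dx l (box_op \<psi>) p"
proof -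
  have C3: "C_k (Suc (Suc (Suc 0))) \<psi>" using C by (simp add: numeral_3_eq_3)
  have C2: "C_k 2 \<psi>" "C_k 2 (dt \<psi>)" "C_k 2 (dx i \<psi>)" for i
    using C_k_dt[OF C3] C_k_dx[OF C3] C_k_decr[OF C3] by (simp_all add: numeral_2_eq_2 del: C_k.simps)
  have 1: "C_k (Suc 0) (dt (dt \<psi>))" "C_k (Suc 0) (dx i (dx i \<psi>))" for i
    using C_k_dt[OF C_k_dt[OF C3]] C_k_dx[OF C_k_dx[OF C3]] by blast+
  then have d: "dt (dt \<psi>) differentiable (at p)" "dx i (dx i \<psi>) differentiable (at p)" for i
    using C_k_differentiable by blast+
  have "dx l (box_op \<psi>) p = - dx l (dt (dt \<psi>)) p + (\<Sum>i\<in>UNIV. dx l (dx i (dx i \<psi>)) p)"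
    unfolding box_op_def[abs_def] dx_def[of l]
    by (subst dderiv_add) (auto simp: dderiv_minus dderiv_sum d intro!: differentiable_minus differentiable_sum)
  then show ?thesis
    unfolding box_op_def by (simp add: dx_dt_commute C2 dx_dx_commute[OF C2(1), of l] dx_dx_commute[OF C2(3), of l])
qed

section \<open>Lower bounds for the shell weights and local norms\<close>

text \<open>The last link from a weighted global estimate to an unweighted one on a compact set
  where the weight is bounded below.\<close>

lemma integral_le_of_weight:
  fixes F K :: "real^3 \<Rightarrow> real"
  assumes S: "compact S" and F: "continuous_on UNIV F" and K: "comp_supp K" "\<And>x. 0 \<le> K x"
    and c: "0 < c" "\<And>x. x \<in> S \<Longrightarrow> c * F x \<le> K x" and B: "integral UNIV K \<le> B"
  shows "integral S F \<le> B / c"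
proof -
  have Fi: "F integrable_on S" by (rule integrable_on_compact[OF S continuous_on_subset[OF F]]) simp
  have Ki: "K integrable_on S" by (rule integrable_on_compact[OF S continuous_on_subset[OF comp_supp_cont[OF K(1)]]]) simp
  have "c * integral S F = integral S (\<lambda>x. c * F x)" by simp
  also have "\<dots> \<le> integral S K" by (rule integral_le) (use Fi Ki c in auto)
  also have "\<dots> \<le> integral UNIV K" by (rule integral_subset_le) (use Ki comp_supp_integrable K in auto)
  also have "\<dots> \<le> B" by (rule B)
  finally show ?thesis using c by (simp add: field_simps)
qed

text \<open>The width 3 r0 \<epsilon> is chosen for these radii: there |x|^2 - r0^2 runs from about
  2 r0 \<epsilon> to about 4 r0 \<epsilon>, inside the middle range of the hat, from 3/2 to 9/2
  times r0 \<epsilon>.\<close>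

lemma shell_ge':
  assumes \<epsilon>: "0 < \<epsilon>" "160 * \<epsilon> \<le> r0" and x: "r0 + \<epsilon> \<le> norm x" "norm x \<le> r0 + 2 * \<epsilon>"
  shows "1 / (6 * r0 * \<epsilon>) \<le> shell (r0\<^sup>2) (3 * r0 * \<epsilon>) (x \<bullet> x)"
proof -
  have r0: "0 < r0" using \<epsilon> by linarith
  have xx: "x \<bullet> x = (norm x)\<^sup>2" by (simp add: power2_norm_eq_inner)
  have "(r0 + \<epsilon>)\<^sup>2 \<le> (norm x)\<^sup>2" "(norm x)\<^sup>2 \<le> (r0 + 2 * \<epsilon>)\<^sup>2" using x r0 \<epsilon> by (auto intro!: power_mono)
  moreover have "(r0 + \<epsilon>)\<^sup>2 = r0\<^sup>2 + 2 * (r0 * \<epsilon>) + \<epsilon>\<^sup>2" "(r0 + 2 * \<epsilon>)\<^sup>2 = r0\<^sup>2 + 4 * (r0 * \<epsilon>) + 4 * \<epsilon>\<^sup>2"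
    by (simp_all add: power2_eq_square algebra_simps)
  moreover have "160 * \<epsilon>\<^sup>2 \<le> r0 * \<epsilon>" using mult_right_mono[OF \<epsilon>(2), of \<epsilon>] \<epsilon> by (simp add: power2_eq_square)
  moreover have "0 \<le> \<epsilon>\<^sup>2" "0 \<le> r0 * \<epsilon>" using r0 \<epsilon> by auto
  moreover have "3 * r0 * \<epsilon> = 3 * (r0 * \<epsilon>)" by simp
  ultimately have "r0\<^sup>2 + (3 * r0 * \<epsilon>) / 2 \<le> x \<bullet> x" "x \<bullet> x \<le> r0\<^sup>2 + 3/2 * (3 * r0 * \<epsilon>)"
    unfolding xx by linarith+
  from shell_ge[OF _ this] r0 \<epsilon> show ?thesis by simp
qed

lemma shell_region_bounds:
  fixes x :: "real^3"
  assumes \<epsilon>: "0 < \<epsilon>" "160 * \<epsilon> \<le> r0" and x: "r0 + \<epsilon> \<le> norm x" "norm x \<le> r0 + 2 * \<epsilon>"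
  shows "r0\<^sup>2 \<le> x \<bullet> x" "x \<bullet> x \<le> 2 * r0\<^sup>2"
proof -
  have r0: "0 < r0" using \<epsilon> by linarith
  have xx: "x \<bullet> x = (norm x)\<^sup>2" by (simp add: power2_norm_eq_inner)
  show "r0\<^sup>2 \<le> x \<bullet> x" unfolding xx using x r0 \<epsilon> by (intro power_mono) auto
  have "(norm x)\<^sup>2 \<le> (81/80 * r0)\<^sup>2" using x r0 \<epsilon> by (intro power_mono) auto
  also have "\<dots> \<le> 2 * r0\<^sup>2" by (simp add: power_mult_distrib power_divide)
  finally show "x \<bullet> x \<le> 2 * r0\<^sup>2" unfolding xx .
qed

text \<open>30 = 6 times 5, with t^2 + |x|^2 <= 16 r0^2 + 2 r0^2 <= 25 r0^2.\<close>

lemma shell_weight_ge: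
  fixes x :: "real^3"
  assumes \<epsilon>: "0 < \<epsilon>" "160 * \<epsilon> \<le> r0" and x: "r0 + \<epsilon> \<le> norm x" "norm x \<le> r0 + 2 * \<epsilon>" and t: "0 < t" "t \<le> 4 * r0"
  shows "1 / (30 * r0\<^sup>2 * \<epsilon>) \<le> shell (r0\<^sup>2) (3 * r0 * \<epsilon>) (x \<bullet> x) * (1 / sqrt (t\<^sup>2 + x \<bullet> x))"
proof -
  have r0: "0 < r0" using \<epsilon> by linarith
  have "t\<^sup>2 \<le> (4 * r0)\<^sup>2" using t by (intro power_mono) auto
  then have "t\<^sup>2 + x \<bullet> x \<le> (5 * r0)\<^sup>2" using shell_region_bounds[OF \<epsilon> x] zero_le_power2[of r0]
    unfolding power_mult_distrib by (simp add: power_mult_distrib)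
  then have le: "sqrt (t\<^sup>2 + x \<bullet> x) \<le> 5 * r0" using r0 by (intro real_le_lsqrt) auto
  have "0 < t\<^sup>2 + x \<bullet> x" using t by (simp add: add_pos_nonneg)
  then have "1 / (5 * r0) \<le> 1 / sqrt (t\<^sup>2 + x \<bullet> x)" using le by (intro divide_left_mono) (auto simp: r0)
  then have "1 / (6 * r0 * \<epsilon>) * (1 / (5 * r0)) \<le> shell (r0\<^sup>2) (3 * r0 * \<epsilon>) (x \<bullet> x) * (1 / sqrt (t\<^sup>2 + x \<bullet> x))"
    using shell_ge'[OF \<epsilon> x] r0 \<epsilon> by (intro mult_mono) (auto intro: order_trans[rotated])
  then show ?thesis by (simp add: power2_eq_square mult_ac)
qed

lemma loc_bd_of_L2sq:
  assumes "continuous_on UNIV v" "sq_integrable v" "L2sq v \<le> B\<^sup>2"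
  shows "loc_bd x \<rho> B v"
proof -
  have "integral (cball x \<rho>) (\<lambda>y. (v y)\<^sup>2) \<le> L2sq v"
    by (rule integral_subset_le) (use assms in \<open>auto intro!: integrable_on_compact continuous_intros intro: continuous_on_subset\<close>)
  then show ?thesis using assms(3) by (simp add: loc_bd_def)
qed

section \<open>The derivatives of a solution on one slice\<close>

locale wave_slice =
  fixes \<phi> :: "spacetime \<Rightarrow> real" and t :: real
  assumes C4: "C_k 4 \<phi>" and t100: "100 \<le> t"
begin

text \<open>Time translation is not a commuting field, so the time derivative of a word is kept
  apart in \<open>h\<close>; \<open>g_Scal\<close> recovers it from the words.\<close>

definition g :: "gamma list \<Rightarrow> real^3 \<Rightarrow> real" where "g w x = Gam w \<phi> (t, x)"
definition h :: "gamma list \<Rightarrow> real^3 \<Rightarrow> real" where "h w x = dt (Gam w \<phi>) (t, x)"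
definition bx :: "gamma list \<Rightarrow> real^3 \<Rightarrow> real" where "bx w x = box_op (Gam w \<phi>) (t, x)"

lemma Ck_Gam: "n + length w \<le> 4 \<Longrightarrow> C_k n (Gam w \<phi>)"
  by (rule C_k_Gam) (rule C_k_le[OF _ C4])

lemma Gam_Cons: "Gam (Transl i # w) \<phi> = dx i (Gam w \<phi>)" "Gam (Scal # w) \<phi> = scaling (Gam w \<phi>)"
  by (simp_all add: Gam_def)

lemma g_grad: "length w \<le> 3 \<Longrightarrow> has_grad (g w) (\<lambda>i. g (Transl i # w))"
  using slice_has_grad[OF Ck_Gam[of "Suc 0" w], of t] by (simp add: g_def[abs_def] Gam_Cons)

lemma g_cont: "length w \<le> 4 \<Longrightarrow> continuous_on UNIV (g w)"
  unfolding g_def[abs_def] by (rule continuous_on_compose2[OF C_k_cont[OF Ck_Gam[of 0]]]) (auto intro!: continuous_intros)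

lemma Gam_sym: "length w \<le> 2 \<Longrightarrow> Gam (Transl i # Transl j # w) \<phi> = Gam (Transl j # Transl i # w) \<phi>"
  unfolding Gam_Cons by (rule dx_dx_commute[OF Ck_Gam]) simp

lemma g_sym: "length w \<le> 2 \<Longrightarrow> g (Transl i # Transl j # w) x = g (Transl j # Transl i # w) x"
  by (simp add: g_def Gam_sym)

lemma g_sym3: "length w \<le> 1 \<Longrightarrow> g (Transl k # Transl j # Transl i # w) x = g (Transl j # Transl i # Transl k # w) x"
proof -
  assume w: "length w \<le> 1"
  then have "Gam (Transl j # Transl k # Transl i # w) \<phi> = Gam (Transl j # Transl i # Transl k # w) \<phi>"
    using Gam_sym[of w k i] by (simp only: Gam_Cons(1)[of j])
  moreover have "Gam (Transl k # Transl j # Transl i # w) \<phi> = Gam (Transl j # Transl k # Transl i # w) \<phi>"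
    using w by (intro Gam_sym) simp
  ultimately show ?thesis by (simp add: g_def)
qed

lemma h_grad: "length w \<le> 2 \<Longrightarrow> has_grad (h w) (\<lambda>i. h (Transl i # w))"
proof -
  assume w: "length w \<le> 2"
  then have "C_k (Suc (Suc 0)) (Gam w \<phi>)" by (intro Ck_Gam) simp
  from slice_has_grad[OF C_k_dt[OF this], of t] dx_dt_commute[OF this[unfolded numeral_2_eq_2[symmetric]]] show ?thesis
    by (simp add: h_def[abs_def] Gam_Cons)
qed

lemma h_cont: "length w \<le> 3 \<Longrightarrow> continuous_on UNIV (h w)"
proof -
  assume "length w \<le> 3"
  then have "C_k 0 (dt (Gam w \<phi>))" by (intro C_k_dt Ck_Gam) simp
  then show ?thesis
    unfolding h_def[abs_def] by (rule continuous_on_compose2[OF C_k_cont]) (auto intro!: continuous_intros)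
qed

lemma g_Scal: "g (Scal # w) x = t * h w x + (\<Sum>i\<in>UNIV. x $ i * g (Transl i # w) x)"
  by (simp add: g_def h_def Gam_Cons scaling_def)

lemma equation:
  assumes "length w \<le> 2"
  shows "(\<Sum>i\<in>UNIV. g (Transl i # Transl i # w) x) - (1 / t\<^sup>2) * (\<Sum>i\<in>UNIV. \<Sum>j\<in>UNIV. x $ i * x $ j * g (Transl j # Transl i # w) x)
    = bx w x + (1 / t\<^sup>2) * (2 * (\<Sum>i\<in>UNIV. x $ i * g (Transl i # w) x) - 2 * (\<Sum>i\<in>UNIV. x $ i * g (Transl i # Scal # w) x)
       + (g (Scal # Scal # w) x - g (Scal # w) x))"
  unfolding g_def bx_def Gam_Cons by (rule slice_equation[OF Ck_Gam]) (use assms t100 in auto)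

definition LL :: "gamma list \<Rightarrow> real^3 \<Rightarrow> real" where
  "LL w x = (\<Sum>i\<in>UNIV. g (Transl i # Transl i # w) x) - (1 / t\<^sup>2) * (\<Sum>i\<in>UNIV. \<Sum>j\<in>UNIV. x $ i * x $ j * g (Transl j # Transl i # w) x)"

text \<open>The k-th derivative of \<open>LL w\<close>, arranged as the slice operator on the word
  \<open>Transl k # w\<close> minus its commutator. This makes \<open>LL_eq\<close> the equation
  that the elliptic estimates want, with \<open>LL w\<close> in the role of G, so that only
  \<open>LL w\<close> and not its derivative has to be bounded.\<close>

definition LLk :: "3 \<Rightarrow> gamma list \<Rightarrow> real^3 \<Rightarrow> real" where
  "LLk k w x = (\<Sum>i\<in>UNIV. g (Transl i # Transl i # Transl k # w) x)
     - (1 / t\<^sup>2) * (\<Sum>i\<in>UNIV. \<Sum>j\<in>UNIV. x $ i * x $ j * g (Transl j # Transl i # Transl k # w) x)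
     - 2 * (1 / t\<^sup>2) * (\<Sum>i\<in>UNIV. x $ i * g (Transl i # Transl k # w) x)"

lemma LL_pd:
  assumes w: "length w \<le> 1"
  shows "pd k (LL w) (LLk k w)"
proof -
  let ?d = "\<lambda>i. if k = i then 1 else (0::real)"
  have p: "pd k (g (Transl j # Transl i # w)) (g (Transl k # Transl j # Transl i # w))" for i j
    using w by (intro has_grad_pd g_grad) simp
  have "pd k (\<lambda>x. x $ i * x $ j * g (Transl j # Transl i # w) x)
      (\<lambda>x. (?d i * x $ j + ?d j * x $ i) * g (Transl j # Transl i # w) x + g (Transl k # Transl j # Transl i # w) x * (x $ i * x $ j))" for i j
    by (rule pd_mult[OF pd_mult[OF pd_coord pd_coord] p])
  then have "pd k (LL w) (\<lambda>x. (\<Sum>i\<in>UNIV. g (Transl k # Transl i # Transl i # w) x) - (1 / t\<^sup>2) * (\<Sum>i\<in>UNIV. \<Sum>j\<in>UNIV.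
      (?d i * x $ j + ?d j * x $ i) * g (Transl j # Transl i # w) x + g (Transl k # Transl j # Transl i # w) x * (x $ i * x $ j)))"
    unfolding LL_def[abs_def] by (intro pd_diff pd_cmult pd_sum p)
  then show ?thesis
  proof (rule pd_cong)
    fix x
    have s: "g (Transl k # Transl j # Transl i # w) x = g (Transl j # Transl i # Transl k # w) x" for i j
      by (rule g_sym3[OF w])
    have "(\<Sum>i\<in>UNIV. \<Sum>j\<in>UNIV. (?d i * x $ j + ?d j * x $ i) * g (Transl j # Transl i # w) x)
        = 2 * (\<Sum>i\<in>UNIV. x $ i * g (Transl i # Transl k # w) x)"
      using exhaust_3[of k] g_sym[of w 1 2 x] g_sym[of w 1 3 x] g_sym[of w 2 3 x] w by (auto simp: sum_3)
    then show "(\<Sum>i\<in>UNIV. g (Transl k # Transl i # Transl i # w) x) - (1 / t\<^sup>2) * (\<Sum>i\<in>UNIV. \<Sum>j\<in>UNIV.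
      (?d i * x $ j + ?d j * x $ i) * g (Transl j # Transl i # w) x + g (Transl k # Transl j # Transl i # w) x * (x $ i * x $ j)) = LLk k w x"
      unfolding LLk_def s sum.distrib by (simp add: algebra_simps)
  qed
qed

lemma LL_cont: "length w \<le> 1 \<Longrightarrow> continuous_on UNIV (LL w)" "length w \<le> 1 \<Longrightarrow> continuous_on UNIV (LLk k w)"
  unfolding LL_def[abs_def] LLk_def[abs_def] by (intro continuous_intros g_cont; simp)+

lemma LL_eq:
  assumes "length w \<le> 1"
  shows "(\<Sum>i\<in>UNIV. g (Transl i # Transl i # Transl k # w) x)
     - (1 / t\<^sup>2) * (\<Sum>i\<in>UNIV. \<Sum>j\<in>UNIV. x $ i * x $ j * g (Transl j # Transl i # Transl k # w) x)
     = LLk k w x + 2 * (1 / t\<^sup>2) * (\<Sum>i\<in>UNIV. x $ i * g (Transl i # Transl k # w) x)"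
  unfolding LLk_def by (simp only: diff_add_cancel)

end

text \<open>1 + x <= exp x at x = \<delta> ln J: a logarithm is traded for the factor 1/\<delta> and
  the power \<delta>.\<close>

lemma ln_jap_bound:
  fixes \<delta> J :: real
  assumes "0 < \<delta>" "\<delta> \<le> 1" "0 < J"
  shows "1 + ln J \<le> 1 / \<delta> * J powr \<delta>"
proof -
  have "\<delta> * (1 + ln J) = \<delta> + \<delta> * ln J" by (simp add: distrib_left)
  then have "\<delta> * (1 + ln J) \<le> 1 + \<delta> * ln J" using assms by linarith
  also have "\<dots> \<le> exp (\<delta> * ln J)" by (rule exp_ge_add_one_self)
  also have "\<dots> = J powr \<delta>" using assms by (simp add: powr_def)
  finally show ?thesis using assms by (simp add: field_simps)
qed

text \<open>The common ground of both estimates: A controls each spatial derivative of \<phi>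
  together with its first and second spatial derivatives, which yields the Hoelder modulus and the
  trace on the shell.\<close>

locale slice_bounded = wave_slice +
  fixes A :: real
  assumes A_pos: "0 < A"
    and int1: "sq_integrable (g [Transl l])" and int2: "sq_integrable (g [Transl i, Transl l])" and int3: "sq_integrable (g [Transl j, Transl i, Transl l])"
    and bd1: "L2sq (g [Transl l]) \<le> A\<^sup>2" and bd2: "L2sq (g [Transl i, Transl l]) \<le> A\<^sup>2" and bd3: "L2sq (g [Transl j, Transl i, Transl l]) \<le> A\<^sup>2"
begin

lemma trace_bound:
  assumes \<epsilon>: "0 < \<epsilon>" "160 * \<epsilon> \<le> r0" and r0: "t \<le> 4 * r0" and v: "has_grad v v1" "sq_integrable v" "\<And>i. sq_integrable (v1 i)"
    "L2sq v \<le> A\<^sup>2" "\<And>i. L2sq (v1 i) \<le> A\<^sup>2"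
    and S: "compact S" "S \<subseteq> {x. r0 + \<epsilon> \<le> norm x \<and> norm x \<le> r0 + 2 * \<epsilon>}"
  shows "integral S (\<lambda>x. (v x)\<^sup>2) \<le> \<epsilon> * (16 * A)\<^sup>2"
proof -
  have r0p: "0 < r0" using \<epsilon> by linarith
  have t0: "0 < t" "1 \<le> t" using t100 by auto
  have \<kappa>: "0 < 3 * r0 * \<epsilon>" using r0p \<epsilon> by simp
  note st = shell_trace[OF t0(2) \<kappa> v(1-3), of "r0\<^sup>2"]
  have "integral UNIV (\<lambda>x. shell (r0\<^sup>2) (3 * r0 * \<epsilon>) (x \<bullet> x) * (1 / sqrt (t\<^sup>2 + x \<bullet> x)) * (2 * (x \<bullet> x) * (v x)\<^sup>2)) \<le> 4 * (L2sq v + (\<Sum>i\<in>UNIV. L2sq (v1 i)))"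
    by (rule st(2))
  also have "\<dots> \<le> 4 * (A\<^sup>2 + (\<Sum>i\<in>(UNIV::3 set). A\<^sup>2))" by (intro mult_left_mono add_mono sum_mono v) auto
  also have "\<dots> = 16 * A\<^sup>2" by simp
  finally have le: "integral UNIV (\<lambda>x. shell (r0\<^sup>2) (3 * r0 * \<epsilon>) (x \<bullet> x) * (1 / sqrt (t\<^sup>2 + x \<bullet> x)) * (2 * (x \<bullet> x) * (v x)\<^sup>2)) \<le> 16 * A\<^sup>2" .
  have "integral S (\<lambda>x. (v x)\<^sup>2) \<le> (16 * A\<^sup>2) / (1 / (15 * \<epsilon>))"
  proof (rule integral_le_of_weight[OF S(1) _ st(1) _ _ _ le])
    show "continuous_on UNIV (\<lambda>x. (v x)\<^sup>2)" using has_grad_cont[OF v(1)] by (intro continuous_intros)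
    show "0 \<le> shell (r0\<^sup>2) (3 * r0 * \<epsilon>) (x \<bullet> x) * (1 / sqrt (t\<^sup>2 + x \<bullet> x)) * (2 * (x \<bullet> x) * (v x)\<^sup>2)" for x
      using shell_nonneg[OF \<kappa>] by simp
    show "1 / (15 * \<epsilon>) * (v x)\<^sup>2 \<le> shell (r0\<^sup>2) (3 * r0 * \<epsilon>) (x \<bullet> x) * (1 / sqrt (t\<^sup>2 + x \<bullet> x)) * (2 * (x \<bullet> x) * (v x)\<^sup>2)"
      if "x \<in> S" for x
    proof -
      have x: "r0 + \<epsilon> \<le> norm x" "norm x \<le> r0 + 2 * \<epsilon>" using S that by auto
      have "1 / (15 * \<epsilon>) * (v x)\<^sup>2 = 1 / (30 * r0\<^sup>2 * \<epsilon>) * (2 * r0\<^sup>2 * (v x)\<^sup>2)" using r0p by simp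
      also have "\<dots> \<le> shell (r0\<^sup>2) (3 * r0 * \<epsilon>) (x \<bullet> x) * (1 / sqrt (t\<^sup>2 + x \<bullet> x)) * (2 * (x \<bullet> x) * (v x)\<^sup>2)"
        using shell_weight_ge[OF \<epsilon> x t0(1) r0] shell_region_bounds[OF \<epsilon> x] shell_nonneg[OF \<kappa>, of "r0\<^sup>2" "x \<bullet> x"]
        by (intro mult_mono mult_right_mono) auto
      finally show ?thesis .
    qed
  qed (use \<epsilon> in auto)
  \<comment> \<open>240 = 16 times 15, rounded up to the square 16^2 below.\<close>
  also have "\<dots> = 240 * \<epsilon> * A\<^sup>2" using \<epsilon> by simp
  also have "\<dots> \<le> \<epsilon> * (16 * A)\<^sup>2" using \<epsilon> by (simp add: power_mult_distrib)
  finally show ?thesis .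
qed

text \<open>With thickness r0^(-2) the Hoelder error 105 A sqrt(20 \<epsilon>) is of order A/r0,
  like the trace term 20 * 16 A / r0, while ln(r0/\<epsilon>) = 3 ln r0 is still a logarithm. What
  is left to supply is the angular energy M.\<close>

lemma sup_of_tang:
  assumes r0: "norm x0 = r0" "t \<le> 4 * r0" and M: "0 < M"
    and T: "\<And>S. compact S \<Longrightarrow> S \<subseteq> {x. r0 + 1/r0\<^sup>2 \<le> norm x \<and> norm x \<le> r0 + 2 * (1/r0\<^sup>2)} \<Longrightarrow>
       integral S (\<lambda>x. tang x (\<lambda>i. g [Transl i, Transl l] x)) \<le> 1/r0\<^sup>2 * (r0 * M)\<^sup>2"
  shows "\<bar>g [Transl l] x0\<bar> \<le> 1000 * A / r0 + 21 * M * ln r0"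
proof -
  have r: "25 \<le> r0" using r0 t100 by linarith
  define \<epsilon> where "\<epsilon> = 1/r0\<^sup>2"
  have rr: "625 \<le> r0\<^sup>2" using power_mono[OF r, of 2] by simp
  have \<epsilon>: "0 < \<epsilon>" "160 * \<epsilon> \<le> r0" "20 * \<epsilon> \<le> 1"
  proof -
    show "0 < \<epsilon>" using r by (simp add: \<epsilon>_def)
    have e: "\<epsilon> \<le> 1/625" unfolding \<epsilon>_def using rr by (intro divide_left_mono) auto
    show "160 * \<epsilon> \<le> r0" "20 * \<epsilon> \<le> 1" using e r by auto
  qed
  have gr: "has_grad (g [Transl l]) (\<lambda>i. g [Transl i, Transl l])" "\<And>i. has_grad (g [Transl i, Transl l]) (\<lambda>j. g [Transl j, Transl i, Transl l])"
    by (intro g_grad; simp)+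
  have "\<bar>g [Transl l] x0\<bar> \<le> 105 * A * sqrt (20 * \<epsilon>) + 7 * M * ln (r0 / \<epsilon>) + 20 * (16 * A) / r0"
  proof (rule shell_sup_bound[OF r0(1) \<epsilon>(1,2) gr(1) M])
    show "0 < 16 * A" using A_pos by simp
    show "\<bar>g [Transl l] y - g [Transl l] x0\<bar> \<le> 105 * A * sqrt (20 * \<epsilon>)" if "norm (y - x0) \<le> 20 * \<epsilon>" for y
      by (rule hoelder_half[OF gr that _ \<epsilon>(3)])
        (use \<epsilon> A_pos int2 int3 bd2 bd3 in \<open>auto intro!: loc_bd_of_L2sq g_cont\<close>)
    show "integral S (\<lambda>x. (g [Transl l] x)\<^sup>2) \<le> \<epsilon> * (16 * A)\<^sup>2"
      if "compact S" "S \<subseteq> {x. r0 + \<epsilon> \<le> norm x \<and> norm x \<le> r0 + 2 * \<epsilon>}" for S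
      by (rule trace_bound[OF \<epsilon>(1,2) r0(2) gr(1) int1 int2 bd1 bd2 that])
    show "integral S (\<lambda>x. tang x (\<lambda>i. g [Transl i, Transl l] x)) \<le> \<epsilon> * (r0 * M)\<^sup>2"
      if "compact S" "S \<subseteq> {x. r0 + \<epsilon> \<le> norm x \<and> norm x \<le> r0 + 2 * \<epsilon>}" for S
      using T[OF that[unfolded \<epsilon>_def]] unfolding \<epsilon>_def .
  qed
  moreover have "sqrt (20 * \<epsilon>) \<le> 5 / r0"
    by (rule real_le_lsqrt) (use r in \<open>auto simp: \<epsilon>_def power_divide divide_right_mono\<close>)
  then have "105 * A * sqrt (20 * \<epsilon>) \<le> 105 * A * (5 / r0)" using A_pos by (intro mult_left_mono) auto
  moreover have "ln (r0 / \<epsilon>) = 3 * ln r0"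
  proof -
    have "r0 / \<epsilon> = r0 ^ 3" by (simp add: \<epsilon>_def power2_eq_square power3_eq_cube)
    then show ?thesis using r by (simp add: ln_realpow)
  qed
  moreover have "105 * A * (5 / r0) + 20 * (16 * A) / r0 \<le> 1000 * A / r0"
    using A_pos r by (simp add: field_simps)
  ultimately show ?thesis by simp
qed

end

section \<open>The estimate without support assumption\<close>

lemma sq_integrable_bound:
  assumes f: "continuous_on UNIV f" and b: "\<And>x. (f x)\<^sup>2 \<le> k x" "k integrable_on UNIV"
  shows "sq_integrable f" "L2sq f \<le> integral UNIV k"
proof -
  have c: "continuous_on UNIV (\<lambda>x. (f x)\<^sup>2)" by (intro continuous_intros f)
  show *: "sq_integrable f"
  proof (rule measurable_bounded_by_integrable_imp_integrable[OF _ b(2)])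
    show "(\<lambda>x. (f x)\<^sup>2) \<in> borel_measurable (lebesgue_on UNIV)"
      by (rule continuous_imp_measurable_on_sets_lebesgue[OF c]) simp
  qed (use b in auto)
  show "L2sq f \<le> integral UNIV k" by (rule integral_le[OF * b(2)]) (use b in auto)
qed

lemma sq_sum4_le: "(a + b + c + d)\<^sup>2 \<le> 4 * (a\<^sup>2 + b\<^sup>2 + c\<^sup>2 + d\<^sup>2)" for a b c d :: real
proof -
  have "0 \<le> (a - b)\<^sup>2 + (a - c)\<^sup>2 + (a - d)\<^sup>2 + (b - c)\<^sup>2 + (b - d)\<^sup>2 + (c - d)\<^sup>2" by simp
  then show ?thesis by (simp add: power2_eq_square algebra_simps)
qed

lemma sq_diff_le: "(a - b)\<^sup>2 \<le> 2 * (a\<^sup>2 + b\<^sup>2)" for a b :: real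
proof -
  have "0 \<le> (a + b)\<^sup>2" by simp
  then show ?thesis by (simp add: power2_eq_square algebra_simps)
qed

lemma eps_bounds:
  fixes r0 :: real
  assumes "25 \<le> r0"
  shows "0 < 1/r0\<^sup>2" "160 * (1/r0\<^sup>2) \<le> r0" "r0 * (1/r0\<^sup>2) \<le> 1"
proof -
  have "625 \<le> r0\<^sup>2" using power_mono[OF assms, of 2] by simp
  then have "1/r0\<^sup>2 \<le> 1/625" by (intro divide_left_mono) auto
  then show "160 * (1/r0\<^sup>2) \<le> r0" using assms by linarith
  show "0 < 1/r0\<^sup>2" "r0 * (1/r0\<^sup>2) \<le> 1" using assms by (auto simp: power2_eq_square)
qed

locale slice_energy = wave_slice +
  fixes A F :: real
  assumes Ap: "0 < A" and F0: "0 \<le> F"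
    and gi: "\<And>w. length w \<le> 3 \<Longrightarrow> sq_integrable (g w)" and gb: "\<And>w. length w \<le> 3 \<Longrightarrow> L2sq (g w) \<le> A\<^sup>2"
    and bi: "sq_integrable (bx [])" "\<And>l. sq_integrable (bx [Transl l])"
    and bb: "L2sq (bx []) \<le> F\<^sup>2" "\<And>l. L2sq (bx [Transl l]) \<le> F\<^sup>2"
begin

sublocale slice_bounded \<phi> t A
  by unfold_locales (auto intro: Ap gi gb)

text \<open>The value that balances the estimates: \<theta> A^2 = (F + A/t)^2 / \<theta> = m0.
  Having F + A/t in place of F ensures \<theta> >= 1/t, which the elliptic and the Rellich estimate
  require.\<close>

definition "\<theta> = (F + A / t) / A"
definition "m0 = A * (F + A / t)"

lemma t0: "0 < t" "1 \<le> t" "9 \<le> t" using t100 by auto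

lemma \<theta>_ge: "1 / t \<le> \<theta>"
  using Ap F0 t0 by (simp add: \<theta>_def field_simps)

lemma \<theta>_pos: "0 < \<theta>"
  using Ap F0 t0 by (simp add: \<theta>_def add_nonneg_pos)

lemma m0_pos: "0 < m0"
  using Ap F0 t0 by (simp add: m0_def add_nonneg_pos)

lemma \<theta>A: "\<theta> * A\<^sup>2 = m0"
  using Ap by (simp add: \<theta>_def m0_def power2_eq_square)

lemma FA\<theta>: "(F + A / t)\<^sup>2 / \<theta> = m0"
proof -
  have "0 < F + A / t" using Ap F0 t0 by (simp add: add_nonneg_pos)
  then show ?thesis using Ap by (simp add: \<theta>_def m0_def power2_eq_square)
qed

lemma F\<theta>: "F\<^sup>2 / \<theta> \<le> m0"
proof -
  have "F\<^sup>2 \<le> (F + A / t)\<^sup>2" using Ap F0 t0 by (intro power_mono) auto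
  then have "F\<^sup>2 / \<theta> \<le> (F + A / t)\<^sup>2 / \<theta>" using \<theta>_pos by (intro divide_right_mono) auto
  then show ?thesis by (simp add: FA\<theta>)
qed

text \<open>m0 contains A^2/t, and t >= 100 makes sqrt t at least 10. Errors of size A/t are
  absorbed into sqrt m0 in this way.\<close>

lemma A_div_t_le: "A\<^sup>2 / t \<le> m0" "A / t \<le> sqrt m0 / 10" "A \<le> sqrt m0 * sqrt t"
proof -
  show 1: "A\<^sup>2 / t \<le> m0" using Ap F0 by (simp add: m0_def power2_eq_square distrib_left)
  have "A\<^sup>2 \<le> m0 * t" using 1 t0 by (simp add: field_simps)
  then have "A \<le> sqrt (m0 * t)" by (rule real_le_rsqrt)
  then show 2: "A \<le> sqrt m0 * sqrt t" by (simp add: real_sqrt_mult)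
  have "10 \<le> sqrt t" by (rule real_le_rsqrt) (use t100 in auto)
  then have "10 * sqrt t \<le> sqrt t * sqrt t" by (rule mult_right_mono) (use t0 in simp)
  then have "10 * sqrt t \<le> t" using t0 by simp
  then have "sqrt m0 * (10 * sqrt t) \<le> sqrt m0 * t" using m0_pos by (intro mult_left_mono) auto
  then have "10 * A \<le> sqrt m0 * t" using 2 by simp
  then show "A / t \<le> sqrt m0 / 10" using t0 by (simp add: field_simps)
qed

text \<open>Majorant of the squared right side of the slice equation, with |x| <= 2t used in the
  radial terms. All but the source carries t^(-2), so the integral is of order (F + A/t)^2.\<close>

definition \<Gamma> :: "gamma list \<Rightarrow> real^3 \<Rightarrow> real" where
  "\<Gamma> w x = 4 * (bx w x)\<^sup>2 + 64 / t\<^sup>2 * (\<Sum>i\<in>UNIV. (g (Transl i # w) x)\<^sup>2) + 64 / t\<^sup>2 * (\<Sum>i\<in>UNIV. (g (Transl i # Scal # w) x)\<^sup>2)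
     + 8 / t\<^sup>2 * ((g (Scal # Scal # w) x)\<^sup>2 + (g (Scal # w) x)\<^sup>2)"

lemma scaled_radial_sq_le:
  fixes x :: "real^3"
  assumes "norm x \<le> t + 3"
  shows "(2 * (1 / t\<^sup>2) * (\<Sum>i\<in>UNIV. x $ i * v i))\<^sup>2 \<le> 16 / t\<^sup>2 * (\<Sum>i\<in>UNIV. (v i)\<^sup>2)"
proof -
  have "norm x \<le> 2 * t" using assms t100 by linarith
  then have "x \<bullet> x \<le> (2 * t)\<^sup>2" by (metis norm_ge_zero power2_norm_eq_inner power_mono)
  then have "(x \<bullet> x) * (\<Sum>i\<in>UNIV. (v i)\<^sup>2) \<le> (2 * t)\<^sup>2 * (\<Sum>i\<in>UNIV. (v i)\<^sup>2)"
    by (intro mult_right_mono sum_nonneg) auto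
  then have "(\<Sum>i\<in>UNIV. x $ i * v i)\<^sup>2 \<le> (2 * t)\<^sup>2 * (\<Sum>i\<in>UNIV. (v i)\<^sup>2)"
    using radial_deriv_sq_le[of x v] by linarith
  then have "(2 * (1 / t\<^sup>2))\<^sup>2 * (\<Sum>i\<in>UNIV. x $ i * v i)\<^sup>2 \<le> (2 * (1 / t\<^sup>2))\<^sup>2 * ((2 * t)\<^sup>2 * (\<Sum>i\<in>UNIV. (v i)\<^sup>2))"
    by (intro mult_left_mono) auto
  also have "\<dots> = 16 / t\<^sup>2 * (\<Sum>i\<in>UNIV. (v i)\<^sup>2)"
    using t0 by (simp add: power2_eq_square)
  finally show ?thesis unfolding power_mult_distrib .
qed

lemma LL_le_\<Gamma>:
  assumes w: "length w \<le> 2" and x: "norm x \<le> t + 3"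
  shows "(LL w x)\<^sup>2 \<le> \<Gamma> w x"
proof -
  let ?a = "1 / t\<^sup>2"
  let ?R = "\<Sum>i\<in>UNIV. x $ i * g (Transl i # w) x" and ?RP = "\<Sum>i\<in>UNIV. x $ i * g (Transl i # Scal # w) x"
  let ?Q = "g (Scal # Scal # w) x - g (Scal # w) x"
  have "LL w x = bx w x + 2 * ?a * ?R + - (2 * ?a * ?RP) + ?a * ?Q"
    unfolding LL_def equation[OF w] by (simp add: right_diff_distrib distrib_left)
  from this have "(LL w x)\<^sup>2 \<le> 4 * ((bx w x)\<^sup>2 + (2 * ?a * ?R)\<^sup>2 + (- (2 * ?a * ?RP))\<^sup>2 + (?a * ?Q)\<^sup>2)"
    by (simp only: sq_sum4_le)
  also have "\<dots> \<le> 4 * ((bx w x)\<^sup>2 + 16 / t\<^sup>2 * (\<Sum>i\<in>UNIV. (g (Transl i # w) x)\<^sup>2) + 16 / t\<^sup>2 * (\<Sum>i\<in>UNIV. (g (Transl i # Scal # w) x)\<^sup>2)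
     + 2 / t\<^sup>2 * ((g (Scal # Scal # w) x)\<^sup>2 + (g (Scal # w) x)\<^sup>2))"
  proof (intro mult_left_mono add_mono order_refl)
    show "(2 * ?a * ?R)\<^sup>2 \<le> 16 / t\<^sup>2 * (\<Sum>i\<in>UNIV. (g (Transl i # w) x)\<^sup>2)" by (rule scaled_radial_sq_le[OF x])
    show "(- (2 * ?a * ?RP))\<^sup>2 \<le> 16 / t\<^sup>2 * (\<Sum>i\<in>UNIV. (g (Transl i # Scal # w) x)\<^sup>2)" 
      unfolding power2_minus by (rule scaled_radial_sq_le[OF x])
    have "1 \<le> t\<^sup>2" using t0 by (simp add: one_le_power)
    then have "0 \<le> ?a" "?a \<le> 1" using t0 by (auto simp: divide_le_eq)
    then have "?a\<^sup>2 \<le> ?a" unfolding power2_eq_square[of ?a] by (rule mult_left_le[rotated])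
    then have "?a\<^sup>2 * ?Q\<^sup>2 \<le> ?a * (2 * ((g (Scal # Scal # w) x)\<^sup>2 + (g (Scal # w) x)\<^sup>2))"
      by (intro mult_mono sq_diff_le) auto
    then show "(?a * ?Q)\<^sup>2 \<le> 2 / t\<^sup>2 * ((g (Scal # Scal # w) x)\<^sup>2 + (g (Scal # w) x)\<^sup>2)"
      by (simp add: power_mult_distrib power_divide)
  qed simp
  also have "\<dots> = \<Gamma> w x" by (simp add: \<Gamma>_def)
  finally show ?thesis .
qed

lemma \<Gamma>_integral:
  assumes w: "w = [] \<or> (\<exists>l. w = [Transl l])"
  shows "\<Gamma> w integrable_on UNIV" "integral UNIV (\<Gamma> w) \<le> 400 * (F + A / t)\<^sup>2"
proof -
  have len: "length w \<le> 1" using w by auto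
  have b: "sq_integrable (bx w)" "L2sq (bx w) \<le> F\<^sup>2" using w bi bb by auto
  have I: "(\<Gamma> w has_integral (4 * L2sq (bx w) + 64 / t\<^sup>2 * (\<Sum>i\<in>UNIV. L2sq (g (Transl i # w))) + 64 / t\<^sup>2 * (\<Sum>i\<in>UNIV. L2sq (g (Transl i # Scal # w)))
     + 8 / t\<^sup>2 * (L2sq (g (Scal # Scal # w)) + L2sq (g (Scal # w))))) UNIV"
    unfolding \<Gamma>_def[abs_def]
    by (intro has_integral_add has_integral_mult_right has_integral_sum integrable_integral gi b finite) (use len in auto)
  then show "\<Gamma> w integrable_on UNIV" by blast
  have "integral UNIV (\<Gamma> w) \<le> 4 * F\<^sup>2 + 64 / t\<^sup>2 * (\<Sum>i\<in>(UNIV::3 set). A\<^sup>2) + 64 / t\<^sup>2 * (\<Sum>i\<in>(UNIV::3 set). A\<^sup>2) + 8 / t\<^sup>2 * (A\<^sup>2 + A\<^sup>2)"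
    unfolding integral_unique[OF I]
    by (intro add_mono mult_left_mono sum_mono gb b) (use len in auto)
  also have "\<dots> = 4 * F\<^sup>2 + 400 * (A / t)\<^sup>2" by (simp add: power_divide)
  also have "\<dots> \<le> 400 * (F + A / t)\<^sup>2"
  proof -
    have "0 \<le> F * (A / t)" using F0 Ap t0 by simp
    then show ?thesis using zero_le_power2[of F] by (simp add: power2_sum)
  qed
  finally show "integral UNIV (\<Gamma> w) \<le> 400 * (F + A / t)\<^sup>2" .
qed

definition EK :: "gamma list \<Rightarrow> real^3 \<Rightarrow> real" where
  "EK u x = ewt t (x \<bullet> x) * (((\<Sum>i\<in>UNIV. (g (Transl i # u) x)\<^sup>2) - (1/t\<^sup>2) * (\<Sum>i\<in>UNIV. x $ i * g (Transl i # u) x)\<^sup>2) + (7/t) * (\<Sum>i\<in>UNIV. (g (Transl i # u) x)\<^sup>2))"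

lemma EK_integral:
  assumes w: "w = [] \<or> (\<exists>l. w = [Transl l])"
  shows "comp_supp (EK (Transl k # w))" "integral UNIV (EK (Transl k # w)) \<le> 50000 * m0"
proof -
  have len: "length w \<le> 1" using w by auto
  have gr: "has_grad (g (Transl k # w)) (\<lambda>i. g (Transl i # Transl k # w))"
      "\<And>i. has_grad (g (Transl i # Transl k # w)) (\<lambda>j. g (Transl j # Transl i # Transl k # w))"
    using len by (intro g_grad; simp)+
  have sym: "g (Transl j # Transl i # Transl k # w) x = g (Transl i # Transl j # Transl k # w) x" for i j x
    using len by (intro g_sym) simp
  have \<Gamma>0: "0 \<le> \<Gamma> w x" for x by (simp add: \<Gamma>_def sum_nonneg)
  note E = elliptic_estimate_cut[OF t0(3) \<theta>_ge gr sym LL_pd[OF len] LL_cont[OF len] LL_eq[OF len] \<Gamma>_integral(1)[OF w] \<Gamma>0]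
  have E': "comp_supp (EK (Transl k # w)) \<and> integral UNIV (EK (Transl k # w)) \<le> 100 * (\<theta> * (L2sq (g (Transl k # w)) + (\<Sum>i\<in>UNIV. L2sq (g (Transl i # Transl k # w))))) + 100 * (integral UNIV (\<Gamma> w) / \<theta>)"
    unfolding EK_def[abs_def]
    by (intro conjI E LL_le_\<Gamma> gi) (use len in auto)
  then show "comp_supp (EK (Transl k # w))" by blast
  have "L2sq (g (Transl k # w)) + (\<Sum>i\<in>UNIV. L2sq (g (Transl i # Transl k # w))) \<le> A\<^sup>2 + (\<Sum>i\<in>(UNIV::3 set). A\<^sup>2)"
    using len by (intro add_mono sum_mono gb) auto
  then have "\<theta> * (L2sq (g (Transl k # w)) + (\<Sum>i\<in>UNIV. L2sq (g (Transl i # Transl k # w)))) \<le> \<theta> * (4 * A\<^sup>2)"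
    using \<theta>_pos by (intro mult_left_mono) auto
  also have "\<dots> = 4 * m0" using \<theta>A by simp
  finally have 1: "\<theta> * (L2sq (g (Transl k # w)) + (\<Sum>i\<in>UNIV. L2sq (g (Transl i # Transl k # w)))) \<le> 4 * m0" .
  have "integral UNIV (\<Gamma> w) / \<theta> \<le> 400 * (F + A / t)\<^sup>2 / \<theta>"
    using \<Gamma>_integral(2)[OF w] \<theta>_pos by (intro divide_right_mono) auto
  also have "\<dots> = 400 * m0" using FA\<theta> by (metis times_divide_eq_right)
  finally show "integral UNIV (EK (Transl k # w)) \<le> 50000 * m0" using E' 1 m0_pos by linarith
qed

text \<open>On the support of the weight |x|^2 < (t + 3)^2 <= t^2 + 7t, so t^2 times the bracket in
  \<open>EK\<close> is (t^2 + 7t) D - R^2 >= |x|^2 D - R^2. Nonnegativity of \<open>EK\<close> is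
  inherited from \<open>tang\<close>.\<close>

lemma EK_tang: "ewt t (x \<bullet> x) * tang x (\<lambda>i. g (Transl i # u) x) \<le> t\<^sup>2 * EK u x"
  and EK_nonneg: "0 \<le> EK u x"
proof -
  let ?D = "\<Sum>i\<in>UNIV. (g (Transl i # u) x)\<^sup>2" and ?R = "\<Sum>i\<in>UNIV. x $ i * g (Transl i # u) x"
  have D: "0 \<le> ?D" by (simp add: sum_nonneg)
  have "ewt t (x \<bullet> x) * tang x (\<lambda>i. g (Transl i # u) x) \<le> t\<^sup>2 * EK u x \<and> 0 \<le> EK u x"
  proof (cases "(t + 3)\<^sup>2 \<le> x \<bullet> x")
    case True
    then show ?thesis using t0 by (simp add: EK_def ewt_zero)
  next
    case False
    have "9 \<le> t" by (rule t0)
    then have "(t + 3)\<^sup>2 \<le> t\<^sup>2 + 7 * t" by (simp add: power2_eq_square algebra_simps)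
    then have "x \<bullet> x \<le> t\<^sup>2 + 7 * t" using False by linarith
    then have "(x \<bullet> x) * ?D \<le> (t\<^sup>2 + 7 * t) * ?D" using D by (intro mult_right_mono) auto
    then have T: "tang x (\<lambda>i. g (Transl i # u) x) \<le> t\<^sup>2 * ((?D - (1/t\<^sup>2) * ?R\<^sup>2) + (7/t) * ?D)"
    proof -
      have "t\<^sup>2 * ((?D - (1/t\<^sup>2) * ?R\<^sup>2) + (7/t) * ?D) = (t\<^sup>2 + 7 * t) * ?D - ?R\<^sup>2"
        using t0 by (simp add: right_diff_distrib distrib_left distrib_right power2_eq_square[of t])
      then show ?thesis using \<open>(x \<bullet> x) * ?D \<le> (t\<^sup>2 + 7 * t) * ?D\<close> unfolding tang_def by linarith
    qed
    have "ewt t (x \<bullet> x) * tang x (\<lambda>i. g (Transl i # u) x) \<le> ewt t (x \<bullet> x) * (t\<^sup>2 * ((?D - (1/t\<^sup>2) * ?R\<^sup>2) + (7/t) * ?D))"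
      using T ewt_bounds by (intro mult_left_mono) auto
    also have "\<dots> = t\<^sup>2 * EK u x" by (simp add: EK_def)
    finally have 1: "ewt t (x \<bullet> x) * tang x (\<lambda>i. g (Transl i # u) x) \<le> t\<^sup>2 * EK u x" .
    have "0 \<le> ewt t (x \<bullet> x) * tang x (\<lambda>i. g (Transl i # u) x)" using ewt_bounds tang_nonneg by simp
    then have "0 \<le> t\<^sup>2 * EK u x" using 1 by linarith
    then show ?thesis using 1 t0 by (simp add: zero_le_mult_iff)
  qed
  then show "ewt t (x \<bullet> x) * tang x (\<lambda>i. g (Transl i # u) x) \<le> t\<^sup>2 * EK u x" "0 \<le> EK u x" by auto
qed

text \<open>Here |x|^2/t^2 <= 1/4, so the form keeps 3/4 of the full gradient, and the weight is at
  least 1/2.\<close>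

lemma EK_inner:
  assumes "norm x \<le> t / 2"
  shows "1/3 * (g (Transl i # u) x)\<^sup>2 \<le> EK u x"
proof -
  let ?D = "\<Sum>i\<in>UNIV. (g (Transl i # u) x)\<^sup>2" and ?R = "\<Sum>i\<in>UNIV. x $ i * g (Transl i # u) x"
  have D: "0 \<le> ?D" by (simp add: sum_nonneg)
  have s: "x \<bullet> x \<le> t\<^sup>2 / 4"
    using power_mono[OF assms norm_ge_zero, of 2] by (simp add: power2_norm_eq_inner power_divide)
  have w: "1/2 \<le> ewt t (x \<bullet> x)" 
  proof (rule ewt_ge[OF t0(2)])
    have "0 \<le> t\<^sup>2" "t\<^sup>2 \<le> (t + 2)\<^sup>2" using t0 by (auto intro: power_mono)
    then show "x \<bullet> x \<le> (t + 2)\<^sup>2" using s by linarith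
  qed
  have "?R\<^sup>2 \<le> t\<^sup>2 / 4 * ?D"
    using radial_deriv_sq_le[of x "\<lambda>i. g (Transl i # u) x"] mult_right_mono[OF s D] by linarith
  then have "(1/t\<^sup>2) * ?R\<^sup>2 \<le> (1/t\<^sup>2) * (t\<^sup>2 / 4 * ?D)" by (intro mult_left_mono) auto
  also have "\<dots> = ?D / 4" using t0 by simp
  finally have 1: "3/4 * ?D \<le> (?D - (1/t\<^sup>2) * ?R\<^sup>2) + (7/t) * ?D" using D t0 by (simp add: add_increasing2)
  have "1/3 * (g (Transl i # u) x)\<^sup>2 \<le> 1/3 * ?D" using term_le_sum_sq[of "\<lambda>i. g (Transl i # u) x" i] by simp
  also have "\<dots> \<le> 1/2 * (3/4 * ?D)" using D by simp
  also have "\<dots> \<le> EK u x" unfolding EK_def using 1 w D by (intro mult_mono) auto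
  finally show ?thesis .
qed

text \<open>Well inside the cone the full second and third spatial derivatives have local norm of
  order sqrt m0, and the scaled Sobolev bound with R = t/8 applies without any logarithm. The first
  derivative contributes A t^(-3/2) up to a constant, which is below sqrt m0.\<close>

lemma near_bound:
  assumes r0: "norm x0 \<le> t / 4"
  shows "\<bar>g [Transl l] x0\<bar> \<le> 20000 * sqrt m0"
proof -
  have gr: "has_grad (g [Transl l]) (\<lambda>i. g [Transl i, Transl l])" "\<And>i. has_grad (g [Transl i, Transl l]) (\<lambda>j. g [Transl j, Transl i, Transl l])"
    by (intro g_grad; simp)+
  have sub: "norm x \<le> t / 2" if "x \<in> cball x0 (2 * (t / 8))" for x
    using that r0 norm_triangle_ineq[of "x - x0" x0] by (simp add: dist_norm norm_minus_commute)
  have loc: "loc_bd x0 (2 * (t / 8)) (400 * sqrt m0) (g (Transl i # Transl k # w))" if w: "w = [] \<or> (\<exists>l. w = [Transl l])" for i k w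
  proof -
    have "continuous_on UNIV (\<lambda>x. (g (Transl i # Transl k # w) x)\<^sup>2)"
      using w by (intro continuous_intros g_cont) auto
    then have "integral (cball x0 (2 * (t / 8))) (\<lambda>x. (g (Transl i # Transl k # w) x)\<^sup>2) \<le> (50000 * m0) / (1/3)"
      using sub EK_integral[OF w, of k]
      by (intro integral_le_of_weight[where K="EK (Transl k # w)"] EK_inner EK_nonneg) auto
    also have "\<dots> \<le> (400 * sqrt m0)\<^sup>2" using m0_pos by (simp add: power_mult_distrib)
    finally show ?thesis by (simp add: loc_bd_def)
  qed
  have "\<bar>g [Transl l] x0\<bar> \<le> 48 * (400 * sqrt m0) + A / (t / 8 * sqrt (t / 8))"
  proof (rule sobolev_scaled[OF gr])
    show "loc_bd x0 (2 * (t / 8)) (400 * sqrt m0) (g [Transl i, Transl l])" for i by (rule loc) simp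
    show "loc_bd x0 (2 * (t / 8)) (400 * sqrt m0) (g [Transl j, Transl i, Transl l])" for i j by (rule loc) simp
    show "loc_bd x0 (2 * (t / 8)) A (g [Transl l])" by (intro loc_bd_of_L2sq int1 bd1 g_cont) simp
  qed (use t100 Ap m0_pos in auto)
  also have "A / (t / 8 * sqrt (t / 8)) \<le> sqrt m0"
  proof -
    have "sqrt (t / 8) = sqrt t / sqrt 8" by (simp add: real_sqrt_divide)
    moreover have "sqrt 8 \<le> 3" by (rule real_le_lsqrt) auto
    moreover have "sqrt t / 3 \<le> sqrt t / sqrt 8" using calculation(2) t0 by (intro divide_left_mono) auto
    ultimately have "sqrt t / 3 \<le> sqrt (t / 8)" by simp
    moreover have "3 \<le> t / 8" using t100 by simp
    ultimately have "3 * (sqrt t / 3) \<le> t / 8 * sqrt (t / 8)" using t0 by (intro mult_mono) auto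
    then have "sqrt t \<le> t / 8 * sqrt (t / 8)" by simp
    then have "sqrt m0 * sqrt t \<le> sqrt m0 * (t / 8 * sqrt (t / 8))" by (rule mult_left_mono) (use m0_pos in simp)
    then have "A \<le> sqrt m0 * (t / 8 * sqrt (t / 8))" using A_div_t_le(3) by (rule order_trans[rotated])
    then show ?thesis using t0 by (simp add: pos_divide_le_eq)
  qed
  finally show ?thesis using m0_pos by simp
qed

text \<open>Near the cone \<open>EK\<close> retains only angular derivatives. Taken for the words of
  one and of two translations it bounds the angular parts of second and third derivatives in the
  bulk, which is what \<open>tang_trace\<close> converts into a trace on the shell.\<close>

lemma mid_bound:
  assumes r0: "norm x0 = r0" "t \<le> 4 * r0" "r0 \<le> t"
  shows "\<bar>g [Transl l] x0\<bar> \<le> 1000 * A / r0 + 21 * (120000 * sqrt m0) * ln r0"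
proof (rule sup_of_tang[OF r0(1,2)])
  show "0 < 120000 * sqrt m0" using m0_pos by simp
  fix S :: "(real^3) set" assume S: "compact S" "S \<subseteq> {x. r0 + 1/r0\<^sup>2 \<le> norm x \<and> norm x \<le> r0 + 2 * (1/r0\<^sup>2)}"
  define \<epsilon> where "\<epsilon> = 1/r0\<^sup>2"
  have r: "25 \<le> r0" using r0 t100 by linarith
  have \<epsilon>: "0 < \<epsilon>" "160 * \<epsilon> \<le> r0" "r0 * \<epsilon> \<le> 1" unfolding \<epsilon>_def by (rule eps_bounds[OF r])+
  have \<kappa>: "0 < 3 * r0 * \<epsilon>" using r \<epsilon> by simp
  let ?H1 = "\<lambda>i. g [Transl i, Transl l]" and ?H2 = "\<lambda>i j. g [Transl j, Transl i, Transl l]"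
  let ?Bd = "\<lambda>x. 80 * t ^ 3 * (EK [Transl l] x + (\<Sum>k\<in>UNIV. EK [Transl k, Transl l] x))"
  have gr: "has_grad (?H1 i) (?H2 i)" for i by (intro g_grad) simp
  have EKc: "comp_supp (EK [Transl l])" "comp_supp (EK [Transl k, Transl l])" for k by (intro EK_integral; simp)+
  have Bi: "(?Bd has_integral (80 * t ^ 3 * (integral UNIV (EK [Transl l]) + (\<Sum>k\<in>UNIV. integral UNIV (EK [Transl k, Transl l]))))) UNIV"
    by (intro has_integral_mult_right has_integral_add has_integral_sum integrable_integral comp_supp_integrable EKc finite)
  have H2s: "?H2 i j x = ?H2 j i x" for i j x by (intro g_sym) simp
  \<comment> \<open>The weight enters squared, so that its derivative carries a factor
    \<open>ewt\<close> and the hypothesis on p' follows from the bound 1/t for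
    \<open>ewt'\<close>.\<close>
  have pd: "((\<lambda>y. (ewt t y)\<^sup>2) has_real_derivative 2 * ewt t y * ewt' t y) (at y)" for y
    using DERIV_power[OF ewt_deriv[OF t0(1)], of 2 y] by (simp add: mult_ac)
  have pc: "continuous_on {0..} (\<lambda>y. 2 * ewt t y * ewt' t y)"
    by (intro continuous_intros ewt_cont ewt'_cont t0)
  have Bint: "?Bd integrable_on UNIV" using Bi by blast
  have bnd: "shellcut (r0\<^sup>2) (3 * r0 * \<epsilon>) (x \<bullet> x) = 0 \<or> (\<forall>i. ?H1 i x = 0 \<and> (\<forall>j. ?H2 i j x = 0)) \<or>
     0 \<le> (ewt t (x \<bullet> x))\<^sup>2 \<and> (ewt t (x \<bullet> x))\<^sup>2 \<le> ewt t (x \<bullet> x) \<and> 2 * (x \<bullet> x) * \<bar>2 * ewt t (x \<bullet> x) * ewt' t (x \<bullet> x)\<bar> \<le> 64 * t * ewt t (x \<bullet> x) \<and> norm x \<le> 2 * t" for x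
  proof (cases "r0\<^sup>2 + 2 * (3 * r0 * \<epsilon>) \<le> x \<bullet> x")
    case True
    then show ?thesis using shellcut_zero[OF \<kappa>] by blast
  next
    case False
    have "r0\<^sup>2 \<le> t\<^sup>2" using r0 r by (intro power_mono) auto
    moreover have "2 * (3 * r0 * \<epsilon>) \<le> 6" using \<epsilon> by simp
    moreover have "100 * t \<le> t\<^sup>2" using t100 by (simp add: power2_eq_square)
    ultimately have s: "x \<bullet> x \<le> (2 * t)\<^sup>2" using False t100 by (simp add: power_mult_distrib)
    then have nx: "norm x \<le> 2 * t" using t0 by (simp add: norm_le_square)
    have w: "0 \<le> ewt t (x \<bullet> x)" "ewt t (x \<bullet> x) \<le> 1" by (rule ewt_bounds)+
    have "2 * (x \<bullet> x) * \<bar>2 * ewt t (x \<bullet> x) * ewt' t (x \<bullet> x)\<bar> = ewt t (x \<bullet> x) * (4 * (x \<bullet> x) * \<bar>ewt' t (x \<bullet> x)\<bar>)"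
      using w by (simp add: abs_mult)
    also have "4 * (x \<bullet> x) * \<bar>ewt' t (x \<bullet> x)\<bar> \<le> 4 * (2 * t)\<^sup>2 * (1 / t)"
      using s ewt'_abs[OF t0(1), of "x \<bullet> x"] by (intro mult_mono) auto
    then have "ewt t (x \<bullet> x) * (4 * (x \<bullet> x) * \<bar>ewt' t (x \<bullet> x)\<bar>) \<le> ewt t (x \<bullet> x) * (64 * t)"
      using w t0 by (intro mult_left_mono) (auto simp: power2_eq_square)
    finally have "2 * (x \<bullet> x) * \<bar>2 * ewt t (x \<bullet> x) * ewt' t (x \<bullet> x)\<bar> \<le> 64 * t * ewt t (x \<bullet> x)" by (simp add: mult_ac)
    moreover have "(ewt t (x \<bullet> x))\<^sup>2 \<le> ewt t (x \<bullet> x)" using w by (simp add: power2_eq_square mult_left_le)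
    ultimately show ?thesis using nx by simp
  qed
  have BdL: "80 * t * (if shellcut (r0\<^sup>2) (3 * r0 * \<epsilon>) (x \<bullet> x) = 0 then 0 else ewt t (x \<bullet> x)) * (tang x (\<lambda>i. ?H1 i x) + (\<Sum>k\<in>UNIV. tang x (\<lambda>i. ?H2 k i x))) \<le> ?Bd x" for x
  proof -
    have nn: "0 \<le> tang x (\<lambda>i. ?H1 i x) + (\<Sum>k\<in>UNIV. tang x (\<lambda>i. ?H2 k i x))" by (intro add_nonneg_nonneg sum_nonneg tang_nonneg)
    have "80 * t * (if shellcut (r0\<^sup>2) (3 * r0 * \<epsilon>) (x \<bullet> x) = 0 then 0 else ewt t (x \<bullet> x)) * (tang x (\<lambda>i. ?H1 i x) + (\<Sum>k\<in>UNIV. tang x (\<lambda>i. ?H2 k i x)))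
      \<le> 80 * t * ewt t (x \<bullet> x) * (tang x (\<lambda>i. ?H1 i x) + (\<Sum>k\<in>UNIV. tang x (\<lambda>i. ?H2 k i x)))"
      using nn t0 ewt_bounds by (intro mult_right_mono mult_left_mono) auto
    also have "\<dots> = 80 * t * (ewt t (x \<bullet> x) * tang x (\<lambda>i. ?H1 i x) + (\<Sum>k\<in>UNIV. ewt t (x \<bullet> x) * tang x (\<lambda>i. ?H2 k i x)))"
      by (simp add: distrib_left sum_distrib_left mult_ac)
    also have "\<dots> \<le> 80 * t * (t\<^sup>2 * EK [Transl l] x + (\<Sum>k\<in>UNIV. t\<^sup>2 * EK [Transl k, Transl l] x))"
      using t0 by (intro mult_left_mono add_mono sum_mono EK_tang) auto
    also have "\<dots> = ?Bd x" by (simp add: power2_eq_square power3_eq_cube distrib_left mult_ac flip: sum_distrib_left)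
    finally show ?thesis .
  qed
  note tt = tang_trace[OF t0(2) \<kappa> gr H2s pd pc ewt_cont[OF t0(1)] bnd Bint BdL]
  have tt': "comp_supp (\<lambda>x. shell (r0\<^sup>2) (3 * r0 * \<epsilon>) (x \<bullet> x) * (2 * (x \<bullet> x) * (ewt t (x \<bullet> x))\<^sup>2 * tang x (\<lambda>i. ?H1 i x))) \<and>
    integral UNIV (\<lambda>x. shell (r0\<^sup>2) (3 * r0 * \<epsilon>) (x \<bullet> x) * (2 * (x \<bullet> x) * (ewt t (x \<bullet> x))\<^sup>2 * tang x (\<lambda>i. ?H1 i x))) \<le> integral UNIV ?Bd"
    by (intro conjI tt)
  have "integral UNIV ?Bd \<le> 80 * t ^ 3 * (50000 * m0 + (\<Sum>k\<in>(UNIV::3 set). 50000 * m0))"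
    unfolding integral_unique[OF Bi] using t0 by (intro mult_left_mono add_mono sum_mono EK_integral) auto
  also have "\<dots> = 16000000 * (t ^ 3 * m0)" by simp
  finally have B: "integral UNIV (\<lambda>x. shell (r0\<^sup>2) (3 * r0 * \<epsilon>) (x \<bullet> x) * (2 * (x \<bullet> x) * (ewt t (x \<bullet> x))\<^sup>2 * tang x (\<lambda>i. ?H1 i x))) \<le> 16000000 * (t ^ 3 * m0)"
    using tt' by linarith
  have c: "0 < r0 / (12 * \<epsilon>)" using r \<epsilon> by simp
  have "integral S (\<lambda>x. tang x (\<lambda>i. ?H1 i x)) \<le> 16000000 * (t ^ 3 * m0) / (r0 / (12 * \<epsilon>))"
  proof (rule integral_le_of_weight[OF S(1) _ conjunct1[OF tt'] _ c _ B])
    show "continuous_on UNIV (\<lambda>x. tang x (\<lambda>i. ?H1 i x))" unfolding tang_def by (intro continuous_intros g_cont; simp)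
    show "0 \<le> shell (r0\<^sup>2) (3 * r0 * \<epsilon>) (x \<bullet> x) * (2 * (x \<bullet> x) * (ewt t (x \<bullet> x))\<^sup>2 * tang x (\<lambda>i. ?H1 i x))" for x
      using shell_nonneg[OF \<kappa>] tang_nonneg by simp
    fix x assume "x \<in> S"
    then have x: "r0 + \<epsilon> \<le> norm x" "norm x \<le> r0 + 2 * \<epsilon>" using S by (auto simp: \<epsilon>_def)
    have "\<epsilon> \<le> 1" using \<epsilon>(3) r mult_right_mono[of 1 r0 \<epsilon>] \<epsilon>(1) by linarith
    \<comment> \<open>The shell may stick out of the cone, by at most 2; the weight reaches up to t
      + 3 and is therefore still at least 1/2 there.\<close>
    then have "norm x \<le> t + 2" using x r0 by linarith
    then have "x \<bullet> x \<le> (t + 2)\<^sup>2" using t0 by (simp add: norm_le_square)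
    then have w: "1/2 \<le> ewt t (x \<bullet> x)" by (rule ewt_ge[OF t0(2)])
    have w2: "1/4 \<le> (ewt t (x \<bullet> x))\<^sup>2" using power_mono[OF w, of 2] by (simp add: power_divide)
    have "r0 / (12 * \<epsilon>) * tang x (\<lambda>i. ?H1 i x) = 1 / (6 * r0 * \<epsilon>) * (2 * r0\<^sup>2 * (1/4) * tang x (\<lambda>i. ?H1 i x))"
      using r \<epsilon> by (simp add: power2_eq_square)
    also have "\<dots> \<le> shell (r0\<^sup>2) (3 * r0 * \<epsilon>) (x \<bullet> x) * (2 * (x \<bullet> x) * (ewt t (x \<bullet> x))\<^sup>2 * tang x (\<lambda>i. ?H1 i x))"
      using shell_ge'[OF \<epsilon>(1,2) x] shell_nonneg[OF \<kappa>] w2 shell_region_bounds[OF \<epsilon>(1,2) x] tang_nonneg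
      by (intro mult_mono) auto
    finally show "r0 / (12 * \<epsilon>) * tang x (\<lambda>i. ?H1 i x) \<le> shell (r0\<^sup>2) (3 * r0 * \<epsilon>) (x \<bullet> x) * (2 * (x \<bullet> x) * (ewt t (x \<bullet> x))\<^sup>2 * tang x (\<lambda>i. ?H1 i x))" .
  qed
  also have "\<dots> = 192000000 * (\<epsilon> * m0 * (t ^ 3 / r0))" using r \<epsilon> by simp
  also have "\<dots> \<le> 192000000 * (\<epsilon> * m0 * (64 * r0\<^sup>2))"
  proof -
    have "t ^ 3 \<le> (4 * r0) ^ 3" using r0 t0 by (intro power_mono) auto
    then have "t ^ 3 / r0 \<le> 64 * r0\<^sup>2" using r by (simp add: field_simps power2_eq_square power3_eq_cube)
    then show ?thesis using \<epsilon> m0_pos by (intro mult_left_mono) auto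
  qed
  also have "\<dots> \<le> \<epsilon> * (r0 * (120000 * sqrt m0))\<^sup>2"
    using \<epsilon> m0_pos by (simp add: power_mult_distrib mult_ac)
  finally show "integral S (\<lambda>x. tang x (\<lambda>i. ?H1 i x)) \<le> 1/r0\<^sup>2 * (r0 * (120000 * sqrt m0))\<^sup>2" by (simp add: \<epsilon>_def)
qed

end

section \<open>Outside the cone, and the time derivative\<close>

context slice_energy
begin

text \<open>The Rellich estimate for a derivative \<partial>_l \<phi>, with P = S \<partial>_l
  \<phi> and Q = (S^2 - S) \<partial>_l \<phi>. The second claim reads off the radial part: for r0
  >= 2t its coefficient is at least r0^2 / (4 t^2), the gain that the time derivative needs far out.
  The constants come from 480 = 40 (3 + 1 + 3 + 4) + 40 and the lower bound 1/30 for the weight on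
  the shell.\<close>

lemma far_energy:
  fixes S :: "(real^3) set"
  assumes r0: "t \<le> r0" and S: "compact S" "S \<subseteq> {x. r0 + 1/r0\<^sup>2 \<le> norm x \<and> norm x \<le> r0 + 2 * (1/r0\<^sup>2)}"
  shows "integral S (\<lambda>x. tang x (\<lambda>i. g [Transl i, Transl l] x)) \<le> 14400 * m0"
    and "2 * t \<le> r0 \<Longrightarrow> integral S (\<lambda>x. (\<Sum>i\<in>UNIV. x $ i * g [Transl i, Transl l] x)\<^sup>2) \<le> 57600 * (t\<^sup>2 / r0\<^sup>2) * m0"
proof -
  define \<epsilon> where "\<epsilon> = 1/r0\<^sup>2"
  have r: "25 \<le> r0" using r0 t100 by linarith
  have \<epsilon>: "0 < \<epsilon>" "160 * \<epsilon> \<le> r0" "r0 * \<epsilon> \<le> 1" unfolding \<epsilon>_def by (rule eps_bounds[OF r])+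
  have \<epsilon>r: "r0\<^sup>2 * \<epsilon> = 1" using r by (simp add: \<epsilon>_def)
  have \<kappa>: "0 < 3 * r0 * \<epsilon>" using r \<epsilon> by simp
  have s0: "t\<^sup>2 \<le> r0\<^sup>2" using r0 t0 by (intro power_mono) auto
  let ?Q = "\<lambda>x. g [Scal, Scal, Transl l] x - g [Scal, Transl l] x"
  have Qi: "((\<lambda>x. 2 * ((g [Scal, Scal, Transl l] x)\<^sup>2 + (g [Scal, Transl l] x)\<^sup>2)) has_integral
      2 * (L2sq (g [Scal, Scal, Transl l]) + L2sq (g [Scal, Transl l]))) UNIV"
    by (intro has_integral_mult_right has_integral_add integrable_integral gi) auto
  have Q: "sq_integrable ?Q" "L2sq ?Q \<le> 2 * (A\<^sup>2 + A\<^sup>2)"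
  proof -
    have c: "continuous_on UNIV ?Q" by (intro continuous_intros g_cont) auto
    show "sq_integrable ?Q" by (rule sq_integrable_bound(1)[OF c sq_diff_le has_integral_integrable[OF Qi]])
    have "L2sq ?Q \<le> 2 * (L2sq (g [Scal, Scal, Transl l]) + L2sq (g [Scal, Transl l]))"
      using sq_integrable_bound(2)[OF c sq_diff_le has_integral_integrable[OF Qi]] integral_unique[OF Qi] by simp
    also have "\<dots> \<le> 2 * (A\<^sup>2 + A\<^sup>2)" by (intro mult_left_mono add_mono gb) auto
    finally show "L2sq ?Q \<le> 2 * (A\<^sup>2 + A\<^sup>2)" .
  qed
  let ?T = "\<lambda>x. tang x (\<lambda>i. g [Transl i, Transl l] x)" and ?R = "\<lambda>x. \<Sum>i\<in>UNIV. x $ i * g [Transl i, Transl l] x"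
  let ?W = "\<lambda>x::real^3. shell (r0\<^sup>2) (3 * r0 * \<epsilon>) (x \<bullet> x) * (1 / sqrt (t\<^sup>2 + x \<bullet> x))"
  let ?K = "\<lambda>x. ?W x * (?T x + ((1/t\<^sup>2) * (x \<bullet> x) - 1) / 2 * (?R x)\<^sup>2)"
  have pdl: "pd i (g [Transl l]) (g [Transl i, Transl l])" for i by (intro has_grad_pd g_grad) simp
  have gr: "has_grad (g [Transl i, Transl l]) (\<lambda>j. g [Transl j, Transl i, Transl l])" for i by (intro g_grad) simp
  have gP: "has_grad (g [Scal, Transl l]) (\<lambda>i. g [Transl i, Scal, Transl l])" by (intro g_grad) simp
  have sym: "g [Transl j, Transl i, Transl l] x = g [Transl i, Transl j, Transl l] x" for i j x by (intro g_sym) simp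
  have eq: "(\<Sum>i\<in>UNIV. g [Transl i, Transl i, Transl l] x) - (1 / t\<^sup>2) * (\<Sum>i\<in>UNIV. \<Sum>j\<in>UNIV. x $ i * x $ j * g [Transl j, Transl i, Transl l] x)
    = bx [Transl l] x + (1 / t\<^sup>2) * (2 * ?R x - 2 * (\<Sum>i\<in>UNIV. x $ i * g [Transl i, Scal, Transl l] x) + ?Q x)" for x
    by (rule equation) simp
  have sq: "sq_integrable (g [Transl i, Transl l])" "sq_integrable (g [Scal, Transl l])" "sq_integrable (g [Transl i, Scal, Transl l])" for i
    by (intro gi; simp)+
  note re = rellich_estimate[OF t0(2) \<theta>_ge s0 \<kappa> pdl gr sym gP eq sq Q(1) bi(2)]
  have Kc: "comp_supp ?K" by (rule re(1))
  have "integral UNIV ?K \<le> 40 * (\<theta> * ((\<Sum>i\<in>UNIV. L2sq (g [Transl i, Transl l])) + L2sq (g [Scal, Transl l]) + (\<Sum>i\<in>UNIV. L2sq (g [Transl i, Scal, Transl l])) + L2sq ?Q))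
     + 40 * (L2sq (bx [Transl l]) / \<theta>)"
    by (rule re(2))
  also have "\<dots> \<le> 40 * (\<theta> * ((\<Sum>i\<in>(UNIV::3 set). A\<^sup>2) + A\<^sup>2 + (\<Sum>i\<in>(UNIV::3 set). A\<^sup>2) + 2 * (A\<^sup>2 + A\<^sup>2))) + 40 * (F\<^sup>2 / \<theta>)"
    using \<theta>_pos by (intro add_mono mult_left_mono divide_right_mono sum_mono gb bb Q) auto
  also have "\<dots> = 440 * (\<theta> * A\<^sup>2) + 40 * (F\<^sup>2 / \<theta>)" by simp
  also have "\<dots> \<le> 480 * m0" using F\<theta> \<theta>A by simp
  finally have B: "integral UNIV ?K \<le> 480 * m0" .
  have W0: "0 \<le> ?W x" for x using shell_nonneg[OF \<kappa>] by simp
  have K0: "0 \<le> ?K x" for x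
  proof (cases "x \<bullet> x \<le> r0\<^sup>2")
    case True
    then show ?thesis by (simp add: shell_zero[OF \<kappa>])
  next
    case False
    then have "1 \<le> (1/t\<^sup>2) * (x \<bullet> x)" using s0 t0 by (simp add: pos_le_divide_eq)
    then have "0 \<le> ?T x + ((1/t\<^sup>2) * (x \<bullet> x) - 1) / 2 * (?R x)\<^sup>2"
      by (intro add_nonneg_nonneg tang_nonneg mult_nonneg_nonneg) auto
    then show ?thesis using W0 by (rule mult_nonneg_nonneg[rotated])
  qed
  have t4: "t \<le> 4 * r0" using r0 t0 by linarith
  have x: "r0 + \<epsilon> \<le> norm x" "norm x \<le> r0 + 2 * \<epsilon>" if "x \<in> S" for x using S that by (auto simp: \<epsilon>_def)
  have W: "1 / 30 \<le> ?W x" if "x \<in> S" for x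
    using shell_weight_ge[OF \<epsilon>(1,2) x[OF that] t0(1) t4] by (simp add: \<epsilon>r mult.assoc)
  have s: "(1/t\<^sup>2) * r0\<^sup>2 \<le> (1/t\<^sup>2) * (x \<bullet> x)" if "x \<in> S" for x
    using shell_region_bounds(1)[OF \<epsilon>(1,2) x[OF that]] by (intro mult_left_mono) auto
  have s1: "1 \<le> (1/t\<^sup>2) * r0\<^sup>2" using s0 t0 by (simp add: pos_le_divide_eq)
  have "integral S ?T \<le> 480 * m0 / (1/30)"
  proof (rule integral_le_of_weight[OF S(1) _ Kc K0 _ _ B])
    show "continuous_on UNIV ?T" unfolding tang_def by (intro continuous_intros g_cont; simp)
    fix x assume xS: "x \<in> S"
    have "?T x \<le> ?T x + ((1/t\<^sup>2) * (x \<bullet> x) - 1) / 2 * (?R x)\<^sup>2"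
      using s[OF xS] s1 by simp
    then show "1/30 * ?T x \<le> ?K x" using W[OF xS] W0 tang_nonneg by (intro mult_mono) auto
  qed simp
  then show "integral S ?T \<le> 14400 * m0" by simp
  assume r2: "2 * t \<le> r0"
  have "(2 * t)\<^sup>2 \<le> r0\<^sup>2" using r2 t0 by (intro power_mono) auto
  then have s4: "4 \<le> (1/t\<^sup>2) * r0\<^sup>2" using t0 by (simp add: pos_le_divide_eq power_mult_distrib)
  let ?c = "1/30 * ((1/t\<^sup>2) * r0\<^sup>2 / 4)"
  have "integral S (\<lambda>x. (?R x)\<^sup>2) \<le> 480 * m0 / ?c"
  proof (rule integral_le_of_weight[OF S(1) _ Kc K0 _ _ B])
    show "continuous_on UNIV (\<lambda>x. (?R x)\<^sup>2)" by (intro continuous_intros g_cont; simp)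
    show "0 < ?c" using s4 by simp
    fix x assume xS: "x \<in> S"
    have "p / 4 \<le> (q - 1) / 2" if "p \<le> q" "4 \<le> p" for p q :: real using that by (simp add: field_simps)
    from this[OF s[OF xS] s4] have "(1/t\<^sup>2) * r0\<^sup>2 / 4 \<le> ((1/t\<^sup>2) * (x \<bullet> x) - 1) / 2" .
    then have "(1/t\<^sup>2) * r0\<^sup>2 / 4 * (?R x)\<^sup>2 \<le> ((1/t\<^sup>2) * (x \<bullet> x) - 1) / 2 * (?R x)\<^sup>2" by (intro mult_right_mono) auto
    then have "(1/t\<^sup>2) * r0\<^sup>2 / 4 * (?R x)\<^sup>2 \<le> ?T x + ((1/t\<^sup>2) * (x \<bullet> x) - 1) / 2 * (?R x)\<^sup>2"
      using tang_nonneg[of x "\<lambda>i. g [Transl i, Transl l] x"] by linarith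
    then have "1/30 * ((1/t\<^sup>2) * r0\<^sup>2 / 4 * (?R x)\<^sup>2) \<le> ?K x"
      using W[OF xS] W0 by (intro mult_mono) auto
    then show "?c * (?R x)\<^sup>2 \<le> ?K x" by (simp only: mult.assoc)
  qed
  also have "\<dots> = 57600 * (t\<^sup>2 / r0\<^sup>2) * m0" using t0 r by simp
  finally show "integral S (\<lambda>x. (?R x)\<^sup>2) \<le> 57600 * (t\<^sup>2 / r0\<^sup>2) * m0" .
qed

lemma far_bound:
  assumes r0: "norm x0 = r0" "t \<le> r0"
  shows "\<bar>g [Transl l] x0\<bar> \<le> 1000 * A / r0 + 21 * (120 * sqrt m0) * ln r0"
proof (rule sup_of_tang[OF r0(1)])
  have r: "0 < r0" using r0 t0 by linarith
  show "t \<le> 4 * r0" using r0 t0 by linarith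
  show "0 < 120 * sqrt m0" using m0_pos by simp
  fix S :: "(real^3) set" assume S: "compact S" "S \<subseteq> {x. r0 + 1/r0\<^sup>2 \<le> norm x \<and> norm x \<le> r0 + 2 * (1/r0\<^sup>2)}"
  have "1/r0\<^sup>2 * (r0 * (120 * sqrt m0))\<^sup>2 = 14400 * m0" using r m0_pos by (simp add: power_mult_distrib)
  then show "integral S (\<lambda>x. tang x (\<lambda>i. g [Transl i, Transl l] x)) \<le> 1/r0\<^sup>2 * (r0 * (120 * sqrt m0))\<^sup>2"
    using far_energy(1)[OF r0(2) S] by simp
qed

text \<open>The three regimes meet at |x0| = t/4 and |x0| = t. In the outer two A/|x0| is at most
  4A/t, which sqrt m0 absorbs.\<close>

lemma spatial_bound: "\<bar>g [Transl l] x0\<bar> \<le> 3000000 * sqrt m0 * (1 + ln (jap x0))"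
proof -
  have j1: "1 \<le> jap x0" "norm x0 \<le> jap x0" by (auto simp: jap_def intro!: real_le_rsqrt)
  have l0: "0 \<le> ln (jap x0)" using j1 by simp
  have m: "0 \<le> sqrt m0" using m0_pos by simp
  consider "norm x0 \<le> t / 4" | "t \<le> 4 * norm x0" "norm x0 \<le> t" | "t \<le> norm x0" by linarith
  then have "\<bar>g [Transl l] x0\<bar> \<le> 20000 * sqrt m0 \<or> (t \<le> 4 * norm x0 \<and> \<bar>g [Transl l] x0\<bar> \<le> 1000 * A / norm x0 + 21 * (120000 * sqrt m0) * ln (norm x0))"
  proof cases
    case 1 then show ?thesis using near_bound by blast
  next
    case 2 then show ?thesis using mid_bound[OF refl, of x0] by blast
  next
    case 3
    then have "0 \<le> sqrt m0 * ln (norm x0)" using m t100 by (intro mult_nonneg_nonneg) auto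
    moreover have "t \<le> 4 * norm x0" using 3 t0 by linarith
    ultimately show ?thesis using far_bound[OF refl 3, of l] by linarith
  qed
  then show ?thesis
  proof
    assume "\<bar>g [Transl l] x0\<bar> \<le> 20000 * sqrt m0"
    moreover have "20000 * sqrt m0 * 1 \<le> 3000000 * sqrt m0 * (1 + ln (jap x0))" using l0 m by (intro mult_mono) auto
    ultimately show ?thesis by linarith
  next
    assume *: "t \<le> 4 * norm x0 \<and> \<bar>g [Transl l] x0\<bar> \<le> 1000 * A / norm x0 + 21 * (120000 * sqrt m0) * ln (norm x0)"
    then have n: "t / 4 \<le> norm x0" "1 \<le> norm x0" using t100 by auto
    have "1000 * A / norm x0 \<le> 1000 * A / (t / 4)" using n t0 Ap by (intro divide_left_mono mult_pos_pos) auto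
    also have "\<dots> = 4000 * (A / t)" by simp
    also have "\<dots> \<le> 4000 * (sqrt m0 / 10)" using A_div_t_le(2) by (rule mult_left_mono) simp
    finally have 1: "1000 * A / norm x0 \<le> 400 * sqrt m0" by simp
    have "0 < norm x0" using n by linarith
    then have "ln (norm x0) \<le> ln (jap x0)" using j1 ln_le_cancel_iff[of "norm x0" "jap x0"] by linarith
    then have "sqrt m0 * ln (norm x0) \<le> sqrt m0 * ln (jap x0)" using m by (rule mult_left_mono)
    moreover have "0 \<le> sqrt m0 * ln (jap x0)" using m l0 by simp
    ultimately show ?thesis using * 1 m unfolding distrib_left mult.assoc by linarith
  qed
qed

lemma scaling_bound: "\<bar>g [Scal] x0\<bar> \<le> 49 * A"
proof -
  have "\<bar>g [Scal] x0\<bar> \<le> 48 * A + A / (1 * sqrt 1)"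
    by (rule sobolev_scaled[of _ "\<lambda>i. g [Transl i, Scal]" "\<lambda>i j. g [Transl j, Transl i, Scal]"])
      (auto intro!: g_grad loc_bd_of_L2sq g_cont gi gb simp: Ap)
  then show ?thesis by simp
qed

lemma h_sq_le: "(h w x)\<^sup>2 \<le> 2 / t\<^sup>2 * ((g (Scal # w) x)\<^sup>2 + (\<Sum>i\<in>UNIV. x $ i * g (Transl i # w) x)\<^sup>2)"
proof -
  have "h w x = (g (Scal # w) x - (\<Sum>i\<in>UNIV. x $ i * g (Transl i # w) x)) / t"
    using g_Scal[of w x] t0 by simp
  then have "(h w x)\<^sup>2 = 1 / t\<^sup>2 * (g (Scal # w) x - (\<Sum>i\<in>UNIV. x $ i * g (Transl i # w) x))\<^sup>2"
    by (simp add: power_divide)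
  also have "\<dots> \<le> 1 / t\<^sup>2 * (2 * ((g (Scal # w) x)\<^sup>2 + (\<Sum>i\<in>UNIV. x $ i * g (Transl i # w) x)\<^sup>2))"
    by (intro mult_left_mono sq_diff_le) auto
  finally show ?thesis by simp
qed

text \<open>The square of t \<partial>_t = S - x . \<partial>, integrated where |x|^2 <= D, reduces
  \<open>h\<close> to words.\<close>

lemma h_integral_le:
  assumes S: "compact S" "\<And>x. x \<in> S \<Longrightarrow> x \<bullet> x \<le> D" "0 \<le> D" and w: "length w \<le> 3"
    and a: "integral S (\<lambda>x. (g (Scal # w) x)\<^sup>2) \<le> a" "\<And>i. integral S (\<lambda>x. (g (Transl i # w) x)\<^sup>2) \<le> a"
  shows "integral S (\<lambda>x. (h w x)\<^sup>2) \<le> 2 / t\<^sup>2 * (a + D * (3 * a))"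
proof -
  have c: "(\<lambda>x. (g (v # w) x)\<^sup>2) integrable_on S" for v
    using w by (intro integrable_on_compact[OF S(1)] continuous_intros continuous_on_subset[OF g_cont]) auto
  have I: "((\<lambda>x. 2 / t\<^sup>2 * ((g (Scal # w) x)\<^sup>2 + D * (\<Sum>i\<in>UNIV. (g (Transl i # w) x)\<^sup>2))) has_integral
      2 / t\<^sup>2 * (integral S (\<lambda>x. (g (Scal # w) x)\<^sup>2) + D * (\<Sum>i\<in>UNIV. integral S (\<lambda>x. (g (Transl i # w) x)\<^sup>2)))) S"
    by (intro has_integral_mult_right has_integral_add has_integral_sum integrable_integral c finite)
  have "integral S (\<lambda>x. (h w x)\<^sup>2) \<le> integral S (\<lambda>x. 2 / t\<^sup>2 * ((g (Scal # w) x)\<^sup>2 + D * (\<Sum>i\<in>UNIV. (g (Transl i # w) x)\<^sup>2)))"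
  proof (rule integral_le)
    show "(\<lambda>x. (h w x)\<^sup>2) integrable_on S"
      by (intro integrable_on_compact[OF S(1)] continuous_intros continuous_on_subset[OF h_cont[OF w]]) auto
    fix x assume x: "x \<in> S"
    have "(\<Sum>i\<in>UNIV. x $ i * g (Transl i # w) x)\<^sup>2 \<le> D * (\<Sum>i\<in>UNIV. (g (Transl i # w) x)\<^sup>2)"
      by (rule order_trans[OF radial_deriv_sq_le]) (use S(2)[OF x] in \<open>intro mult_right_mono sum_nonneg, auto\<close>)
    then have "2 / t\<^sup>2 * ((g (Scal # w) x)\<^sup>2 + (\<Sum>i\<in>UNIV. x $ i * g (Transl i # w) x)\<^sup>2)
        \<le> 2 / t\<^sup>2 * ((g (Scal # w) x)\<^sup>2 + D * (\<Sum>i\<in>UNIV. (g (Transl i # w) x)\<^sup>2))"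
      by (intro mult_left_mono add_left_mono) auto
    then show "(h w x)\<^sup>2 \<le> 2 / t\<^sup>2 * ((g (Scal # w) x)\<^sup>2 + D * (\<Sum>i\<in>UNIV. (g (Transl i # w) x)\<^sup>2))"
      using h_sq_le order_trans by blast
  qed (use I in blast)
  also have "\<dots> \<le> 2 / t\<^sup>2 * (a + D * (\<Sum>i\<in>(UNIV::3 set). a))"
    unfolding integral_unique[OF I] by (intro mult_left_mono add_mono sum_mono a S(3)) auto
  finally show ?thesis by simp
qed

text \<open>Beyond 2t the relation t \<partial>_t = S - x . \<partial> would lose |x|/t pointwise,
  so the shell argument is applied to \<partial>_t \<phi> itself. Its angular energy is at most
  |x|^2 times the squares of \<partial>_t \<partial>_a \<phi>, and the same relation, used under the
  integral, splits these into a scaling part of size (A/t)^2 and a radial part that the factor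
  t^2/r0^2 of \<open>far_energy\<close> saves. The factors r0 in \<open>N\<close> and
  \<open>\<beta>\<close> disappear in 20 N / r0 and in sqrt(20 \<epsilon>) <= 5/r0.\<close>

lemma time_bound_far:
  assumes r0: "norm x0 = r0" "2 * t \<le> r0"
  shows "\<bar>h [] x0\<bar> \<le> 500 * sqrt m0 + 21000 * sqrt m0 * ln r0"
proof -
  define \<epsilon> where "\<epsilon> = 1/r0\<^sup>2"
  have r: "200 \<le> r0" "25 \<le> r0" "t \<le> r0" "t \<le> 4 * r0" using r0 t100 by auto
  have rp: "0 < r0" using r by simp
  have \<epsilon>: "0 < \<epsilon>" "160 * \<epsilon> \<le> r0" "r0 * \<epsilon> \<le> 1" unfolding \<epsilon>_def by (rule eps_bounds[OF r(2)])+
  have \<epsilon>1: "20 * \<epsilon> \<le> 1"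
  proof -
    have "200 * \<epsilon> \<le> r0 * \<epsilon>" using r \<epsilon> by (intro mult_right_mono) auto
    then show ?thesis using \<epsilon> by linarith
  qed
  define N where "N = 60 * (r0 * (A / t))"
  define \<beta> where "\<beta> = 105 * (6 * (r0 * (A / t))) * sqrt (20 * \<epsilon>)"
  have At0: "0 < A / t" using Ap t0 by simp
  have "\<bar>h [] x0\<bar> \<le> \<beta> + 7 * (1000 * sqrt m0) * ln (r0 / \<epsilon>) + 20 * N / r0"
  proof (rule shell_sup_bound[OF r0(1) \<epsilon>(1,2)])
    show "has_grad (h []) (\<lambda>i. h [Transl i])" by (rule h_grad) simp
    show "0 < 1000 * sqrt m0" using m0_pos by simp
    show "0 < N" unfolding N_def using At0 rp by (intro mult_pos_pos) auto
    show "\<bar>h [] y - h [] x0\<bar> \<le> \<beta>" if y: "norm (y - x0) \<le> 20 * \<epsilon>" for y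
    proof -
      have loc: "loc_bd x0 3 (6 * (r0 * (A / t))) (h w)" if w: "length w \<le> 2" for w
      proof -
        have b: "x \<bullet> x \<le> (11/10 * r0)\<^sup>2" if "x \<in> cball x0 3" for x
        proof -
          have "norm x \<le> norm x0 + norm (x - x0)" by (rule norm_triangle_sub)
          then have "norm x \<le> 11/10 * r0" using that r0 r by (simp add: dist_norm norm_minus_commute)
          then have "(norm x)\<^sup>2 \<le> (11/10 * r0)\<^sup>2" by (intro power_mono) auto
          then show ?thesis by (simp add: power2_norm_eq_inner)
        qed
        have "integral (cball x0 3) (\<lambda>x. (g (v # w) x)\<^sup>2) \<le> A\<^sup>2" for v
          using loc_bd_of_L2sq[of "g (v # w)" A x0 3] w g_cont gi gb by (simp add: loc_bd_def)
        then have "integral (cball x0 3) (\<lambda>x. (h w x)\<^sup>2) \<le> 2 / t\<^sup>2 * (A\<^sup>2 + (11/10 * r0)\<^sup>2 * (3 * A\<^sup>2))"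
          using b w by (intro h_integral_le) auto
        also have "\<dots> = (A / t)\<^sup>2 * (2 + 726/100 * r0\<^sup>2)" by (simp add: power_divide power_mult_distrib distrib_left mult_ac)
        also have "\<dots> \<le> (A / t)\<^sup>2 * (36 * r0\<^sup>2)"
        proof (rule mult_left_mono)
          have "1 \<le> r0\<^sup>2" using r by simp
          then show "2 + 726/100 * r0\<^sup>2 \<le> 36 * r0\<^sup>2" by linarith
        qed simp
        also have "\<dots> = (6 * (r0 * (A / t)))\<^sup>2" by (simp add: power_mult_distrib power_divide)
        finally show ?thesis by (simp add: loc_bd_def)
      qed
      show ?thesis unfolding \<beta>_def
        by (rule hoelder_half[of _ "\<lambda>i. h [Transl i]" "\<lambda>i j. h [Transl j, Transl i]", OF _ _ y])
          (use \<epsilon> \<epsilon>1 mult_pos_pos[OF rp At0] in \<open>simp_all add: h_grad loc del: times_divide_eq_right\<close>)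
    qed
    fix S :: "(real^3) set" assume S: "compact S" "S \<subseteq> {x. r0 + \<epsilon> \<le> norm x \<and> norm x \<le> r0 + 2 * \<epsilon>}"
    have D: "x \<bullet> x \<le> 2 * r0\<^sup>2" if "x \<in> S" for x
      using shell_region_bounds(2)[OF \<epsilon>(1,2), of x] S that by auto
    have tr: "integral S (\<lambda>x. (g w x)\<^sup>2) \<le> \<epsilon> * (16 * A)\<^sup>2" if "length w \<le> 2" for w
      by (rule trace_bound[OF \<epsilon>(1,2) r(4) _ _ _ _ _ S, of _ "\<lambda>i. g (Transl i # w)"])
        (use that in \<open>auto intro!: g_grad gi gb\<close>)
    have "integral S (\<lambda>x. (h [] x)\<^sup>2) \<le> 2 / t\<^sup>2 * (\<epsilon> * (16 * A)\<^sup>2 + 2 * r0\<^sup>2 * (3 * (\<epsilon> * (16 * A)\<^sup>2)))"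
      using D by (intro h_integral_le[OF S(1)] tr) auto
    also have "\<dots> = \<epsilon> * ((A / t)\<^sup>2 * (512 + 3072 * r0\<^sup>2))" by (simp add: power_divide power_mult_distrib distrib_left mult_ac)
    also have "\<dots> \<le> \<epsilon> * ((A / t)\<^sup>2 * (3600 * r0\<^sup>2))"
    proof (intro mult_left_mono)
      have "200\<^sup>2 \<le> r0\<^sup>2" using r by (intro power_mono) auto
      then show "512 + 3072 * r0\<^sup>2 \<le> 3600 * r0\<^sup>2" by simp
    qed (use \<epsilon> in auto)
    also have "\<dots> = \<epsilon> * N\<^sup>2" by (simp add: N_def power_divide power_mult_distrib)
    finally show "integral S (\<lambda>x. (h [] x)\<^sup>2) \<le> \<epsilon> * N\<^sup>2" .
    let ?R = "\<lambda>a x. \<Sum>i\<in>UNIV. x $ i * g [Transl i, Transl a] x"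
    have fe: "integral S (\<lambda>x. (?R a x)\<^sup>2) \<le> 57600 * (t\<^sup>2 / r0\<^sup>2) * m0" for a
      by (rule far_energy(2)[OF r(3) S[unfolded \<epsilon>_def] r0(2)])
    have ci: "(\<lambda>x. (g [Scal, Transl a] x)\<^sup>2) integrable_on S" "(\<lambda>x. (?R a x)\<^sup>2) integrable_on S"
      "(\<lambda>x. tang x (\<lambda>a. h [Transl a] x)) integrable_on S" for a
      unfolding tang_def by (rule integrable_on_compact[OF S(1)]; intro continuous_intros continuous_on_subset[OF g_cont] continuous_on_subset[OF h_cont]; simp)+
    have I: "((\<lambda>x. 2 * r0\<^sup>2 * (\<Sum>a\<in>UNIV. 2 / t\<^sup>2 * ((g [Scal, Transl a] x)\<^sup>2 + (?R a x)\<^sup>2))) has_integral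
        2 * r0\<^sup>2 * (\<Sum>a\<in>UNIV. 2 / t\<^sup>2 * (integral S (\<lambda>x. (g [Scal, Transl a] x)\<^sup>2) + integral S (\<lambda>x. (?R a x)\<^sup>2)))) S"
      by (intro has_integral_mult_right has_integral_add has_integral_sum integrable_integral ci finite)
    have "integral S (\<lambda>x. tang x (\<lambda>a. h [Transl a] x)) \<le> integral S (\<lambda>x. 2 * r0\<^sup>2 * (\<Sum>a\<in>UNIV. 2 / t\<^sup>2 * ((g [Scal, Transl a] x)\<^sup>2 + (?R a x)\<^sup>2)))"
    proof (rule integral_le[OF ci(3)])
      fix x assume x: "x \<in> S"
      have "tang x (\<lambda>a. h [Transl a] x) \<le> (x \<bullet> x) * (\<Sum>a\<in>UNIV. (h [Transl a] x)\<^sup>2)" by (simp add: tang_def)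
      also have "\<dots> \<le> 2 * r0\<^sup>2 * (\<Sum>a\<in>UNIV. 2 / t\<^sup>2 * ((g [Scal, Transl a] x)\<^sup>2 + (?R a x)\<^sup>2))"
        using D[OF x] by (intro mult_mono sum_mono h_sq_le sum_nonneg) auto
      finally show "tang x (\<lambda>a. h [Transl a] x) \<le> 2 * r0\<^sup>2 * (\<Sum>a\<in>UNIV. 2 / t\<^sup>2 * ((g [Scal, Transl a] x)\<^sup>2 + (?R a x)\<^sup>2))" .
    qed (use I in blast)
    also have "\<dots> \<le> 2 * r0\<^sup>2 * (\<Sum>a\<in>(UNIV::3 set). 2 / t\<^sup>2 * (\<epsilon> * (16 * A)\<^sup>2 + 57600 * (t\<^sup>2 / r0\<^sup>2) * m0))"
      unfolding integral_unique[OF I] by (intro mult_left_mono add_mono sum_mono fe tr) auto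
    also have "\<dots> = 3072 * (A / t)\<^sup>2 + 691200 * m0"
      using rp t0 by (simp add: \<epsilon>_def power_divide power_mult_distrib distrib_left)
    also have "\<dots> \<le> 1000000 * m0"
    proof -
      have "(A / t)\<^sup>2 \<le> (sqrt m0 / 10)\<^sup>2" using A_div_t_le(2) At0 by (intro power_mono) auto
      also have "\<dots> = m0 / 100" using m0_pos by (simp add: power_divide)
      finally show ?thesis using m0_pos by simp
    qed
    also have "\<dots> = \<epsilon> * (r0 * (1000 * sqrt m0))\<^sup>2" using rp m0_pos by (simp add: \<epsilon>_def power_mult_distrib)
    finally show "integral S (\<lambda>x. tang x (\<lambda>a. h [Transl a] x)) \<le> \<epsilon> * (r0 * (1000 * sqrt m0))\<^sup>2" .
  qed
  moreover have "sqrt (20 * \<epsilon>) \<le> 5 / r0"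
    by (rule real_le_lsqrt) (use r in \<open>auto simp: \<epsilon>_def power_divide divide_right_mono\<close>)
  then have "\<beta> \<le> 105 * (6 * (r0 * (A / t))) * (5 / r0)" unfolding \<beta>_def
    using At0 rp by (intro mult_left_mono mult_nonneg_nonneg) auto
  then have "\<beta> \<le> 3150 * (A / t)" using rp by simp
  moreover have "20 * N / r0 = 1200 * (A / t)" using rp by (simp add: N_def)
  moreover have "ln (r0 / \<epsilon>) = 3 * ln r0"
  proof -
    have "r0 / \<epsilon> = r0 ^ 3" by (simp add: \<epsilon>_def power2_eq_square power3_eq_cube)
    then show ?thesis using rp by (simp add: ln_realpow)
  qed
  moreover have "4350 * (A / t) \<le> 4350 * (sqrt m0 / 10)" using A_div_t_le(2) by simp
  moreover have "b \<le> 500 * s + 21000 * s * l"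
    if "b \<le> c + 7 * (1000 * s) * L + n" "c \<le> 3150 * q" "n = 1200 * q" "L = 3 * l" "4350 * q \<le> 4350 * (s / 10)" "0 \<le> s"
    for b c n L l s q :: real
    using that by simp
  ultimately show ?thesis using m0_pos real_sqrt_ge_zero[of m0] by (meson less_imp_le)
qed

text \<open>Up to |x0| = 2t, dividing S - x . \<partial> by t loses only a constant;
  \<open>time_bound_far\<close> takes over from there.\<close>

lemma time_bound: "\<bar>h [] x0\<bar> \<le> 20000000 * sqrt m0 * (1 + ln (jap x0))"
proof -
  have j1: "1 \<le> jap x0" "norm x0 \<le> jap x0" by (auto simp: jap_def intro!: real_le_rsqrt)
  have l0: "0 \<le> ln (jap x0)" using j1 by simp
  have m: "0 \<le> sqrt m0" using m0_pos by simp
  show ?thesis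
  proof (cases "norm x0 \<le> 2 * t")
    case True
    let ?Z = "3000000 * sqrt m0 * (1 + ln (jap x0))"
    have "\<bar>\<Sum>i\<in>UNIV. x0 $ i * g [Transl i] x0\<bar> \<le> (\<Sum>i\<in>(UNIV::3 set). 2 * t * ?Z)"
    proof (rule order_trans[OF sum_abs sum_mono])
      fix i :: 3
      have "\<bar>x0 $ i\<bar> \<le> 2 * t" using component_le_norm_cart[of x0 i] True by linarith
      then show "\<bar>x0 $ i * g [Transl i] x0\<bar> \<le> 2 * t * ?Z" unfolding abs_mult using t0 by (intro mult_mono spatial_bound) auto
    qed
    then have "\<bar>\<Sum>i\<in>UNIV. x0 $ i * g [Transl i] x0\<bar> \<le> t * (6 * ?Z)" by simp
    moreover have "\<bar>g [Scal] x0\<bar> \<le> t * (5 * sqrt m0)"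
      using scaling_bound[of x0] A_div_t_le(2) t0 m by (simp add: field_simps)
    moreover have "t * \<bar>h [] x0\<bar> = \<bar>g [Scal] x0 - (\<Sum>i\<in>UNIV. x0 $ i * g [Transl i] x0)\<bar>"
      using g_Scal[of "[]" x0] t0 by (simp add: abs_mult)
    ultimately have "t * \<bar>h [] x0\<bar> \<le> t * (5 * sqrt m0) + t * (6 * ?Z)" by linarith
    then have "t * \<bar>h [] x0\<bar> \<le> t * (5 * sqrt m0 + 6 * ?Z)" by (simp only: distrib_left)
    then have "\<bar>h [] x0\<bar> \<le> 5 * sqrt m0 + 6 * ?Z" using t0 by simp
    moreover have "0 \<le> sqrt m0 * ln (jap x0)" using m l0 by simp
    ultimately show ?thesis using m by (simp add: distrib_left)
  next
    case False
    then have n: "2 * t \<le> norm x0" "1 \<le> norm x0" using t100 by auto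
    have "0 < norm x0" using n by linarith
    then have "ln (norm x0) \<le> ln (jap x0)" using j1 ln_le_cancel_iff[of "norm x0" "jap x0"] by linarith
    then have "sqrt m0 * ln (norm x0) \<le> sqrt m0 * ln (jap x0)" using m by (rule mult_left_mono)
    moreover have "0 \<le> sqrt m0 * ln (jap x0)" using m l0 by simp
    ultimately show ?thesis using time_bound_far[OF refl n(1)] m unfolding distrib_left mult.assoc by linarith
  qed
qed

end

section \<open>Passage to the norms of the statement\<close>

lemma abs_grad_le: "abs_grad \<psi> p \<le> \<bar>dt \<psi> p\<bar> + (\<Sum>i\<in>UNIV. \<bar>dx i \<psi> p\<bar>)"
proof -
  have B3: "(Basis :: (real^3) set) = range (\<lambda>i. axis i 1)" by (auto simp: Basis_vec_def)
  have B: "(Basis :: spacetime set) = insert (1, 0) (range (\<lambda>i. (0, axis i 1)))"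
    by (auto simp: Basis_prod_def B3)
  have inj: "inj (\<lambda>i::3. (0::real, axis i (1::real)))" by (auto simp: inj_def axis_eq_axis)
  have "abs_grad \<psi> p = L2_set (\<lambda>b. dderiv b \<psi> p) Basis" by (simp add: abs_grad_def L2_set_def)
  also have "\<dots> \<le> (\<Sum>b\<in>Basis. \<bar>dderiv b \<psi> p\<bar>)" by (rule L2_set_le_sum_abs)
  also have "\<dots> = \<bar>dderiv (1, 0) \<psi> p\<bar> + (\<Sum>b\<in>range (\<lambda>i. (0, axis i 1)). \<bar>dderiv b \<psi> p\<bar>)"
    unfolding B by (subst sum.insert) auto
  also have "(\<Sum>b\<in>range (\<lambda>i. (0, axis i 1)). \<bar>dderiv b \<psi> p\<bar>) = (\<Sum>i\<in>UNIV. \<bar>dx i \<psi> p\<bar>)"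
    by (subst sum.reindex[OF inj]) (simp add: dx_def)
  finally show ?thesis by (simp add: dt_def)
qed

lemma L2norm_on_nonneg: "0 \<le> L2norm_on S v"
  unfolding L2norm_on_def set_lebesgue_integral_def
  by (intro real_sqrt_ge_zero Bochner_Integration.integral_nonneg) (simp add: indicator_def)

text \<open>Bridge between the Lebesgue integrals of the statement and the gauge integrals of the
  slice estimates.\<close>

lemma L2_on_UNIV:
  assumes "L2_on UNIV v"
  shows "sq_integrable v" "L2sq v = (L2norm_on UNIV v)\<^sup>2"
proof -
  have "integrable lborel (\<lambda>x. (v x)\<^sup>2)" using assms by (simp add: L2_on_def set_integrable_def)
  then have i: "((\<lambda>x. (v x)\<^sup>2) has_integral (LINT x|lborel. (v x)\<^sup>2)) UNIV" by (rule has_integral_integral_lborel)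
  then show "sq_integrable v" by blast
  have "0 \<le> (LINT x|lborel. (v x)\<^sup>2)" by (rule Bochner_Integration.integral_nonneg) simp
  then show "L2sq v = (L2norm_on UNIV v)\<^sup>2"
    using i by (simp add: L2norm_on_def set_lebesgue_integral_def integral_unique)
qed

lemma L2norm_Gam_ge: "w \<in> words k \<Longrightarrow> L2norm_on UNIV (\<lambda>x. Gam w \<psi> (t, x)) \<le> L2norm_Gam k \<psi> t"
  unfolding L2norm_Gam_def by (rule member_le_sum) (auto intro: L2norm_on_nonneg finite_words)

lemma L2norm_Gam_nonneg: "0 \<le> L2norm_Gam k \<psi> t"
  unfolding L2norm_Gam_def by (intro sum_nonneg L2norm_on_nonneg)

lemma L2sq_Gam_le:
  assumes "L2_on UNIV (\<lambda>x. Gam w \<psi> (t, x))" "w \<in> words k" "L2norm_Gam k \<psi> t \<le> B"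
  shows "L2sq (\<lambda>x. Gam w \<psi> (t, x)) \<le> B\<^sup>2"
  unfolding L2_on_UNIV(2)[OF assms(1)]
  by (intro power_mono L2norm_on_nonneg order_trans[OF L2norm_Gam_ge[OF assms(2)] assms(3)])

text \<open>Spatial translations commute with the wave operator. These two words are the ones for
  which the slice estimates ask for a norm of the source.\<close>

lemma (in wave_slice) box_slice: "bx [] = (\<lambda>x. Gam [] (box_op \<phi>) (t, x))" "bx [Transl l] = (\<lambda>x. Gam [Transl l] (box_op \<phi>) (t, x))"
  using box_dx[OF C_k_le[OF _ C4], of l] by (simp_all add: bx_def[abs_def] Gam_def)

lemma (in slice_energy) abs_grad_bound: "abs_grad \<phi> (t, x0) \<le> 30000000 * sqrt m0 * (1 + ln (jap x0))"
proof -
  have 0: "dt \<phi> (t, x0) = h [] x0" "dx i \<phi> (t, x0) = g [Transl i] x0" for i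
    by (simp_all add: h_def g_def Gam_def)
  have "abs_grad \<phi> (t, x0) \<le> 20000000 * sqrt m0 * (1 + ln (jap x0)) + (\<Sum>i\<in>(UNIV::3 set). 3000000 * sqrt m0 * (1 + ln (jap x0)))"
    by (rule order_trans[OF abs_grad_le]) (unfold 0, intro add_mono sum_mono time_bound spatial_bound)
  also have "\<dots> = 29000000 * (sqrt m0 * (1 + ln (jap x0)))" by simp
  also have "\<dots> \<le> 30000000 * (sqrt m0 * (1 + ln (jap x0)))"
  proof (rule mult_right_mono)
    have "1 \<le> jap x0" by (simp add: jap_def)
    then show "0 \<le> sqrt m0 * (1 + ln (jap x0))" using m0_pos by simp
  qed simp
  finally show ?thesis by simp
qed

text \<open>A (F + A/t) = A (A + tF) / t, so the root is t^(-1/2) times the geometric mean of A and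
  A + tF. Because A <= B, a power \<delta>/2 of A may be moved into the bracket B.\<close>

lemma sqrt_interpolate:
  fixes A B F G t \<delta> :: real
  assumes "0 \<le> A" "A \<le> B" "A + t * F \<le> B" "0 < t" "0 \<le> F" "0 < \<delta>"
  shows "sqrt (A * (F + A / t)) \<le> \<bar>t\<bar> powr (- 1 / 2) * A powr ((1 - \<delta>) / 2) * B powr ((1 + \<delta>) / 2)"
proof (cases "A = 0")
  case False
  then have A: "0 < A" "0 < B" using assms by auto
  have "A * (F + A / t) = (A + t * F) * (A * (1 / t))" using assms by (simp add: field_simps)
  also have "\<dots> \<le> B * (A * (1 / t))" using assms A by (intro mult_right_mono) auto
  finally have "sqrt (A * (F + A / t)) \<le> sqrt (B * (A * (1 / t)))" by simp
  also have "\<dots> = \<bar>t\<bar> powr (- 1 / 2) * A powr (1 / 2) * B powr (1 / 2)"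
    using assms A by (simp add: real_sqrt_mult real_sqrt_divide powr_minus_divide powr_half_sqrt)
  also have "\<dots> = \<bar>t\<bar> powr (- 1 / 2) * A powr ((1 - \<delta>) / 2) * (A powr (\<delta> / 2) * B powr (1 / 2))"
    using A by (simp add: powr_add[symmetric] add_divide_distrib[symmetric])
  also have "\<dots> \<le> \<bar>t\<bar> powr (- 1 / 2) * A powr ((1 - \<delta>) / 2) * (B powr (\<delta> / 2) * B powr (1 / 2))"
    using assms by (intro mult_left_mono mult_right_mono powr_mono2) auto
  also have "\<dots> = \<bar>t\<bar> powr (- 1 / 2) * A powr ((1 - \<delta>) / 2) * B powr ((1 + \<delta>) / 2)"
    using A by (simp add: powr_add[symmetric] add_divide_distrib[symmetric] add.commute)
  finally show ?thesis .
qed simp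

lemma general_estimate:
  assumes C4: "C_k 4 \<phi>" and f: "\<And>p. box_op \<phi> p = f p" and t: "100 \<le> t" and fin: "finite_norms \<phi> f t" and \<delta>: "0 < \<delta>" "\<delta> \<le> 1"
  shows "abs_grad \<phi> (t, x0) \<le> 30000000 *
              ((1 / \<delta>) * \<bar>t\<bar> powr (- 1 / 2) * jap x0 powr \<delta>
                 * L2norm_Gam 3 \<phi> t powr ((1 - \<delta>) / 2)
                 * (L2norm_Gam 3 \<phi> t + L2norm_r2_Gam 3 \<phi> 0 + jap t * L2norm_Gam 1 f t
                    + (LBINT s:{0..t}. L2norm_u_grad_Gam_ext 1 f s)) powr ((1 + \<delta>) / 2)
               + L2norm_Gam 1 f t)"
proof -
  define A F J where "A = L2norm_Gam 3 \<phi> t" and "F = L2norm_Gam 1 f t" and "J = jap x0"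
  define B where "B = A + L2norm_r2_Gam 3 \<phi> 0 + jap t * F + (LBINT s:{0..t}. L2norm_u_grad_Gam_ext 1 f s)"
  have f': "box_op \<phi> = f" using f by blast
  have A0: "0 \<le> A" and F0: "0 \<le> F" by (simp_all add: A_def F_def L2norm_Gam_nonneg)
  have J: "1 \<le> J" by (simp add: J_def jap_def)
  interpret wave_slice \<phi> t by unfold_locales (rule C4, rule t)
  have gL: "L2_on UNIV (g w)" if "length w \<le> 3" for w
    using fin that by (simp add: finite_norms_def words_def g_def[abs_def])
  have fL: "L2_on UNIV (\<lambda>x. Gam w f (t, x))" if "length w \<le> 1" for w
    using fin that by (simp add: finite_norms_def words_def)
  \<comment> \<open>The locale wants a positive bound, but the norm A may vanish. It is enlarged to
    A' > A, and A' tends to A afterwards.\<close>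
  have *: "abs_grad \<phi> (t, x0) \<le> 30000000 * sqrt (A' * (F + A' / t)) * (1 + ln J)" if A': "A < A'" for A'
  proof -
    interpret slice_energy \<phi> t A' F
    proof unfold_locales
      show "0 < A'" "0 \<le> F" using A0 F0 A' by auto
      show "sq_integrable (g w)" if "length w \<le> 3" for w by (rule L2_on_UNIV(1)[OF gL[OF that]])
      show "L2sq (g w) \<le> A'\<^sup>2" if "length w \<le> 3" for w
        using L2sq_Gam_le[OF gL[OF that, unfolded g_def[abs_def]], of 3 A'] that A' by (simp add: g_def[abs_def] words_def A_def)
      show "sq_integrable (bx [])" "sq_integrable (bx [Transl l])" for l
        unfolding box_slice f' by (intro L2_on_UNIV(1) fL; simp)+
      show "L2sq (bx []) \<le> F\<^sup>2" "L2sq (bx [Transl l]) \<le> F\<^sup>2" for l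
        unfolding box_slice f' by (rule L2sq_Gam_le[where k=1, OF fL]; simp add: words_def F_def)+
    qed
    show ?thesis using abs_grad_bound[of x0] by (simp add: m0_def J_def)
  qed
  have "abs_grad \<phi> (t, x0) \<le> 30000000 * sqrt (A * (F + A / t)) * (1 + ln J)"
  proof (rule LIMSEQ_le_const)
    have z: "(\<lambda>n. 1 / real (Suc n)) \<longlonglongrightarrow> 0" by (rule LIMSEQ_Suc[OF lim_1_over_n])
    have z': "(\<lambda>n. A + 1 / real (Suc n)) \<longlonglongrightarrow> A" using tendsto_add[OF tendsto_const z, of A] by simp
    show "(\<lambda>n. 30000000 * sqrt ((A + 1 / real (Suc n)) * (F + (A + 1 / real (Suc n)) / t)) * (1 + ln J))
        \<longlonglongrightarrow> 30000000 * sqrt (A * (F + A / t)) * (1 + ln J)"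
      using t by (intro tendsto_intros z') auto
    show "\<exists>N. \<forall>n\<ge>N. abs_grad \<phi> (t, x0) \<le> 30000000 * sqrt ((A + 1 / real (Suc n)) * (F + (A + 1 / real (Suc n)) / t)) * (1 + ln J)"
      by (intro exI allI impI *) simp
  qed
  also have "\<dots> \<le> 30000000 * sqrt (A * (F + A / t)) * (1 / \<delta> * J powr \<delta>)"
    using ln_jap_bound[OF \<delta>, of J] J A0 F0 t by (intro mult_left_mono) auto
  also have "\<dots> \<le> 30000000 * (\<bar>t\<bar> powr (- 1 / 2) * A powr ((1 - \<delta>) / 2) * B powr ((1 + \<delta>) / 2)) * (1 / \<delta> * J powr \<delta>)"
  proof (intro mult_right_mono mult_left_mono sqrt_interpolate)
    have r2: "0 \<le> L2norm_r2_Gam 3 \<phi> 0" unfolding L2norm_r2_Gam_def by (intro sum_nonneg L2norm_on_nonneg)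
    have "0 \<le> L2norm_u_grad_Gam_ext 1 f s" for s unfolding L2norm_u_grad_Gam_ext_def by (intro sum_nonneg L2norm_on_nonneg)
    then have lb: "0 \<le> (LBINT s:{0..t}. L2norm_u_grad_Gam_ext 1 f s)"
      unfolding set_lebesgue_integral_def by (intro Bochner_Integration.integral_nonneg) simp
    have "t \<le> jap t" by (auto simp: jap_def intro!: real_le_rsqrt)
    then have "t * F \<le> jap t * F" using F0 by (rule mult_right_mono)
    then show "A + t * F \<le> B" using r2 lb by (simp add: B_def)
    moreover have "0 \<le> t * F" using t F0 by simp
    ultimately show "A \<le> B" by linarith
  qed (use A0 F0 t \<delta> in auto)
  also have "\<dots> = 30000000 * ((1 / \<delta>) * \<bar>t\<bar> powr (- 1 / 2) * J powr \<delta> * A powr ((1 - \<delta>) / 2) * B powr ((1 + \<delta>) / 2))" by simp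
  also have "\<dots> \<le> 30000000 * ((1 / \<delta>) * \<bar>t\<bar> powr (- 1 / 2) * J powr \<delta> * A powr ((1 - \<delta>) / 2) * B powr ((1 + \<delta>) / 2) + F)"
    using F0 by simp
  finally show ?thesis unfolding A_def F_def J_def B_def .
qed

section \<open>The interior estimate\<close>

text \<open>A now bounds \<partial> of every word up to length three. So \<open>h\<close> is
  controlled directly, but \<open>g\<close> only on words that begin with a translation: neither
  \<phi> nor S\<phi> has a norm of its own. \<open>gz\<close> encodes the support.\<close>

locale slice_interior = wave_slice +
  fixes A F :: real
  assumes Ap: "0 < A" and F0: "0 \<le> F"
    and gi: "\<And>i w. length w \<le> 3 \<Longrightarrow> sq_integrable (g (Transl i # w))" and gb: "\<And>i w. length w \<le> 3 \<Longrightarrow> L2sq (g (Transl i # w)) \<le> A\<^sup>2"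
    and hi: "\<And>w. length w \<le> 3 \<Longrightarrow> sq_integrable (h w)" and hb: "\<And>w. length w \<le> 3 \<Longrightarrow> L2sq (h w) \<le> A\<^sup>2"
    and bi: "sq_integrable (bx [])" "\<And>l. sq_integrable (bx [Transl l])"
    and bb: "L2sq (bx []) \<le> F\<^sup>2" "\<And>l. L2sq (bx [Transl l]) \<le> F\<^sup>2"
    and gz: "\<And>w x. t < norm x \<Longrightarrow> g w x = 0"
begin

sublocale slice_bounded \<phi> t A
  by unfold_locales (auto intro: Ap gi gb)

text \<open>The loss of the elliptic estimate with 1/t for \<theta>: A^2/t from gradients and t F^2
  from the source. After division by the weight 1 + t - |x| its root is the final bound up to the
  logarithm.\<close>

definition "m1 = A\<^sup>2 / t + t * F\<^sup>2"

lemma t0: "0 < t" "1 \<le> t" using t100 by auto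

lemma m1_pos: "0 < m1"
  using Ap t0 by (simp add: m1_def add_pos_nonneg)

lemma A_div_t_le: "A / t \<le> sqrt (m1 / t)"
proof -
  have "(A / t)\<^sup>2 \<le> (A / t)\<^sup>2 + F\<^sup>2" by simp
  also have "\<dots> = m1 / t" using t0 by (simp add: m1_def power2_eq_square add_divide_distrib)
  finally show ?thesis by (rule real_le_rsqrt)
qed

text \<open>1 + U <= 2t and sqrt 2 <= 3/2: decay in t is at least as good as decay in the distance U
  to the cone.\<close>

lemma sqrt_m1_t_le:
  assumes "0 \<le> U" "U \<le> t"
  shows "sqrt (m1 / t) \<le> 3 / 2 * sqrt (m1 / (1 + U))"
proof -
  have "1 / t \<le> 2 / (1 + U)" using t0 assms by (simp add: field_simps)
  then have "m1 * (1 / t) \<le> m1 * (2 / (1 + U))" using m1_pos by (intro mult_left_mono) auto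
  then have "m1 / t \<le> m1 * (2 / (1 + U))" by simp
  also have "\<dots> = 2 * (m1 / (1 + U))" by simp
  also have "\<dots> \<le> (3 / 2)\<^sup>2 * (m1 / (1 + U))" using m1_pos assms by (intro mult_right_mono) (auto simp: power2_eq_square)
  finally have "sqrt (m1 / t) \<le> sqrt ((3 / 2)\<^sup>2 * (m1 / (1 + U)))" by simp
  then show ?thesis unfolding real_sqrt_mult by simp
qed

definition \<Gamma> :: "gamma list \<Rightarrow> real^3 \<Rightarrow> real" where
  "\<Gamma> w x = 4 * (bx w x)\<^sup>2 + 4 / t\<^sup>2 * (\<Sum>i\<in>UNIV. (g (Transl i # w) x)\<^sup>2) + 4 / t\<^sup>2 * (\<Sum>i\<in>UNIV. (g (Transl i # Scal # w) x)\<^sup>2)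
     + 8 / t\<^sup>2 * ((h (Scal # w) x)\<^sup>2 + (h w x)\<^sup>2)"

lemma scaled_radial_sq_le:
  fixes x :: "real^3"
  assumes "norm x \<le> t"
  shows "(1 / t\<^sup>2 * (\<Sum>i\<in>UNIV. x $ i * v i))\<^sup>2 \<le> 1 / t\<^sup>2 * (\<Sum>i\<in>UNIV. (v i)\<^sup>2)"
proof -
  have "x \<bullet> x \<le> t\<^sup>2" using assms by (metis norm_ge_zero power2_norm_eq_inner power_mono)
  then have "(x \<bullet> x) * (\<Sum>i\<in>UNIV. (v i)\<^sup>2) \<le> t\<^sup>2 * (\<Sum>i\<in>UNIV. (v i)\<^sup>2)"
    by (intro mult_right_mono sum_nonneg) auto
  then have "(\<Sum>i\<in>UNIV. x $ i * v i)\<^sup>2 \<le> t\<^sup>2 * (\<Sum>i\<in>UNIV. (v i)\<^sup>2)"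
    using radial_deriv_sq_le[of x v] by linarith
  then have "(1 / t\<^sup>2)\<^sup>2 * (\<Sum>i\<in>UNIV. x $ i * v i)\<^sup>2 \<le> (1 / t\<^sup>2)\<^sup>2 * (t\<^sup>2 * (\<Sum>i\<in>UNIV. (v i)\<^sup>2))"
    by (intro mult_left_mono) auto
  also have "\<dots> = 1 / t\<^sup>2 * (\<Sum>i\<in>UNIV. (v i)\<^sup>2)"
    using t0 by (simp add: power2_eq_square)
  finally show ?thesis unfolding power_mult_distrib .
qed

lemma LL_le_\<Gamma>:
  assumes w: "length w \<le> 2" and x: "norm x \<le> t"
  shows "(LL w x)\<^sup>2 \<le> \<Gamma> w x"
proof -
  let ?a = "1 / t\<^sup>2"
  let ?R = "\<Sum>i\<in>UNIV. x $ i * g (Transl i # w) x" and ?RP = "\<Sum>i\<in>UNIV. x $ i * g (Transl i # Scal # w) x"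
  let ?Q = "h (Scal # w) x - h w x"
  \<comment> \<open>S^2 and S applied to the word are expanded into time and radial derivatives,
    because only derivatives have norms here. The radial parts combine to 2R - 2RP + RP - R = R -
    RP, and the time derivatives carry the factor t/t^2 = 1/t.\<close>
  have "LL w x = bx w x + ?a * (2 * ?R - 2 * ?RP + ((t * h (Scal # w) x + ?RP) - (t * h w x + ?R)))"
    unfolding LL_def equation[OF w] g_Scal[of "Scal # w"] g_Scal[of w] ..
  also have "\<dots> = bx w x + ?a * ?R + - (?a * ?RP) + ?a * t * ?Q"
    by (simp add: right_diff_distrib distrib_left mult.assoc)
  also have "?a * t = 1 / t" using t0 by (simp add: power2_eq_square)
  finally have "LL w x = bx w x + ?a * ?R + - (?a * ?RP) + 1 / t * ?Q" .
  from this have "(LL w x)\<^sup>2 \<le> 4 * ((bx w x)\<^sup>2 + (?a * ?R)\<^sup>2 + (- (?a * ?RP))\<^sup>2 + (1 / t * ?Q)\<^sup>2)"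
    by (simp only: sq_sum4_le)
  also have "\<dots> \<le> 4 * ((bx w x)\<^sup>2 + 1 / t\<^sup>2 * (\<Sum>i\<in>UNIV. (g (Transl i # w) x)\<^sup>2) + 1 / t\<^sup>2 * (\<Sum>i\<in>UNIV. (g (Transl i # Scal # w) x)\<^sup>2)
     + 2 / t\<^sup>2 * ((h (Scal # w) x)\<^sup>2 + (h w x)\<^sup>2))"
  proof (intro mult_left_mono add_mono order_refl)
    show "(?a * ?R)\<^sup>2 \<le> 1 / t\<^sup>2 * (\<Sum>i\<in>UNIV. (g (Transl i # w) x)\<^sup>2)" by (rule scaled_radial_sq_le[OF x])
    show "(- (?a * ?RP))\<^sup>2 \<le> 1 / t\<^sup>2 * (\<Sum>i\<in>UNIV. (g (Transl i # Scal # w) x)\<^sup>2)"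
      unfolding power2_minus by (rule scaled_radial_sq_le[OF x])
    have "?a * ?Q\<^sup>2 \<le> ?a * (2 * ((h (Scal # w) x)\<^sup>2 + (h w x)\<^sup>2))"
      by (intro mult_left_mono sq_diff_le) auto
    then show "(1 / t * ?Q)\<^sup>2 \<le> 2 / t\<^sup>2 * ((h (Scal # w) x)\<^sup>2 + (h w x)\<^sup>2)"
      by (simp add: power_mult_distrib power_divide)
  qed simp
  also have "\<dots> = \<Gamma> w x" by (simp add: \<Gamma>_def)
  finally show ?thesis .
qed

lemma \<Gamma>_integral:
  assumes w: "w = [] \<or> (\<exists>l. w = [Transl l])"
  shows "\<Gamma> w integrable_on UNIV" "integral UNIV (\<Gamma> w) \<le> 40 * (m1 / t)"
proof -
  have len: "length w \<le> 1" using w by auto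
  have b: "sq_integrable (bx w)" "L2sq (bx w) \<le> F\<^sup>2" using w bi bb by auto
  have I: "(\<Gamma> w has_integral (4 * L2sq (bx w) + 4 / t\<^sup>2 * (\<Sum>i\<in>UNIV. L2sq (g (Transl i # w))) + 4 / t\<^sup>2 * (\<Sum>i\<in>UNIV. L2sq (g (Transl i # Scal # w)))
     + 8 / t\<^sup>2 * (L2sq (h (Scal # w)) + L2sq (h w)))) UNIV"
    unfolding \<Gamma>_def[abs_def]
    by (intro has_integral_add has_integral_mult_right has_integral_sum integrable_integral gi hi b finite) (use len in auto)
  then show "\<Gamma> w integrable_on UNIV" by blast
  have "integral UNIV (\<Gamma> w) \<le> 4 * F\<^sup>2 + 4 / t\<^sup>2 * (\<Sum>i\<in>(UNIV::3 set). A\<^sup>2) + 4 / t\<^sup>2 * (\<Sum>i\<in>(UNIV::3 set). A\<^sup>2) + 8 / t\<^sup>2 * (A\<^sup>2 + A\<^sup>2)"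
    unfolding integral_unique[OF I]
    by (intro add_mono mult_left_mono sum_mono gb hb b) (use len in auto)
  also have "\<dots> = 4 * F\<^sup>2 + 40 * (A\<^sup>2 / t\<^sup>2)" by simp
  also have "\<dots> \<le> 40 * (A\<^sup>2 / t\<^sup>2 + F\<^sup>2)" by simp
  also have "A\<^sup>2 / t\<^sup>2 + F\<^sup>2 = m1 / t" using t0 by (simp add: m1_def add_divide_distrib power2_eq_square)
  finally show "integral UNIV (\<Gamma> w) \<le> 40 * (m1 / t)" .
qed

definition EK :: "gamma list \<Rightarrow> real^3 \<Rightarrow> real" where
  "EK u x = (1 + (t\<^sup>2 - x \<bullet> x) / t) * ((\<Sum>i\<in>UNIV. (g (Transl i # u) x)\<^sup>2) - (1/t\<^sup>2) * (\<Sum>i\<in>UNIV. x $ i * g (Transl i # u) x)\<^sup>2) / 2"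

lemma EK_integral:
  assumes w: "w = [] \<or> (\<exists>l. w = [Transl l])"
  shows "comp_supp (EK (Transl k # w))" "integral UNIV (EK (Transl k # w)) \<le> 5000 * m1"
proof -
  have len: "length w \<le> 1" using w by auto
  have gr: "has_grad (g (Transl k # w)) (\<lambda>i. g (Transl i # Transl k # w))"
      "\<And>i. has_grad (g (Transl i # Transl k # w)) (\<lambda>j. g (Transl j # Transl i # Transl k # w))"
    using len by (intro g_grad; simp)+
  have sym: "g (Transl j # Transl i # Transl k # w) x = g (Transl i # Transl j # Transl k # w) x" for i j x
    using len by (intro g_sym) simp
  have \<Gamma>0: "0 \<le> \<Gamma> w x" for x by (simp add: \<Gamma>_def sum_nonneg)
  note E = elliptic_estimate_supp[OF t0(2) gr sym LL_pd[OF len] LL_cont[OF len] LL_eq[OF len] \<Gamma>_integral(1)[OF w] \<Gamma>0]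
  have E': "comp_supp (EK (Transl k # w)) \<and> integral UNIV (EK (Transl k # w)) \<le> 100 * (1/t * (L2sq (g (Transl k # w)) + (\<Sum>i\<in>UNIV. L2sq (g (Transl i # Transl k # w))))) + 100 * (integral UNIV (\<Gamma> w) / (1/t))"
    unfolding EK_def[abs_def]
    by (intro conjI E LL_le_\<Gamma> gi gz) (use len in auto)
  then show "comp_supp (EK (Transl k # w))" by blast
  have "L2sq (g (Transl k # w)) + (\<Sum>i\<in>UNIV. L2sq (g (Transl i # Transl k # w))) \<le> A\<^sup>2 + (\<Sum>i\<in>(UNIV::3 set). A\<^sup>2)"
    using len by (intro add_mono sum_mono gb) auto
  then have "1/t * (L2sq (g (Transl k # w)) + (\<Sum>i\<in>UNIV. L2sq (g (Transl i # Transl k # w)))) \<le> 1/t * (4 * A\<^sup>2)"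
    using t0 by (intro mult_left_mono) auto
  also have "\<dots> \<le> 4 * m1" using t0 by (simp add: m1_def)
  finally have 1: "1/t * (L2sq (g (Transl k # w)) + (\<Sum>i\<in>UNIV. L2sq (g (Transl i # Transl k # w)))) \<le> 4 * m1" .
  have "integral UNIV (\<Gamma> w) / (1/t) \<le> 40 * (m1 / t) / (1/t)"
    using \<Gamma>_integral(2)[OF w] t0 by (intro divide_right_mono) auto
  also have "\<dots> = 40 * m1" using t0 by simp
  finally show "integral UNIV (EK (Transl k # w)) \<le> 5000 * m1" using E' 1 m1_pos by linarith
qed

lemma wt_ge:
  fixes x :: "real^3"
  assumes "norm x \<le> t"
  shows "1 + (t - norm x) \<le> 1 + (t\<^sup>2 - x \<bullet> x) / t"
proof -
  have "t * (t - norm x) \<le> (t + norm x) * (t - norm x)" using assms by (intro mult_right_mono) auto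
  also have "\<dots> = t\<^sup>2 - x \<bullet> x" by (simp add: power2_norm_eq_inner[symmetric] power2_eq_square algebra_simps)
  finally show ?thesis using t0 by (simp add: field_simps)
qed

text \<open>The weight turns negative well outside the cone, but there the derivatives vanish;
  inside, |x| <= t gives t^2 D - R^2 >= |x|^2 D - R^2.\<close>

lemma EK_tang: "0 \<le> (1 + (t\<^sup>2 - x \<bullet> x) / t) * tang x (\<lambda>i. g (Transl i # u) x)"
  and EK_tang_le: "(1 + (t\<^sup>2 - x \<bullet> x) / t) * tang x (\<lambda>i. g (Transl i # u) x) \<le> 2 * t\<^sup>2 * EK u x"
proof -
  let ?D = "\<Sum>i\<in>UNIV. (g (Transl i # u) x)\<^sup>2" and ?R = "\<Sum>i\<in>UNIV. x $ i * g (Transl i # u) x"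
  have D: "0 \<le> ?D" by (simp add: sum_nonneg)
  have "0 \<le> (1 + (t\<^sup>2 - x \<bullet> x) / t) * tang x (\<lambda>i. g (Transl i # u) x) \<and>
    (1 + (t\<^sup>2 - x \<bullet> x) / t) * tang x (\<lambda>i. g (Transl i # u) x) \<le> 2 * t\<^sup>2 * EK u x"
  proof (cases "norm x \<le> t")
    case False
    then show ?thesis by (simp add: tang_def EK_def gz)
  next
    case True
    then have w: "0 \<le> 1 + (t\<^sup>2 - x \<bullet> x) / t" using wt_ge[OF True] by linarith
    have "x \<bullet> x \<le> t\<^sup>2" using True by (metis norm_ge_zero power2_norm_eq_inner power_mono)
    then have "(x \<bullet> x) * ?D \<le> t\<^sup>2 * ?D" using D by (rule mult_right_mono)
    moreover have "t\<^sup>2 * (?D - (1/t\<^sup>2) * ?R\<^sup>2) = t\<^sup>2 * ?D - ?R\<^sup>2" using t0 by (simp add: right_diff_distrib)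
    ultimately have "tang x (\<lambda>i. g (Transl i # u) x) \<le> t\<^sup>2 * (?D - (1/t\<^sup>2) * ?R\<^sup>2)" unfolding tang_def by linarith
    then have "(1 + (t\<^sup>2 - x \<bullet> x) / t) * tang x (\<lambda>i. g (Transl i # u) x) \<le> (1 + (t\<^sup>2 - x \<bullet> x) / t) * (t\<^sup>2 * (?D - (1/t\<^sup>2) * ?R\<^sup>2))"
      using w by (rule mult_left_mono)
    also have "\<dots> = 2 * t\<^sup>2 * EK u x" by (simp add: EK_def)
    finally show ?thesis using w tang_nonneg by simp
  qed
  then show "0 \<le> (1 + (t\<^sup>2 - x \<bullet> x) / t) * tang x (\<lambda>i. g (Transl i # u) x)"
    "(1 + (t\<^sup>2 - x \<bullet> x) / t) * tang x (\<lambda>i. g (Transl i # u) x) \<le> 2 * t\<^sup>2 * EK u x" by auto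
qed

lemma EK_nonneg: "0 \<le> EK u x"
proof -
  have "0 \<le> 2 * t\<^sup>2 * EK u x" using EK_tang[of x u] EK_tang_le[of x u] by linarith
  then show ?thesis using t0 by (simp add: zero_le_mult_iff)
qed

text \<open>For |x| <= t/2 the weight is at least t/2. This is the extra factor t that improves m1
  to m1/t away from the cone.\<close>

lemma EK_inner:
  assumes x: "norm x \<le> t / 2"
  shows "t/6 * (g (Transl i # u) x)\<^sup>2 \<le> EK u x"
proof -
  let ?D = "\<Sum>i\<in>UNIV. (g (Transl i # u) x)\<^sup>2" and ?R = "\<Sum>i\<in>UNIV. x $ i * g (Transl i # u) x"
  have D: "0 \<le> ?D" by (simp add: sum_nonneg)
  have s: "x \<bullet> x \<le> t\<^sup>2 / 4"
    using power_mono[OF x norm_ge_zero, of 2] by (simp add: power2_norm_eq_inner power_divide)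
  have w: "t / 2 \<le> 1 + (t\<^sup>2 - x \<bullet> x) / t" using wt_ge[of x] x t0 by linarith
  have w0: "0 \<le> 1 + (t\<^sup>2 - x \<bullet> x) / t" using w t0 by linarith
  have "?R\<^sup>2 \<le> t\<^sup>2 / 4 * ?D"
    using radial_deriv_sq_le[of x "\<lambda>i. g (Transl i # u) x"] mult_right_mono[OF s D] by linarith
  then have "(1/t\<^sup>2) * ?R\<^sup>2 \<le> (1/t\<^sup>2) * (t\<^sup>2 / 4 * ?D)" by (intro mult_left_mono) auto
  also have "\<dots> = ?D / 4" using t0 by simp
  finally have 1: "3/4 * ?D \<le> ?D - (1/t\<^sup>2) * ?R\<^sup>2" by simp
  have "t/6 * (g (Transl i # u) x)\<^sup>2 \<le> t/6 * ?D" using term_le_sum_sq[of "\<lambda>i. g (Transl i # u) x" i] t0 by simp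
  also have "\<dots> \<le> (t / 2) * (3/4 * ?D) / 2" using D t0 by simp
  also have "\<dots> \<le> EK u x" unfolding EK_def using 1 w w0 D t0 by (intro divide_right_mono mult_mono) auto
  finally show ?thesis .
qed

lemma near_bound:
  assumes r0: "norm x0 \<le> t / 4"
  shows "\<bar>g [Transl l] x0\<bar> \<le> 10000 * sqrt (m1 / t)"
proof -
  have gr: "has_grad (g [Transl l]) (\<lambda>i. g [Transl i, Transl l])" "\<And>i. has_grad (g [Transl i, Transl l]) (\<lambda>j. g [Transl j, Transl i, Transl l])"
    by (intro g_grad; simp)+
  have sub: "norm x \<le> t / 2" if "x \<in> cball x0 (2 * (t / 8))" for x
    using that r0 norm_triangle_ineq[of "x - x0" x0] by (simp add: dist_norm norm_minus_commute)
  have mt: "0 < m1 / t" using m1_pos t0 by simp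
  have loc: "loc_bd x0 (2 * (t / 8)) (200 * sqrt (m1 / t)) (g (Transl i # Transl k # w))" if w: "w = [] \<or> (\<exists>l. w = [Transl l])" for i k w
  proof -
    have "continuous_on UNIV (\<lambda>x. (g (Transl i # Transl k # w) x)\<^sup>2)"
      using w by (intro continuous_intros g_cont) auto
    then have "integral (cball x0 (2 * (t / 8))) (\<lambda>x. (g (Transl i # Transl k # w) x)\<^sup>2) \<le> (5000 * m1) / (t/6)"
      using sub EK_integral[OF w, of k] t0
      by (intro integral_le_of_weight[where K="EK (Transl k # w)"] EK_inner EK_nonneg) auto
    also have "\<dots> = 30000 * (m1 / t)" by simp
    also have "\<dots> \<le> (200 * sqrt (m1 / t))\<^sup>2" using mt by (simp add: power_mult_distrib)
    finally show ?thesis by (simp add: loc_bd_def)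
  qed
  have "\<bar>g [Transl l] x0\<bar> \<le> 48 * (200 * sqrt (m1 / t)) + A / (t / 8 * sqrt (t / 8))"
  proof (rule sobolev_scaled[OF gr])
    show "loc_bd x0 (2 * (t / 8)) (200 * sqrt (m1 / t)) (g [Transl i, Transl l])" for i by (rule loc) simp
    show "loc_bd x0 (2 * (t / 8)) (200 * sqrt (m1 / t)) (g [Transl j, Transl i, Transl l])" for i j by (rule loc) simp
    show "loc_bd x0 (2 * (t / 8)) A (g [Transl l])" by (intro loc_bd_of_L2sq int1 bd1 g_cont) simp
    show "0 < 200 * sqrt (m1 / t)" using mt by simp
  qed (use t100 Ap in auto)
  also have "A / (t / 8 * sqrt (t / 8)) \<le> 8 * (A / t)"
  proof -
    have "1 \<le> sqrt (t / 8)" using t100 by simp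
    then have "t / 8 * 1 \<le> t / 8 * sqrt (t / 8)" using t0 by (intro mult_left_mono) auto
    then have "A / (t / 8 * sqrt (t / 8)) \<le> A / (t / 8)" using t0 Ap by (intro divide_left_mono) auto
    then show ?thesis by (simp add: mult.commute)
  qed
  finally show ?thesis using A_div_t_le by simp
qed

text \<open>The weight 1 + (t^2 - |x|^2)/t serves both as p and as w in \<open>tang_trace\<close>.
  On the part of the shell inside the cone it is at least half of 1 + t - r0, and this factor passes
  to the trace.\<close>

lemma mid_bound:
  assumes r0: "norm x0 = r0" "t \<le> 4 * r0" "r0 \<le> t"
  shows "\<bar>g [Transl l] x0\<bar> \<le> 1000 * A / r0 + 21 * (36000 * sqrt (m1 / (1 + (t - r0)))) * ln r0"
proof (rule sup_of_tang[OF r0(1,2)])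
  define N where "N = m1 / (1 + (t - r0))"
  have N: "0 < N" using m1_pos r0 by (simp add: N_def)
  then show "0 < 36000 * sqrt (m1 / (1 + (t - r0)))" by (simp add: N_def)
  fix S :: "(real^3) set" assume S: "compact S" "S \<subseteq> {x. r0 + 1/r0\<^sup>2 \<le> norm x \<and> norm x \<le> r0 + 2 * (1/r0\<^sup>2)}"
  define \<epsilon> where "\<epsilon> = 1/r0\<^sup>2"
  have r: "25 \<le> r0" using r0 t100 by linarith
  have \<epsilon>: "0 < \<epsilon>" "160 * \<epsilon> \<le> r0" "r0 * \<epsilon> \<le> 1" unfolding \<epsilon>_def by (rule eps_bounds[OF r])+
  have \<epsilon>1: "2 * \<epsilon> \<le> 1 / 2"
  proof -
    have "25 * \<epsilon> \<le> r0 * \<epsilon>" using r \<epsilon> by (intro mult_right_mono) auto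
    then show ?thesis using \<epsilon> by linarith
  qed
  have \<kappa>: "0 < 3 * r0 * \<epsilon>" using r \<epsilon> by simp
  let ?H1 = "\<lambda>i. g [Transl i, Transl l]" and ?H2 = "\<lambda>i j. g [Transl j, Transl i, Transl l]"
  let ?p = "\<lambda>y. 1 + (t\<^sup>2 - y) / t"
  let ?Bd = "\<lambda>x. 160 * t ^ 3 * (EK [Transl l] x + (\<Sum>k\<in>UNIV. EK [Transl k, Transl l] x))"
  have gr: "has_grad (?H1 i) (?H2 i)" for i by (intro g_grad) simp
  have H2s: "?H2 i j x = ?H2 j i x" for i j x by (intro g_sym) simp
  have EKc: "comp_supp (EK [Transl l])" "comp_supp (EK [Transl k, Transl l])" for k by (intro EK_integral; simp)+
  have Bi: "(?Bd has_integral (160 * t ^ 3 * (integral UNIV (EK [Transl l]) + (\<Sum>k\<in>UNIV. integral UNIV (EK [Transl k, Transl l]))))) UNIV"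
    by (intro has_integral_mult_right has_integral_add has_integral_sum integrable_integral comp_supp_integrable EKc finite)
  have pd: "(?p has_real_derivative - 1 / t) (at y)" for y
    using t0 by (auto intro!: derivative_eq_intros)
  have pc: "continuous_on {0..} (\<lambda>y::real. - 1 / t)" "continuous_on {0..} ?p" using t0 by (intro continuous_intros; simp)+
  have Bint: "?Bd integrable_on UNIV" using Bi by blast
  have bnd: "shellcut (r0\<^sup>2) (3 * r0 * \<epsilon>) (x \<bullet> x) = 0 \<or> (\<forall>i. ?H1 i x = 0 \<and> (\<forall>j. ?H2 i j x = 0)) \<or>
       0 \<le> ?p (x \<bullet> x) \<and> ?p (x \<bullet> x) \<le> ?p (x \<bullet> x) \<and> 2 * (x \<bullet> x) * \<bar>- 1 / t\<bar> \<le> 64 * t * ?p (x \<bullet> x) \<and> norm x \<le> 2 * t" for x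
  proof (cases "norm x \<le> t")
    case False
    then show ?thesis by (simp add: gz)
  next
    case True
    have w: "1 \<le> ?p (x \<bullet> x)" using wt_ge[OF True] True by linarith
    have "x \<bullet> x \<le> t\<^sup>2" using True by (metis norm_ge_zero power2_norm_eq_inner power_mono)
    then have "2 * (x \<bullet> x) * \<bar>- 1 / t\<bar> \<le> 2 * t\<^sup>2 * (1 / t)" using t0 by (intro mult_mono) auto
    also have "\<dots> = 2 * t * 1" using t0 by (simp add: power2_eq_square)
    also have "\<dots> \<le> 64 * t * ?p (x \<bullet> x)" using w t0 by (intro mult_mono) auto
    finally show ?thesis using w True t0 by auto
  qed
  have BdL: "80 * t * (if shellcut (r0\<^sup>2) (3 * r0 * \<epsilon>) (x \<bullet> x) = 0 then 0 else ?p (x \<bullet> x)) * (tang x (\<lambda>i. ?H1 i x) + (\<Sum>k\<in>UNIV. tang x (\<lambda>i. ?H2 k i x))) \<le> ?Bd x" for x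
  proof -
    let ?E = "?p (x \<bullet> x) * tang x (\<lambda>i. ?H1 i x) + (\<Sum>k\<in>UNIV. ?p (x \<bullet> x) * tang x (\<lambda>i. ?H2 k i x))"
    have E0: "0 \<le> ?E" by (intro add_nonneg_nonneg sum_nonneg EK_tang)
    have "80 * t * (if shellcut (r0\<^sup>2) (3 * r0 * \<epsilon>) (x \<bullet> x) = 0 then 0 else ?p (x \<bullet> x)) * (tang x (\<lambda>i. ?H1 i x) + (\<Sum>k\<in>UNIV. tang x (\<lambda>i. ?H2 k i x)))
      = 80 * t * (if shellcut (r0\<^sup>2) (3 * r0 * \<epsilon>) (x \<bullet> x) = 0 then 0 else ?E)"
      by (simp only: mult.assoc distrib_left[of "?p (x \<bullet> x)"] sum_distrib_left if_distrib[of "\<lambda>c. c * _"] mult_zero_left split: if_splits)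
    also have "\<dots> \<le> 80 * t * ?E" using E0 t0 by (intro mult_left_mono) auto
    also have "\<dots> \<le> 80 * t * (2 * t\<^sup>2 * EK [Transl l] x + (\<Sum>k\<in>UNIV. 2 * t\<^sup>2 * EK [Transl k, Transl l] x))"
      using t0 by (intro mult_left_mono add_mono sum_mono EK_tang_le) auto
    also have "\<dots> = ?Bd x" by (simp add: power2_eq_square power3_eq_cube distrib_left mult_ac flip: sum_distrib_left)
    finally show ?thesis .
  qed
  note tt = tang_trace[OF t0(2) \<kappa> gr H2s pd pc bnd Bint BdL]
  have tt': "comp_supp (\<lambda>x. shell (r0\<^sup>2) (3 * r0 * \<epsilon>) (x \<bullet> x) * (2 * (x \<bullet> x) * ?p (x \<bullet> x) * tang x (\<lambda>i. ?H1 i x))) \<and>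
    integral UNIV (\<lambda>x. shell (r0\<^sup>2) (3 * r0 * \<epsilon>) (x \<bullet> x) * (2 * (x \<bullet> x) * ?p (x \<bullet> x) * tang x (\<lambda>i. ?H1 i x))) \<le> integral UNIV ?Bd"
    by (intro conjI tt)
  have "integral UNIV ?Bd \<le> 160 * t ^ 3 * (5000 * m1 + (\<Sum>k\<in>(UNIV::3 set). 5000 * m1))"
    unfolding integral_unique[OF Bi] using t0 by (intro mult_left_mono add_mono sum_mono EK_integral) auto
  also have "\<dots> = 3200000 * (t ^ 3 * m1)" by simp
  finally have B: "integral UNIV (\<lambda>x. shell (r0\<^sup>2) (3 * r0 * \<epsilon>) (x \<bullet> x) * (2 * (x \<bullet> x) * ?p (x \<bullet> x) * tang x (\<lambda>i. ?H1 i x))) \<le> 3200000 * (t ^ 3 * m1)"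
    using tt' by linarith
  \<comment> \<open>Halving absorbs the thickness 2 \<epsilon> <= 1/2: 1 + t - |x| >= 1/2 + t - r0
    >= (1 + t - r0)/2.\<close>
  let ?V = "(1 + (t - r0)) / 2"
  have V: "0 < ?V" using r0 by simp
  have c: "0 < r0 / (3 * \<epsilon>) * ?V" using r \<epsilon> V by (intro mult_pos_pos) auto
  have "integral S (\<lambda>x. tang x (\<lambda>i. ?H1 i x)) \<le> 3200000 * (t ^ 3 * m1) / (r0 / (3 * \<epsilon>) * ?V)"
  proof (rule integral_le_of_weight[OF S(1) _ conjunct1[OF tt'] _ c _ B])
    show "continuous_on UNIV (\<lambda>x. tang x (\<lambda>i. ?H1 i x))" unfolding tang_def by (intro continuous_intros g_cont; simp)
    show "0 \<le> shell (r0\<^sup>2) (3 * r0 * \<epsilon>) (x \<bullet> x) * (2 * (x \<bullet> x) * ?p (x \<bullet> x) * tang x (\<lambda>i. ?H1 i x))" for x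
    proof -
      have "0 \<le> 2 * (x \<bullet> x) * (?p (x \<bullet> x) * tang x (\<lambda>i. ?H1 i x))" by (intro mult_nonneg_nonneg EK_tang) auto
      then have "0 \<le> shell (r0\<^sup>2) (3 * r0 * \<epsilon>) (x \<bullet> x) * (2 * (x \<bullet> x) * (?p (x \<bullet> x) * tang x (\<lambda>i. ?H1 i x)))"
        by (rule mult_nonneg_nonneg[OF shell_nonneg[OF \<kappa>]])
      then show ?thesis by (simp only: mult.assoc)
    qed
    fix x assume "x \<in> S"
    then have x: "r0 + \<epsilon> \<le> norm x" "norm x \<le> r0 + 2 * \<epsilon>" using S by (auto simp: \<epsilon>_def)
    show "r0 / (3 * \<epsilon>) * ?V * tang x (\<lambda>i. ?H1 i x) \<le> shell (r0\<^sup>2) (3 * r0 * \<epsilon>) (x \<bullet> x) * (2 * (x \<bullet> x) * ?p (x \<bullet> x) * tang x (\<lambda>i. ?H1 i x))"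
    proof (cases "norm x \<le> t")
      case False
      then show ?thesis by (simp add: gz tang_def)
    next
      case True
      have "?V \<le> 1 + (t - norm x)" using x \<epsilon>1 r0 by (simp add: field_simps)
      then have w: "?V \<le> ?p (x \<bullet> x)" using wt_ge[OF True] by linarith
      have "r0 / (3 * \<epsilon>) * ?V * tang x (\<lambda>i. ?H1 i x) = 1 / (6 * r0 * \<epsilon>) * (2 * r0\<^sup>2 * ?V * tang x (\<lambda>i. ?H1 i x))"
        using r \<epsilon> by (simp add: power2_eq_square)
      also have "\<dots> \<le> shell (r0\<^sup>2) (3 * r0 * \<epsilon>) (x \<bullet> x) * (2 * (x \<bullet> x) * ?p (x \<bullet> x) * tang x (\<lambda>i. ?H1 i x))"
      proof (rule mult_mono[OF shell_ge'[OF \<epsilon>(1,2) x] _ shell_nonneg[OF \<kappa>]])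
        show "2 * r0\<^sup>2 * ?V * tang x (\<lambda>i. ?H1 i x) \<le> 2 * (x \<bullet> x) * ?p (x \<bullet> x) * tang x (\<lambda>i. ?H1 i x)"
          using w V shell_region_bounds[OF \<epsilon>(1,2) x] by (intro mult_right_mono mult_mono tang_nonneg) auto
        show "0 \<le> 2 * r0\<^sup>2 * ?V * tang x (\<lambda>i. ?H1 i x)" using V by (intro mult_nonneg_nonneg tang_nonneg) auto
      qed
      finally show ?thesis .
    qed
  qed
  also have "\<dots> = 19200000 * (\<epsilon> * N * (t ^ 3 / r0))" using r \<epsilon> by (simp add: N_def mult_ac)
  also have "\<dots> \<le> 19200000 * (\<epsilon> * N * (64 * r0\<^sup>2))"
  proof -
    have "t ^ 3 \<le> (4 * r0) ^ 3" using r0 t0 by (intro power_mono) auto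
    then have "t ^ 3 / r0 \<le> 64 * r0\<^sup>2" using r by (simp add: field_simps power2_eq_square power3_eq_cube)
    then show ?thesis using \<epsilon> N by (intro mult_left_mono) auto
  qed
  also have "\<dots> \<le> \<epsilon> * (r0 * (36000 * sqrt N))\<^sup>2"
    using \<epsilon> N by (simp add: power_mult_distrib mult_ac)
  finally show "integral S (\<lambda>x. tang x (\<lambda>i. ?H1 i x)) \<le> 1/r0\<^sup>2 * (r0 * (36000 * sqrt (m1 / (1 + (t - r0)))))\<^sup>2"
    by (simp add: \<epsilon>_def N_def)
qed

lemma ln_t: "1 \<le> ln t"
proof -
  have "exp 1 \<le> t" using exp_le t100 by linarith
  then show ?thesis using t0 by (simp add: ln_ge_iff)
qed

lemma spatial_bound:
  assumes x0: "norm x0 \<le> t"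
  shows "\<bar>g [Transl l] x0\<bar> \<le> 800000 * (ln t * sqrt (m1 / (1 + (t - norm x0))))"
proof -
  define q where "q = sqrt (m1 / (1 + (t - norm x0)))"
  have q: "0 \<le> q" using m1_pos x0 by (simp add: q_def)
  have mt: "sqrt (m1 / t) \<le> 3 / 2 * q" unfolding q_def using x0 by (intro sqrt_m1_t_le) auto
  have lq: "q \<le> ln t * q" using mult_right_mono[OF ln_t q] by simp
  show ?thesis
  proof (cases "norm x0 \<le> t / 4")
    case True
    then show ?thesis using near_bound[OF True, of l] mt lq q by (simp add: q_def[symmetric])
  next
    case False
    then have r: "t / 4 \<le> norm x0" "0 < norm x0" using t0 by auto
    have "1000 * A / norm x0 \<le> 1000 * A / (t / 4)" using r t0 Ap by (intro divide_left_mono mult_pos_pos) auto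
    also have "\<dots> = 4000 * (A / t)" by simp
    also have "\<dots> \<le> 4000 * (3 / 2 * q)" by (intro mult_left_mono order_trans[OF A_div_t_le mt]) auto
    finally have 1: "1000 * A / norm x0 \<le> 6000 * q" by simp
    have "ln (norm x0) \<le> ln t" using r x0 t0 ln_le_cancel_iff[of "norm x0" t] by linarith
    then have "q * ln (norm x0) \<le> q * ln t" using q by (rule mult_left_mono)
    then have 2: "21 * (36000 * q) * ln (norm x0) \<le> 756000 * (ln t * q)" by (simp add: mult.commute)
    have "\<bar>g [Transl l] x0\<bar> \<le> 1000 * A / norm x0 + 21 * (36000 * q) * ln (norm x0)"
      using mid_bound[OF refl _ x0] r by (simp add: q_def)
    then show ?thesis using 1 2 lq q unfolding q_def[symmetric] by linarith
  qed
qed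

text \<open>On the support S\<phi> is pointwise at most of order t times the gradient, so its L2
  norm is at most 3tA. The Sobolev bound at scale R = t divides this by t^(3/2).\<close>

lemma scaling_bound: "\<bar>g [Scal] x0\<bar> \<le> 51 * A"
proof -
  have k: "((\<lambda>x. 2 * ((t * h [] x)\<^sup>2 + t\<^sup>2 * (\<Sum>i\<in>UNIV. (g [Transl i] x)\<^sup>2))) has_integral
      2 * (t\<^sup>2 * L2sq (h []) + t\<^sup>2 * (\<Sum>i\<in>UNIV. L2sq (g [Transl i])))) UNIV"
    unfolding power_mult_distrib
    by (intro has_integral_mult_right has_integral_add has_integral_sum integrable_integral gi hi finite; simp)
  have le: "(g [Scal] x)\<^sup>2 \<le> 2 * ((t * h [] x)\<^sup>2 + t\<^sup>2 * (\<Sum>i\<in>UNIV. (g [Transl i] x)\<^sup>2))" for x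
  proof (cases "norm x \<le> t")
    case False
    then show ?thesis by (simp add: gz sum_nonneg)
  next
    case True
    let ?R = "\<Sum>i\<in>UNIV. x $ i * g [Transl i] x"
    have "x \<bullet> x \<le> t\<^sup>2" using True by (metis norm_ge_zero power2_norm_eq_inner power_mono)
    then have "?R\<^sup>2 \<le> t\<^sup>2 * (\<Sum>i\<in>UNIV. (g [Transl i] x)\<^sup>2)"
      by (intro order_trans[OF radial_deriv_sq_le] mult_right_mono sum_nonneg) auto
    then have "2 * ((t * h [] x)\<^sup>2 + ?R\<^sup>2) \<le> 2 * ((t * h [] x)\<^sup>2 + t\<^sup>2 * (\<Sum>i\<in>UNIV. (g [Transl i] x)\<^sup>2))" by simp
    then show ?thesis using sq_diff_le[of "t * h [] x" "- ?R"] by (simp add: g_Scal)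
  qed
  have c: "continuous_on UNIV (g [Scal])" by (rule g_cont) simp
  have "L2sq (g [Scal]) \<le> 2 * (t\<^sup>2 * L2sq (h []) + t\<^sup>2 * (\<Sum>i\<in>UNIV. L2sq (g [Transl i])))"
    using sq_integrable_bound(2)[OF c le has_integral_integrable[OF k]] integral_unique[OF k] by simp
  also have "\<dots> \<le> 2 * (t\<^sup>2 * A\<^sup>2 + t\<^sup>2 * (\<Sum>i\<in>(UNIV::3 set). A\<^sup>2))"
    by (intro mult_left_mono add_mono sum_mono gb hb) auto
  also have "\<dots> \<le> (3 * t * A)\<^sup>2" by (simp add: power_mult_distrib)
  finally have V: "L2sq (g [Scal]) \<le> (3 * t * A)\<^sup>2" .
  have "\<bar>g [Scal] x0\<bar> \<le> 48 * A + 3 * t * A / (t * sqrt t)"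
  proof (rule sobolev_scaled[of _ "\<lambda>i. g [Transl i, Scal]" "\<lambda>i j. g [Transl j, Transl i, Scal]"])
    show "loc_bd x0 (2 * t) (3 * t * A) (g [Scal])"
      by (rule loc_bd_of_L2sq[OF c sq_integrable_bound(1)[OF c le has_integral_integrable[OF k]] V])
  qed (auto intro!: g_grad loc_bd_of_L2sq g_cont gi gb simp: Ap t0)
  also have "3 * t * A / (t * sqrt t) \<le> 3 * A"
  proof -
    have "3 * A / sqrt t \<le> 3 * A / 1" using t0 Ap by (intro divide_left_mono) auto
    then show ?thesis using t0 by simp
  qed
  finally show ?thesis by simp
qed

lemma abs_grad_bound:
  assumes x0: "norm x0 \<le> t"
  shows "abs_grad \<phi> (t, x0) \<le> 5000000 * (ln t * sqrt (m1 / (1 + (t - norm x0))))"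
proof -
  define q where "q = sqrt (m1 / (1 + (t - norm x0)))"
  have q: "0 \<le> q" using m1_pos x0 by (simp add: q_def)
  have mt: "sqrt (m1 / t) \<le> 3 / 2 * q" unfolding q_def using x0 by (intro sqrt_m1_t_le) auto
  have lq: "q \<le> ln t * q" using mult_right_mono[OF ln_t q] by simp
  let ?Z = "800000 * (ln t * q)"
  have sp: "\<bar>g [Transl l] x0\<bar> \<le> ?Z" for l unfolding q_def by (rule spatial_bound[OF x0])
  have "\<bar>\<Sum>i\<in>UNIV. x0 $ i * g [Transl i] x0\<bar> \<le> (\<Sum>i\<in>(UNIV::3 set). t * ?Z)"
  proof (rule order_trans[OF sum_abs sum_mono])
    fix i :: 3
    have "\<bar>x0 $ i\<bar> \<le> t" using component_le_norm_cart[of x0 i] x0 by linarith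
    then show "\<bar>x0 $ i * g [Transl i] x0\<bar> \<le> t * ?Z" unfolding abs_mult using t0 by (intro mult_mono sp) auto
  qed
  then have "\<bar>\<Sum>i\<in>UNIV. x0 $ i * g [Transl i] x0\<bar> \<le> t * (3 * ?Z)" by simp
  moreover have "\<bar>g [Scal] x0\<bar> \<le> t * (100 * q)"
  proof -
    have "51 * A \<le> t * (51 * (A / t))" using t0 by simp
    also have "\<dots> \<le> t * (100 * q)" using t0 A_div_t_le mt q by (intro mult_left_mono) auto
    finally show ?thesis using scaling_bound[of x0] by linarith
  qed
  moreover have "t * \<bar>h [] x0\<bar> = \<bar>g [Scal] x0 - (\<Sum>i\<in>UNIV. x0 $ i * g [Transl i] x0)\<bar>"
    using g_Scal[of "[]" x0] t0 by (simp add: abs_mult)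
  ultimately have "t * \<bar>h [] x0\<bar> \<le> t * (100 * q) + t * (3 * ?Z)" by linarith
  then have "t * \<bar>h [] x0\<bar> \<le> t * (100 * q + 3 * ?Z)" by (simp only: distrib_left)
  then have h: "\<bar>h [] x0\<bar> \<le> 100 * q + 3 * ?Z" using t0 by simp
  have 0: "dt \<phi> (t, x0) = h [] x0" "dx i \<phi> (t, x0) = g [Transl i] x0" for i
    by (simp_all add: h_def g_def Gam_def)
  have "abs_grad \<phi> (t, x0) \<le> (100 * q + 3 * ?Z) + (\<Sum>i\<in>(UNIV::3 set). ?Z)"
    by (rule order_trans[OF abs_grad_le]) (unfold 0, intro add_mono sum_mono h sp)
  moreover have "(\<Sum>i\<in>(UNIV::3 set). ?Z) = 3 * ?Z" by simp
  ultimately show ?thesis using lq q unfolding q_def[symmetric] by linarith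
qed

end

text \<open>The condition 0 < s makes the region open, so that vanishing passes to all
  derivatives.\<close>

definition vanishes_outside_cone :: "(spacetime \<Rightarrow> real) \<Rightarrow> bool" where
  "vanishes_outside_cone \<psi> \<longleftrightarrow> (\<forall>s x. 0 < s \<and> s < norm x \<longrightarrow> \<psi> (s, x) = 0)"

lemma vanishes_dderiv:
  assumes "vanishes_outside_cone \<psi>"
  shows "vanishes_outside_cone (dderiv b \<psi>)"
  unfolding vanishes_outside_cone_def
proof (intro allI impI)
  fix s x assume sx: "0 < s \<and> s < norm (x :: real^3)"
  let ?W = "{p :: spacetime. 0 < fst p \<and> fst p < norm (snd p)}"
  have "open ?W" by (intro open_Collect_conj open_Collect_less continuous_intros)
  then have "(\<psi> has_derivative (\<lambda>_. 0)) (at (s, x))"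
    by (rule has_derivative_transform_within_open[OF has_derivative_const[of 0]])
      (use sx assms in \<open>auto simp: vanishes_outside_cone_def\<close>)
  then show "dderiv b \<psi> (s, x) = 0" by (simp add: dderiv_def frechet_derivative_at[symmetric])
qed

lemma vanishes_Gam:
  assumes "vanishes_outside_cone \<psi>"
  shows "vanishes_outside_cone (Gam w \<psi>)"
proof (induction w)
  case Nil
  then show ?case using assms by (simp add: Gam_def)
next
  case (Cons a w)
  note d = vanishes_dderiv[OF Cons.IH]
  have "vanishes_outside_cone (gamma_op a (Gam w \<psi>))"
  proof (cases a)
    case Scal
    then show ?thesis using d by (simp add: vanishes_outside_cone_def scaling_def dt_def dx_def)
  next
    case (Transl i)
    then show ?thesis using d by (simp add: dx_def)
  qed
  then show ?case by (simp add: Gam_def)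
qed

text \<open>On a slice the support lies in a ball, so continuity alone makes the norms of the
  interior estimate finite.\<close>

lemma L2_on_of_bounded_support:
  fixes v :: "real^3 \<Rightarrow> real"
  assumes v: "continuous_on UNIV v" and z: "\<And>x. t < norm x \<Longrightarrow> v x = 0"
  shows "L2_on UNIV v"
proof -
  have "integrable lborel (\<lambda>x. indicator (cball 0 t) x *\<^sub>R (v x)\<^sup>2)"
    by (intro borel_integrable_compact continuous_intros continuous_on_subset[OF v]) auto
  moreover have "(\<lambda>x. indicator (cball 0 t) x *\<^sub>R (v x)\<^sup>2) = (\<lambda>x. (v x)\<^sup>2)"
    by (rule ext) (use z in \<open>force simp: indicator_def\<close>)
  ultimately have "integrable lborel (\<lambda>x. (v x)\<^sup>2)" by simp
  moreover have "v \<in> borel_measurable borel" by (rule borel_measurable_continuous_onI[OF v])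
  ultimately show ?thesis by (simp add: L2_on_def set_integrable_def set_borel_measurable_def)
qed

text \<open>The wave operator contains two time derivatives; the slice equation rewrites it through
  words, whose continuity is known.\<close>

lemma (in wave_slice) bx_cont:
  assumes w: "length w \<le> 1"
  shows "continuous_on UNIV (bx w)"
proof -
  have "bx w x = LL w x - (1 / t\<^sup>2) * (2 * (\<Sum>i\<in>UNIV. x $ i * g (Transl i # w) x) - 2 * (\<Sum>i\<in>UNIV. x $ i * g (Transl i # Scal # w) x)
       + (g (Scal # Scal # w) x - g (Scal # w) x))" for x
    using equation[of w x] w by (simp add: LL_def)
  then have "bx w = (\<lambda>x. LL w x - (1 / t\<^sup>2) * (2 * (\<Sum>i\<in>UNIV. x $ i * g (Transl i # w) x) - 2 * (\<Sum>i\<in>UNIV. x $ i * g (Transl i # Scal # w) x)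
       + (g (Scal # Scal # w) x - g (Scal # w) x)))" by blast
  then show ?thesis using w by (simp only:) (intro continuous_intros LL_cont g_cont; simp)
qed

lemma L2norm_grad_Gam_ge:
  assumes "w \<in> words k" "b \<in> Basis"
  shows "L2norm_on UNIV (\<lambda>x. dderiv b (Gam w \<psi>) (t, x)) \<le> L2norm_grad_Gam k \<psi> t"
proof -
  have "L2norm_on UNIV (\<lambda>x. dderiv b (Gam w \<psi>) (t, x)) \<le> (\<Sum>b\<in>Basis. L2norm_on UNIV (\<lambda>x. dderiv b (Gam w \<psi>) (t, x)))"
    by (rule member_le_sum[OF assms(2)]) (auto intro: L2norm_on_nonneg)
  also have "\<dots> \<le> L2norm_grad_Gam k \<psi> t"
    unfolding L2norm_grad_Gam_def
    by (rule member_le_sum[OF assms(1)]) (auto intro: sum_nonneg L2norm_on_nonneg finite_words)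
  finally show ?thesis .
qed

text \<open>The bound ln t <= (2/\<delta>) t^(\<delta>/2) pays for the logarithm with the power of
  t; the power of \<open>jap U\<close> may be raised from -1/2 to -1/2 + \<delta> because
  \<open>jap U\<close> is at least 1. Replacing t by \<open>jap t\<close>, which is at most 2t, in a
  negative power costs a factor 2.\<close>

lemma interior_weights:
  fixes A F U t \<delta> :: real
  assumes "0 \<le> A" "0 \<le> F" "0 \<le> U" "U \<le> t" "100 \<le> t" "0 < \<delta>" "\<delta> \<le> 1"
  shows "ln t * sqrt ((A\<^sup>2 / t + t * F\<^sup>2) / (1 + U))
     \<le> 4 * (1 / \<delta>) * (jap t powr (- (1 - \<delta>) / 2) * jap U powr (- 1 / 2 + \<delta>) * A + jap t powr (1 / 2 + \<delta>) * F)"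
proof -
  have t: "0 < t" "1 \<le> t" using assms by auto
  have jU: "1 \<le> jap U" by (simp add: jap_def)
  have "(jap U)\<^sup>2 \<le> (1 + U)\<^sup>2" using assms by (simp add: jap_def power2_eq_square algebra_simps)
  then have jU2: "jap U \<le> 1 + U" by (rule power2_le_imp_le) (use assms in simp)
  have "t \<le> jap t" by (auto simp: jap_def intro!: real_le_rsqrt)
  have "1 \<le> t\<^sup>2" using t by simp
  then have "(jap t)\<^sup>2 \<le> (2 * t)\<^sup>2" by (simp add: jap_def power_mult_distrib)
  then have jt: "jap t \<le> 2 * t" by (rule power2_le_imp_le) (use t in simp)
  have jt0: "0 < jap t" using \<open>t \<le> jap t\<close> t by linarith
  define a where "a = t powr (- 1 / 2) * A"
  define b where "b = t powr (1 / 2) * F"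
  have ab: "0 \<le> a" "0 \<le> b" using assms by (simp_all add: a_def b_def)
  have ta: "t powr (- 1 / 2) = 1 / sqrt t" using t by (simp add: powr_minus_divide powr_half_sqrt)
  have "A\<^sup>2 / t + t * F\<^sup>2 = a\<^sup>2 + b\<^sup>2"
    unfolding a_def b_def ta using t by (simp add: powr_half_sqrt power_mult_distrib power_divide)
  also have "\<dots> \<le> (a + b)\<^sup>2" using ab by (simp add: power2_sum)
  finally have "(A\<^sup>2 / t + t * F\<^sup>2) / (1 + U) \<le> (a + b)\<^sup>2 / jap U"
    using jU jU2 assms by (intro frac_le) auto
  then have "sqrt ((A\<^sup>2 / t + t * F\<^sup>2) / (1 + U)) \<le> sqrt ((a + b)\<^sup>2 / jap U)" by simp
  also have "\<dots> = (a + b) * jap U powr (- 1 / 2)"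
    using ab jU by (simp add: real_sqrt_divide powr_minus_divide powr_half_sqrt)
  finally have 1: "sqrt ((A\<^sup>2 / t + t * F\<^sup>2) / (1 + U)) \<le> (a + b) * jap U powr (- 1 / 2)" .
  have 2: "ln t \<le> 2 / \<delta> * t powr (\<delta> / 2)" using ln_jap_bound[of "\<delta> / 2" t] assms t by simp
  have "ln t * sqrt ((A\<^sup>2 / t + t * F\<^sup>2) / (1 + U)) \<le> (2 / \<delta> * t powr (\<delta> / 2)) * ((a + b) * jap U powr (- 1 / 2))"
    using 1 2 t assms by (intro mult_mono) auto
  also have "\<dots> = 2 / \<delta> * (t powr (\<delta> / 2) * t powr (- 1 / 2) * jap U powr (- 1 / 2) * A + t powr (\<delta> / 2) * t powr (1 / 2) * jap U powr (- 1 / 2) * F)"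
    by (simp add: a_def b_def algebra_simps)
  also have "\<dots> \<le> 2 / \<delta> * (2 * jap t powr (- (1 - \<delta>) / 2) * jap U powr (- 1 / 2 + \<delta>) * A + jap t powr (1 / 2 + \<delta>) * 1 * F)"
  proof -
    have "t powr (\<delta> / 2) * t powr (- 1 / 2) = t powr (- (1 - \<delta>) / 2)"
      by (simp add: powr_add[symmetric] diff_divide_distrib)
    also have "\<dots> = 2 powr ((1 - \<delta>) / 2) * (2 * t) powr (- (1 - \<delta>) / 2)"
      using t by (simp add: powr_mult powr_add[symmetric] mult.assoc[symmetric] add_divide_distrib[symmetric])
    also have "\<dots> \<le> 2 powr 1 * jap t powr (- (1 - \<delta>) / 2)"
      using jt jt0 assms by (intro mult_mono powr_mono powr_mono2') auto
    finally have h1: "t powr (\<delta> / 2) * t powr (- 1 / 2) \<le> 2 * jap t powr (- (1 - \<delta>) / 2)" by simp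
    have h2: "jap U powr (- 1 / 2) \<le> jap U powr (- 1 / 2 + \<delta>)" using jU assms by (intro powr_mono) auto
    have "t powr (\<delta> / 2) * t powr (1 / 2) = t powr (1 / 2 + \<delta> / 2)" by (simp add: powr_add[symmetric] add.commute)
    also have "\<dots> \<le> t powr (1 / 2 + \<delta>)" using t assms by (intro powr_mono) auto
    also have "\<dots> \<le> jap t powr (1 / 2 + \<delta>)" using \<open>t \<le> jap t\<close> t assms by (intro powr_mono2) auto
    finally have h3: "t powr (\<delta> / 2) * t powr (1 / 2) \<le> jap t powr (1 / 2 + \<delta>)" .
    have h4: "jap U powr (- 1 / 2) \<le> 1" using powr_mono[of "- 1 / 2" 0 "jap U"] jU by simp
    show ?thesis
      by (rule mult_left_mono[OF add_mono[OF mult_right_mono[OF mult_mono[OF h1 h2]] mult_right_mono[OF mult_mono[OF h3 h4]]]])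
        (use assms in auto)
  qed
  also have "\<dots> \<le> 2 / \<delta> * (2 * (jap t powr (- (1 - \<delta>) / 2) * jap U powr (- 1 / 2 + \<delta>) * A + jap t powr (1 / 2 + \<delta>) * F))"
    using assms by (intro mult_left_mono) auto
  finally show ?thesis by simp
qed

lemma interior_estimate:
  assumes C4: "C_k 4 \<phi>" and f: "\<And>p. box_op \<phi> p = f p" and supp: "\<And>t x. 0 \<le> t \<Longrightarrow> \<phi> (t, x) \<noteq> 0 \<Longrightarrow> norm x \<le> t"
    and t: "100 \<le> t" and \<delta>: "0 < \<delta>" "\<delta> \<le> 1"
  shows "abs_grad \<phi> (t, x) \<le> 30000000 * (1 / \<delta>) *
              (jap t powr (- (1 - \<delta>) / 2) * jap (t - norm x) powr (- 1 / 2 + \<delta>)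
                  * L2norm_grad_Gam 3 \<phi> t
               + jap t powr (1 / 2 + \<delta>) * L2norm_Gam 2 f t)"
proof -
  define A F where "A = L2norm_grad_Gam 3 \<phi> t" and "F = L2norm_Gam 2 f t"
  have f': "box_op \<phi> = f" using f by blast
  have A0: "0 \<le> A" unfolding A_def L2norm_grad_Gam_def by (intro sum_nonneg L2norm_on_nonneg)
  have F0: "0 \<le> F" by (simp add: F_def L2norm_Gam_nonneg)
  have van: "vanishes_outside_cone \<phi>" unfolding vanishes_outside_cone_def using supp by (meson less_imp_le not_le)
  interpret wave_slice \<phi> t by unfold_locales (rule C4, rule t)
  have z: "g w x = 0" "h w x = 0" if "t < norm x" for w x
    using vanishes_Gam[OF van, of w] vanishes_dderiv[OF vanishes_Gam[OF van, of w], of "(1, 0)"] that t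
    by (auto simp: vanishes_outside_cone_def g_def h_def dt_def)
  show ?thesis
  proof (cases "norm x \<le> t")
    case False
    then have "t < norm x" by simp
    then have "abs_grad \<phi> (t, x) = 0"
      using vanishes_dderiv[OF van] t by (simp add: abs_grad_def vanishes_outside_cone_def)
    then show ?thesis using A0 F0 \<delta> by (simp add: A_def[symmetric] F_def[symmetric])
  next
    case x: True
    have gL: "L2_on UNIV (g (Transl i # w))" if "length w \<le> 3" for i w
      by (rule L2_on_of_bounded_support[OF g_cont z(1)]) (use that in simp)
    have hL: "L2_on UNIV (h w)" if "length w \<le> 3" for w
      by (rule L2_on_of_bounded_support[OF h_cont z(2)]) (use that in simp)
    have bz: "bx w x = 0" if "t < norm x" "length w \<le> 2" for w x
      using equation[OF that(2), of x] by (simp add: z(1)[OF that(1)])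
    have bL: "L2_on UNIV (bx w)" if "length w \<le> 1" for w
      by (rule L2_on_of_bounded_support[OF bx_cont[OF that] bz]) (use that in auto)
    have gn: "L2norm_on UNIV (g (Transl i # w)) \<le> A" if "length w \<le> 3" for i w
      using L2norm_grad_Gam_ge[of w 3 "(0, axis i 1)" \<phi> t] that
      by (simp add: A_def words_def basis_spacetime g_def[abs_def] Gam_Cons dx_def)
    have hn: "L2norm_on UNIV (h w) \<le> A" if "length w \<le> 3" for w
      using L2norm_grad_Gam_ge[of w 3 "(1, 0)" \<phi> t] that
      by (simp add: A_def words_def basis_spacetime h_def[abs_def] dt_def)
    have bn: "L2norm_on UNIV (bx []) \<le> F" "L2norm_on UNIV (bx [Transl l]) \<le> F" for l
      unfolding box_slice f' F_def by (rule L2norm_Gam_ge; simp add: words_def)+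
    \<comment> \<open>As in the general case, A is enlarged to a positive A' and the limit is taken
      afterwards.\<close>
    have *: "abs_grad \<phi> (t, x) \<le> 5000000 * (ln t * sqrt ((A'\<^sup>2 / t + t * F\<^sup>2) / (1 + (t - norm x))))" if A': "A < A'" for A'
    proof -
      interpret slice_interior \<phi> t A' F
      proof unfold_locales
        show "0 < A'" "0 \<le> F" using A0 F0 A' by auto
        show "sq_integrable (g (Transl i # w))" if "length w \<le> 3" for i w by (rule L2_on_UNIV(1)[OF gL[OF that]])
        show "L2sq (g (Transl i # w)) \<le> A'\<^sup>2" if "length w \<le> 3" for i w
          unfolding L2_on_UNIV(2)[OF gL[OF that]] using gn[OF that, of i] A' by (intro power_mono L2norm_on_nonneg) simp
        show "sq_integrable (h w)" if "length w \<le> 3" for w by (rule L2_on_UNIV(1)[OF hL[OF that]])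
        show "L2sq (h w) \<le> A'\<^sup>2" if "length w \<le> 3" for w
          unfolding L2_on_UNIV(2)[OF hL[OF that]] using hn[OF that] A' by (intro power_mono L2norm_on_nonneg) simp
        show "sq_integrable (bx [])" "sq_integrable (bx [Transl l])" for l
          by (intro L2_on_UNIV(1) bL; simp)+
        have "L2_on UNIV (bx [])" "L2_on UNIV (bx [Transl l])" for l by (intro bL; simp)+
        from L2_on_UNIV(2)[OF this(1)] L2_on_UNIV(2)[OF this(2)]
        show "L2sq (bx []) \<le> F\<^sup>2" "L2sq (bx [Transl l]) \<le> F\<^sup>2" for l
          using bn by (auto intro: power_mono L2norm_on_nonneg)
        show "g w x = 0" if "t < norm x" for w x by (rule z(1)[OF that])
      qed
      show ?thesis using abs_grad_bound[OF x] by (simp add: m1_def)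
    qed
    have "abs_grad \<phi> (t, x) \<le> 5000000 * (ln t * sqrt ((A\<^sup>2 / t + t * F\<^sup>2) / (1 + (t - norm x))))"
    proof (rule LIMSEQ_le_const)
      have z: "(\<lambda>n. 1 / real (Suc n)) \<longlonglongrightarrow> 0" by (rule LIMSEQ_Suc[OF lim_1_over_n])
      have z': "(\<lambda>n. A + 1 / real (Suc n)) \<longlonglongrightarrow> A" using tendsto_add[OF tendsto_const z, of A] by simp
      show "(\<lambda>n. 5000000 * (ln t * sqrt (((A + 1 / real (Suc n))\<^sup>2 / t + t * F\<^sup>2) / (1 + (t - norm x)))))
          \<longlonglongrightarrow> 5000000 * (ln t * sqrt ((A\<^sup>2 / t + t * F\<^sup>2) / (1 + (t - norm x))))"
        using t x by (intro tendsto_intros z') auto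
      show "\<exists>N. \<forall>n\<ge>N. abs_grad \<phi> (t, x) \<le> 5000000 * (ln t * sqrt (((A + 1 / real (Suc n))\<^sup>2 / t + t * F\<^sup>2) / (1 + (t - norm x))))"
        by (intro exI allI impI *) simp
    qed
    also have "\<dots> \<le> 5000000 * (4 * (1 / \<delta>) * (jap t powr (- (1 - \<delta>) / 2) * jap (t - norm x) powr (- 1 / 2 + \<delta>) * A + jap t powr (1 / 2 + \<delta>) * F))"
      using x t \<delta> A0 F0 by (intro mult_left_mono interior_weights) auto
    also have "\<dots> = 20000000 * ((1 / \<delta>) * (jap t powr (- (1 - \<delta>) / 2) * jap (t - norm x) powr (- 1 / 2 + \<delta>) * A + jap t powr (1 / 2 + \<delta>) * F))"
      by simp
    also have "\<dots> \<le> 30000000 * ((1 / \<delta>) * (jap t powr (- (1 - \<delta>) / 2) * jap (t - norm x) powr (- 1 / 2 + \<delta>) * A + jap t powr (1 / 2 + \<delta>) * F))"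
      using A0 F0 \<delta> by (intro mult_right_mono mult_nonneg_nonneg add_nonneg_nonneg) auto
    finally show ?thesis unfolding A_def F_def by (simp only: mult.assoc)
  qed
qed

theorem theorem1p1:
  "\<exists>\<delta>0>0. \<exists>C>0. \<exists>T>0. \<forall>\<delta>::real. 0 < \<delta> \<and> \<delta> < \<delta>0 \<longrightarrow>
    (\<forall>(\<phi> :: spacetime \<Rightarrow> real) (f :: spacetime \<Rightarrow> real).
      C_k 4 \<phi> \<and> (\<forall>p. box_op \<phi> p = f p) \<longrightarrow>
        ((\<forall>t x. 0 \<le> t \<and> \<phi> (t, x) \<noteq> 0 \<longrightarrow> norm x \<le> t) \<longrightarrow>
          (\<forall>t\<ge>T. \<forall>x.
            abs_grad \<phi> (t, x) \<le> C * (1 / \<delta>) *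
              (jap t powr (- (1 - \<delta>) / 2) * jap (t - norm x) powr (- 1 / 2 + \<delta>)
                  * L2norm_grad_Gam 3 \<phi> t
               + jap t powr (1 / 2 + \<delta>) * L2norm_Gam 2 f t))) \<and>
        (\<forall>t\<ge>T. \<forall>x0. finite_norms \<phi> f t \<longrightarrow>
            abs_grad \<phi> (t, x0) \<le> C *
              ((1 / \<delta>) * \<bar>t\<bar> powr (- 1 / 2) * jap x0 powr \<delta>
                 * L2norm_Gam 3 \<phi> t powr ((1 - \<delta>) / 2)
                 * (L2norm_Gam 3 \<phi> t + L2norm_r2_Gam 3 \<phi> 0 + jap t * L2norm_Gam 1 f t
                    + (LBINT s:{0..t}. L2norm_u_grad_Gam_ext 1 f s)) powr ((1 + \<delta>) / 2)
               + L2norm_Gam 1 f t)))"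
\<comment> \<open>\<delta>0 = 1, C = 3 * 10^7 and T = 100. The last gives sqrt t >= 10 and ln t >=
  1; C rounds up 29 * 10^6 from the general estimate and covers 4 * 5 * 10^6 from the interior
  one.\<close>
proof (rule exI[of _ 1], rule conjI[OF zero_less_one], rule exI[of _ 30000000], rule conjI,
    simp, rule exI[of _ 100], rule conjI, simp, intro allI impI conjI)
  fix \<delta> :: real and \<phi> f :: "spacetime \<Rightarrow> real" and t :: real and x :: "real^3"
  assume d: "0 < \<delta> \<and> \<delta> < 1" and e: "C_k 4 \<phi> \<and> (\<forall>p. box_op \<phi> p = f p)" and t: "100 \<le> t"
  have d': "0 < \<delta>" "\<delta> \<le> 1" and C4: "C_k 4 \<phi>" and f: "box_op \<phi> p = f p" for p using d e by (simp_all del: split_paired_All)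
  {
    assume "\<forall>t x. 0 \<le> t \<and> \<phi> (t, x) \<noteq> 0 \<longrightarrow> norm x \<le> t"
    then have "norm x \<le> t" if "0 \<le> t" "\<phi> (t, x) \<noteq> 0" for t x using that by blast
    from interior_estimate[OF C4 f this t d']
    show "abs_grad \<phi> (t, x) \<le> 30000000 * (1 / \<delta>) *
              (jap t powr (- (1 - \<delta>) / 2) * jap (t - norm x) powr (- 1 / 2 + \<delta>)
                  * L2norm_grad_Gam 3 \<phi> t
               + jap t powr (1 / 2 + \<delta>) * L2norm_Gam 2 f t)" .
  next
    assume "finite_norms \<phi> f t"
    from general_estimate[OF C4 f t this d']
    show "abs_grad \<phi> (t, x) \<le> 30000000 *
              ((1 / \<delta>) * \<bar>t\<bar> powr (- 1 / 2) * jap x powr \<delta>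
                 * L2norm_Gam 3 \<phi> t powr ((1 - \<delta>) / 2)
                 * (L2norm_Gam 3 \<phi> t + L2norm_r2_Gam 3 \<phi> 0 + jap t * L2norm_Gam 1 f t
                    + (LBINT s:{0..t}. L2norm_u_grad_Gam_ext 1 f s)) powr ((1 + \<delta>) / 2)
               + L2norm_Gam 1 f t)" .
  }
qed

end
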